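(* Let $\hbar>0$. Let $a=\sum_{P,Q}a_{P,Q}\mathsf{f}_{P,Q}\in\widehat{\mathcal{A}}_\hbar(\mathbb{D}_n)$ and $\psi=\sum_Q\psi_Q\mathsf{f}_{0,Q}\in\mathfrak{D}_\hbar$ be given. Then the GNS representation $\pi_0$ of $\delta_0$, realized on $\mathfrak{D}_\hbar$, is determined by $$\pi_0(a)\psi=\mathrm{pr}_{\mathfrak{D}_\hbar}\big(a\star_{\mathbb{D}_n}\iota(\psi)\big)$$ $$=\sum_{Q,S}\sum_{P\le S}a_{P,Q}\,\psi_S\,\frac{1}{P!\,(\alpha-|Q|)!}\binom{Q+S-P}{Q}\binom{\alpha+|S|-|P|}{|S|}\,\frac{\frac{1}{(\alpha+|S|-|P|)!}\left(\frac{1}{2\hbar}\right)_{\alpha+|S|-|P|}}{\frac{1}{(|Q|+|S|-|P|)!}\left(\frac{1}{2\hbar}\right)_{|Q|+|S|-|P|}}\,\mathsf{f}_{0,Q+S-P},$$ where $\alpha=\max(|P|,|Q|)$ and $P,Q,S$ run over $\mathbb{N}_0^n$. The series converges in the Fréchet topology of $\mathfrak{D}_\hbar$.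
   Context: Fix $n\ge1$. On $\mathbb{C}^{n+1}$ with coordinates $z^0,\dots,z^n$ let $\mathsf{g}=\mathrm{diag}(-1,1,\dots,1)$, $y(z)=|z^0|^2-|z^1|^2-\dots-|z^n|^2$, $C_{n+1}^+=\{z: y(z)>0\}$, $\mathbb{D}_n=\{v\in\mathbb{C}^n:|v|^2<1\}$, and $\pi\colon C_{n+1}^+\to\mathbb{D}_n$, $\pi(z)=(z^1/z^0,\dots,z^n/z^0)$. An index triple is $(P,Q,\alpha)$ with $P,Q\in\mathbb{N}_0^n$, $\alpha\in\mathbb{N}_0$, $|P|,|Q|\le\alpha$. Put $\mathsf{e}_{P,Q,\alpha}(z)=(z^0)^{\alpha-|P|}z^P(\bar z^0)^{\alpha-|Q|}\bar z^Q$ where $z^P=(z^1)^{P_1}\cdots(z^n)^{P_n}$; these form a basis of the $\mathrm{U}(1)$-invariant polynomials in $z,\bar z$. For $\hbar\ne0$ the Wick product of polynomials is $f\star g=\sum_{r\ge0}\frac{(2\hbar)^r}{r!}\sum_{i_1,\dots,i_r,j_1,\dots,j_r=0}^n\mathsf{g}^{i_1j_1}\cdots\mathsf{g}^{i_rj_r}\frac{\partial^rf}{\partial z^{i_1}\cdots\partial z^{i_r}}\frac{\partial^rg}{\partial\bar z^{j_1}\cdots\partial\bar z^{j_r}}$; it preserves $\mathrm{U}(1)$-invariant polynomials. With $(x)_r=x(x+1)\cdots(x+r-1)$, let $S$ (as an operator) be the injective linear map from $\mathrm{U}(1)$-invariant polynomials to $C^\infty(C_{n+1}^+)$ with $S\mathsf{e}_{P,Q,\alpha}=(2\hbar)^\alpha\big(\tfrac{y}{2\hbar}\big)_\alpha\frac{\mathsf{e}_{P,Q,\alpha}}{y^\alpha}$,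 and $\mathsf{f}_{P,Q,\alpha}=\frac{1}{P!(\alpha-|P|)!Q!(\alpha-|Q|)!}\big(\frac{y}{2\hbar}\big)_\alpha\frac{\mathsf{e}_{P,Q,\alpha}}{y^\alpha}$. $\mathcal{A}_\hbar(C_{n+1}^+)$ is the span of the (linearly independent) $\mathsf{f}_{P,Q,\alpha}$, with product $a\,\tilde\star\,b=S(S^{-1}a\star S^{-1}b)$. $\mathcal{A}_\hbar(C_{n+1}^+)$ carries the locally convex topology of the seminorms $\sup_{(P,Q,\alpha)}|a_{P,Q,\alpha}|/(\alpha!)^\epsilon$, $0<\epsilon<1$, for $a=\sum a_{P,Q,\alpha}\mathsf{f}_{P,Q,\alpha}$. The product and all evaluations $\delta_w(a)=a(w)$, $w\in C_{n+1}^+$, are continuous, and the completion $\widehat{\mathcal{A}}_\hbar(C_{n+1}^+)$ is a Fréchet algebra of functions on $C_{n+1}^+$, consisting of all $\sum a_{P,Q,\alpha}\mathsf{f}_{P,Q,\alpha}$ for which all these seminorms are finite. For $\hbar>0$, $\mathcal{J}_{y=1}=\bigcap_{y(w)=1}\ker\delta_w$ is a closed two-sided $^*$-ideal, and $\widehat{\mathcal{A}}_\hbar(\mathbb{D}_n)=\widehat{\mathcal{A}}_\hbar(C_{n+1}^+)/\mathcal{J}_{y=1}$ with quotient topology, induced product $\star_{\mathbb{D}_n}$, and pointwise complex conjugation as $^*$-involution; its elements are functions on $\mathbb{D}_n$ via $\delta_v([a])=[a](v)=a(w)$ for any $w$ with $\pi(w)=v$, $y(w)=1$. It has the absolute Schauder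 basis $\mathsf{f}_{P,Q}=[\mathsf{f}_{P,Q,\max(|P|,|Q|)}]$, $P,Q\in\mathbb{N}_0^n$, and consists of all $\sum_{P,Q}a_{P,Q}\mathsf{f}_{P,Q}$ with $\sup_{P,Q}|a_{P,Q}|/(\max(|P|,|Q|)!)^\epsilon<\infty$ for all $0<\epsilon<1$, these suprema defining its topology. GNS data: $\delta_0$, the evaluation at $v=0$, is a positive functional with Gel'fand ideal $\mathcal{J}_0=\{a:\delta_0(\bar a\star_{\mathbb{D}_n}a)=0\}=\{a=\sum_{P,Q}a_{P,Q}\mathsf{f}_{P,Q}: a_{0,Q}=0\text{ for all }Q\}$. It has the closed complement $\mathfrak{D}_\hbar=\{\psi=\sum_Q\psi_Q\mathsf{f}_{0,Q}:(\psi_Q)\text{ has sub-factorial growth in }|Q|\}$, where sub-factorial growth means that for every $\epsilon>0$ there is $c$ with $|\psi_Q|\le c(|Q|!)^\epsilon$. Let $\iota\colon\mathfrak{D}_\hbar\to\widehat{\mathcal{A}}_\hbar(\mathbb{D}_n)$ be the inclusion and $\mathrm{pr}_{\mathfrak{D}_\hbar}$ the projection along $\mathcal{J}_0$. The GNS representation $\pi_0(a)[b]=[a\star_{\mathbb{D}_n}b]$ on $\widehat{\mathcal{A}}_\hbar(\mathbb{D}_n)/\mathcal{J}_0$ is transported to $\mathfrak{D}_\hbar$ by the induced isomorphism $\mathfrak{D}_\hbar\cong\widehat{\mathcal{A}}_\hbar(\mathbb{D}_n)/\mathcal{J}_0$. Inequalities and binomial coefficients of multiindices are componentwise (products of binomials).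 In the displayed formula of the claim, $S$ is a multiindex. *)

theory Defs
  imports "HOL-Analysis.Analysis" "HOL-Library.Function_Algebras"
begin

section \<open>Spaces of complex-valued functions\<close>

definition cscale :: "complex \<Rightarrow> ('x \<Rightarrow> complex) \<Rightarrow> 'x \<Rightarrow> complex" (infixr \<open>\<cdot>\<^sub>C\<close> 75)
  where "c \<cdot>\<^sub>C f = (\<lambda>x. c * f x)"

global_interpretation cfun: vector_space "cscale :: complex \<Rightarrow> ('x \<Rightarrow> complex) \<Rightarrow> 'x \<Rightarrow> complex"
  by standard (auto simp: cscale_def fun_eq_iff algebra_simps)

definition seminorm_topology ::
    "('x \<Rightarrow> complex) set \<Rightarrow> (('x \<Rightarrow> complex) \<Rightarrow> real) set \<Rightarrow> ('x \<Rightarrow> complex) topology"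
  where "seminorm_topology V N =
    topology_generated_by {{b \<in> V. p (b - a) < r} | a p r. a \<in> V \<and> p \<in> N \<and> 0 < r}"

definition quotient_topology :: "'a topology \<Rightarrow> ('a \<Rightarrow> 'b) \<Rightarrow> 'b topology"
  where "quotient_topology X q =
    topology (\<lambda>U. U \<subseteq> q ` topspace X \<and> openin X {x \<in> topspace X. q x \<in> U})"

lemma openin_quotient_topology:
  "openin (quotient_topology X q) U \<longleftrightarrow>
     U \<subseteq> q ` topspace X \<and> openin X {x \<in> topspace X. q x \<in> U}"
proof -
  have "istopology (\<lambda>U. U \<subseteq> q ` topspace X \<and> openin X {x \<in> topspace X. q x \<in> U})"
    unfolding istopology_def
  proof (rule conjI; intro allI impI)
    fix S T
    assume S: "S \<subseteq> q ` topspace X \<and> openin X {x \<in> topspace X. q x \<in> S}"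
      and T: "T \<subseteq> q ` topspace X \<and> openin X {x \<in> topspace X. q x \<in> T}"
    then have "openin X ({x \<in> topspace X. q x \<in> S} \<inter> {x \<in> topspace X. q x \<in> T})" by blast
    moreover have "{x \<in> topspace X. q x \<in> S} \<inter> {x \<in> topspace X. q x \<in> T}
        = {x \<in> topspace X. q x \<in> S \<inter> T}" by blast
    ultimately show "S \<inter> T \<subseteq> q ` topspace X \<and> openin X {x \<in> topspace X. q x \<in> S \<inter> T}"
      using S by auto
  next
    fix K assume K: "\<forall>U\<in>K. U \<subseteq> q ` topspace X \<and> openin X {x \<in> topspace X. q x \<in> U}"
    then have "openin X (\<Union>U\<in>K. {x \<in> topspace X. q x \<in> U})" by blast
    moreover have "(\<Union>U\<in>K. {x \<in> topspace X. q x \<in> U}) = {x \<in> topspace X. q x \<in> \<Union>K}" by blast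
    ultimately show "\<Union>K \<subseteq> q ` topspace X \<and> openin X {x \<in> topspace X. q x \<in> \<Union>K}"
      using K by auto
  qed
  then show ?thesis
    by (simp add: quotient_topology_def)
qed

lemma topspace_quotient_topology: "topspace (quotient_topology X q) = q ` topspace X"
proof
  show "topspace (quotient_topology X q) \<subseteq> q ` topspace X"
    by (metis openin_quotient_topology openin_topspace)
  have "{x \<in> topspace X. q x \<in> q ` topspace X} = topspace X" by blast
  then have "openin (quotient_topology X q) (q ` topspace X)"
    by (simp add: openin_quotient_topology)
  then show "q ` topspace X \<subseteq> topspace (quotient_topology X q)"
    by (rule openin_subset)
qed

lemma quotient_map_quotient_topology: "quotient_map X (quotient_topology X q) q"
  unfolding quotient_map_def
  by (simp add: topspace_quotient_topology openin_quotient_topology)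

text \<open>Convergence of an (unordered) series in a topological vector space of functions: the net
  of all finite partial sums converges.\<close>

definition series_sums ::
    "('x \<Rightarrow> complex) topology \<Rightarrow> ('i \<Rightarrow> 'x \<Rightarrow> complex) \<Rightarrow> ('x \<Rightarrow> complex) \<Rightarrow> bool"
  where "series_sums X t s \<longleftrightarrow> limitin X (\<lambda>F. \<Sum>i\<in>F. t i) s (finite_subsets_at_top UNIV)"


section \<open>Multiindices, coordinates and the Wick product\<close>

text \<open>The type \<open>'n\<close> indexes the coordinates \<open>1, \<dots>, n\<close>, so \<open>n = CARD('n)\<close> is an arbitrary
  positive number; \<open>'n option\<close> indexes \<open>0, \<dots>, n\<close>, with \<open>None\<close> in the role of \<open>0\<close>.
  Order, sum and difference of multiindices are the pointwise ones on functions.\<close>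

type_synonym 'n mindex = "'n \<Rightarrow> nat"

type_synonym 'n triple = "'n mindex \<times> 'n mindex \<times> nat"

type_synonym 'n point = "complex ^ ('n option)"

definition mdeg :: "'n::finite mindex \<Rightarrow> nat"
  where "mdeg P = (\<Sum>i\<in>UNIV. P i)"

definition mfact :: "'n::finite mindex \<Rightarrow> nat"
  where "mfact P = (\<Prod>i\<in>UNIV. fact (P i))"

definition mchoose :: "'n::finite mindex \<Rightarrow> 'n mindex \<Rightarrow> nat"
  where "mchoose P Q = (\<Prod>i\<in>UNIV. P i choose Q i)"

definition gmetric :: "'n option \<Rightarrow> 'n option \<Rightarrow> complex"
  where "gmetric i j = (if i \<noteq> j then 0 else if i = None then - 1 else 1)"

definition yfun :: "'n::finite point \<Rightarrow> real"
  where "yfun z = (cmod (z $ None))\<^sup>2 - (\<Sum>i\<in>UNIV. (cmod (z $ Some i))\<^sup>2)"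

definition pos_cone :: "'n::finite point set"
  where "pos_cone = {z. yfun z > 0}"

definition disc :: "(complex ^ 'n::finite) set"
  where "disc = {v. (norm v)\<^sup>2 < 1}"

definition disc_proj :: "'n::finite point \<Rightarrow> complex ^ 'n"
  where "disc_proj z = (\<chi> i. z $ Some i / z $ None)"

definition wirt_z :: "'n::finite option \<Rightarrow> ('n point \<Rightarrow> complex) \<Rightarrow> 'n point \<Rightarrow> complex"
  where "wirt_z i f z =
    (vector_derivative (\<lambda>t. f (z + t *\<^sub>R axis i 1)) (at 0)
      - \<i> * vector_derivative (\<lambda>t. f (z + t *\<^sub>R axis i \<i>)) (at 0)) / 2"

definition wirt_zbar :: "'n::finite option \<Rightarrow> ('n point \<Rightarrow> complex) \<Rightarrow> 'n point \<Rightarrow> complex"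
  where "wirt_zbar i f z =
    (vector_derivative (\<lambda>t. f (z + t *\<^sub>R axis i 1)) (at 0)
      + \<i> * vector_derivative (\<lambda>t. f (z + t *\<^sub>R axis i \<i>)) (at 0)) / 2"

text \<open>For polynomials only finitely many \<open>r\<close> contribute.\<close>

definition wick :: "real \<Rightarrow> ('n::finite point \<Rightarrow> complex) \<Rightarrow> ('n point \<Rightarrow> complex)
    \<Rightarrow> 'n point \<Rightarrow> complex"
  where "wick h f g z =
    (\<Sum>r. complex_of_real ((2 * h) ^ r / fact r) *
      (\<Sum>I | length I = r. \<Sum>J | length J = r.
        (\<Prod>k<r. gmetric (I ! k) (J ! k)) * foldr wirt_z I f z * foldr wirt_zbar J g z))"

definition u1_polys :: "('n::finite point \<Rightarrow> complex) set"
  where "u1_polys =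
    {p \<in> cfun.span {\<lambda>z. \<Prod>i\<in>UNIV. (z $ i) ^ K i * cnj (z $ i) ^ L i | K L. True}.
      \<forall>u z. cmod u = 1 \<longrightarrow> p (u *s z) = p z}"


section \<open>The algebra on the cone\<close>

definition triples :: "'n::finite triple set"
  where "triples = {(P, Q, \<alpha>). mdeg P \<le> \<alpha> \<and> mdeg Q \<le> \<alpha>}"

definition e_fun :: "'n::finite triple \<Rightarrow> 'n point \<Rightarrow> complex"
  where "e_fun = (\<lambda>(P, Q, \<alpha>) z.
    (z $ None) ^ (\<alpha> - mdeg P) * (\<Prod>i\<in>UNIV. (z $ Some i) ^ P i) *
    cnj (z $ None) ^ (\<alpha> - mdeg Q) * (\<Prod>i\<in>UNIV. cnj (z $ Some i) ^ Q i))"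

text \<open>Functions on the cone are represented by their extensions by zero to the whole space.\<close>

definition Se_fun :: "real \<Rightarrow> 'n::finite triple \<Rightarrow> 'n point \<Rightarrow> complex"
  where "Se_fun h = (\<lambda>(P, Q, \<alpha>) z. if z \<in> pos_cone then
    complex_of_real ((2 * h) ^ \<alpha> * pochhammer (yfun z / (2 * h)) \<alpha>) *
      e_fun (P, Q, \<alpha>) z / complex_of_real (yfun z) ^ \<alpha> else 0)"

definition f_fun :: "real \<Rightarrow> 'n::finite triple \<Rightarrow> 'n point \<Rightarrow> complex"
  where "f_fun h = (\<lambda>(P, Q, \<alpha>) z. if z \<in> pos_cone then
    complex_of_real (1 / (mfact P * fact (\<alpha> - mdeg P) * mfact Q * fact (\<alpha> - mdeg Q))
        * pochhammer (yfun z / (2 * h)) \<alpha>) *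
      e_fun (P, Q, \<alpha>) z / complex_of_real (yfun z) ^ \<alpha> else 0)"

text \<open>The values of this operator outside \<open>u1_polys\<close> are irrelevant; on \<open>u1_polys\<close>, of which
  the functions \<open>e_fun k\<close> form a basis, it is uniquely determined.\<close>

definition S_op :: "real \<Rightarrow> ('n::finite point \<Rightarrow> complex) \<Rightarrow> 'n point \<Rightarrow> complex"
  where "S_op h = (SOME T. Vector_Spaces.linear cscale cscale T \<and>
    (\<forall>k\<in>triples. T (e_fun k) = Se_fun h k))"

definition A_cone :: "real \<Rightarrow> ('n::finite point \<Rightarrow> complex) set"
  where "A_cone h = cfun.span (f_fun h ` triples)"

definition star_cone :: "real \<Rightarrow> ('n::finite point \<Rightarrow> complex) \<Rightarrow> ('n point \<Rightarrow> complex)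
    \<Rightarrow> 'n point \<Rightarrow> complex"
  where "star_cone h a b =
    S_op h (wick h (inv_into u1_polys (S_op h) a) (inv_into u1_polys (S_op h) b))"

text \<open>The completion of \<open>A_cone\<close>, realised as an algebra of functions: \<open>f_series h\<close> is injective on
  \<open>coeff_space\<close>, so that \<open>the_inv_into\<close> below recovers the coefficients of a function.\<close>

definition weight :: "real \<Rightarrow> ('n::finite triple \<Rightarrow> complex) \<Rightarrow> 'n triple \<Rightarrow> real"
  where "weight \<epsilon> c = (\<lambda>(P, Q, \<alpha>). cmod (c (P, Q, \<alpha>)) / (fact \<alpha>) powr \<epsilon>)"

definition coeff_space :: "('n::finite triple \<Rightarrow> complex) set"
  where "coeff_space = {c. (\<forall>k. k \<notin> triples \<longrightarrow> c k = 0) \<and>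
    (\<forall>\<epsilon>. 0 < \<epsilon> \<and> \<epsilon> < 1 \<longrightarrow> bdd_above (weight \<epsilon> c ` triples))}"

definition f_series :: "real \<Rightarrow> ('n::finite triple \<Rightarrow> complex) \<Rightarrow> 'n point \<Rightarrow> complex"
  where "f_series h c z = (\<Sum>\<^sub>\<infinity>k\<in>triples. c k * f_fun h k z)"

definition Ahat_cone :: "real \<Rightarrow> ('n::finite point \<Rightarrow> complex) set"
  where "Ahat_cone h = f_series h ` coeff_space"

definition Ahat_seminorm :: "real \<Rightarrow> real \<Rightarrow> ('n::finite point \<Rightarrow> complex) \<Rightarrow> real"
  where "Ahat_seminorm h \<epsilon> a =
    (SUP k\<in>triples. weight \<epsilon> (the_inv_into coeff_space (f_series h) a) k)"

definition top_cone :: "real \<Rightarrow> ('n::finite point \<Rightarrow> complex) topology"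
  where "top_cone h =
    seminorm_topology (Ahat_cone h) {Ahat_seminorm h \<epsilon> | \<epsilon>. 0 < \<epsilon> \<and> \<epsilon> < 1}"

text \<open>The continuous extension of the product from \<open>A_cone\<close> to its completion. It is unique on
  \<open>Ahat_cone\<close>, and its values elsewhere are irrelevant.\<close>

definition star_hat :: "real \<Rightarrow> ('n::finite point \<Rightarrow> complex) \<Rightarrow> ('n point \<Rightarrow> complex)
    \<Rightarrow> 'n point \<Rightarrow> complex"
  where "star_hat h = (SOME m.
    continuous_map (prod_topology (top_cone h) (top_cone h)) (top_cone h) (\<lambda>(a, b). m a b) \<and>
    (\<forall>a\<in>A_cone h. \<forall>b\<in>A_cone h. m a b = star_cone h a b))"


section \<open>The quotient algebra on the disc\<close>

definition J_level :: "real \<Rightarrow> ('n::finite point \<Rightarrow> complex) set"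
  where "J_level h = {a \<in> Ahat_cone h. \<forall>w. yfun w = 1 \<longrightarrow> a w = 0}"

text \<open>The class of \<open>a\<close> modulo \<open>J_level\<close> is represented by the function \<open>v \<mapsto> a w\<close> on the disc,
  where \<open>w\<close> is any point above \<open>v\<close> with \<open>yfun w = 1\<close>, again extended by zero. The lemmas
  \<open>quot_class_apply\<close> and \<open>quot_class_eq_iff\<close> below justify this.\<close>

definition quot_class :: "('n::finite point \<Rightarrow> complex) \<Rightarrow> complex ^ 'n \<Rightarrow> complex"
  where "quot_class a v = (if v \<in> disc then a (SOME w. disc_proj w = v \<and> yfun w = 1) else 0)"

definition Ahat_disc :: "real \<Rightarrow> (complex ^ 'n::finite \<Rightarrow> complex) set"
  where "Ahat_disc h = quot_class ` Ahat_cone h"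

definition top_disc :: "real \<Rightarrow> (complex ^ 'n::finite \<Rightarrow> complex) topology"
  where "top_disc h = quotient_topology (top_cone h) quot_class"

definition star_disc :: "real \<Rightarrow> (complex ^ 'n::finite \<Rightarrow> complex) \<Rightarrow> (complex ^ 'n \<Rightarrow> complex)
    \<Rightarrow> complex ^ 'n \<Rightarrow> complex"
  where "star_disc h F G = (THE H. \<forall>a\<in>Ahat_cone h. \<forall>b\<in>Ahat_cone h.
    quot_class a = F \<and> quot_class b = G \<longrightarrow> H = quot_class (star_hat h a b))"

definition f_disc :: "real \<Rightarrow> 'n::finite mindex \<Rightarrow> 'n mindex \<Rightarrow> complex ^ 'n \<Rightarrow> complex"
  where "f_disc h P Q = quot_class (f_fun h (P, Q, max (mdeg P) (mdeg Q)))"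

lemma norm_vec_sq: "(norm (v :: complex ^ 'n::finite))\<^sup>2 = (\<Sum>i\<in>UNIV. (cmod (v $ i))\<^sup>2)"
  by (simp add: norm_vec_def L2_set_def sum_nonneg)

lemma yfun_disc_proj:
  assumes "z $ None \<noteq> 0"
  shows "yfun z = (cmod (z $ None))\<^sup>2 * (1 - (norm (disc_proj z))\<^sup>2)"
  using assms
  by (simp add: yfun_def norm_vec_sq disc_proj_def norm_divide power_divide right_diff_distrib
      sum_distrib_left)

lemma None_nonzero: "yfun z > 0 \<Longrightarrow> z $ None \<noteq> 0"
  unfolding yfun_def using sum_nonneg[of UNIV "\<lambda>i. (cmod (z $ Some i))\<^sup>2"] by auto

lemma disc_proj_in_disc:
  assumes "yfun z > 0"
  shows "disc_proj z \<in> disc"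
  using assms yfun_disc_proj[OF None_nonzero[OF assms]] None_nonzero[OF assms]
  by (auto simp: disc_def zero_less_mult_iff)

lemma ex_level_point:
  fixes v :: "complex ^ 'n::finite"
  assumes "v \<in> disc"
  shows "\<exists>w. disc_proj w = v \<and> yfun w = 1"
proof -
  define s where "s = 1 / sqrt (1 - (norm v)\<^sup>2)"
  have s: "s > 0" "s\<^sup>2 * (1 - (norm v)\<^sup>2) = 1"
    using assms by (simp_all add: s_def disc_def power_divide)
  define w :: "'n point" where
    "w = (\<chi> i. case i of None \<Rightarrow> of_real s | Some j \<Rightarrow> of_real s * v $ j)"
  have p: "disc_proj w = v"
    using s by (simp add: w_def disc_proj_def vec_eq_iff)
  have "yfun w = 1"
    using yfun_disc_proj[of w] s p by (simp add: w_def)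
  with p show ?thesis by blast
qed

lemma e_fun_phase:
  assumes k: "k \<in> triples" and u: "cmod u = 1"
  shows "e_fun k (u *s z) = e_fun k z"
proof -
  obtain P Q \<alpha> where k': "k = (P, Q, \<alpha>)" by (cases k)
  have le: "mdeg P \<le> \<alpha>" "mdeg Q \<le> \<alpha>" using k by (auto simp: triples_def k')
  have 1: "u ^ (\<alpha> - mdeg R) * (\<Prod>i\<in>UNIV. u ^ R i) = u ^ \<alpha>" if "mdeg R \<le> \<alpha>"
    for u :: complex and R :: "'a mindex"
  proof -
    have "(\<Prod>i\<in>UNIV. u ^ R i) = u ^ mdeg R" by (simp add: mdeg_def power_sum)
    then show ?thesis using that by (metis le_add_diff_inverse2 power_add)
  qed
  have "e_fun k (u *s z) = (u ^ (\<alpha> - mdeg P) * (\<Prod>i\<in>UNIV. u ^ P i)) *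
      (cnj u ^ (\<alpha> - mdeg Q) * (\<Prod>i\<in>UNIV. cnj u ^ Q i)) * e_fun k z"
    by (simp add: e_fun_def k' power_mult_distrib prod.distrib)
  also have "\<dots> = (u * cnj u) ^ \<alpha> * e_fun k z"
    using le by (simp add: 1 power_mult_distrib)
  also have "u * cnj u = 1"
    using u by (simp add: complex_norm_square[symmetric])
  finally show ?thesis by simp
qed

lemma f_fun_level:
  assumes k: "k \<in> triples" and y: "yfun w = 1" "yfun w' = 1" and p: "disc_proj w = disc_proj w'"
  shows "f_fun h k w = f_fun h k w'"
proof -
  have nz: "w $ None \<noteq> 0" "w' $ None \<noteq> 0" using y by (auto intro!: None_nonzero)
  define u where "u = w' $ None / w $ None"
  have "disc_proj w \<in> disc" using y disc_proj_in_disc[of w] by simp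
  then have pos: "1 - (norm (disc_proj w))\<^sup>2 > 0" by (simp add: disc_def)
  have "(cmod (w $ None))\<^sup>2 * (1 - (norm (disc_proj w))\<^sup>2)
      = (cmod (w' $ None))\<^sup>2 * (1 - (norm (disc_proj w))\<^sup>2)"
    using yfun_disc_proj[OF nz(1)] yfun_disc_proj[OF nz(2)] y p by simp
  then have "(cmod (w $ None))\<^sup>2 = (cmod (w' $ None))\<^sup>2" using pos by simp
  then have u: "cmod u = 1" using nz by (simp add: u_def norm_divide)
  have "w' $ i = u * w $ i" for i
  proof (cases i)
    case None
    then show ?thesis using nz by (simp add: u_def)
  next
    case (Some j)
    have "w $ Some j / w $ None = w' $ Some j / w' $ None"
      using p by (simp add: disc_proj_def vec_eq_iff)
    then show ?thesis using nz Some by (simp add: u_def field_simps)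
  qed
  then have "w' = u *s w" by (simp add: vec_eq_iff)
  then have "e_fun k w' = e_fun k w" using e_fun_phase[OF k u] by simp
  then show ?thesis
    using y by (cases k) (simp add: f_fun_def pos_cone_def)
qed

lemma Ahat_cone_level:
  assumes "a \<in> Ahat_cone h" "yfun w = 1" "yfun w' = 1" "disc_proj w = disc_proj w'"
  shows "a w = a w'"
  using assms f_fun_level[OF _ assms(2-4)]
  by (auto simp: Ahat_cone_def f_series_def intro!: infsum_cong)

lemma quot_class_apply:
  assumes "a \<in> Ahat_cone h" "yfun w = 1"
  shows "quot_class a (disc_proj w) = a w"
proof -
  have "disc_proj w \<in> disc" using assms disc_proj_in_disc[of w] by simp
  moreover define w' where "w' = (SOME w'. disc_proj w' = disc_proj w \<and> yfun w' = 1)"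
  moreover have "disc_proj w' = disc_proj w \<and> yfun w' = 1"
    unfolding w'_def by (rule someI[of _ w]) (use assms in simp)
  then have "a w' = a w"
    by (intro Ahat_cone_level[OF assms(1)]) (use assms(2) in simp_all)
  ultimately show ?thesis
    by (simp add: quot_class_def)
qed

lemma quot_class_eq_iff:
  assumes a: "a \<in> Ahat_cone h" and b: "b \<in> Ahat_cone h" and d: "a - b \<in> Ahat_cone h"
  shows "quot_class a = quot_class b \<longleftrightarrow> a - b \<in> J_level h"
proof
  assume "quot_class a = quot_class b"
  then have "a w = b w" if "yfun w = 1" for w
    using quot_class_apply[OF a that] quot_class_apply[OF b that] by simp
  then show "a - b \<in> J_level h" using d by (simp add: J_level_def)
next
  assume J: "a - b \<in> J_level h"
  show "quot_class a = quot_class b"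
  proof
    fix v :: "complex ^ 'a"
    show "quot_class a v = quot_class b v"
    proof (cases "v \<in> disc")
      case True
      then obtain w where w: "disc_proj w = v" "yfun w = 1" using ex_level_point by blast
      then have "(a - b) w = 0" using J by (auto simp: J_level_def)
      then show ?thesis
        using quot_class_apply[OF a w(2)] quot_class_apply[OF b w(2)] w(1) by simp
    next
      case False
      then show ?thesis by (simp add: quot_class_def)
    qed
  qed
qed


section \<open>The GNS representation of the evaluation at zero\<close>

definition J_zero :: "real \<Rightarrow> (complex ^ 'n::finite \<Rightarrow> complex) set"
  where "J_zero h = {a \<in> Ahat_disc h. star_disc h (\<lambda>v. cnj (a v)) a 0 = 0}"

definition subfactorial_growth :: "('n::finite mindex \<Rightarrow> complex) \<Rightarrow> bool"
  where "subfactorial_growth c \<longleftrightarrow> (\<forall>\<epsilon>>0. \<exists>C. \<forall>Q. cmod (c Q) \<le> C * (fact (mdeg Q)) powr \<epsilon>)"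

definition D_space :: "real \<Rightarrow> (complex ^ 'n::finite \<Rightarrow> complex) set"
  where "D_space h = {\<psi>. \<exists>c. subfactorial_growth c \<and>
    series_sums (top_disc h) (\<lambda>Q. c Q \<cdot>\<^sub>C f_disc h 0 Q) \<psi>}"

definition top_D :: "real \<Rightarrow> (complex ^ 'n::finite \<Rightarrow> complex) topology"
  where "top_D h = subtopology (top_disc h) (D_space h)"

definition pr_D :: "real \<Rightarrow> (complex ^ 'n::finite \<Rightarrow> complex) \<Rightarrow> complex ^ 'n \<Rightarrow> complex"
  where "pr_D h b = (THE d. d \<in> D_space h \<and> b - d \<in> J_zero h)"

definition gns_class ::
    "real \<Rightarrow> (complex ^ 'n::finite \<Rightarrow> complex) \<Rightarrow> (complex ^ 'n \<Rightarrow> complex) set"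
  where "gns_class h b = {b + j | j. j \<in> J_zero h}"

text \<open>\<open>gns_rep h a\<close> maps the class of \<open>b\<close> modulo \<open>J_zero\<close> to the class of \<open>star_disc h a b\<close>; the
  latter does not depend on the representative \<open>b\<close>, so the union is a single class.\<close>

definition gns_rep :: "real \<Rightarrow> (complex ^ 'n::finite \<Rightarrow> complex)
    \<Rightarrow> (complex ^ 'n \<Rightarrow> complex) set \<Rightarrow> (complex ^ 'n \<Rightarrow> complex) set"
  where "gns_rep h a X = (\<Union>b\<in>X. gns_class h (star_disc h a b))"

text \<open>The representation transported along the isomorphism \<open>gns_class h\<close> from \<open>D_space h\<close> onto
  the quotient by \<open>J_zero h\<close>.\<close>

definition gns_rep_D :: "real \<Rightarrow> (complex ^ 'n::finite \<Rightarrow> complex) \<Rightarrow> (complex ^ 'n \<Rightarrow> complex)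
    \<Rightarrow> complex ^ 'n \<Rightarrow> complex"
  where "gns_rep_D h a \<psi> =
    the_inv_into (D_space h) (gns_class h) (gns_rep h a (gns_class h \<psi>))"

end

theory Submission
  imports Defs "HOL-Combinatorics.Multiset_Permutations" "HOL-Complex_Analysis.Complex_Analysis"
begin

text \<open>
  Everything is transported to coefficients. A function in the completed algebra on the cone is a series
  \<open>f_series h c\<close> whose coefficients \<open>c\<close> grow more slowly than every positive power of the factorial of
  the degree. There are only exponentially many index triples of a given degree, which any such power
  beats (\<open>summable_on_triples\<close>). Hence finitely supported coefficients are dense, a bounded functional
  is determined by its values on the basis (\<open>functional_vanishes_by_density\<close>), and identities in the
  completed algebras reduce to identities between basis functions.

  The product on the cone. A term of the Wick product of two monomials is given by the multiindex \<open>T\<close>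
  that counts how often each coordinate is contracted (\<open>wick_sums\<close>). In the normalized basis the structure
  constants become products of binomial coefficients, which grow at most exponentially, so they define a
  continuous bilinear map \<open>cprod\<close> on coefficients. It represents the completed product
  (\<open>star_hat_f_series\<close>), since the coefficients of a function are unique: along a ray a function is an
  entire function of \<open>y\<close> given by a series of Pochhammer symbols, and its values at \<open>0, -1, -2, \<dots>\<close>
  recover the homogeneous parts (\<open>homogeneous_parts_vanish\<close>).

  Passage to the disc. On the level set \<open>y = 1\<close> the factor \<open>z\<^sup>0\<close> times its conjugate equals
  \<open>1 + \<Sum>i |z\<^sup>i|\<^sup>2\<close>. Expanding it rewrites every basis function in terms of those with
  \<open>\<alpha> = max |P| |Q|\<close>; this is the operator \<open>Red\<close>. The result is unique, because near the point \<open>(1, 0)\<close>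
  the terms of lowest degree in the other coordinates dominate (\<open>reduced_coefficients_unique\<close>). Functions
  on the disc are therefore the same as coefficients \<open>kap h F\<close> on reduced triples. The product descends
  because \<open>y\<close> is central and acts by pointwise multiplication (\<open>wick_mode_shift\<close>): the expansion only
  uses multiples of \<open>y - 1\<close>, and their products with anything vanish on the level set.

  The representation. The evaluation at \<open>0\<close> of the square of \<open>F\<close> is a sum of the numbers
  \<open>|c(0, Q)|\<^sup>2\<close> with positive weights, where \<open>c = kap h F\<close>; hence the Gel'fand ideal consists of the
  functions without coefficients at \<open>P = 0\<close> (\<open>J_zero_eq\<close>), and the projection along it keeps precisely
  these coefficients (\<open>vac\<close>). In the product of \<open>f\<^bsub>P,Q\<^esub>\<close> with \<open>f\<^bsub>0,S\<^esub>\<close> a term survives the projection only if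
  all of \<open>P\<close> is contracted, which needs \<open>P \<le> S\<close> and leaves a multiple of \<open>f\<^bsub>0,Q+S-P\<^esub>\<close>
  (\<open>vac_basis_product\<close>). Splitting both factors according to the second index gives pieces whose norms are
  summable, so the resulting double series converges absolutely in every norm (\<open>product_series\<close>).
\<close>

section \<open>Factorial estimates\<close>

lemma summable_power_over_fact_powr:
  fixes C \<delta> :: real
  assumes C: "0 \<le> C" and d: "0 < \<delta>"
  shows "summable (\<lambda>n. C ^ n / (fact n) powr \<delta>)"
proof -
  have "(\<lambda>n. C * real (Suc n) powr (- \<delta>)) \<longlonglongrightarrow> C * 0"
    using d by (intro tendsto_mult tendsto_const tendsto_neg_powr
        filterlim_compose[OF filterlim_real_sequentially filterlim_Suc]) auto
  then have "(\<lambda>n. C / real (Suc n) powr \<delta>) \<longlonglongrightarrow> 0"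
    by (simp add: powr_minus divide_inverse)
  then have "eventually (\<lambda>n. C / real (Suc n) powr \<delta> < 1/2) sequentially"
    by (rule order_tendstoD) simp
  then obtain N where N: "C / real (Suc n) powr \<delta> < 1/2" if "n \<ge> N" for n
    by (auto simp: eventually_sequentially)
  show ?thesis
  proof (rule summable_ratio_test[of "1/2" N])
    fix n assume n: "n \<ge> N"
    have "C ^ Suc n / (fact (Suc n)) powr \<delta> = (C / real (Suc n) powr \<delta>) * (C ^ n / (fact n) powr \<delta>)"
      by (simp add: powr_mult)
    also have "\<dots> \<le> 1/2 * (C ^ n / (fact n) powr \<delta>)"
      by (rule mult_right_mono) (use N[OF n] C in auto)
    finally show "norm (C ^ Suc n / (fact (Suc n)) powr \<delta>) \<le> 1/2 * norm (C ^ n / (fact n) powr \<delta>)"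
      using C by (simp add: abs_mult)
  qed simp
qed

lemma fact_powr_ge_1: "0 \<le> \<epsilon> \<Longrightarrow> 1 \<le> (fact n :: real) powr \<epsilon>"
  by (simp add: ge_one_powr_ge_zero)

lemma fact_powr_mono: "0 \<le> \<epsilon> \<Longrightarrow> m \<le> n \<Longrightarrow> (fact m :: real) powr \<epsilon> \<le> fact n powr \<epsilon>"
  by (intro powr_mono2 fact_mono) auto

lemma pochhammer_upper:
  fixes x :: real
  assumes "0 \<le> x"
  shows "pochhammer x n \<le> (x + 1) ^ n * fact n"
proof (induction n)
  case (Suc n)
  have "x + real n \<le> (x + 1) * real (Suc n)"
    using assms by (simp add: algebra_simps)
  then have "pochhammer x n * (x + real n) \<le> ((x + 1) ^ n * fact n) * ((x + 1) * real (Suc n))"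
    using Suc assms by (intro mult_mono) (auto simp: pochhammer_nonneg)
  then show ?case by (simp add: pochhammer_Suc algebra_simps)
qed simp

lemma pochhammer_lower:
  fixes x :: real
  assumes "0 < x"
  shows "(min x 1) ^ n * fact n \<le> pochhammer x n"
proof (induction n)
  case (Suc n)
  have "min x 1 * real (Suc n) \<le> x + real n"
    using assms mult_right_mono[of "min x 1" 1 "real n"] by (simp add: algebra_simps)
  then have "((min x 1) ^ n * fact n) * (min x 1 * real (Suc n)) \<le> pochhammer x n * (x + real n)"
    using Suc assms by (intro mult_mono) (auto intro: pochhammer_nonneg)
  then show ?case by (simp add: pochhammer_Suc algebra_simps)
qed simp


section \<open>Multiindices\<close>

lemma mdeg_zero [simp]: "mdeg 0 = 0"
  by (simp add: mdeg_def)

lemma mdeg_add: "mdeg (P + Q) = mdeg P + mdeg Q"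
  by (simp add: mdeg_def sum.distrib)

lemma mdeg_mono: "P \<le> Q \<Longrightarrow> mdeg P \<le> mdeg Q"
  unfolding mdeg_def by (intro sum_mono) (simp add: le_fun_def)

lemma mindex_add_diff: "P \<le> Q \<Longrightarrow> P + (Q - P) = (Q :: 'n mindex)"
  by (auto simp: le_fun_def fun_eq_iff)

lemma mdeg_diff: "P \<le> Q \<Longrightarrow> mdeg (Q - P) = mdeg Q - mdeg P"
  using mdeg_add[of P "Q - P"] by (simp add: mindex_add_diff)

lemma mdeg_eq_0_iff: "mdeg P = 0 \<longleftrightarrow> P = 0"
  by (auto simp: mdeg_def fun_eq_iff)

lemma mindex_le_deg: "P i \<le> mdeg P"
  unfolding mdeg_def by (rule member_le_sum) auto

lemma finite_mindex_le: "finite {T :: 'n::finite mindex. T \<le> K}"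
  by (rule finite_subset[of _ "PiE UNIV (\<lambda>i. {..K i})"]) (auto simp: le_fun_def intro: finite_PiE)

lemma finite_mdeg_le: "finite {P :: 'n::finite mindex. mdeg P \<le> N}"
  by (rule finite_subset[of _ "PiE UNIV (\<lambda>i. {..N})"])
     (auto intro: finite_PiE order_trans[OF mindex_le_deg])

lemma finite_mdeg_eq: "finite {P :: 'n::finite mindex. mdeg P = N}"
  by (rule finite_subset[OF _ finite_mdeg_le[of N]]) auto

lemma mfact_pos: "0 < mfact P"
  by (simp add: mfact_def prod_pos)

lemma mfact_zero [simp]: "mfact 0 = 1"
  by (simp add: mfact_def)

lemma mfact_ge_1: "1 \<le> mfact P"
  using mfact_pos[of P] by simp

lemma mchoose_le: "mchoose P Q \<le> 2 ^ mdeg P"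
proof -
  have "mchoose P Q \<le> (\<Prod>i\<in>UNIV. 2 ^ P i)"
    unfolding mchoose_def by (intro prod_mono) (auto simp: binomial_le_pow2)
  then show ?thesis by (simp add: mdeg_def power_sum)
qed

lemma card_mindex_le: "card {T :: 'n::finite mindex. T \<le> K} \<le> 2 ^ mdeg K"
proof -
  have "{T. T \<le> K} = PiE UNIV (\<lambda>i. {..K i})"
    by (auto simp: le_fun_def)
  then have "card {T. T \<le> K} = (\<Prod>i\<in>UNIV. K i + 1)"
    by (simp add: card_PiE)
  also have "\<dots> \<le> (\<Prod>i\<in>UNIV. 2 ^ K i)"
    by (intro prod_mono conjI) (simp_all add: Suc_leI less_exp)
  finally show ?thesis by (simp add: mdeg_def power_sum)
qed

lemma mfact_le: "mfact P \<le> fact (mdeg P)"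
proof -
  have "(\<Prod>i\<in>A. fact (P i) :: nat) \<le> fact (\<Sum>i\<in>A. P i)" if "finite A" for A
    using that
  proof induction
    case (insert a A)
    have "(\<Prod>i\<in>insert a A. fact (P i) :: nat) \<le> fact (P a) * fact (\<Sum>i\<in>A. P i)"
      using insert by simp
    also have "\<dots> \<le> fact (P a + (\<Sum>i\<in>A. P i))"
      by (rule dvd_imp_le[OF fact_fact_dvd_fact]) simp
    finally show ?case using insert by simp
  qed simp
  then show ?thesis by (simp add: mfact_def mdeg_def)
qed

text \<open>Differentiating along lists of coordinates only depends on how often each coordinate occurs,
  so sums over lists become sums over multiindices with multinomial weights.\<close>

lemma card_lists_with_counts:
  fixes T :: "'n::finite mindex"
  shows "card {I. count (mset I) = T} * mfact T = fact (mdeg T)"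
proof -
  define A where "A = Abs_multiset T"
  have cA: "count A = T" by (simp add: A_def)
  have "{I. count (mset I) = T} = permutations_of_multiset A"
    by (auto simp: permutations_of_multiset_def cA[symmetric] multiset_eq_iff fun_eq_iff)
  moreover have "size A = mdeg T"
    unfolding size_multiset_overloaded_eq cA mdeg_def
    by (rule sum.mono_neutral_left) (auto simp: cA[symmetric] not_in_iff)
  moreover have "(\<Prod>x\<in>set_mset A. fact (count A x)) = mfact T"
    unfolding cA mfact_def
    by (rule prod.mono_neutral_left) (auto simp: cA[symmetric] not_in_iff)
  ultimately show ?thesis
    using card_permutations_of_multiset_aux[of A] by simp
qed

lemma mdeg_count_mset: "mdeg (count (mset I)) = length I"
proof -
  have "mdeg (count (mset I)) = size (mset I)"
    unfolding mdeg_def size_multiset_overloaded_eq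
    by (rule sum.mono_neutral_right) (auto simp: not_in_iff[symmetric])
  then show ?thesis by simp
qed

lemma finite_lists_of_length: "finite {I :: 'n::finite list. length I = r}"
  using finite_lists_length_eq[of "UNIV :: 'n set" r] by simp

lemma sum_over_lists_by_counts:
  fixes \<phi> :: "'n::finite mindex \<Rightarrow> complex"
  shows "(\<Sum>I | length I = r. \<phi> (count (mset I)))
    = (\<Sum>T | mdeg T = r. of_nat (fact r) / of_nat (mfact T) * \<phi> T)"
proof -
  have "(\<Sum>I | length I = r. \<phi> (count (mset I)))
      = (\<Sum>T | mdeg T = r. \<Sum>I | I \<in> {I. length I = r} \<and> count (mset I) = T. \<phi> (count (mset I)))"
    by (rule sum.group[symmetric])
       (auto simp: finite_lists_of_length finite_mdeg_eq mdeg_count_mset)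
  also have "\<dots> = (\<Sum>T | mdeg T = r. of_nat (fact r) / of_nat (mfact T) * \<phi> T)"
  proof (rule sum.cong[OF refl])
    fix T :: "'n mindex" assume T: "T \<in> {T. mdeg T = r}"
    have eq: "{I. I \<in> {I. length I = r} \<and> count (mset I) = T} = {I. count (mset I) = T}"
    proof -
      have "length I = r" if "count (mset I) = T" for I
        using mdeg_count_mset[of I] that T by simp
      then show ?thesis by blast
    qed
    have "(\<Sum>I | count (mset I) = T. \<phi> (count (mset I))) = (\<Sum>I | count (mset I) = T. \<phi> T)"
      by (rule sum.cong) auto
    also have "\<dots> = of_nat (card {I. count (mset I) = T}) * \<phi> T"
      by (rule sum_constant)
    also have "of_nat (card {I. count (mset I) = T}) = (of_nat (fact r) / of_nat (mfact T) :: complex)"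
    proof -
      have "of_nat (card {I. count (mset I) = T}) * of_nat (mfact T) = (of_nat (fact r) :: complex)"
        unfolding of_nat_mult[symmetric] card_lists_with_counts using T by blast
      then show ?thesis
        by (rule eq_divide_imp[rotated]) (use mfact_pos[of T] in simp)
    qed
    finally show "(\<Sum>I | I \<in> {I. length I = r} \<and> count (mset I) = T. \<phi> (count (mset I)))
        = of_nat (fact r) / of_nat (mfact T) * \<phi> T"
      unfolding eq .
  qed
  finally show ?thesis .
qed

lemma fact_mdeg_le: "fact (mdeg T) \<le> CARD('n::finite) ^ mdeg T * mfact (T :: 'n mindex)"
proof -
  have "length I = mdeg T" if "count (mset I) = T" for I
    using mdeg_count_mset[of I] that by simp
  then have "{I. count (mset I) = T} \<subseteq> {I :: 'n list. length I = mdeg T}"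
    by blast
  then have "card {I. count (mset I) = T} \<le> card {I :: 'n list. length I = mdeg T}"
    by (rule card_mono[OF finite_lists_of_length])
  also have "\<dots> = CARD('n) ^ mdeg T"
    using card_lists_length_eq[of "UNIV :: 'n set" "mdeg T"] by simp
  finally have "card {I. count (mset I) = T} * mfact T \<le> CARD('n) ^ mdeg T * mfact T"
    by simp
  then show ?thesis
    by (simp add: card_lists_with_counts)
qed

lemma summable_on_power_mdeg:
  fixes r :: real
  assumes r: "0 \<le> r" "r < 1"
  shows "(\<lambda>P :: 'n::finite mindex. r ^ mdeg P) summable_on UNIV"
proof (rule nonneg_bdd_above_summable_on)
  show "bdd_above (sum (\<lambda>P :: 'n mindex. r ^ mdeg P) ` {F. F \<subseteq> UNIV \<and> finite F})"
  proof (rule bdd_aboveI2)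
    fix F :: "'n mindex set" assume "F \<in> {F. F \<subseteq> UNIV \<and> finite F}"
    then have F: "finite F" by simp
    define N where "N = Max (insert 0 (mdeg ` F))"
    have N: "P i \<le> N" if "P \<in> F" for P i
    proof -
      have "mdeg P \<le> N" unfolding N_def using F that by (intro Max_ge) auto
      then show ?thesis using mindex_le_deg[of P i] by simp
    qed
    have "(\<Sum>P\<in>F. r ^ mdeg P) \<le> (\<Sum>P\<in>PiE (UNIV :: 'n set) (\<lambda>i. {..N}). r ^ mdeg P)"
    proof (rule sum_mono2)
      show "finite (PiE (UNIV :: 'n set) (\<lambda>i. {..N}))" by (rule finite_PiE) auto
    qed (use N r in auto)
    also have "\<dots> = (\<Prod>i\<in>(UNIV :: 'n set). \<Sum>j\<le>N. r ^ j)"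
      by (subst prod_sum_PiE) (auto simp: mdeg_def power_sum)
    also have "\<dots> \<le> (\<Prod>i\<in>(UNIV :: 'n set). 1 / (1 - r))"
    proof (rule prod_mono, safe)
      have "(\<Sum>j\<le>N. r ^ j) = (\<Sum>j<Suc N. r ^ j)" by (simp add: lessThan_Suc_atMost)
      also have "\<dots> \<le> (\<Sum>j. r ^ j)"
        by (rule sum_le_suminf) (use r in auto)
      also have "\<dots> = 1 / (1 - r)" using r by (simp add: suminf_geometric)
      finally show "(\<Sum>j\<le>N. r ^ j) \<le> 1 / (1 - r)" .
    qed (use r in \<open>auto intro: sum_nonneg\<close>)
    finally show "(\<Sum>P\<in>F. r ^ mdeg P) \<le> (\<Prod>i\<in>(UNIV :: 'n set). 1 / (1 - r))" .
  qed
qed (use r in auto)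

lemma summable_on_product_nonneg:
  fixes f :: "'a \<Rightarrow> real" and g :: "'b \<Rightarrow> real"
  assumes "f summable_on A" "g summable_on B" "\<And>x. 0 \<le> f x" "\<And>y. 0 \<le> g y"
  shows "(\<lambda>(x, y). f x * g y) summable_on A \<times> B"
proof -
  have "(\<lambda>(x, y). f x * g y) summable_on Sigma A (\<lambda>_. B)"
  proof (rule summable_on_SigmaI)
    fix x assume "x \<in> A"
    show "((\<lambda>y. case (x, y) of (x, y) \<Rightarrow> f x * g y) has_sum f x * infsum g B) B"
      using assms by (auto intro!: has_sum_cmult_right)
  next
    show "(\<lambda>x. f x * infsum g B) summable_on A"
      using assms by (auto intro!: summable_on_cmult_left)
  qed (use assms in auto)
  then show ?thesis .
qed

definition tdeg :: "'n triple \<Rightarrow> nat"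
  where "tdeg k = snd (snd k)"

lemma tdeg_simp [simp]: "tdeg (P, Q, \<alpha>) = \<alpha>"
  by (simp add: tdeg_def)

lemma finite_triples_le: "finite {k \<in> triples :: 'n::finite triple set. tdeg k \<le> N}"
proof -
  have "{k \<in> triples. tdeg k \<le> N} \<subseteq> {P :: 'n mindex. mdeg P \<le> N} \<times> {P. mdeg P \<le> N} \<times> {..N}"
    by (auto simp: triples_def)
  then show ?thesis
    by (rule finite_subset) (intro finite_SigmaI finite_mdeg_le finite_atMost)
qed

text \<open>The number of triples of degree \<open>\<alpha>\<close> grows at most exponentially in \<open>\<alpha>\<close>, which any positive power
  of \<open>\<alpha>!\<close> beats.\<close>

lemma summable_on_triples:
  fixes C \<delta> :: real
  assumes C: "0 \<le> C" and d: "0 < \<delta>"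
  shows "(\<lambda>k. C ^ tdeg k / (fact (tdeg k)) powr \<delta>) summable_on (triples :: 'n::finite triple set)"
proof -
  define g where "g = (\<lambda>P :: 'n mindex. (1/2 :: real) ^ mdeg P)"
  define u where "u = (\<lambda>n. (4 * C) ^ n / (fact n) powr \<delta> :: real)"
  have g: "g summable_on UNIV"
    unfolding g_def by (rule summable_on_power_mdeg) auto
  have "u summable_on UNIV"
    unfolding u_def
    by (rule summable_nonneg_imp_summable_on[OF summable_power_over_fact_powr]) (use C d in auto)
  then have "(\<lambda>(P, x). g P * (case x of (Q, n) \<Rightarrow> g Q * u n)) summable_on UNIV \<times> (UNIV \<times> UNIV)"
    by (intro summable_on_product_nonneg g) (auto simp: g_def u_def C)
  then have "(\<lambda>(P, x). g P * (case x of (Q, n) \<Rightarrow> g Q * u n)) summable_on triples"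
    by (rule summable_on_subset_banach) auto
  then show ?thesis
  proof (rule summable_on_comparison_test)
    fix k :: "'n triple" assume k: "k \<in> triples"
    obtain P Q n where [simp]: "k = (P, Q, n)" by (cases k)
    have le: "mdeg P \<le> n" "mdeg Q \<le> n" using k by (auto simp: triples_def)
    have *: "1 \<le> g R * 2 ^ n" if "mdeg R \<le> n" for R
    proof -
      have "(2 :: real) ^ mdeg R \<le> 2 ^ n" using that by simp
      then show ?thesis by (simp add: g_def power_divide le_divide_eq)
    qed
    have "1 * 1 \<le> (g P * 2 ^ n) * (g Q * 2 ^ n)"
      by (intro mult_mono *) (auto simp: le g_def)
    then have "1 * (C ^ n / (fact n) powr \<delta>) \<le> (g P * 2 ^ n) * (g Q * 2 ^ n) * (C ^ n / (fact n) powr \<delta>)"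
      by (intro mult_right_mono) (use C in auto)
    also have "\<dots> = g P * (g Q * u n)"
    proof -
      have "(2 :: real) ^ n * 2 ^ n = 4 ^ n" by (simp flip: power_mult_distrib)
      then show ?thesis by (simp add: u_def power_mult_distrib)
    qed
    finally show "C ^ tdeg k / (fact (tdeg k)) powr \<delta> \<le> (case k of (P, x) \<Rightarrow> g P * (case x of (Q, n) \<Rightarrow> g Q * u n))"
      by simp
  qed (use C in auto)
qed

text \<open>A triple \<open>(P, Q, \<alpha>)\<close> stands for the monomial with exponents \<open>up P \<alpha>\<close> and \<open>up Q \<alpha>\<close> in all
  \<open>n + 1\<close> coordinates; both have degree \<open>\<alpha>\<close>. In this form the Wick product treats the coordinate \<open>0\<close>
  like any other, up to a sign.\<close>

definition up :: "'n::finite mindex \<Rightarrow> nat \<Rightarrow> 'n option mindex"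
  where "up P \<alpha> = (\<lambda>i. case i of None \<Rightarrow> \<alpha> - mdeg P | Some j \<Rightarrow> P j)"

definition tri :: "'n::finite option mindex \<Rightarrow> 'n option mindex \<Rightarrow> 'n triple"
  where "tri K L = (K \<circ> Some, L \<circ> Some, mdeg K)"

lemma sum_option: "(\<Sum>i\<in>(UNIV :: 'n::finite option set). f i) = f None + (\<Sum>i\<in>UNIV. f (Some i))"
  by (simp add: UNIV_option_conv sum.reindex)

lemma prod_option: "(\<Prod>i\<in>(UNIV :: 'n::finite option set). f i) = f None * (\<Prod>i\<in>UNIV. f (Some i))"
  by (simp add: UNIV_option_conv prod.reindex)

lemma mdeg_option: "mdeg K = K None + mdeg (K \<circ> Some)"
  by (simp add: mdeg_def sum_option)

lemma up_simps [simp]: "up P \<alpha> None = \<alpha> - mdeg P" "up P \<alpha> (Some j) = P j" "up P \<alpha> \<circ> Some = P"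
  by (auto simp: up_def fun_eq_iff)

lemma mdeg_up [simp]: "mdeg P \<le> \<alpha> \<Longrightarrow> mdeg (up P \<alpha>) = \<alpha>"
  by (simp add: mdeg_option)

lemma mfact_up: "mfact (up P \<alpha>) = mfact P * fact (\<alpha> - mdeg P)"
  by (simp add: mfact_def prod_option)

lemma up_of_ext: "up (K \<circ> Some) (mdeg K) = K"
  by (auto simp: fun_eq_iff up_def mdeg_option split: option.split)

lemma tri_up: "(P, Q, \<alpha>) \<in> triples \<Longrightarrow> tri (up P \<alpha>) (up Q \<alpha>) = (P, Q, \<alpha>)"
  by (auto simp: tri_def triples_def)

lemma tri_in_triples: "mdeg K = mdeg L \<Longrightarrow> tri K L \<in> triples"
  by (simp add: tri_def triples_def mdeg_option)

lemma tdeg_tri [simp]: "tdeg (tri K L) = mdeg K"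
  by (simp add: tri_def)

lemma triples_cases:
  assumes "k \<in> triples"
  obtains K L where "k = tri K L" "mdeg K = mdeg L" "mdeg K = tdeg k"
proof -
  obtain P Q \<alpha> where [simp]: "k = (P, Q, \<alpha>)" by (cases k)
  show ?thesis
    using assms by (intro that[of "up P \<alpha>" "up Q \<alpha>"]) (auto simp: tri_up triples_def)
qed


section \<open>Monomials in a variable and its conjugate\<close>

definition mon :: "'m::finite mindex \<Rightarrow> 'm mindex \<Rightarrow> complex ^ 'm \<Rightarrow> complex"
  where "mon K L z = (\<Prod>i\<in>UNIV. (z $ i) ^ K i * cnj (z $ i) ^ L i)"

lemma mon_mult: "mon K L z * mon K' L' z = mon (K + K') (L + L') z"
  by (simp add: mon_def power_add algebra_simps flip: prod.distrib)

lemma mon_phase: "mon K L (u *s z) = u ^ mdeg K * cnj u ^ mdeg L * mon K L z"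
  by (simp add: mon_def power_mult_distrib prod.distrib mdeg_def power_sum)

lemma mon_scale: "mon K L (of_real t *s z) = of_real t ^ (mdeg K + mdeg L) * mon K L z"
  by (simp add: mon_phase power_add)

lemma e_fun_eq_mon: "(P, Q, \<alpha>) \<in> triples \<Longrightarrow> e_fun (P, Q, \<alpha>) = mon (up P \<alpha>) (up Q \<alpha>)"
  by (simp add: fun_eq_iff e_fun_def mon_def prod_option prod.distrib mult_ac)

lemma e_fun_tri: "mdeg K = mdeg L \<Longrightarrow> e_fun (tri K L) = mon K L"
  by (metis e_fun_eq_mon tri_def tri_in_triples up_of_ext)

text \<open>On a ray the sum is a polynomial in the radius; its homogeneous parts are, up to a power of the
  phase \<open>u\<close>, polynomials in \<open>u\<^sup>2\<close>.\<close>

lemma one_variable_coefficients_zero: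
  fixes C :: "nat \<times> nat \<Rightarrow> complex"
  assumes G: "finite G" and r: "0 < \<rho>"
    and zero: "\<And>w. cmod w < \<rho> \<Longrightarrow> (\<Sum>x\<in>G. C x * w ^ fst x * cnj w ^ snd x) = 0"
    and x0: "x0 \<in> G"
  shows "C x0 = 0"
proof -
  define s where "s = fst x0 + snd x0"
  define H where "H = {x \<in> G. fst x + snd x = s}"
  have H: "finite H" using G by (simp add: H_def)
  have 1: "(\<Sum>x\<in>H. C x * u ^ fst x * cnj u ^ snd x) = 0" if u: "cmod u = 1" for u
  proof -
    define p where "p = (\<Sum>x\<in>G. monom (C x * u ^ fst x * cnj u ^ snd x) (fst x + snd x))"
    have "poly p (of_real t) = 0" if t: "0 < t" "t < \<rho>" for t :: real
    proof -
      have "poly p (of_real t) = (\<Sum>x\<in>G. C x * (of_real t * u) ^ fst x * cnj (of_real t * u) ^ snd x)"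
        by (simp add: p_def poly_sum poly_monom power_mult_distrib power_add mult_ac)
      also have "\<dots> = 0"
        by (rule zero) (use t u in \<open>simp add: norm_mult\<close>)
      finally show ?thesis .
    qed
    then have "complex_of_real ` {0<..<\<rho>} \<subseteq> {x. poly p x = 0}" by auto
    moreover have "infinite (complex_of_real ` {0<..<\<rho>})"
      using r by (subst finite_image_iff) (auto simp: inj_on_def infinite_Ioo)
    ultimately have "p = 0"
      using poly_roots_finite[of p] finite_subset by blast
    then have "coeff p s = 0" by simp
    also have "coeff p s = (\<Sum>x\<in>G. if fst x + snd x = s then C x * u ^ fst x * cnj u ^ snd x else 0)"
      by (simp add: p_def coeff_sum)
    also have "\<dots> = (\<Sum>x\<in>H. C x * u ^ fst x * cnj u ^ snd x)"
      unfolding H_def by (rule sum.inter_filter[OF G, symmetric])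
    finally show ?thesis .
  qed
  define q where "q = (\<Sum>x\<in>H. monom (C x) (2 * fst x))"
  have "poly q (cis t) = 0" for t
  proof -
    have c: "cis t * cnj (cis t) = 1" by (simp add: cis_cnj cis_mult)
    have "poly q (cis t) = (\<Sum>x\<in>H. cis t ^ s * (C x * cis t ^ fst x * cnj (cis t) ^ snd x))"
      unfolding q_def poly_sum poly_monom
    proof (rule sum.cong[OF refl])
      fix x assume "x \<in> H"
      then have "s = fst x + snd x" by (simp add: H_def)
      moreover have "cis t ^ (2 * fst x) = cis t ^ fst x * cis t ^ fst x"
        by (simp add: mult_2 power_add del: cis_cnj)
      ultimately have key: "cis t ^ s * (C x * cis t ^ fst x * cnj (cis t) ^ snd x)
          = C x * cis t ^ (2 * fst x) * (cis t * cnj (cis t)) ^ snd x"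
        by (simp add: power_add power_mult_distrib mult_ac del: cis_cnj)
      show "C x * cis t ^ (2 * fst x) = cis t ^ s * (C x * cis t ^ fst x * cnj (cis t) ^ snd x)"
        using key[symmetric] by (simp only: c power_one mult_1_right)
    qed
    also have "\<dots> = 0"
      unfolding sum_distrib_left[symmetric] using 1[of "cis t"] by simp
    finally show ?thesis .
  qed
  then have "cis ` {0<..<1} \<subseteq> {x. poly q x = 0}" by auto
  moreover have "infinite (cis ` {0<..<1 :: real})"
  proof (subst finite_image_iff)
    show "inj_on cis {0<..<1 :: real}"
    proof (rule inj_onI)
      fix x y :: real assume xy: "x \<in> {0<..<1}" "y \<in> {0<..<1}" "cis x = cis y"
      have "cos x = cos y" using xy(3) by (metis cis.sel(1))
      then show "x = y"
        by (rule cos_inj_pi[rotated -1]) (use xy pi_gt3 in auto)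
    qed
  qed (simp add: infinite_Ioo)
  ultimately have "q = 0"
    using poly_roots_finite[of q] finite_subset by blast
  then have "coeff q (2 * fst x0) = 0" by simp
  also have "coeff q (2 * fst x0) = (\<Sum>x\<in>H. if x = x0 then C x else 0)"
    unfolding q_def coeff_sum coeff_monom
    by (rule sum.cong) (auto simp: H_def s_def prod_eq_iff)
  also have "\<dots> = C x0" using H x0 by (simp add: H_def s_def)
  finally show ?thesis .
qed

text \<open>With all coordinates but \<open>j\<close> frozen, the terms with equal exponents in the coordinate \<open>j\<close> must
  cancel; this removes the coordinate \<open>j\<close> from the product.\<close>

lemma coefficients_zero_induct:
  fixes K L :: "'x \<Rightarrow> 'm \<Rightarrow> nat" and c :: "'x \<Rightarrow> complex"
  assumes "finite A" "finite F" and r: "0 < \<rho>"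
    and "\<And>v. (\<And>i. cmod (v i) < \<rho>) \<Longrightarrow>
      (\<Sum>x\<in>F. c x * (\<Prod>i\<in>A. v i ^ K x i * cnj (v i) ^ L x i)) = 0"
    and "x0 \<in> F"
  shows "(\<Sum>x | x \<in> F \<and> (\<forall>i\<in>A. K x i = K x0 i \<and> L x i = L x0 i). c x) = 0"
  using assms(1,2,4,5)
proof (induction A arbitrary: F rule: finite_induct)
  case empty
  from empty.prems(2)[of "\<lambda>_. 0"] r show ?case by simp
next
  case (insert j A)
  define F' where "F' = {x \<in> F. K x j = K x0 j \<and> L x j = L x0 j}"
  have "(\<Sum>x | x \<in> F' \<and> (\<forall>i\<in>A. K x i = K x0 i \<and> L x i = L x0 i). c x) = 0"
  proof (rule insert.IH)
    fix v :: "'m \<Rightarrow> complex" assume v: "\<And>i. cmod (v i) < \<rho>"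
    define pr where "pr x = c x * (\<Prod>i\<in>A. v i ^ K x i * cnj (v i) ^ L x i)" for x
    define g where "g x = (K x j, L x j)" for x
    have "(\<lambda>y. \<Sum>x | x \<in> F \<and> g x = y. pr x) (g x0) = 0"
    proof (rule one_variable_coefficients_zero[of "g ` F" \<rho>])
      fix w :: complex assume w: "cmod w < \<rho>"
      have "(\<Sum>y\<in>g ` F. (\<Sum>x | x \<in> F \<and> g x = y. pr x) * w ^ fst y * cnj w ^ snd y)
          = (\<Sum>y\<in>g ` F. \<Sum>x | x \<in> F \<and> g x = y. pr x * w ^ fst (g x) * cnj w ^ snd (g x))"
        by (simp add: sum_distrib_right)
      also have "\<dots> = (\<Sum>x\<in>F. pr x * w ^ fst (g x) * cnj w ^ snd (g x))"
        by (rule sum.group) (use insert.prems(1) in auto)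
      also have "\<dots> = (\<Sum>x\<in>F. c x * (\<Prod>i\<in>insert j A. (v(j := w)) i ^ K x i * cnj ((v(j := w)) i) ^ L x i))"
      proof (rule sum.cong[OF refl])
        fix x
        have "(\<Prod>i\<in>A. (v(j := w)) i ^ K x i * cnj ((v(j := w)) i) ^ L x i)
            = (\<Prod>i\<in>A. v i ^ K x i * cnj (v i) ^ L x i)"
          by (rule prod.cong) (use insert.hyps in auto)
        then show "pr x * w ^ fst (g x) * cnj w ^ snd (g x)
            = c x * (\<Prod>i\<in>insert j A. (v(j := w)) i ^ K x i * cnj ((v(j := w)) i) ^ L x i)"
          using insert.hyps by (simp add: pr_def g_def mult_ac)
      qed
      also have "\<dots> = 0"
        by (rule insert.prems(2)) (use v w in auto)
      finally show "(\<Sum>y\<in>g ` F. (\<Sum>x | x \<in> F \<and> g x = y. pr x) * w ^ fst y * cnj w ^ snd y) = 0" .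
    qed (use insert.prems r in auto)
    then show "(\<Sum>x\<in>F'. c x * (\<Prod>i\<in>A. v i ^ K x i * cnj (v i) ^ L x i)) = 0"
      by (simp add: g_def pr_def F'_def)
  qed (use insert.prems in \<open>auto simp: F'_def\<close>)
  then show ?case
    by (simp add: F'_def conj_ac)
qed

lemma monomials_independent:
  fixes K L :: "'x \<Rightarrow> 'm::finite mindex" and c :: "'x \<Rightarrow> complex"
  assumes F: "finite F" and r: "0 < \<rho>"
    and zero: "\<And>v. (\<And>i. cmod (v $ i) < \<rho>) \<Longrightarrow> (\<Sum>x\<in>F. c x * mon (K x) (L x) v) = 0"
    and inj: "inj_on (\<lambda>x. (K x, L x)) F" and x0: "x0 \<in> F"
  shows "c x0 = 0"
proof -
  have "(\<Sum>x | x \<in> F \<and> (\<forall>i\<in>UNIV. K x i = K x0 i \<and> L x i = L x0 i). c x) = 0"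
    by (rule coefficients_zero_induct[OF _ F r]) (use zero[of "\<chi> i. _ i"] x0 in \<open>auto simp: mon_def\<close>)
  also have "{x. x \<in> F \<and> (\<forall>i\<in>UNIV. K x i = K x0 i \<and> L x i = L x0 i)} = {x0}"
    using inj x0 by (auto simp: inj_on_def fun_eq_iff)
  finally show ?thesis by simp
qed


section \<open>The Wick product of monomials\<close>

definition unitm :: "'m \<Rightarrow> 'm mindex"
  where "unitm i = (\<lambda>j. if j = i then 1 else 0)"

definition fall :: "'m::finite mindex \<Rightarrow> 'm mindex \<Rightarrow> nat"
  where "fall K T = (\<Prod>i\<in>UNIV. \<Prod>j<T i. K i - j)"

lemma mdeg_unitm [simp]: "mdeg (unitm i) = 1"
  by (simp add: mdeg_def unitm_def)

lemma fall_unitm: "fall K (T + unitm i) = fall K T * (K i - T i)"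
proof -
  have "fall K (T + unitm i) = (\<Prod>j\<in>UNIV. (\<Prod>l<T j. K j - l) * (if j = i then K i - T i else 1))"
    unfolding fall_def by (rule prod.cong) (auto simp: unitm_def)
  then show ?thesis by (simp add: prod.distrib fall_def)
qed

lemma fall_nonzero_iff: "fall K T \<noteq> 0 \<longleftrightarrow> T \<le> K"
proof -
  have "fall K T = 0 \<longleftrightarrow> (\<exists>i. \<exists>j<T i. K i \<le> j)"
    by (auto simp: fall_def)
  also have "\<dots> \<longleftrightarrow> (\<exists>i. K i < T i)"
    by (metis le_less_trans order_refl)
  finally show ?thesis by (auto simp: le_fun_def not_less)
qed

lemma fall_mfact:
  assumes "T \<le> K"
  shows "fall K T * mfact (K - T) = mfact K"
proof -
  have "(\<Prod>j<t. k - j) * fact (k - t) = (fact k :: nat)" if "t \<le> k" for t k :: nat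
    using that
  proof (induction t)
    case (Suc t)
    then have "fact (k - t) = (k - t) * (fact (k - Suc t) :: nat)"
      by (simp add: fact_reduce)
    then show ?case using Suc by (simp add: mult_ac)
  qed simp
  then show ?thesis
    using assms by (simp add: fall_def mfact_def le_fun_def flip: prod.distrib)
qed

lemma mon_split: "mon K L z = z $ i ^ K i * cnj (z $ i) ^ L i
    * (\<Prod>j\<in>UNIV - {i}. z $ j ^ K j * cnj (z $ j) ^ L j)"
  unfolding mon_def by (rule prod.remove) auto

lemma mon_directional_derivative:
  "((\<lambda>t. mon K L (z + t *\<^sub>R axis i d)) has_vector_derivative
     (of_nat (K i) * d * mon (K - unitm i) L z + of_nat (L i) * cnj d * mon K (L - unitm i) z)) (at 0)"
proof -
  define R where "R = (\<Prod>j\<in>UNIV - {i}. z $ j ^ K j * cnj (z $ j) ^ L j)"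
  define g where "g s = (z $ i + s * d) ^ K i * (cnj (z $ i) + s * cnj d) ^ L i * R" for s :: complex
  have R: "(\<Prod>j\<in>UNIV - {i}. w $ j ^ K' j * cnj (w $ j) ^ L' j) = R"
    if "\<And>j. j \<noteq> i \<Longrightarrow> w $ j = z $ j \<and> K' j = K j \<and> L' j = L j" for w K' L'
    unfolding R_def by (rule prod.cong) (use that in auto)
  have "mon K L (z + t *\<^sub>R axis i d) = g (of_real t)" for t
  proof -
    have c: "axis i d $ j = (if j = i then d else 0)" for j
      by (simp add: axis_def)
    show ?thesis
      unfolding mon_split[of _ _ _ i] by (subst R) (simp_all add: c g_def scaleR_conv_of_real[where ?'a = complex])
  qed
  moreover have "(g has_field_derivative
      (of_nat (K i) * d * mon (K - unitm i) L z + of_nat (L i) * cnj d * mon K (L - unitm i) z)) (at 0)"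
  proof -
    have "mon (K - unitm i) L z = z $ i ^ (K i - 1) * cnj (z $ i) ^ L i * R"
         "mon K (L - unitm i) z = z $ i ^ K i * cnj (z $ i) ^ (L i - 1) * R"
      unfolding mon_split[of _ _ _ i] by (subst R; simp add: unitm_def)+
    then show ?thesis
      unfolding g_def by (auto intro!: derivative_eq_intros simp: algebra_simps)
  qed
  ultimately show ?thesis
    using has_vector_derivative_real_field[of g _ 0] by simp
qed

lemma directional_derivative_sum:
  assumes "finite F"
  shows "vector_derivative (\<lambda>t. \<Sum>x\<in>F. c x * mon (K x) (L x) (z + t *\<^sub>R axis i d)) (at 0)
    = (\<Sum>x\<in>F. c x * (of_nat (K x i) * d * mon (K x - unitm i) (L x) z
        + of_nat (L x i) * cnj d * mon (K x) (L x - unitm i) z))"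
  by (intro vector_derivative_at has_vector_derivative_sum has_vector_derivative_mult_right
      mon_directional_derivative)

lemma wirt_z_sum:
  assumes F: "finite F"
  shows "wirt_z i (\<lambda>z. \<Sum>x\<in>F. c x * mon (K x) (L x) z)
    = (\<lambda>z. \<Sum>x\<in>F. (c x * of_nat (K x i)) * mon (K x - unitm i) (L x) z)"
  unfolding wirt_z_def directional_derivative_sum[OF F]
  by (simp add: fun_eq_iff sum_distrib_left algebra_simps flip: sum_subtractf sum_divide_distrib)

lemma wirt_zbar_sum:
  assumes F: "finite F"
  shows "wirt_zbar i (\<lambda>z. \<Sum>x\<in>F. c x * mon (K x) (L x) z)
    = (\<lambda>z. \<Sum>x\<in>F. (c x * of_nat (L x i)) * mon (K x) (L x - unitm i) z)"
  unfolding wirt_zbar_def directional_derivative_sum[OF F]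
  by (simp add: fun_eq_iff sum_distrib_left algebra_simps flip: sum_subtractf sum_divide_distrib)
     (simp add: algebra_simps sum.distrib sum_subtractf sum_negf sum_distrib_left)

lemma count_mset_Cons: "count (mset (i # I)) = count (mset I) + unitm i"
  by (auto simp: fun_eq_iff unitm_def)

lemma mindex_diff_diff: "K - T - S = K - (T + S :: 'm mindex)"
  by (simp add: fun_eq_iff)

lemma foldr_wirt_z_sum:
  assumes F: "finite F"
  shows "foldr wirt_z I (\<lambda>z. \<Sum>x\<in>F. c x * mon (K x) (L x) z)
    = (\<lambda>z. \<Sum>x\<in>F. (c x * of_nat (fall (K x) (count (mset I)))) * mon (K x - count (mset I)) (L x) z)"
proof (induction I)
  case Nil
  then show ?case by (simp add: fun_eq_iff fall_def)
next
  case (Cons i I)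
  show ?case
    unfolding foldr_Cons o_apply Cons wirt_z_sum[OF F] count_mset_Cons fall_unitm mindex_diff_diff
    by (simp only: of_nat_mult mult.assoc fun_diff_def plus_fun_def)
qed

lemma foldr_wirt_zbar_sum:
  assumes F: "finite F"
  shows "foldr wirt_zbar I (\<lambda>z. \<Sum>x\<in>F. c x * mon (K x) (L x) z)
    = (\<lambda>z. \<Sum>x\<in>F. (c x * of_nat (fall (L x) (count (mset I)))) * mon (K x) (L x - count (mset I)) z)"
proof (induction I)
  case Nil
  then show ?case by (simp add: fun_eq_iff fall_def)
next
  case (Cons i I)
  show ?case
    unfolding foldr_Cons o_apply Cons wirt_zbar_sum[OF F] count_mset_Cons fall_unitm mindex_diff_diff
    by (simp only: of_nat_mult mult.assoc fun_diff_def plus_fun_def)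
qed

definition sgm :: "'n option mindex \<Rightarrow> complex"
  where "sgm T = (-1) ^ T None"

lemma prod_gmetric:
  assumes "length I = r" "length J = r"
  shows "(\<Prod>k<r. gmetric (I ! k) (J ! k)) = (if J = I then sgm (count (mset I)) else 0)"
proof (cases "J = I")
  case True
  have "(\<Prod>k<length I. gmetric (I ! k) (I ! k)) = sgm (count (mset I))"
  proof (induction I)
    case (Cons i I)
    then show ?case
      by (auto simp: prod.lessThan_Suc_shift gmetric_def sgm_def simp del: prod.lessThan_Suc)
  qed (simp add: sgm_def)
  then show ?thesis using True assms by simp
next
  case False
  then obtain k where "k < r" "I ! k \<noteq> J ! k"
    using assms by (metis nth_equalityI)
  then have "\<exists>k\<in>{..<r}. gmetric (I ! k) (J ! k) = 0"
    by (intro bexI[of _ k]) (simp_all add: gmetric_def)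
  then show ?thesis using False by simp
qed

text \<open>Only diagonal pairs of lists contribute to the \<open>r\<close>-th term, and the multinomial coefficient
  \<open>r!/T!\<close> turns the sum over lists into one over multiindices \<open>T\<close>.\<close>

lemma wick_sums:
  fixes K L :: "'x \<Rightarrow> 'n::finite option mindex" and K' L' :: "'y \<Rightarrow> 'n option mindex"
  assumes F: "finite F" and G: "finite G"
  shows "wick h (\<lambda>z. \<Sum>x\<in>F. c x * mon (K x) (L x) z) (\<lambda>z. \<Sum>y\<in>G. d y * mon (K' y) (L' y) z) z
    = (\<Sum>x\<in>F. \<Sum>y\<in>G. c x * d y * (\<Sum>T | T \<le> K x \<and> T \<le> L' y.
        of_real (2 * h) ^ mdeg T * sgm T / of_nat (mfact T) * of_nat (fall (K x) T * fall (L' y) T)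
          * mon (K x - T + K' y) (L x + L' y - T) z))"
proof -
  define p where "p = (\<lambda>z. \<Sum>x\<in>F. c x * mon (K x) (L x) z)"
  define q where "q = (\<lambda>z. \<Sum>y\<in>G. d y * mon (K' y) (L' y) z)"
  define t where "t x y T = of_real (2 * h) ^ mdeg T * sgm T / of_nat (mfact T)
      * of_nat (fall (K x) T * fall (L' y) T) * (mon (K x - T) (L x) z * mon (K' y) (L' y - T) z)" for x y T
  define N where "N = (\<Sum>x\<in>F. mdeg (K x))"
  have t0: "t x y T = 0" if "\<not> (T \<le> K x \<and> T \<le> L' y)" for x y T
    using that fall_nonzero_iff by (auto simp: t_def)
  have term_r: "complex_of_real ((2 * h) ^ r / fact r) *
      (\<Sum>I | length I = r. \<Sum>J | length J = r.
        (\<Prod>k<r. gmetric (I ! k) (J ! k)) * foldr wirt_z I p z * foldr wirt_zbar J q z)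
      = (\<Sum>T | mdeg T = r. \<Sum>x\<in>F. \<Sum>y\<in>G. c x * d y * t x y T)" (is "?l = ?r") for r
  proof -
    define \<phi> where "\<phi> T = sgm T * (\<Sum>x\<in>F. (c x * of_nat (fall (K x) T)) * mon (K x - T) (L x) z)
        * (\<Sum>y\<in>G. (d y * of_nat (fall (L' y) T)) * mon (K' y) (L' y - T) z)" for T
    have "(\<Sum>J | length J = r.
        (\<Prod>k<r. gmetric (I ! k) (J ! k)) * foldr wirt_z I p z * foldr wirt_zbar J q z)
        = \<phi> (count (mset I))" if I: "length I = r" for I
    proof -
      have "(\<Sum>J | length J = r.
        (\<Prod>k<r. gmetric (I ! k) (J ! k)) * foldr wirt_z I p z * foldr wirt_zbar J q z)
        = (\<Sum>J | length J = r. if J = I then \<phi> (count (mset I)) else 0)"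
        by (rule sum.cong) (use I in \<open>auto simp: prod_gmetric \<phi>_def p_def q_def
            foldr_wirt_z_sum[OF F] foldr_wirt_zbar_sum[OF G]\<close>)
      also have "\<dots> = \<phi> (count (mset I))"
        using I by (simp add: finite_lists_of_length)
      finally show ?thesis .
    qed
    then have "?l = complex_of_real ((2 * h) ^ r / fact r) * (\<Sum>I | length I = r. \<phi> (count (mset I)))"
      by simp
    also have "\<dots> = (\<Sum>T | mdeg T = r. complex_of_real ((2 * h) ^ r) / of_nat (mfact T) * \<phi> T)"
      by (simp add: sum_over_lists_by_counts sum_distrib_left mult.assoc)
    also have "\<dots> = ?r"
    proof (rule sum.cong[OF refl])
      fix T :: "'n option mindex" assume T: "T \<in> {T. mdeg T = r}"
      have "\<phi> T = (\<Sum>x\<in>F. \<Sum>y\<in>G. sgm T * (c x * of_nat (fall (K x) T) * mon (K x - T) (L x) z)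
          * (d y * of_nat (fall (L' y) T) * mon (K' y) (L' y - T) z))"
        unfolding \<phi>_def by (simp add: sum_distrib_left sum_distrib_right) (subst sum.swap, simp)
      then show "complex_of_real ((2 * h) ^ r) / of_nat (mfact T) * \<phi> T
          = (\<Sum>x\<in>F. \<Sum>y\<in>G. c x * d y * t x y T)"
        using T by (simp add: sum_distrib_left t_def mult_ac)
    qed
    finally show ?thesis .
  qed
  have "wick h p q z = (\<Sum>r. \<Sum>T | mdeg T = r. \<Sum>x\<in>F. \<Sum>y\<in>G. c x * d y * t x y T)"
    unfolding wick_def term_r ..
  also have "\<dots> = (\<Sum>r\<le>N. \<Sum>T | mdeg T = r. \<Sum>x\<in>F. \<Sum>y\<in>G. c x * d y * t x y T)"
  proof (rule suminf_finite)
    fix r assume r: "r \<notin> {..N}"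
    have "t x y T = 0" if "x \<in> F" "mdeg T = r" for x y T
    proof -
      have "mdeg (K x) \<le> N"
        unfolding N_def using F that by (intro member_le_sum) auto
      then have "\<not> T \<le> K x" using mdeg_mono[of T "K x"] r that by auto
      then show ?thesis using t0 by blast
    qed
    then show "(\<Sum>T | mdeg T = r. \<Sum>x\<in>F. \<Sum>y\<in>G. c x * d y * t x y T) = 0" by simp
  qed simp
  also have "\<dots> = (\<Sum>T | mdeg T \<le> N. \<Sum>x\<in>F. \<Sum>y\<in>G. c x * d y * t x y T)"
  proof -
    have "(\<Sum>r\<le>N. \<Sum>T | T \<in> {T. mdeg T \<le> N} \<and> mdeg T = r. \<Sum>x\<in>F. \<Sum>y\<in>G. c x * d y * t x y T)
        = (\<Sum>T | mdeg T \<le> N. \<Sum>x\<in>F. \<Sum>y\<in>G. c x * d y * t x y T)"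
      by (rule sum.group) (auto simp: finite_mdeg_le)
    moreover have "{T \<in> {T :: 'n option mindex. mdeg T \<le> N}. mdeg T = r} = {T. mdeg T = r}"
      if "r \<le> N" for r using that by auto
    ultimately show ?thesis by simp
  qed
  also have "\<dots> = (\<Sum>x\<in>F. \<Sum>y\<in>G. c x * d y * (\<Sum>T | mdeg T \<le> N. t x y T))"
    by (subst sum.swap, rule sum.cong[OF refl], subst sum.swap) (simp add: sum_distrib_left)
  also have "\<dots> = (\<Sum>x\<in>F. \<Sum>y\<in>G. c x * d y * (\<Sum>T | T \<le> K x \<and> T \<le> L' y. t x y T))"
  proof (rule sum.cong[OF refl], rule sum.cong[OF refl], rule arg_cong2[of _ _ _ _ "(*)"], rule refl)
    fix x y assume x: "x \<in> F"
    have "mdeg (K x) \<le> N"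
      unfolding N_def using F x by (intro member_le_sum) auto
    then show "(\<Sum>T | mdeg T \<le> N. t x y T) = (\<Sum>T | T \<le> K x \<and> T \<le> L' y. t x y T)"
      by (intro sum.mono_neutral_right finite_mdeg_le)
         (auto intro: t0 order_trans[OF mdeg_mono])
  qed
  also have "\<dots> = (\<Sum>x\<in>F. \<Sum>y\<in>G. c x * d y * (\<Sum>T | T \<le> K x \<and> T \<le> L' y.
        of_real (2 * h) ^ mdeg T * sgm T / of_nat (mfact T) * of_nat (fall (K x) T * fall (L' y) T)
          * mon (K x - T + K' y) (L x + L' y - T) z))"
  proof (intro sum.cong refl arg_cong2[of _ _ _ _ "(*)"])
    fix x y T assume "T \<in> {T. T \<le> K x \<and> T \<le> L' y}"
    then have "L x + (L' y - T) = L x + L' y - T"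
      by (auto simp: fun_eq_iff le_fun_def)
    then show "t x y T = of_real (2 * h) ^ mdeg T * sgm T / of_nat (mfact T)
          * of_nat (fall (K x) T * fall (L' y) T) * mon (K x - T + K' y) (L x + L' y - T) z"
      by (simp add: t_def mon_mult)
  qed
  finally show ?thesis by (simp add: p_def q_def)
qed


section \<open>Invariant polynomials\<close>

lemma sum_fun_apply: "(\<Sum>x\<in>A. f x) z = (\<Sum>x\<in>A. f x z)"
  by (induction A rule: infinite_finite_induct) auto

text \<open>For this \<open>u\<close> the integral power of exponent \<open>a - b\<close> has an argument strictly between \<open>-\<pi>\<close> and \<open>\<pi>\<close>.\<close>

lemma phase_separates_degrees:
  assumes "u ^ a * cnj u ^ b = 1" "u = cis (pi / real (a + b + 1))"
  shows "a = b"
proof (rule ccontr)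
  assume ne: "a \<noteq> b"
  define x where "x = pi * ((real a - real b) / real (a + b + 1))"
  have "\<bar>(real a - real b) / real (a + b + 1)\<bar> < 1"
    by (simp add: abs_divide)
  then have "pi * \<bar>(real a - real b) / real (a + b + 1)\<bar> < pi * 1"
    by (intro mult_strict_left_mono) auto
  then have x: "\<bar>x\<bar> < pi" unfolding x_def abs_mult by simp
  have "x \<noteq> 0" using ne by (simp add: x_def)
  define \<theta> where "\<theta> = pi / real (a + b + 1)"
  have "x = real a * \<theta> - real b * \<theta>"
    by (simp add: x_def \<theta>_def left_diff_distrib diff_divide_distrib right_diff_distrib mult.commute)
  then have "u ^ a * cnj u ^ b = cis x"
    unfolding assms(2) \<theta>_def[symmetric] by (simp add: cis_cnj Complex.DeMoivre cis_mult)
  then have "sin x = 0" using assms(1) by (metis cis.sel(2) one_complex.sel(2))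
  then show False using x \<open>x \<noteq> 0\<close> sin_gt_zero[of x] sin_gt_zero[of "-x"] by fastforce
qed

text \<open>Comparing coefficients in \<open>p (u z) = p z\<close> shows that an invariant polynomial only contains
  monomials of equal degree in \<open>z\<close> and in its conjugate.\<close>

lemma u1_polys_eq_span: "u1_polys = cfun.span (e_fun ` (triples :: 'n::finite triple set))"
proof
  have mem: "mon K L \<in> {\<lambda>z. \<Prod>i\<in>UNIV. (z $ i) ^ K i * cnj (z $ i) ^ L i | K L. True}"
    for K L :: "'n option mindex"
    by (auto simp: mon_def fun_eq_iff)
  have "cfun.subspace (u1_polys :: ('n point \<Rightarrow> complex) set)"
    unfolding cfun.subspace_def u1_polys_def mem_Collect_eq
    by (intro conjI ballI allI impI cfun.span_zero cfun.span_add cfun.span_scale)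
       (auto simp: cscale_def)
  moreover have "e_fun ` triples \<subseteq> (u1_polys :: ('n point \<Rightarrow> complex) set)"
  proof safe
    fix P Q :: "'n mindex" and \<alpha> assume k: "(P, Q, \<alpha>) \<in> triples"
    show "e_fun (P, Q, \<alpha>) \<in> u1_polys"
      unfolding u1_polys_def using e_fun_phase[OF k] mem[of "up P \<alpha>" "up Q \<alpha>"]
      by (auto simp: e_fun_eq_mon[OF k] intro: cfun.span_base)
  qed
  ultimately show "cfun.span (e_fun ` triples) \<subseteq> (u1_polys :: ('n point \<Rightarrow> complex) set)"
    by (intro cfun.span_minimal)
next
  show "u1_polys \<subseteq> cfun.span (e_fun ` (triples :: 'n triple set))"
  proof
    fix p :: "'n point \<Rightarrow> complex" assume p: "p \<in> u1_polys"
    let ?M = "{\<lambda>z. \<Prod>i\<in>UNIV. (z $ i) ^ K i * cnj (z $ i) ^ L i | K L :: 'n option mindex. True}"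
    have "p \<in> cfun.span ?M" and inv: "p (u *s z) = p z" if "cmod u = 1" for u z
      using p that by (auto simp: u1_polys_def)
    then have "p \<in> cfun.span ?M" by (metis norm_one)
    then obtain t r where t: "finite t" "t \<subseteq> ?M" and pt: "p = (\<Sum>f\<in>t. r f \<cdot>\<^sub>C f)"
      unfolding cfun.span_explicit by auto
    have "\<forall>f\<in>t. \<exists>K L. f = mon K L"
      using t(2) by (fastforce simp: mon_def fun_eq_iff)
    then obtain K L where KL: "f = mon (K f) (L f)" if "f \<in> t" for f by metis
    have pt': "p z = (\<Sum>f\<in>t. r f * mon (K f) (L f) z)" for z
      unfolding pt sum_fun_apply cscale_def by (intro sum.cong refl) (metis KL)
    have "r f \<cdot>\<^sub>C f \<in> cfun.span (e_fun ` (triples :: 'n triple set))" if f: "f \<in> t" for f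
    proof (cases "mdeg (K f) = mdeg (L f)")
      case True
      then have "f \<in> e_fun ` triples"
        by (intro image_eqI[of _ _ "tri (K f) (L f)"])
           (use KL[OF f] in \<open>auto simp: e_fun_tri tri_in_triples\<close>)
      then show ?thesis by (intro cfun.span_scale cfun.span_base)
    next
      case False
      define a b where ab: "a = mdeg (K f)" "b = mdeg (L f)"
      define u where "u = cis (pi / real (a + b + 1))"
      have u: "cmod u = 1" by (simp add: u_def)
      define c where "c f = r f * (u ^ mdeg (K f) * cnj u ^ mdeg (L f) - 1)" for f
      have "c f = 0"
      proof (rule monomials_independent[OF t(1) zero_less_one, where c = c and K = K and L = L and ?x0.0 = f])
        fix v :: "'n point"
        have "(\<Sum>f\<in>t. c f * mon (K f) (L f) v) = p (u *s v) - p v"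
          unfolding pt' mon_phase c_def by (simp add: algebra_simps sum_subtractf)
        then show "(\<Sum>f\<in>t. c f * mon (K f) (L f) v) = 0"
          using inv[OF u] by simp
      next
        show "inj_on (\<lambda>x. (K x, L x)) t"
          by (rule inj_onI) (metis KL prod.inject)
      qed (rule f)
      moreover have "u ^ a * cnj u ^ b \<noteq> 1"
        using phase_separates_degrees[of u a b] False u_def ab by blast
      ultimately have "r f = 0" by (simp add: ab c_def)
      then show ?thesis by (simp add: cfun.span_zero)
    qed
    then show "p \<in> cfun.span (e_fun ` (triples :: 'n triple set))"
      unfolding pt by (intro cfun.span_sum)
  qed
qed


section \<open>The coefficient space\<close>

definition pn :: "real \<Rightarrow> ('n::finite triple \<Rightarrow> complex) \<Rightarrow> real"
  where "pn \<epsilon> c = (SUP k\<in>triples. weight \<epsilon> c k)"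

definition delta :: "'k \<Rightarrow> 'k \<Rightarrow> complex"
  where "delta k i = (if i = k then 1 else 0)"

definition restr :: "'k set \<Rightarrow> ('k \<Rightarrow> complex) \<Rightarrow> 'k \<Rightarrow> complex"
  where "restr A c k = (if k \<in> A then c k else 0)"

lemma zero_in_triples: "(0, 0, 0) \<in> triples"
  by (simp add: triples_def)

lemma weight_eq: "weight \<epsilon> c k = cmod (c k) / (fact (tdeg k)) powr \<epsilon>"
  by (cases k) (simp add: weight_def)

lemma cscale_apply [simp]: "(s \<cdot>\<^sub>C c) k = s * c k"
  by (simp add: cscale_def)

lemma coeff_zero: "c \<in> coeff_space \<Longrightarrow> k \<notin> triples \<Longrightarrow> c k = 0"
  by (cases k) (simp add: coeff_space_def)

lemma coeff_bound:
  assumes "c \<in> coeff_space" "0 < \<epsilon>" "\<epsilon> < 1"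
  shows "cmod (c k) \<le> pn \<epsilon> c * (fact (tdeg k)) powr \<epsilon>"
    and "0 \<le> pn \<epsilon> c"
proof -
  have bdd: "bdd_above (weight \<epsilon> c ` triples)"
    using assms by (simp add: coeff_space_def)
  have 1: "weight \<epsilon> c k \<le> pn \<epsilon> c" if "k \<in> triples" for k
    unfolding pn_def by (rule cSUP_upper[OF that bdd])
  have "0 \<le> weight \<epsilon> c (0, 0, 0)" by (simp add: weight_eq)
  with 1[OF zero_in_triples] show 2: "0 \<le> pn \<epsilon> c" by linarith
  show "cmod (c k) \<le> pn \<epsilon> c * (fact (tdeg k)) powr \<epsilon>"
  proof (cases "k \<in> triples")
    case True
    from 1[OF this] show ?thesis by (simp add: weight_eq pos_divide_le_eq)
  next
    case False
    then show ?thesis using coeff_zero[OF assms(1)] 2 by simp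
  qed
qed

lemma pn_le:
  assumes "\<And>k. k \<in> triples \<Longrightarrow> cmod (c k) \<le> B * (fact (tdeg k)) powr \<epsilon>"
  shows "pn \<epsilon> c \<le> B"
  unfolding pn_def using zero_in_triples
  by (intro cSUP_least) (auto simp: weight_eq pos_divide_le_eq intro: assms)

lemma coeff_spaceI:
  assumes "\<And>k. k \<notin> triples \<Longrightarrow> c k = 0"
    and "\<And>\<epsilon>. 0 < \<epsilon> \<Longrightarrow> \<epsilon> < 1 \<Longrightarrow> \<exists>B. \<forall>k\<in>triples. cmod (c k) \<le> B * (fact (tdeg k)) powr \<epsilon>"
  shows "c \<in> coeff_space"
  unfolding coeff_space_def mem_Collect_eq
proof (intro conjI allI impI)
  fix \<epsilon> :: real assume "0 < \<epsilon> \<and> \<epsilon> < 1"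
  then obtain B where "\<forall>k\<in>triples. cmod (c k) \<le> B * (fact (tdeg k)) powr \<epsilon>" using assms(2) by blast
  then show "bdd_above (weight \<epsilon> c ` triples)"
    by (intro bdd_aboveI2[of _ _ B]) (simp add: weight_eq pos_divide_le_eq)
qed (use assms(1) in blast)

lemma coeff_space_zero: "0 \<in> coeff_space"
  by (rule coeff_spaceI) (auto intro: exI[of _ 0])

lemma coeff_space_add:
  assumes "c \<in> coeff_space" "d \<in> coeff_space"
  shows "c + d \<in> coeff_space"
proof (rule coeff_spaceI)
  fix \<epsilon> :: real assume e: "0 < \<epsilon>" "\<epsilon> < 1"
  have "cmod ((c + d) k) \<le> (pn \<epsilon> c + pn \<epsilon> d) * (fact (tdeg k)) powr \<epsilon>" for k
    using norm_triangle_ineq[of "c k" "d k"] coeff_bound(1)[OF assms(1) e, of k]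
      coeff_bound(1)[OF assms(2) e, of k] by (simp add: algebra_simps)
  then show "\<exists>B. \<forall>k\<in>triples. cmod ((c + d) k) \<le> B * (fact (tdeg k)) powr \<epsilon>" by blast
qed (use assms in \<open>simp add: coeff_zero\<close>)

lemma coeff_space_scale:
  assumes "c \<in> coeff_space"
  shows "s \<cdot>\<^sub>C c \<in> coeff_space"
proof (rule coeff_spaceI)
  fix \<epsilon> :: real assume e: "0 < \<epsilon>" "\<epsilon> < 1"
  have "cmod ((s \<cdot>\<^sub>C c) k) \<le> (cmod s * pn \<epsilon> c) * (fact (tdeg k)) powr \<epsilon>" for k
    using mult_left_mono[OF coeff_bound(1)[OF assms(1) e, of k], of "cmod s"]
    by (simp add: norm_mult mult.assoc)
  then show "\<exists>B. \<forall>k\<in>triples. cmod ((s \<cdot>\<^sub>C c) k) \<le> B * (fact (tdeg k)) powr \<epsilon>" by blast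
qed (use assms in \<open>simp add: coeff_zero\<close>)

lemma coeff_space_subspace: "cfun.subspace coeff_space"
  by (simp add: cfun.subspace_def coeff_space_zero coeff_space_add coeff_space_scale)

lemmas coeff_space_diff = cfun.subspace_diff[OF coeff_space_subspace]
lemmas coeff_space_sum = cfun.subspace_sum[OF coeff_space_subspace]

lemma restr_in_coeff_space:
  assumes "c \<in> coeff_space"
  shows "restr A c \<in> coeff_space"
proof (rule coeff_spaceI)
  fix \<epsilon> :: real assume e: "0 < \<epsilon>" "\<epsilon> < 1"
  have "cmod (restr A c k) \<le> pn \<epsilon> c * (fact (tdeg k)) powr \<epsilon>" for k
    using coeff_bound[OF assms(1) e] by (simp add: restr_def)
  then show "\<exists>B. \<forall>k\<in>triples. cmod (restr A c k) \<le> B * (fact (tdeg k)) powr \<epsilon>" by blast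
qed (use assms in \<open>simp add: restr_def coeff_zero\<close>)

lemma delta_in_coeff_space: "k \<in> triples \<Longrightarrow> delta k \<in> coeff_space"
  by (rule coeff_spaceI) (auto simp: delta_def intro!: exI[of _ 1] fact_powr_ge_1)

lemma pn_triangle:
  assumes "c \<in> coeff_space" "d \<in> coeff_space" and e: "0 < \<epsilon>" "\<epsilon> < 1"
  shows "pn \<epsilon> (c + d) \<le> pn \<epsilon> c + pn \<epsilon> d"
proof (rule pn_le)
  fix k
  show "cmod ((c + d) k) \<le> (pn \<epsilon> c + pn \<epsilon> d) * (fact (tdeg k)) powr \<epsilon>"
    using norm_triangle_ineq[of "c k" "d k"] coeff_bound(1)[OF assms(1) e, of k]
      coeff_bound(1)[OF assms(2) e, of k] by (simp add: algebra_simps)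
qed

lemma pn_diff_commute: "pn \<epsilon> (c - d) = pn \<epsilon> (d - c)"
  by (simp add: pn_def weight_eq norm_minus_commute)

lemma pn_zero: "pn \<epsilon> (0 :: 'n::finite triple \<Rightarrow> complex) = 0"
proof -
  have "(triples :: 'n triple set) \<noteq> {}" using zero_in_triples by blast
  then show ?thesis by (simp add: pn_def weight_eq)
qed

lemma pn_antimono:
  assumes c: "c \<in> coeff_space" and e: "0 < \<epsilon>" "\<epsilon> \<le> \<epsilon>'" "\<epsilon>' < 1"
  shows "pn \<epsilon>' c \<le> pn \<epsilon> c"
proof (rule pn_le)
  fix k
  have e1: "\<epsilon> < 1" using e by linarith
  have "cmod (c k) \<le> pn \<epsilon> c * (fact (tdeg k)) powr \<epsilon>"
    by (rule coeff_bound(1)[OF c e(1) e1])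
  also have "\<dots> \<le> pn \<epsilon> c * (fact (tdeg k)) powr \<epsilon>'"
    by (intro mult_left_mono powr_mono e coeff_bound(2)[OF c e(1) e1]) simp
  finally show "cmod (c k) \<le> pn \<epsilon> c * (fact (tdeg k)) powr \<epsilon>'" .
qed

text \<open>Passing from \<open>\<epsilon>\<close> to a larger exponent gains a power of \<open>N!\<close> on coefficients of degree at least
  \<open>N\<close>. This makes tails small and families of restrictions summable.\<close>

lemma pn_restr_high_degree:
  assumes c: "c \<in> coeff_space" and e: "0 < \<epsilon>" "\<epsilon> < \<epsilon>'" "\<epsilon>' < 1"
    and A: "\<And>k. k \<in> A \<Longrightarrow> N \<le> tdeg k"
  shows "pn \<epsilon>' (restr A c) \<le> pn \<epsilon> c / (fact N) powr (\<epsilon>' - \<epsilon>)"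
proof (rule pn_le)
  fix k
  have e1: "\<epsilon> < 1" using e by linarith
  show "cmod (restr A c k) \<le> pn \<epsilon> c / (fact N) powr (\<epsilon>' - \<epsilon>) * (fact (tdeg k)) powr \<epsilon>'"
  proof (cases "k \<in> A")
    case True
    have "cmod (c k) * (fact N) powr (\<epsilon>' - \<epsilon>)
        \<le> (pn \<epsilon> c * (fact (tdeg k)) powr \<epsilon>) * (fact (tdeg k)) powr (\<epsilon>' - \<epsilon>)"
      by (intro mult_mono coeff_bound[OF c e(1) e1] fact_powr_mono A[OF True])
         (use e coeff_bound[OF c e(1) e1] in auto)
    also have "\<dots> = pn \<epsilon> c * (fact (tdeg k)) powr \<epsilon>'"
      by (simp flip: powr_add)
    finally show ?thesis using True by (simp add: restr_def pos_le_divide_eq)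
  next
    case False
    then show ?thesis using coeff_bound(2)[OF c e(1) e1] by (simp add: restr_def)
  qed
qed


section \<open>Bounded functionals and operators\<close>

definition linear_on_coeffs :: "(('n::finite triple \<Rightarrow> complex) \<Rightarrow> ('a \<Rightarrow> complex)) \<Rightarrow> bool"
  where "linear_on_coeffs T \<longleftrightarrow> (\<forall>c\<in>coeff_space. \<forall>d\<in>coeff_space. T (c + d) = T c + T d)
    \<and> (\<forall>s. \<forall>c\<in>coeff_space. T (s \<cdot>\<^sub>C c) = s \<cdot>\<^sub>C T c)"

definition bounded_functional :: "(('n::finite triple \<Rightarrow> complex) \<Rightarrow> complex) \<Rightarrow> bool"
  where "bounded_functional \<Lambda> \<longleftrightarrow>
    (\<forall>c\<in>coeff_space. \<forall>d\<in>coeff_space. \<Lambda> (c + d) = \<Lambda> c + \<Lambda> d)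
    \<and> (\<forall>s. \<forall>c\<in>coeff_space. \<Lambda> (s \<cdot>\<^sub>C c) = s * \<Lambda> c)
    \<and> (\<exists>\<epsilon> B. 0 < \<epsilon> \<and> \<epsilon> < 1 \<and> (\<forall>c\<in>coeff_space. cmod (\<Lambda> c) \<le> B * pn \<epsilon> c))"

definition bounded_operator :: "(('n::finite triple \<Rightarrow> complex) \<Rightarrow> ('n triple \<Rightarrow> complex)) \<Rightarrow> bool"
  where "bounded_operator T \<longleftrightarrow> (\<forall>c\<in>coeff_space. T c \<in> coeff_space) \<and> linear_on_coeffs T
    \<and> (\<forall>\<epsilon>. 0 < \<epsilon> \<and> \<epsilon> < 1 \<longrightarrow>
        (\<exists>\<epsilon>' B. 0 < \<epsilon>' \<and> \<epsilon>' < 1 \<and> 0 \<le> B \<and> (\<forall>c\<in>coeff_space. pn \<epsilon> (T c) \<le> B * pn \<epsilon>' c)))"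

lemma bounded_functionalI:
  assumes "\<And>c d. c \<in> coeff_space \<Longrightarrow> d \<in> coeff_space \<Longrightarrow> \<Lambda> (c + d) = \<Lambda> c + \<Lambda> d"
    and "\<And>s c. c \<in> coeff_space \<Longrightarrow> \<Lambda> (s \<cdot>\<^sub>C c) = s * \<Lambda> c"
    and "0 < \<epsilon>" "\<epsilon> < 1" "\<And>c. c \<in> coeff_space \<Longrightarrow> cmod (\<Lambda> c) \<le> B * pn \<epsilon> c"
  shows "bounded_functional \<Lambda>"
  unfolding bounded_functional_def using assms by blast

lemma bounded_functional_add: "bounded_functional \<Lambda> \<Longrightarrow> c \<in> coeff_space \<Longrightarrow> d \<in> coeff_space \<Longrightarrow>
    \<Lambda> (c + d) = \<Lambda> c + \<Lambda> d"
  and bounded_functional_scale: "bounded_functional \<Lambda> \<Longrightarrow> c \<in> coeff_space \<Longrightarrow> \<Lambda> (s \<cdot>\<^sub>C c) = s * \<Lambda> c"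
  by (auto simp: bounded_functional_def)

lemma bounded_functional_zero: "bounded_functional \<Lambda> \<Longrightarrow> \<Lambda> 0 = 0"
  using bounded_functional_scale[of \<Lambda> 0 0] coeff_space_zero by (simp add: cscale_def zero_fun_def)

lemma bounded_functional_diff:
  assumes "bounded_functional \<Lambda>" "c \<in> coeff_space" "d \<in> coeff_space"
  shows "\<Lambda> (c - d) = \<Lambda> c - \<Lambda> d"
  using bounded_functional_add[OF assms(1) coeff_space_diff[OF assms(2,3)] assms(3)] by simp

lemma bounded_functional_sum:
  assumes "bounded_functional \<Lambda>" "\<And>x. x \<in> A \<Longrightarrow> g x \<in> coeff_space"
  shows "\<Lambda> (\<Sum>x\<in>A. g x) = (\<Sum>x\<in>A. \<Lambda> (g x))"
  using assms(2)
proof (induction A rule: infinite_finite_induct)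
  case (insert x A)
  have "\<Lambda> (sum g (insert x A)) = \<Lambda> (g x + sum g A)"
    by (rule arg_cong[OF sum.insert[OF insert.hyps], of \<Lambda>])
  also have "\<dots> = \<Lambda> (g x) + \<Lambda> (sum g A)"
    by (intro bounded_functional_add[OF assms(1)] coeff_space_sum) (use insert.prems in auto)
  also have "\<Lambda> (sum g A) = (\<Sum>x\<in>A. \<Lambda> (g x))"
    by (rule insert.IH) (use insert.prems in auto)
  also have "\<Lambda> (g x) + (\<Sum>x\<in>A. \<Lambda> (g x)) = (\<Sum>x\<in>insert x A. \<Lambda> (g x))"
    by (rule sum.insert[OF insert.hyps, symmetric])
  finally show ?case .
qed (use bounded_functional_zero[OF assms(1)] in auto)

text \<open>Truncations at a degree \<open>N\<close> converge to \<open>c\<close> in every norm, by \<open>pn_restr_high_degree\<close>.\<close>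

lemma functional_vanishes_by_density:
  assumes L: "bounded_functional \<Lambda>" and zero: "\<And>k. k \<in> triples \<Longrightarrow> \<Lambda> (delta k) = 0"
    and c: "c \<in> coeff_space"
  shows "\<Lambda> c = 0"
proof -
  from L obtain \<epsilon> B where e: "0 < \<epsilon>" "\<epsilon> < 1"
    and B: "\<And>c. c \<in> coeff_space \<Longrightarrow> cmod (\<Lambda> c) \<le> B * pn \<epsilon> c"
    unfolding bounded_functional_def by blast
  have Bp: "cmod (\<Lambda> c) \<le> \<bar>B\<bar> * pn \<epsilon> c" if "c \<in> coeff_space" for c
    using B[OF that] mult_right_mono[OF abs_ge_self[of B] coeff_bound(2)[OF that e]] by linarith
  have *: "cmod (\<Lambda> c) \<le> \<bar>B\<bar> * pn (\<epsilon>/2) c * (1 ^ N / (fact N) powr (\<epsilon> - \<epsilon>/2))" for N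
  proof -
    define A where "A = {k \<in> triples :: 'a triple set. tdeg k \<le> N}"
    have A: "finite A" unfolding A_def by (rule finite_triples_le)
    have At: "k \<in> triples" if "k \<in> A" for k using that by (simp add: A_def)
    define t where "t = (\<Sum>k\<in>A. c k \<cdot>\<^sub>C delta k)"
    have tk: "t k = restr A c k" for k
      using A by (simp add: t_def sum_fun_apply delta_def restr_def if_distrib cong: if_cong)
    have tC: "t \<in> coeff_space"
      unfolding t_def by (intro coeff_space_sum coeff_space_scale delta_in_coeff_space At)
    have "\<Lambda> t = (\<Sum>k\<in>A. \<Lambda> (c k \<cdot>\<^sub>C delta k))"
      unfolding t_def
      by (rule bounded_functional_sum[OF L]) (intro coeff_space_scale delta_in_coeff_space At)
    also have "\<dots> = 0"
      by (rule sum.neutral)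
         (auto simp: bounded_functional_scale[OF L delta_in_coeff_space[OF At]] zero At)
    finally have "\<Lambda> c = \<Lambda> (c - t)"
      by (simp add: bounded_functional_diff[OF L c tC])
    also have "c - t = restr {k. N \<le> tdeg k \<and> k \<notin> A} c"
    proof
      fix k
      show "(c - t) k = restr {k. N \<le> tdeg k \<and> k \<notin> A} c k"
        using coeff_zero[OF c, of k] by (auto simp: tk restr_def A_def)
    qed
    finally have eq: "\<Lambda> c = \<Lambda> (restr {k. N \<le> tdeg k \<and> k \<notin> A} c)" .
    have "cmod (\<Lambda> c) \<le> \<bar>B\<bar> * pn \<epsilon> (restr {k. N \<le> tdeg k \<and> k \<notin> A} c)"
      unfolding eq by (rule Bp[OF restr_in_coeff_space[OF c]])
    also have "\<dots> \<le> \<bar>B\<bar> * (pn (\<epsilon>/2) c / (fact N) powr (\<epsilon> - \<epsilon>/2))"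
      by (intro mult_left_mono pn_restr_high_degree[OF c]) (use e in auto)
    finally show ?thesis by (simp only: power_one times_divide_eq_right mult_1_right)
  qed
  have "(\<lambda>N. \<bar>B\<bar> * pn (\<epsilon>/2) c * (1 ^ N / (fact N) powr (\<epsilon> - \<epsilon>/2))) \<longlonglongrightarrow> \<bar>B\<bar> * pn (\<epsilon>/2) c * 0"
    by (intro tendsto_mult tendsto_const summable_LIMSEQ_zero summable_power_over_fact_powr) (use e in auto)
  then have "cmod (\<Lambda> c) \<le> \<bar>B\<bar> * pn (\<epsilon>/2) c * 0"
    by (rule tendsto_lowerbound[OF _ always_eventually[OF allI[OF *]]]) simp
  then show ?thesis by simp
qed

lemma bounded_functional_coordinate: "bounded_functional (\<lambda>c. c k)"
proof -
  have "cmod (c k) \<le> (fact (tdeg k)) powr (1/2) * pn (1/2) c" if "c \<in> coeff_space" for c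
    using coeff_bound(1)[OF that, of "1/2" k] by (simp add: mult.commute)
  then show ?thesis
    by (intro bounded_functionalI[where \<epsilon> = "1/2"]) auto
qed

lemma bounded_functional_scaled:
  assumes L: "bounded_functional \<Lambda>"
  shows "bounded_functional (\<lambda>c. s * \<Lambda> c)"
proof -
  from L obtain \<epsilon> B where e: "0 < \<epsilon>" "\<epsilon> < 1"
    and B: "\<And>c. c \<in> coeff_space \<Longrightarrow> cmod (\<Lambda> c) \<le> B * pn \<epsilon> c"
    unfolding bounded_functional_def by blast
  have "cmod (s * \<Lambda> c) \<le> (cmod s * B) * pn \<epsilon> c" if "c \<in> coeff_space" for c
    using mult_left_mono[OF B[OF that], of "cmod s"] by (simp add: norm_mult mult.assoc)
  then show ?thesis
    by (intro bounded_functionalI[OF _ _ e])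
       (auto simp: bounded_functional_add[OF L] bounded_functional_scale[OF L] distrib_left mult.left_commute)
qed

lemma bounded_functional_minus:
  assumes L: "bounded_functional \<Lambda>" and M: "bounded_functional M"
  shows "bounded_functional (\<lambda>c. \<Lambda> c - M c)"
proof -
  from L obtain \<epsilon> B where e: "0 < \<epsilon>" "\<epsilon> < 1"
    and B: "\<And>c. c \<in> coeff_space \<Longrightarrow> cmod (\<Lambda> c) \<le> B * pn \<epsilon> c"
    unfolding bounded_functional_def by blast
  from M obtain \<epsilon>' B' where e': "0 < \<epsilon>'" "\<epsilon>' < 1"
    and B': "\<And>c. c \<in> coeff_space \<Longrightarrow> cmod (M c) \<le> B' * pn \<epsilon>' c"
    unfolding bounded_functional_def by blast
  define m where "m = min \<epsilon> \<epsilon>'"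
  have m: "0 < m" "m < 1" "m \<le> \<epsilon>" "m \<le> \<epsilon>'" using e e' by (auto simp: m_def)
  have "cmod (\<Lambda> c - M c) \<le> (\<bar>B\<bar> + \<bar>B'\<bar>) * pn m c" if c: "c \<in> coeff_space" for c
  proof -
    have "cmod (\<Lambda> c) \<le> \<bar>B\<bar> * pn m c"
      by (rule order_trans[OF B[OF c]])
         (intro mult_mono abs_ge_self pn_antimono[OF c] m e coeff_bound[OF c] abs_ge_zero)
    moreover have "cmod (M c) \<le> \<bar>B'\<bar> * pn m c"
      by (rule order_trans[OF B'[OF c]])
         (intro mult_mono abs_ge_self pn_antimono[OF c] m e' coeff_bound[OF c] abs_ge_zero)
    ultimately show ?thesis
      using norm_triangle_ineq4[of "\<Lambda> c" "M c"] by (simp add: algebra_simps)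
  qed
  then show ?thesis
    by (intro bounded_functionalI[OF _ _ m(1,2)])
       (auto simp: bounded_functional_add[OF L] bounded_functional_scale[OF L]
        bounded_functional_add[OF M] bounded_functional_scale[OF M] right_diff_distrib)
qed

lemma bounded_functional_zero_map: "bounded_functional (\<lambda>c. 0)"
  by (rule bounded_functionalI[where \<epsilon> = "1/2" and B = 0]) auto

lemma bounded_functional_sum_map:
  assumes "finite A" "\<And>x. x \<in> A \<Longrightarrow> bounded_functional (\<Lambda> x)"
  shows "bounded_functional (\<lambda>c. \<Sum>x\<in>A. \<Lambda> x c)"
  using assms
proof (induction A rule: finite_induct)
  case empty
  then show ?case by (simp add: bounded_functional_zero_map)
next
  case (insert x A)
  have "bounded_functional (\<lambda>c. \<Lambda> x c - (-1) * (\<Sum>x\<in>A. \<Lambda> x c))"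
    by (intro bounded_functional_minus bounded_functional_scaled insert) (use insert in auto)
  then show ?case using insert by simp
qed

lemma bounded_operator_mem: "bounded_operator T \<Longrightarrow> c \<in> coeff_space \<Longrightarrow> T c \<in> coeff_space"
  and bounded_operator_add: "bounded_operator T \<Longrightarrow> c \<in> coeff_space \<Longrightarrow> d \<in> coeff_space \<Longrightarrow>
    T (c + d) = T c + T d"
  and bounded_operator_scale: "bounded_operator T \<Longrightarrow> c \<in> coeff_space \<Longrightarrow> T (s \<cdot>\<^sub>C c) = s \<cdot>\<^sub>C T c"
  by (auto simp: bounded_operator_def linear_on_coeffs_def)

lemma bounded_operator_diff:
  assumes "bounded_operator T" "c \<in> coeff_space" "d \<in> coeff_space"
  shows "T (c - d) = T c - T d"
  using bounded_operator_add[OF assms(1) coeff_space_diff[OF assms(2,3)] assms(3)] by simp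

lemma bounded_operatorE:
  assumes "bounded_operator T" "0 < \<epsilon>" "\<epsilon> < 1"
  obtains \<epsilon>' B where "0 < \<epsilon>'" "\<epsilon>' < 1" "0 \<le> B" "\<And>c. c \<in> coeff_space \<Longrightarrow> pn \<epsilon> (T c) \<le> B * pn \<epsilon>' c"
  using assms unfolding bounded_operator_def by metis

lemma bounded_operatorI:
  assumes zero: "\<And>c k. c \<in> coeff_space \<Longrightarrow> k \<notin> triples \<Longrightarrow> T c k = 0"
    and lin: "linear_on_coeffs T"
    and bound: "\<And>\<epsilon>. 0 < \<epsilon> \<Longrightarrow> \<epsilon> < 1 \<Longrightarrow> \<exists>\<epsilon>' B. 0 < \<epsilon>' \<and> \<epsilon>' < 1 \<and> 0 \<le> B \<and>
      (\<forall>c\<in>coeff_space. \<forall>k\<in>triples. cmod (T c k) \<le> B * pn \<epsilon>' c * (fact (tdeg k)) powr \<epsilon>)"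
  shows "bounded_operator T"
  unfolding bounded_operator_def
proof (intro conjI ballI allI impI lin)
  fix c :: "'a triple \<Rightarrow> complex" assume c: "c \<in> coeff_space"
  show "T c \<in> coeff_space"
    by (rule coeff_spaceI) (use zero[OF c] bound c in \<open>blast+\<close>)
next
  fix \<epsilon> :: real assume "0 < \<epsilon> \<and> \<epsilon> < 1"
  then obtain \<epsilon>' B where *: "0 < \<epsilon>'" "\<epsilon>' < 1" "0 \<le> B"
    "\<forall>c\<in>coeff_space. \<forall>k\<in>triples. cmod (T c k) \<le> B * pn \<epsilon>' c * (fact (tdeg k)) powr \<epsilon>"
    using bound by blast
  then show "\<exists>\<epsilon>' B. 0 < \<epsilon>' \<and> \<epsilon>' < 1 \<and> 0 \<le> B \<and> (\<forall>c\<in>coeff_space. pn \<epsilon> (T c) \<le> B * pn \<epsilon>' c)"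
    by (intro exI[of _ \<epsilon>'] exI[of _ B]) (auto intro!: pn_le)
qed

lemma bounded_functional_compose:
  assumes L: "bounded_functional \<Lambda>" and T: "bounded_operator T"
  shows "bounded_functional (\<lambda>c. \<Lambda> (T c))"
proof -
  from L obtain \<epsilon> B where e: "0 < \<epsilon>" "\<epsilon> < 1"
    and B: "\<And>c. c \<in> coeff_space \<Longrightarrow> cmod (\<Lambda> c) \<le> B * pn \<epsilon> c"
    unfolding bounded_functional_def by blast
  obtain \<epsilon>' B' where e': "0 < \<epsilon>'" "\<epsilon>' < 1" "0 \<le> B'"
    and B': "\<And>c. c \<in> coeff_space \<Longrightarrow> pn \<epsilon> (T c) \<le> B' * pn \<epsilon>' c"
    by (rule bounded_operatorE[OF T e]) blast
  have "cmod (\<Lambda> (T c)) \<le> (\<bar>B\<bar> * B') * pn \<epsilon>' c" if c: "c \<in> coeff_space" for c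
  proof -
    have "cmod (\<Lambda> (T c)) \<le> \<bar>B\<bar> * pn \<epsilon> (T c)"
      by (rule order_trans[OF B[OF bounded_operator_mem[OF T c]]])
         (intro mult_right_mono abs_ge_self coeff_bound(2)[OF bounded_operator_mem[OF T c]] e)
    also have "\<dots> \<le> \<bar>B\<bar> * (B' * pn \<epsilon>' c)"
      by (intro mult_left_mono B'[OF c]) auto
    finally show ?thesis by (simp add: mult.assoc)
  qed
  then show ?thesis
    by (intro bounded_functionalI[OF _ _ e'(1,2)])
       (auto simp: bounded_functional_add[OF L] bounded_functional_scale[OF L] bounded_operator_mem[OF T]
        bounded_operator_add[OF T] bounded_operator_scale[OF T])
qed

lemma bounded_operator_compose:
  assumes S: "bounded_operator S" and T: "bounded_operator T"
  shows "bounded_operator (\<lambda>c. S (T c))"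
  unfolding bounded_operator_def linear_on_coeffs_def
proof (intro conjI ballI allI impI)
  fix \<epsilon> :: real assume e: "0 < \<epsilon> \<and> \<epsilon> < 1"
  obtain \<epsilon>1 B where 1: "0 < \<epsilon>1" "\<epsilon>1 < 1" "0 \<le> B"
    "\<And>c. c \<in> coeff_space \<Longrightarrow> pn \<epsilon> (S c) \<le> B * pn \<epsilon>1 c"
    by (rule bounded_operatorE[OF S]) (use e in blast)+
  obtain \<epsilon>2 B' where 2: "0 < \<epsilon>2" "\<epsilon>2 < 1" "0 \<le> B'"
    "\<And>c. c \<in> coeff_space \<Longrightarrow> pn \<epsilon>1 (T c) \<le> B' * pn \<epsilon>2 c"
    by (rule bounded_operatorE[OF T 1(1,2)]) blast
  have "pn \<epsilon> (S (T c)) \<le> (B * B') * pn \<epsilon>2 c" if "c \<in> coeff_space" for c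
    using 1(4)[OF bounded_operator_mem[OF T that]] mult_left_mono[OF 2(4)[OF that] 1(3)]
    by (simp add: mult.assoc)
  then show "\<exists>\<epsilon>' B. 0 < \<epsilon>' \<and> \<epsilon>' < 1 \<and> 0 \<le> B \<and> (\<forall>c\<in>coeff_space. pn \<epsilon> (S (T c)) \<le> B * pn \<epsilon>' c)"
    using 1 2 by (intro exI[of _ \<epsilon>2] exI[of _ "B * B'"]) auto
qed (auto simp: bounded_operator_mem[OF S] bounded_operator_mem[OF T] bounded_operator_add[OF S]
    bounded_operator_add[OF T] bounded_operator_scale[OF S] bounded_operator_scale[OF T])

lemma bounded_operator_restr: "bounded_operator (restr A)"
proof (rule bounded_operatorI)
  show "linear_on_coeffs (restr A)"
    by (auto simp: linear_on_coeffs_def restr_def fun_eq_iff)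
next
  fix \<epsilon> :: real assume e: "0 < \<epsilon>" "\<epsilon> < 1"
  have "cmod (restr A c k) \<le> 1 * pn \<epsilon> c * (fact (tdeg k)) powr \<epsilon>" if "c \<in> coeff_space" for c and k :: "'a triple"
    using coeff_bound(1)[OF that e, of k] coeff_bound(2)[OF that e] by (simp add: restr_def)
  then show "\<exists>\<epsilon>' B. 0 < \<epsilon>' \<and> \<epsilon>' < 1 \<and> 0 \<le> B \<and>
      (\<forall>c\<in>coeff_space. \<forall>k\<in>(triples :: 'a triple set). cmod (restr A c k) \<le> B * pn \<epsilon>' c * (fact (tdeg k)) powr \<epsilon>)"
    using e by (intro exI[of _ \<epsilon>] exI[of _ "1 :: real"]) auto
qed (simp add: restr_def coeff_zero)

text \<open>Coefficients grow by at most a power \<open>\<epsilon>\<close> of the factorial of the degree. If the weights \<open>\<kappa>\<close> decay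
  with a power \<open>\<delta> > \<epsilon>\<close>, the surplus \<open>\<delta> - \<epsilon>\<close> makes the pairing converge.\<close>

lemma kernel_sum:
  fixes \<kappa> :: "'n::finite triple \<Rightarrow> complex"
  assumes c: "c \<in> coeff_space" and e: "0 < \<epsilon>" "\<epsilon> < 1" "\<epsilon> < \<delta>" and BC: "0 \<le> B" "0 \<le> C"
    and bound: "\<And>k. k \<in> triples \<Longrightarrow> cmod (\<kappa> k) \<le> B * (C ^ tdeg k / (fact (tdeg k)) powr \<delta>)"
  shows "(\<lambda>k. norm (c k * \<kappa> k)) summable_on triples"
    and "cmod (\<Sum>\<^sub>\<infinity>k\<in>triples. c k * \<kappa> k)
      \<le> B * (\<Sum>\<^sub>\<infinity>k\<in>(triples :: 'n triple set). C ^ tdeg k / (fact (tdeg k)) powr (\<delta> - \<epsilon>)) * pn \<epsilon> c"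
proof -
  define g where "g k = C ^ tdeg k / (fact (tdeg k)) powr (\<delta> - \<epsilon>)" for k :: "'n triple"
  have g: "g summable_on triples"
    unfolding g_def by (rule summable_on_triples) (use e BC in auto)
  have *: "norm (c k * \<kappa> k) \<le> (B * pn \<epsilon> c) * g k" if k: "k \<in> triples" for k
  proof -
    have "norm (c k * \<kappa> k) \<le> (pn \<epsilon> c * (fact (tdeg k)) powr \<epsilon>) * (B * (C ^ tdeg k / (fact (tdeg k)) powr \<delta>))"
      unfolding norm_mult by (intro mult_mono coeff_bound[OF c e(1,2)] bound[OF k] mult_nonneg_nonneg) auto
    also have "\<dots> = (B * pn \<epsilon> c) * g k"
      by (simp add: g_def powr_diff)
    finally show ?thesis .
  qed
  have gs: "(\<lambda>k. (B * pn \<epsilon> c) * g k) summable_on triples"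
    by (rule summable_on_cmult_right[OF g])
  show s: "(\<lambda>k. norm (c k * \<kappa> k)) summable_on triples"
    by (rule summable_on_comparison_test[OF gs]) (use * in auto)
  have "cmod (\<Sum>\<^sub>\<infinity>k\<in>triples. c k * \<kappa> k) \<le> (\<Sum>\<^sub>\<infinity>k\<in>triples. norm (c k * \<kappa> k))"
    by (rule norm_infsum_bound[OF s])
  also have "\<dots> \<le> (\<Sum>\<^sub>\<infinity>k\<in>triples. (B * pn \<epsilon> c) * g k)"
    by (rule infsum_mono[OF s gs *])
  also have "\<dots> = B * pn \<epsilon> c * infsum g triples"
    by (rule infsum_cmult_right[OF g])
  finally show "cmod (\<Sum>\<^sub>\<infinity>k\<in>triples. c k * \<kappa> k)
      \<le> B * (\<Sum>\<^sub>\<infinity>k\<in>(triples :: 'n triple set). C ^ tdeg k / (fact (tdeg k)) powr (\<delta> - \<epsilon>)) * pn \<epsilon> c"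
    by (simp add: g_def[abs_def] mult_ac)
qed

lemma kernel_sum_linear:
  fixes \<kappa> :: "'n::finite triple \<Rightarrow> complex"
  assumes d: "0 < \<delta>" and BC: "0 \<le> B" "0 \<le> C"
    and bound: "\<And>k. k \<in> triples \<Longrightarrow> cmod (\<kappa> k) \<le> B * (C ^ tdeg k / (fact (tdeg k)) powr \<delta>)"
  shows "c \<in> coeff_space \<Longrightarrow> d \<in> coeff_space \<Longrightarrow>
      (\<Sum>\<^sub>\<infinity>k\<in>triples. (c + d) k * \<kappa> k) = (\<Sum>\<^sub>\<infinity>k\<in>triples. c k * \<kappa> k) + (\<Sum>\<^sub>\<infinity>k\<in>triples. d k * \<kappa> k)"
    and "(\<Sum>\<^sub>\<infinity>k\<in>triples. (s \<cdot>\<^sub>C c) k * \<kappa> k) = s * (\<Sum>\<^sub>\<infinity>k\<in>triples. c k * \<kappa> k)"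
proof -
  define \<epsilon> where "\<epsilon> = min (\<delta>/2) (1/2)"
  have e: "0 < \<epsilon>" "\<epsilon> < 1" "\<epsilon> < \<delta>" using d by (auto simp: \<epsilon>_def)
  have s: "(\<lambda>k. c k * \<kappa> k) summable_on triples" if "c \<in> coeff_space" for c
    by (rule abs_summable_summable[OF kernel_sum(1)[OF that e BC bound]])
  show "(\<Sum>\<^sub>\<infinity>k\<in>triples. (c + d) k * \<kappa> k) = (\<Sum>\<^sub>\<infinity>k\<in>triples. c k * \<kappa> k) + (\<Sum>\<^sub>\<infinity>k\<in>triples. d k * \<kappa> k)"
    if "c \<in> coeff_space" "d \<in> coeff_space"
    using infsum_add[OF s[OF that(1)] s[OF that(2)]] by (simp add: algebra_simps)
  show "(\<Sum>\<^sub>\<infinity>k\<in>triples. (s \<cdot>\<^sub>C c) k * \<kappa> k) = s * (\<Sum>\<^sub>\<infinity>k\<in>triples. c k * \<kappa> k)"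
    by (simp add: mult.assoc infsum_cmult_right')
qed

lemma bounded_functional_kernel:
  fixes \<kappa> :: "'n::finite triple \<Rightarrow> complex"
  assumes d: "0 < \<delta>" and BC: "0 \<le> B" "0 \<le> C"
    and bound: "\<And>k. k \<in> triples \<Longrightarrow> cmod (\<kappa> k) \<le> B * (C ^ tdeg k / (fact (tdeg k)) powr \<delta>)"
  shows "bounded_functional (\<lambda>c. \<Sum>\<^sub>\<infinity>k\<in>triples. c k * \<kappa> k)"
proof -
  define \<epsilon> where "\<epsilon> = min (\<delta>/2) (1/2)"
  have e: "0 < \<epsilon>" "\<epsilon> < 1" "\<epsilon> < \<delta>" using d by (auto simp: \<epsilon>_def)
  show ?thesis
    unfolding bounded_functional_def
    using kernel_sum_linear[OF d BC bound] kernel_sum(2)[OF _ e BC bound] e by blast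
qed

lemma kernel_sum_delta:
  assumes "k \<in> triples"
  shows "(\<Sum>\<^sub>\<infinity>i\<in>triples. delta k i * \<kappa> i) = \<kappa> k"
proof -
  have "(\<Sum>\<^sub>\<infinity>i\<in>triples. delta k i * \<kappa> i) = (\<Sum>\<^sub>\<infinity>i\<in>{k}. delta k i * \<kappa> i)"
    by (rule infsum_cong_neutral) (use assms in \<open>auto simp: delta_def\<close>)
  then show ?thesis by (simp add: delta_def)
qed


section \<open>Functions and their coefficients\<close>

text \<open>The exponents, in all \<open>n + 1\<close> coordinates, of the holomorphic and the antiholomorphic part of the
  monomial that a triple stands for.\<close>

definition exK :: "'n::finite triple \<Rightarrow> 'n option mindex"
  where "exK k = up (fst k) (tdeg k)"

definition exL :: "'n::finite triple \<Rightarrow> 'n option mindex"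
  where "exL k = up (fst (snd k)) (tdeg k)"

lemma tri_ex: "k \<in> triples \<Longrightarrow> tri (exK k) (exL k) = k"
  by (cases k) (simp add: exK_def exL_def tri_up)

lemma mdeg_ex: "k \<in> triples \<Longrightarrow> mdeg (exK k) = tdeg k" "k \<in> triples \<Longrightarrow> mdeg (exL k) = tdeg k"
  by (auto simp: exK_def exL_def triples_def)

lemma ex_tri:
  assumes "mdeg K = mdeg L"
  shows "exK (tri K L) = K" "exL (tri K L) = L"
  using up_of_ext[of K] up_of_ext[of L] assms by (auto simp: exK_def exL_def tri_def)

lemma inj_on_ex: "inj_on (\<lambda>k. (exK k, exL k)) triples"
  by (rule inj_onI) (metis tri_ex prod.inject)

lemma e_fun_ex: "k \<in> triples \<Longrightarrow> e_fun k = mon (exK k) (exL k)"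
  by (cases k) (simp add: exK_def exL_def e_fun_eq_mon)

definition kfact :: "'n::finite triple \<Rightarrow> nat"
  where "kfact k = mfact (exK k) * mfact (exL k)"

lemma kfact_pos: "0 < kfact k"
  by (simp add: kfact_def mfact_pos)

lemma kfact_nonzero [simp]: "kfact k \<noteq> 0"
  using kfact_pos[of k] by simp

lemma f_fun_eq:
  assumes "z \<in> pos_cone"
  shows "f_fun h k z = of_real (pochhammer (yfun z / (2 * h)) (tdeg k)) * e_fun k z
    / (of_nat (kfact k) * of_real (yfun z) ^ tdeg k)"
  using assms by (cases k) (simp add: f_fun_def kfact_def exK_def exL_def mfact_up mult_ac)

lemma Se_fun_eq: "Se_fun h k = (of_real (2 * h) ^ tdeg k * of_nat (kfact k)) \<cdot>\<^sub>C f_fun h k"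
proof
  fix z
  show "Se_fun h k z = ((of_real (2 * h) ^ tdeg k * of_nat (kfact k)) \<cdot>\<^sub>C f_fun h k) z"
  proof (cases "z \<in> pos_cone")
    case True
    then show ?thesis
      using kfact_pos[of k] unfolding cscale_apply f_fun_eq[OF True]
      by (cases k) (simp add: Se_fun_def)
  next
    case False
    then show ?thesis by (cases k) (simp add: Se_fun_def f_fun_def)
  qed
qed

lemma norm_mon_le: "cmod (mon K L z) \<le> (1 + norm z) ^ (mdeg K + mdeg L)"
proof -
  have "cmod (mon K L z) = (\<Prod>i\<in>UNIV. cmod (z $ i) ^ (K i + L i))"
    by (simp add: mon_def norm_mult norm_power power_add flip: prod_norm)
  also have "\<dots> \<le> (\<Prod>i\<in>UNIV. (1 + norm z) ^ (K i + L i))"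
    by (intro prod_mono conjI power_mono zero_le_power norm_ge_zero)
       (use Finite_Cartesian_Product.norm_nth_le[of z] in \<open>simp add: add_increasing\<close>)
  also have "\<dots> = (1 + norm z) ^ (mdeg K + mdeg L)"
    by (simp add: mdeg_def power_sum flip: sum.distrib)
  finally show ?thesis .
qed

text \<open>By the multinomial estimate both factorials \<open>K!\<close> and \<open>L!\<close> in the denominator are as large as \<open>\<alpha>!\<close>,
  up to an exponential factor.\<close>

lemma basis_decay:
  fixes z :: "'n::finite point"
  assumes k: "k \<in> triples"
  shows "cmod (e_fun k z) / real (kfact k)
    \<le> ((real CARD('n option) * (1 + norm z))\<^sup>2) ^ tdeg k / (fact (tdeg k))\<^sup>2"
proof -
  define \<alpha> N R where "\<alpha> = tdeg k" and "N = real CARD('n option)" and "R = 1 + norm z"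
  have *: "1 / real (mfact K) \<le> N ^ \<alpha> / fact \<alpha>" if "mdeg K = \<alpha>" for K :: "'n option mindex"
  proof -
    have "real (fact (mdeg K)) \<le> real (CARD('n option) ^ mdeg K * mfact K)"
      using fact_mdeg_le[of K] by (simp only: of_nat_le_iff)
    then show ?thesis using mfact_pos[of K] that by (simp add: N_def field_simps)
  qed
  have "cmod (e_fun k z) / real (kfact k)
      = cmod (mon (exK k) (exL k) z) * ((1 / real (mfact (exK k))) * (1 / real (mfact (exL k))))"
    by (simp add: e_fun_ex[OF k] kfact_def)
  also have "\<dots> \<le> R ^ (\<alpha> + \<alpha>) * ((N ^ \<alpha> / fact \<alpha>) * (N ^ \<alpha> / fact \<alpha>))"
    using norm_mon_le[of "exK k" "exL k" z] mdeg_ex[OF k]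
    by (intro mult_mono * mult_nonneg_nonneg) (auto simp: R_def \<alpha>_def N_def)
  also have "\<dots> = ((N * R)\<^sup>2) ^ \<alpha> / (fact \<alpha>)\<^sup>2"
    by (simp add: power_add power_mult_distrib power2_eq_square)
  finally show ?thesis by (simp add: \<alpha>_def N_def R_def)
qed

lemma norm_pochhammer_le: "cmod (pochhammer x n) \<le> pochhammer (cmod x) n"
proof (induction n)
  case (Suc n)
  have "cmod (x + of_nat n) \<le> cmod x + real n"
    using norm_triangle_ineq[of x "of_nat n"] by simp
  with Suc have "cmod (pochhammer x n) * cmod (x + of_nat n) \<le> pochhammer (cmod x) n * (cmod x + real n)"
    by (intro mult_mono) (auto intro: order_trans[OF norm_ge_zero])
  then show ?case by (simp add: pochhammer_Suc norm_mult)
qed simp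

lemma pochhammer_basis_bound:
  fixes z :: "'n::finite point"
  assumes k: "k \<in> triples" and x: "cmod x \<le> r"
  shows "cmod (pochhammer x (tdeg k) * e_fun k z / of_nat (kfact k))
    \<le> ((r + 1) * (real CARD('n option) * (1 + norm z))\<^sup>2) ^ tdeg k / (fact (tdeg k)) powr 1"
proof -
  have r: "0 \<le> r" using x norm_ge_zero order_trans by blast
  have "cmod (pochhammer x (tdeg k)) \<le> (cmod x + 1) ^ tdeg k * fact (tdeg k)"
    by (rule order_trans[OF norm_pochhammer_le pochhammer_upper]) simp
  also have "\<dots> \<le> (r + 1) ^ tdeg k * fact (tdeg k)"
    by (intro mult_right_mono power_mono) (use x in auto)
  finally have 1: "cmod (pochhammer x (tdeg k)) \<le> (r + 1) ^ tdeg k * fact (tdeg k)" .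
  have "cmod (pochhammer x (tdeg k) * e_fun k z / of_nat (kfact k))
      = cmod (pochhammer x (tdeg k)) * (cmod (e_fun k z) / real (kfact k))"
    by (simp add: norm_mult norm_divide)
  also have "\<dots> \<le> ((r + 1) ^ tdeg k * fact (tdeg k)) *
      (((real CARD('n option) * (1 + norm z))\<^sup>2) ^ tdeg k / (fact (tdeg k))\<^sup>2)"
    by (intro mult_mono 1 basis_decay[OF k]) (use r in auto)
  also have "\<dots> = ((r + 1) * (real CARD('n option) * (1 + norm z))\<^sup>2) ^ tdeg k / (fact (tdeg k)) powr 1"
    by (simp add: power_mult_distrib power2_eq_square)
  finally show ?thesis .
qed

lemma f_fun_bound:
  fixes z :: "'n::finite point"
  assumes h: "0 < h"
  obtains C where "0 \<le> C"
    "\<And>k. k \<in> triples \<Longrightarrow> cmod (f_fun h k z) \<le> 1 * (C ^ tdeg k / (fact (tdeg k)) powr 1)"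
proof (cases "z \<in> pos_cone")
  case True
  then have y: "0 < yfun z" by (simp add: pos_cone_def)
  define x where "x = complex_of_real (yfun z / (2 * h))"
  define D where "D = (cmod x + 1) * (real CARD('n option) * (1 + norm z))\<^sup>2"
  show ?thesis
  proof (rule that[of "D / yfun z"])
    fix k :: "'n triple" assume k: "k \<in> triples"
    have "f_fun h k z = (pochhammer x (tdeg k) * e_fun k z / of_nat (kfact k)) / of_real (yfun z) ^ tdeg k"
      unfolding f_fun_eq[OF True] pochhammer_of_real[symmetric] x_def[symmetric] by simp
    then have "cmod (f_fun h k z)
        = cmod (pochhammer x (tdeg k) * e_fun k z / of_nat (kfact k)) / yfun z ^ tdeg k"
      using y by (simp add: norm_divide norm_mult norm_power)
    also have "\<dots> \<le> (D ^ tdeg k / (fact (tdeg k)) powr 1) / yfun z ^ tdeg k"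
      unfolding D_def by (intro divide_right_mono pochhammer_basis_bound[OF k]) (use y in auto)
    finally show "cmod (f_fun h k z) \<le> 1 * ((D / yfun z) ^ tdeg k / (fact (tdeg k)) powr 1)"
      by (simp add: power_divide mult.commute)
  qed (use y in \<open>simp add: D_def\<close>)
next
  case False
  have "f_fun h k z = 0" for k using False by (cases k) (simp add: f_fun_def)
  then show ?thesis by (intro that[of 0]) auto
qed

lemma bounded_functional_f_series:
  assumes h: "0 < h"
  shows "bounded_functional (\<lambda>c. f_series h c z)"
proof -
  obtain C where C: "0 \<le> C"
    "\<And>k. k \<in> triples \<Longrightarrow> cmod (f_fun h k z) \<le> 1 * (C ^ tdeg k / (fact (tdeg k)) powr 1)"
    by (rule f_fun_bound[OF h, of z]) blast
  show ?thesis
    unfolding f_series_def by (rule bounded_functional_kernel[OF zero_less_one zero_le_one C])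
qed

lemma f_series_add: "0 < h \<Longrightarrow> c \<in> coeff_space \<Longrightarrow> d \<in> coeff_space \<Longrightarrow>
    f_series h (c + d) = f_series h c + f_series h d"
  using bounded_functional_add[OF bounded_functional_f_series] by fastforce

lemma f_series_diff: "0 < h \<Longrightarrow> c \<in> coeff_space \<Longrightarrow> d \<in> coeff_space \<Longrightarrow>
    f_series h (c - d) = f_series h c - f_series h d"
  using bounded_functional_diff[OF bounded_functional_f_series] by fastforce

lemma f_series_scale: "0 < h \<Longrightarrow> c \<in> coeff_space \<Longrightarrow> f_series h (s \<cdot>\<^sub>C c) = s \<cdot>\<^sub>C f_series h c"
  using bounded_functional_scale[OF bounded_functional_f_series] by (fastforce simp: fun_eq_iff)

lemma f_series_sum:
  assumes "0 < h" "\<And>x. x \<in> A \<Longrightarrow> g x \<in> coeff_space"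
  shows "f_series h (\<Sum>x\<in>A. g x) = (\<Sum>x\<in>A. f_series h (g x))"
proof
  fix z
  show "f_series h (\<Sum>x\<in>A. g x) z = (\<Sum>x\<in>A. f_series h (g x)) z"
    using bounded_functional_sum[OF bounded_functional_f_series[OF assms(1)] assms(2), of A "\<lambda>x. x"]
    by (simp add: sum_fun_apply bounded_functional_sum[OF bounded_functional_f_series[OF assms(1)] assms(2)])
qed

lemma f_series_delta: "k \<in> triples \<Longrightarrow> f_series h (delta k) = f_fun h k"
  by (simp add: fun_eq_iff f_series_def kernel_sum_delta)

lemma f_series_finite:
  assumes "0 < h" "F \<subseteq> triples"
  shows "f_series h (\<Sum>k\<in>F. c k \<cdot>\<^sub>C delta k) = (\<Sum>k\<in>F. c k \<cdot>\<^sub>C f_fun h k)"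
  using assms
  by (subst f_series_sum)
     (auto simp: f_series_scale f_series_delta delta_in_coeff_space coeff_space_scale subset_iff
       intro!: sum.cong)

text \<open>On the ray through a point \<open>w\<close> with \<open>yfun w = 1\<close>, a function with coefficients \<open>c\<close> is a series in
  Pochhammer symbols, which defines an entire function. Its values at \<open>0, -1, -2, \<dots>\<close> are finite sums, so
  they determine the homogeneous parts of the series one after the other.\<close>

lemma homogeneous_parts_vanish:
  fixes w :: "'n::finite point"
  assumes h: "0 < h" and c: "c \<in> coeff_space" and zero: "\<And>z. f_series h c z = 0" and w: "yfun w = 1"
  shows "(\<Sum>k | k \<in> triples \<and> tdeg k = m. c k * e_fun k w / of_nat (kfact k)) = 0"
proof -
  define \<kappa> where "\<kappa> x k = pochhammer x (tdeg k) * e_fun k w / of_nat (kfact k)" for x :: complex and k :: "'n triple"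
  define D where "D r = (r + 1) * (real CARD('n option) * (1 + norm w))\<^sup>2" for r :: real
  have D: "0 \<le> D r" if "0 \<le> r" for r using that by (simp add: D_def)
  have \<kappa>: "cmod (\<kappa> x k) \<le> 1 * (D r ^ tdeg k / (fact (tdeg k)) powr 1)"
    if "k \<in> triples" "cmod x \<le> r" for x k r
    using pochhammer_basis_bound[OF that, of w] by (simp only: \<kappa>_def D_def mult_1_left)
  define H where "H x = (\<Sum>\<^sub>\<infinity>k\<in>triples. c k * \<kappa> x k)" for x
  have hol: "H holomorphic_on ball 0 r" if r: "0 < r" for r
  proof -
    define M where "M k = (pn (1/2) c * (fact (tdeg k)) powr (1/2)) * (D r ^ tdeg k / (fact (tdeg k)) powr 1)"
      for k :: "'n triple"
    have Mle: "norm (c k * \<kappa> x k) \<le> M k" if "k \<in> triples" "x \<in> cball 0 r" for k x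
      unfolding M_def norm_mult
      by (intro mult_mono coeff_bound[OF c] order_trans[OF \<kappa>[OF that(1)]])
         (use that r in \<open>auto intro!: mult_nonneg_nonneg coeff_bound(2)[OF c]\<close>)
    have "(\<lambda>k :: 'n triple. pn (1/2) c * (D r ^ tdeg k / (fact (tdeg k)) powr (1/2))) summable_on triples"
      by (intro summable_on_cmult_right summable_on_triples) (use D r in auto)
    also have "(\<lambda>k :: 'n triple. pn (1/2) c * (D r ^ tdeg k / (fact (tdeg k)) powr (1/2))) = M"
    proof
      fix k :: "'n triple"
      have eq: "(fact (tdeg k) :: real) powr 1 = (fact (tdeg k)) powr (1/2) * (fact (tdeg k)) powr (1/2)"
        by (simp flip: powr_add)
      have split: "a * (d / p) = (a * p) * (d / (p * p))" if "p \<noteq> 0" for a d p :: real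
        using that by simp
      show "pn (1/2) c * (D r ^ tdeg k / (fact (tdeg k)) powr (1/2)) = M k"
        unfolding M_def eq by (rule split) simp
    qed
    finally have M: "M summable_on triples" .
    have ulim: "uniform_limit (cball 0 r) (\<lambda>F x. \<Sum>k\<in>F. c k * \<kappa> x k) H (finite_subsets_at_top triples)"
      unfolding H_def by (rule Weierstrass_m_test_general[OF Mle M])
    have hol: "eventually (\<lambda>F. continuous_on (cball 0 r) (\<lambda>x. \<Sum>k\<in>F. c k * \<kappa> x k) \<and>
        (\<lambda>x. \<Sum>k\<in>F. c k * \<kappa> x k) holomorphic_on ball 0 r) (finite_subsets_at_top triples)"
      by (intro always_eventually allI conjI)
         (auto simp: \<kappa>_def pochhammer_prod intro!: continuous_intros holomorphic_intros)
    show ?thesis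
      by (rule holomorphic_uniform_limit[OF hol ulim]) auto
  qed
  have "H holomorphic_on UNIV"
    unfolding holomorphic_on_open[OF open_UNIV]
  proof (intro ballI)
    fix x :: complex
    have "H holomorphic_on ball 0 (cmod x + 1)" by (rule hol) (simp add: add_nonneg_pos)
    then show "\<exists>f'. DERIV H x :> f'"
      unfolding holomorphic_on_open[OF open_ball] by auto
  qed
  moreover have "H x = 0" if x: "x \<in> of_real ` {0<..}" for x
  proof -
    obtain t where t: "x = of_real t" "0 < t" using x by auto
    \<comment> \<open>The multiple \<open>z\<close> of \<open>w\<close> is chosen such that \<open>yfun z / (2 * h) = t\<close>.\<close>
    define s where "s = sqrt (2 * h * t)"
    define z where "z = of_real s *s w"
    have s: "0 < s" "s\<^sup>2 = 2 * h * t" using t h by (auto simp: s_def)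
    have y: "yfun z = s\<^sup>2"
    proof -
      have "yfun z = s\<^sup>2 * yfun w"
        using s by (simp add: yfun_def z_def norm_mult power_mult_distrib right_diff_distrib sum_distrib_left)
      then show ?thesis using w by simp
    qed
    have cone: "z \<in> pos_cone" using s(1) y by (simp add: pos_cone_def)
    have "\<kappa> x k = f_fun h k z" if k: "k \<in> triples" for k
    proof -
      have "e_fun k z = of_real (s\<^sup>2) ^ tdeg k * e_fun k w"
        by (simp add: e_fun_ex[OF k] z_def mon_scale mdeg_ex[OF k] power2_eq_square power_mult_distrib power_add)
      then show ?thesis
        unfolding f_fun_eq[OF cone] y using s h t
        by (simp add: \<kappa>_def pochhammer_of_real)
    qed
    then have "H x = f_series h c z"
      unfolding H_def f_series_def by (intro infsum_cong) simp
    then show ?thesis using zero by simp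
  qed
  moreover have "(0 :: complex) islimpt of_real ` {0<..}"
    unfolding islimpt_approachable
  proof (intro allI impI)
    fix e :: real assume "0 < e"
    then show "\<exists>x'\<in>complex_of_real ` {0<..}. x' \<noteq> 0 \<and> dist x' 0 < e"
      by (intro bexI[of _ "of_real (e/2)"] imageI) auto
  qed
  ultimately have H0: "H x = 0" for x
    using analytic_continuation[of H UNIV "of_real ` {0<..}" 0 x] by auto
  show ?thesis
  proof (induction m rule: less_induct)
    case (less m)
    define g where "g j = (\<Sum>k | k \<in> triples \<and> tdeg k = j. c k * e_fun k w / of_nat (kfact k))" for j
    have fin: "finite {k \<in> triples :: 'n triple set. tdeg k \<le> m}" by (rule finite_triples_le)
    \<comment> \<open>The Pochhammer symbols of \<open>-m\<close> of order above \<open>m\<close> vanish, and those of lower order come with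
      coefficients that are zero by induction.\<close>
    have "0 = H (- of_nat m)" by (simp add: H0)
    also have "\<dots> = (\<Sum>\<^sub>\<infinity>k\<in>{k \<in> triples. tdeg k \<le> m}. c k * \<kappa> (- of_nat m) k)"
      unfolding H_def
      by (rule infsum_cong_neutral) (auto simp: \<kappa>_def not_le pochhammer_of_nat_eq_0_lemma)
    also have "\<dots> = (\<Sum>k | k \<in> triples \<and> tdeg k \<le> m. c k * \<kappa> (- of_nat m) k)"
      using fin by simp
    also have "\<dots> = (\<Sum>j\<le>m. \<Sum>k | k \<in> {k \<in> triples. tdeg k \<le> m} \<and> tdeg k = j. c k * \<kappa> (- of_nat m) k)"
      by (rule sum.group[symmetric]) (use fin in auto)
    also have "\<dots> = (\<Sum>j\<le>m. pochhammer (- of_nat m) j * g j)"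
    proof (rule sum.cong[OF refl])
      fix j assume "j \<in> {..m}"
      then have "{k. k \<in> {k \<in> triples :: 'n triple set. tdeg k \<le> m} \<and> tdeg k = j} = {k. k \<in> triples \<and> tdeg k = j}"
        by auto
      then show "(\<Sum>k | k \<in> {k \<in> triples. tdeg k \<le> m} \<and> tdeg k = j. c k * \<kappa> (- of_nat m) k)
          = pochhammer (- of_nat m) j * g j"
        unfolding g_def sum_distrib_left by (intro sum.cong) (auto simp: \<kappa>_def)
    qed
    also have "\<dots> = (\<Sum>j\<le>m. if j = m then pochhammer (- of_nat m) m * g m else 0)"
      by (rule sum.cong) (use less.IH in \<open>auto simp: g_def\<close>)
    also have "\<dots> = pochhammer (- of_nat m) m * g m" by simp
    finally show ?case by (simp add: pochhammer_same g_def)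
  qed
qed

text \<open>On points over \<open>v\<close> in the disc, the homogeneous part of degree \<open>m\<close> is a common factor times a
  polynomial in \<open>v\<close> and its conjugate with pairwise different exponents \<open>(P, Q)\<close>.\<close>

lemma coefficients_unique:
  fixes c :: "'n::finite triple \<Rightarrow> complex"
  assumes h: "0 < h" and c: "c \<in> coeff_space" and zero: "\<And>z. f_series h c z = 0"
  shows "c = 0"
proof
  fix k :: "'n triple"
  show "c k = 0 k"
  proof (cases "k \<in> triples")
    case k: True
    define m where "m = tdeg k"
    define F where "F = {k \<in> triples :: 'n triple set. tdeg k = m}"
    \<comment> \<open>The polydisc of this radius lies in the unit ball.\<close>
    define \<rho> where "\<rho> = 1 / real CARD('n)"
    have F: "finite F" unfolding F_def by (rule finite_subset[OF _ finite_triples_le[of m]]) auto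
    have \<rho>: "0 < \<rho>" "\<rho> \<le> 1" by (auto simp: \<rho>_def field_simps Suc_le_eq)
    have "c k / of_nat (kfact k) = 0"
    proof (rule monomials_independent[OF F \<rho>(1), where K = fst and L = "\<lambda>k. fst (snd k)"
          and c = "\<lambda>k. c k / of_nat (kfact k)" and ?x0.0 = k])
      fix v :: "complex ^ 'n" assume v: "\<And>i. cmod (v $ i) < \<rho>"
      have "(norm v)\<^sup>2 < (\<Sum>i\<in>(UNIV :: 'n set). \<rho>)"
        unfolding norm_vec_sq
      proof (rule sum_strict_mono)
        fix i :: 'n
        have "cmod (v $ i) * cmod (v $ i) \<le> cmod (v $ i) * 1"
          by (intro mult_left_mono) (use v[of i] \<rho> in linarith, simp)
        then show "(cmod (v $ i))\<^sup>2 < \<rho>" using v[of i] by (simp add: power2_eq_square)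
      qed auto
      then have "v \<in> disc" by (simp add: disc_def \<rho>_def)
      then obtain w where w: "disc_proj w = v" "yfun w = 1" using ex_level_point by blast
      define a where "a = w $ None"
      have a: "a \<noteq> 0" unfolding a_def using None_nonzero[of w] w by simp
      have wi: "w $ Some i = a * v $ i" for i
        using w(1) a by (auto simp: disc_proj_def a_def)
      have e: "e_fun k w = (a * cnj a) ^ m * mon (fst k) (fst (snd k)) v" if kF: "k \<in> F" for k
      proof -
        obtain P Q where [simp]: "k = (P, Q, m)" using kF by (cases k) (auto simp: F_def)
        have le: "mdeg P \<le> m" "mdeg Q \<le> m" using kF by (auto simp: F_def triples_def)
        have "mon (up P m) (up Q m) w = a ^ (m - mdeg P) * cnj a ^ (m - mdeg Q) * mon P Q (a *s v)"
          by (simp add: mon_def prod_option wi flip: a_def)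
        also have "\<dots> = (a ^ (m - mdeg P) * a ^ mdeg P) * (cnj a ^ (m - mdeg Q) * cnj a ^ mdeg Q) * mon P Q v"
          by (simp add: mon_phase)
        also have "\<dots> = (a * cnj a) ^ m * mon P Q v"
          using le by (simp add: power_mult_distrib flip: power_add)
        finally show ?thesis
          using kF by (simp add: e_fun_ex F_def exK_def exL_def)
      qed
      have "(a * cnj a) ^ m * (\<Sum>k\<in>F. c k / of_nat (kfact k) * mon (fst k) (fst (snd k)) v)
          = (\<Sum>k\<in>F. c k * e_fun k w / of_nat (kfact k))"
        unfolding sum_distrib_left by (rule sum.cong) (auto simp: e)
      also have "\<dots> = 0"
        using homogeneous_parts_vanish[OF h c zero w(2), of m] by (simp add: F_def)
      finally show "(\<Sum>k\<in>F. c k / of_nat (kfact k) * mon (fst k) (fst (snd k)) v) = 0"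
        using a by simp
    next
      show "inj_on (\<lambda>k. (fst k, fst (snd k))) F"
        by (auto simp: inj_on_def F_def)
    qed (simp add: F_def k m_def)
    then show ?thesis using kfact_pos[of k] by simp
  qed (simp add: coeff_zero[OF c])
qed

lemma inj_on_f_series:
  assumes h: "0 < h"
  shows "inj_on (f_series h) coeff_space"
proof (rule inj_onI)
  fix c d :: "'a triple \<Rightarrow> complex"
  assume cd: "c \<in> coeff_space" "d \<in> coeff_space" "f_series h c = f_series h d"
  have "c - d = 0"
    by (rule coefficients_unique[OF h coeff_space_diff[OF cd(1,2)]])
       (simp add: f_series_diff[OF h cd(1,2)] cd(3))
  then show "c = d" by simp
qed


section \<open>The product on the cone in coefficients\<close>

lemma e_fun_coefficients_zero:
  fixes c :: "'n::finite triple \<Rightarrow> complex"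
  assumes F: "finite F" "F \<subseteq> triples" and zero: "\<And>z. (\<Sum>k\<in>F. c k * e_fun k z) = 0" and k: "k \<in> F"
  shows "c k = 0"
proof (rule monomials_independent[OF F(1) zero_less_one, where K = exK and L = exL and ?x0.0 = k])
  fix v :: "'n point"
  have "(\<Sum>k\<in>F. c k * mon (exK k) (exL k) v) = (\<Sum>k\<in>F. c k * e_fun k v)"
    by (rule sum.cong) (use F(2) in \<open>auto simp: e_fun_ex\<close>)
  then show "(\<Sum>k\<in>F. c k * mon (exK k) (exL k) v) = 0" using zero by simp
qed (use inj_on_subset[OF inj_on_ex F(2)] k in auto)

lemma inj_on_e_fun: "inj_on e_fun (triples :: 'n::finite triple set)"
proof (rule inj_onI, rule ccontr)
  fix k l :: "'n triple"
  assume kl: "k \<in> triples" "l \<in> triples" "e_fun k = e_fun l" "k \<noteq> l"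
  have "(\<lambda>i. if i = k then 1 else - 1 :: complex) k = 0"
    by (rule e_fun_coefficients_zero[of "{k, l}"]) (use kl in auto)
  then show False by simp
qed

lemma independent_e_fun: "cfun.independent (e_fun ` (triples :: 'n::finite triple set))"
  unfolding cfun.independent_explicit_finite_subsets
proof (intro allI impI ballI)
  fix A :: "('n point \<Rightarrow> complex) set" and u v
  assume A: "A \<subseteq> e_fun ` triples" "finite A" "(\<Sum>v\<in>A. u v \<cdot>\<^sub>C v) = 0" and v: "v \<in> A"
  obtain F where F: "F \<subseteq> triples" "finite F" "A = e_fun ` F"
    using finite_subset_image[OF A(2,1)] by blast
  obtain k where k: "k \<in> F" "v = e_fun k" using F(3) v by auto
  have inj: "inj_on e_fun F" by (rule inj_on_subset[OF inj_on_e_fun F(1)])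
  have "(\<lambda>k. u (e_fun k)) k = 0"
  proof (rule e_fun_coefficients_zero[OF F(2,1) _ k(1)])
    fix z
    have "(\<Sum>k\<in>F. u (e_fun k) * e_fun k z) = (\<Sum>v\<in>A. u v \<cdot>\<^sub>C v) z"
      unfolding F(3) sum.reindex[OF inj] sum_fun_apply by simp
    then show "(\<Sum>k\<in>F. u (e_fun k) * e_fun k z) = 0" using A(3) by simp
  qed
  then show "u v = 0" using k by simp
qed

text \<open>The monomials \<open>e_fun k\<close> are linearly independent, so a linear map with the prescribed values on them
  exists.\<close>

lemma S_op_spec:
  fixes h :: real
  shows "Vector_Spaces.linear cscale cscale (S_op h :: ('n::finite point \<Rightarrow> complex) \<Rightarrow> 'n point \<Rightarrow> complex)
    \<and> (\<forall>k\<in>triples. S_op h (e_fun k) = Se_fun h (k :: 'n triple))"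
proof -
  have vp: "vector_space_pair (cscale :: _ \<Rightarrow> ('n point \<Rightarrow> complex) \<Rightarrow> _) (cscale :: _ \<Rightarrow> ('n point \<Rightarrow> complex) \<Rightarrow> _)"
    by (intro vector_space_pair.intro cfun.vector_space_axioms)
  obtain g where g: "Vector_Spaces.linear cscale cscale g"
    "\<forall>x\<in>e_fun ` (triples :: 'n triple set). g x = Se_fun h (the_inv_into triples e_fun x)"
    using vector_space_pair.linear_independent_extend[OF vp independent_e_fun,
      where f = "\<lambda>x. Se_fun h (the_inv_into triples e_fun x)"] by blast
  define P where "P T \<longleftrightarrow> Vector_Spaces.linear cscale cscale (T :: ('n point \<Rightarrow> complex) \<Rightarrow> 'n point \<Rightarrow> complex)
    \<and> (\<forall>k\<in>triples. T (e_fun k) = Se_fun h (k :: 'n triple))" for T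
  have "\<forall>k\<in>triples. g (e_fun k) = Se_fun h (k :: 'n triple)"
    using g(2) by (simp add: the_inv_into_f_f[OF inj_on_e_fun])
  with g(1) have "P g" by (simp add: P_def)
  then have "P (SOME T. P T)" by (rule someI[of P])
  then show ?thesis by (simp add: P_def S_op_def)
qed

lemma S_op_sum:
  "S_op h (\<Sum>x\<in>A. c x \<cdot>\<^sub>C p x) = (\<Sum>x\<in>A. c x \<cdot>\<^sub>C S_op h (p x :: 'n::finite point \<Rightarrow> complex))"
proof -
  interpret L: Vector_Spaces.linear cscale cscale
      "S_op h :: ('n point \<Rightarrow> complex) \<Rightarrow> 'n point \<Rightarrow> complex"
    using S_op_spec[where ?'n = 'n] by blast
  show ?thesis by (simp add: L.sum L.scale)
qed

lemma S_op_e_fun: "k \<in> triples \<Longrightarrow> S_op h (e_fun k) = (of_real (2 * h) ^ tdeg k * of_nat (kfact k)) \<cdot>\<^sub>C f_fun h k"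
  using S_op_spec Se_fun_eq by metis

lemma cfun_span_image:
  assumes "p \<in> cfun.span (f ` A)"
  obtains F c where "finite F" "F \<subseteq> A" "p = (\<Sum>k\<in>F. c k \<cdot>\<^sub>C f k)"
proof -
  obtain t r where t: "finite t" "t \<subseteq> f ` A" "p = (\<Sum>v\<in>t. r v \<cdot>\<^sub>C v)"
    using assms unfolding cfun.span_explicit by auto
  obtain F where F: "F \<subseteq> A" "inj_on f F" "t = f ` F"
    using t(2) by (meson subset_image_inj)
  have "finite F" using t(1) unfolding F(3) by (rule finite_imageD) (rule F(2))
  moreover have "p = (\<Sum>k\<in>F. r (f k) \<cdot>\<^sub>C f k)"
    unfolding t(3) F(3) sum.reindex[OF F(2)] by simp
  ultimately show ?thesis by (rule that[OF _ F(1)])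
qed

lemma inj_on_S_op:
  assumes h: "0 < h"
  shows "inj_on (S_op h) (u1_polys :: ('n::finite point \<Rightarrow> complex) set)"
proof (rule inj_onI)
  fix p q :: "'n point \<Rightarrow> complex"
  assume pq: "p \<in> u1_polys" "q \<in> u1_polys" "S_op h p = S_op h q"
  have "p - q \<in> cfun.span (e_fun ` (triples :: 'n triple set))"
    using pq unfolding u1_polys_eq_span by (intro cfun.span_diff)
  then obtain F c where F: "finite F" "F \<subseteq> triples" and r: "p - q = (\<Sum>k\<in>F. c k \<cdot>\<^sub>C e_fun (k :: 'n triple))"
    by (rule cfun_span_image)
  interpret L: Vector_Spaces.linear cscale cscale
      "S_op h :: ('n point \<Rightarrow> complex) \<Rightarrow> 'n point \<Rightarrow> complex"
    using S_op_spec[where ?'n = 'n] by blast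
  define d where "d k = c k * (of_real (2 * h) ^ tdeg k * of_nat (kfact k))" for k
  have "0 = S_op h (p - q)"
    using pq(3) by (simp add: L.diff)
  also have "\<dots> = (\<Sum>k\<in>F. d k \<cdot>\<^sub>C f_fun h k)"
    unfolding r S_op_sum
    by (rule sum.cong) (use F(2) in \<open>auto simp: S_op_e_fun d_def fun_eq_iff\<close>)
  also have "\<dots> = f_series h (\<Sum>k\<in>F. d k \<cdot>\<^sub>C delta k)"
    by (rule f_series_finite[OF h F(2), symmetric])
  finally have "(\<Sum>k\<in>F. d k \<cdot>\<^sub>C delta k) = 0"
    by (intro coefficients_unique[OF h] coeff_space_sum coeff_space_scale delta_in_coeff_space)
       (use F(2) in auto)
  then have "(\<Sum>k\<in>F. d k \<cdot>\<^sub>C delta k) i = 0" for i by simp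
  moreover have "(\<Sum>k\<in>F. d k \<cdot>\<^sub>C delta k) i = (if i \<in> F then d i else 0)" for i
    using F(1) by (simp add: sum_fun_apply delta_def if_distrib cong: if_cong)
  ultimately have "d i = 0" if "i \<in> F" for i
    using that by metis
  then have "c k = 0" if "k \<in> F" for k using that h by (auto simp: d_def)
  then have "p - q = 0" unfolding r by (intro sum.neutral) (auto simp: fun_eq_iff)
  then show "p = q" by simp
qed

text \<open>The \<open>T\<close>-th term of a Wick product: the derivatives remove \<open>T\<close> from the holomorphic exponents of the
  left factor and from the antiholomorphic exponents of the right factor. The constants \<open>sfac\<close> refer to the
  normalized basis \<open>f_fun\<close>.\<close>

definition stri :: "'n::finite triple \<Rightarrow> 'n triple \<Rightarrow> 'n option mindex \<Rightarrow> 'n triple"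
  where "stri k l T = tri (exK k - T + exK l) (exL k + exL l - T)"

definition sfac :: "'n::finite triple \<Rightarrow> 'n triple \<Rightarrow> 'n option mindex \<Rightarrow> complex"
  where "sfac k l T = sgm T / of_nat (mfact T) *
    of_nat (mchoose (exK k - T + exK l) (exK l) * mchoose (exL k + exL l - T) (exL k))"

definition basis_prod :: "'n::finite triple \<Rightarrow> 'n triple \<Rightarrow> 'n triple \<Rightarrow> complex"
  where "basis_prod k l = (\<Sum>T | T \<le> exK k \<and> T \<le> exL l. sfac k l T \<cdot>\<^sub>C delta (stri k l T))"

lemma finite_contractions: "finite {T :: 'n::finite mindex. T \<le> K \<and> T \<le> L}"
  by (rule finite_subset[OF _ finite_mindex_le[of K]]) auto

lemma stri_degrees:
  assumes "k \<in> triples" "l \<in> triples" "T \<le> exK k" "T \<le> exL l"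
  shows "mdeg (exK k - T + exK l) = tdeg k + tdeg l - mdeg T"
    and "mdeg (exL k + exL l - T) = tdeg k + tdeg l - mdeg T"
    and "mdeg T \<le> tdeg k" "mdeg T \<le> tdeg l"
proof -
  show T: "mdeg T \<le> tdeg k" "mdeg T \<le> tdeg l"
    using mdeg_mono[OF assms(3)] mdeg_mono[OF assms(4)] mdeg_ex assms(1,2) by metis+
  show "mdeg (exK k - T + exK l) = tdeg k + tdeg l - mdeg T"
    using T assms by (simp add: mdeg_add mdeg_diff mdeg_ex)
  have "T \<le> exL k + exL l" using assms(4) by (auto simp: le_fun_def intro: trans_le_add2)
  then show "mdeg (exL k + exL l - T) = tdeg k + tdeg l - mdeg T"
    using assms by (simp add: mdeg_add mdeg_diff mdeg_ex)
qed

lemma stri_in_triples: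
  "k \<in> triples \<Longrightarrow> l \<in> triples \<Longrightarrow> T \<le> exK k \<Longrightarrow> T \<le> exL l \<Longrightarrow> stri k l T \<in> triples"
  unfolding stri_def by (intro tri_in_triples) (simp add: stri_degrees)

lemma tdeg_stri:
  "k \<in> triples \<Longrightarrow> l \<in> triples \<Longrightarrow> T \<le> exK k \<Longrightarrow> T \<le> exL l \<Longrightarrow> tdeg (stri k l T) = tdeg k + tdeg l - mdeg T"
  by (simp add: stri_def stri_degrees)

lemma basis_prod_in_coeff_space:
  "k \<in> triples \<Longrightarrow> l \<in> triples \<Longrightarrow> basis_prod k l \<in> coeff_space"
  unfolding basis_prod_def
  by (intro coeff_space_sum coeff_space_scale delta_in_coeff_space) (auto intro: stri_in_triples)

lemma mchoose_mfact:
  assumes "Q \<le> P"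
  shows "mchoose P Q * (mfact Q * mfact (P - Q)) = mfact P"
proof -
  have "(P i choose Q i) * (fact (Q i) * fact (P i - Q i)) = fact (P i)" for i
    using binomial_fact_lemma[of "Q i" "P i"] assms by (simp add: le_fun_def mult_ac)
  then show ?thesis
    by (simp add: mchoose_def mfact_def flip: prod.distrib)
qed

text \<open>The falling factorials from the derivatives combine with the normalizing factorials of the three basis
  functions to binomial coefficients, and the powers of \<open>2 h\<close> cancel because the degrees add up.\<close>

lemma sfac_normalized:
  fixes h :: real
  assumes kl: "k \<in> triples" "l \<in> triples" and T: "T \<le> exK k" "T \<le> exL l" and h: "0 < h"
  shows "of_real (2 * h) ^ mdeg T * sgm T / of_nat (mfact T)
      * of_nat (fall (exK k) T * fall (exL l) T)
      * (of_real (2 * h) ^ tdeg (stri k l T) * of_nat (kfact (stri k l T)))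
    = (of_real (2 * h) ^ tdeg k * of_nat (kfact k)) * (of_real (2 * h) ^ tdeg l * of_nat (kfact l)) * sfac k l T"
proof -
  define K L K' L' where "K = exK k" and "L = exL k" and "K' = exK l" and "L' = exL l"
  have T': "T \<le> K" "T \<le> L'" using T by (simp_all add: K_def L'_def)
  have M: "mchoose (K - T + K') K' * (mfact K' * mfact (K - T)) = mfact (K - T + K')"
    using mchoose_mfact[of K' "K - T + K'"] by (simp add: le_fun_def)
  have LT: "L + L' - T - L = L' - T" by (auto simp: fun_eq_iff)
  have N: "mchoose (L + L' - T) L * (mfact L * mfact (L' - T)) = mfact (L + L' - T)"
    using mchoose_mfact[of L "L + L' - T"] T'(2) unfolding LT
    by (auto simp: le_fun_def) (metis add_le_cancel_left le_add_diff_inverse le_diff_conv2 trans_le_add2 add_diff_assoc le_add1)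
  have kf: "kfact (stri k l T) = mfact (K - T + K') * mfact (L + L' - T)"
    using stri_degrees[OF kl T]
    by (simp add: kfact_def stri_def ex_tri K_def L_def K'_def L'_def)
  have "of_nat (fall K T * fall L' T) * of_nat (kfact (stri k l T))
      = (of_nat ((mchoose (K - T + K') K' * mfact K' * (fall K T * mfact (K - T)))
        * (mchoose (L + L' - T) L * mfact L * (fall L' T * mfact (L' - T)))) :: complex)"
    unfolding kf M[symmetric] N[symmetric] by (simp add: mult_ac)
  also have "\<dots> = of_nat (kfact k) * of_nat (kfact l)
      * of_nat (mchoose (K - T + K') K' * mchoose (L + L' - T) L)"
    unfolding fall_mfact[OF T'(1)] fall_mfact[OF T'(2)]
    by (simp add: kfact_def K_def L_def K'_def L'_def mult_ac)
  finally have 1: "of_nat (fall K T * fall L' T) * of_nat (kfact (stri k l T))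
      = (of_nat (kfact k) * of_nat (kfact l)
        * of_nat (mchoose (K - T + K') K' * mchoose (L + L' - T) L) :: complex)" .
  have "mdeg T + tdeg (stri k l T) = tdeg k + tdeg l"
    using stri_degrees(3)[OF kl T] by (simp add: tdeg_stri[OF kl T])
  then have 2: "of_real (2 * h) ^ mdeg T * of_real (2 * h) ^ tdeg (stri k l T)
      = (of_real (2 * h) ^ tdeg k * of_real (2 * h) ^ tdeg l :: complex)"
    by (simp only: flip: power_add)
  have "of_real (2 * h) ^ mdeg T * sgm T / of_nat (mfact T) * of_nat (fall K T * fall L' T)
      * (of_real (2 * h) ^ tdeg (stri k l T) * of_nat (kfact (stri k l T)))
    = (of_real (2 * h) ^ mdeg T * of_real (2 * h) ^ tdeg (stri k l T)) * (sgm T / of_nat (mfact T))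
      * (of_nat (fall K T * fall L' T) * of_nat (kfact (stri k l T)))"
    by (simp add: mult_ac)
  then show ?thesis
    unfolding 1 2 sfac_def K_def[symmetric] L_def[symmetric] K'_def[symmetric] L'_def[symmetric]
    by (simp only: mult_ac)
qed

text \<open>The product is transported by \<open>S_op\<close>, which only rescales the basis, so it can be computed on
  monomials.\<close>

lemma star_cone_finite:
  fixes F G :: "'n::finite triple set"
  assumes h: "0 < h" and F: "finite F" "F \<subseteq> triples" and G: "finite G" "G \<subseteq> triples"
  shows "star_cone h (\<Sum>k\<in>F. c k \<cdot>\<^sub>C f_fun h k) (\<Sum>l\<in>G. d l \<cdot>\<^sub>C f_fun h l)
    = (\<Sum>k\<in>F. \<Sum>l\<in>G. (c k * d l) \<cdot>\<^sub>C f_series h (basis_prod k l))"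
proof -
  define \<nu> :: "_ \<Rightarrow> complex" where "\<nu> k = of_real (2 * h) ^ tdeg k * of_nat (kfact k)" for k :: "'n triple"
  have \<nu>: "\<nu> k \<noteq> 0" for k using h by (simp add: \<nu>_def)
  have S\<nu>: "S_op h (e_fun k) = \<nu> k \<cdot>\<^sub>C f_fun h k" if "k \<in> triples" for k :: "'n triple"
    unfolding \<nu>_def by (rule S_op_e_fun[OF that])
  have e_u1: "e_fun k \<in> u1_polys" if "k \<in> triples" for k :: "'n triple"
    unfolding u1_polys_eq_span using that by (intro cfun.span_base) auto
  have inv: "inv_into u1_polys (S_op h) (\<Sum>k\<in>A. b k \<cdot>\<^sub>C f_fun h k)
      = (\<lambda>z. \<Sum>k\<in>A. b k / \<nu> k * mon (exK k) (exL k) z)" if A: "A \<subseteq> triples" for A :: "'n triple set" and b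
  proof -
    have "(b k / \<nu> k) \<cdot>\<^sub>C S_op h (e_fun k) = b k \<cdot>\<^sub>C f_fun h k" if "k \<in> A" for k
      using \<nu>[of k] by (simp add: S\<nu> subsetD[OF A that] fun_eq_iff)
    then have eqS: "S_op h (\<Sum>k\<in>A. (b k / \<nu> k) \<cdot>\<^sub>C e_fun k) = (\<Sum>k\<in>A. b k \<cdot>\<^sub>C f_fun h k)"
      unfolding S_op_sum by (intro sum.cong) auto
    have mem: "(\<Sum>k\<in>A. (b k / \<nu> k) \<cdot>\<^sub>C e_fun k) \<in> u1_polys"
      unfolding u1_polys_eq_span
      by (intro cfun.span_sum cfun.span_scale) (use A e_u1 in \<open>auto simp: u1_polys_eq_span\<close>)
    have "inv_into u1_polys (S_op h) (\<Sum>k\<in>A. b k \<cdot>\<^sub>C f_fun h k) = (\<Sum>k\<in>A. (b k / \<nu> k) \<cdot>\<^sub>C e_fun k)"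
      unfolding eqS[symmetric] by (rule inv_into_f_f[OF inj_on_S_op[OF h] mem])
    also have "\<dots> = (\<lambda>z. \<Sum>k\<in>A. b k / \<nu> k * mon (exK k) (exL k) z)"
      using A by (auto simp: fun_eq_iff sum_fun_apply e_fun_ex intro!: sum.cong)
    finally show ?thesis .
  qed
  define t where "t k l T = of_real (2 * h) ^ mdeg T * sgm T / of_nat (mfact T)
      * of_nat (fall (exK k) T * fall (exL l) T)" for k l :: "'n triple" and T
  define I where "I k l = {T. T \<le> exK k \<and> T \<le> exL l}" for k l :: "'n triple"
  define J where "J = (SIGMA k:F. SIGMA l:G. I k l)"
  define w where "w = (\<lambda>(k, l, T). c k / \<nu> k * (d l / \<nu> l) * t k l T)"
  have fin: "finite (I k l)" for k l unfolding I_def by (rule finite_contractions)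
  have J_sum: "(\<Sum>x\<in>J. g x) = (\<Sum>k\<in>F. \<Sum>l\<in>G. \<Sum>T\<in>I k l. g (k, l, T))"
    for g :: "_ \<Rightarrow> 'n point \<Rightarrow> complex"
    unfolding J_def using F(1) G(1) fin by (simp add: sum.Sigma finite_SigmaI)
  have J: "k \<in> triples \<and> l \<in> triples \<and> T \<le> exK k \<and> T \<le> exL l" if "(k, l, T) \<in> J" for k l T
    using that F(2) G(2) by (auto simp: J_def I_def)
  have "wick h (\<lambda>z. \<Sum>k\<in>F. c k / \<nu> k * mon (exK k) (exL k) z) (\<lambda>z. \<Sum>l\<in>G. d l / \<nu> l * mon (exK l) (exL l) z)
      = (\<Sum>k\<in>F. \<Sum>l\<in>G. \<Sum>T\<in>I k l. w (k, l, T) \<cdot>\<^sub>C mon (exK k - T + exK l) (exL k + exL l - T))"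
    unfolding fun_eq_iff wick_sums[OF F(1) G(1)]
    by (simp add: sum_fun_apply w_def t_def I_def sum_distrib_left mult.assoc)
  also have "\<dots> = (\<Sum>x\<in>J. w x \<cdot>\<^sub>C (case x of (k, l, T) \<Rightarrow> e_fun (stri k l T)))"
    unfolding J_sum
  proof (intro sum.cong refl)
    fix k l T assume "k \<in> F" "l \<in> G" "T \<in> I k l"
    then have "(k, l, T) \<in> J" by (simp add: J_def)
    from J[OF this] have "e_fun (stri k l T) = mon (exK k - T + exK l) (exL k + exL l - T)"
      unfolding stri_def by (intro e_fun_tri) (simp add: stri_degrees)
    then show "w (k, l, T) \<cdot>\<^sub>C mon (exK k - T + exK l) (exL k + exL l - T)
        = w (k, l, T) \<cdot>\<^sub>C (case (k, l, T) of (k, l, T) \<Rightarrow> e_fun (stri k l T))" by simp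
  qed
  finally have wick: "wick h (\<lambda>z. \<Sum>k\<in>F. c k / \<nu> k * mon (exK k) (exL k) z) (\<lambda>z. \<Sum>l\<in>G. d l / \<nu> l * mon (exK l) (exL l) z)
      = (\<Sum>x\<in>J. w x \<cdot>\<^sub>C (case x of (k, l, T) \<Rightarrow> e_fun (stri k l T)))" .
  have "star_cone h (\<Sum>k\<in>F. c k \<cdot>\<^sub>C f_fun h k) (\<Sum>l\<in>G. d l \<cdot>\<^sub>C f_fun h l)
      = (\<Sum>x\<in>J. w x \<cdot>\<^sub>C S_op h (case x of (k, l, T) \<Rightarrow> e_fun (stri k l T)))"
    unfolding star_cone_def inv[OF F(2)] inv[OF G(2)] wick S_op_sum ..
  also have "\<dots> = (\<Sum>k\<in>F. \<Sum>l\<in>G. \<Sum>T\<in>I k l. ((c k * d l) * sfac k l T) \<cdot>\<^sub>C f_fun h (stri k l T))"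
    unfolding J_sum
  proof (intro sum.cong refl)
    fix k l T assume "k \<in> F" "l \<in> G" "T \<in> I k l"
    then have "(k, l, T) \<in> J" by (simp add: J_def)
    note kl = J[OF this]
    have "w (k, l, T) * \<nu> (stri k l T) = c k / \<nu> k * (d l / \<nu> l) * (t k l T * \<nu> (stri k l T))"
      by (simp add: w_def mult.assoc)
    also have "t k l T * \<nu> (stri k l T) = \<nu> k * \<nu> l * sfac k l T"
      unfolding t_def \<nu>_def by (rule sfac_normalized) (use kl h in auto)
    also have "c k / \<nu> k * (d l / \<nu> l) * (\<nu> k * \<nu> l * sfac k l T) = c k * d l * sfac k l T"
      using \<nu>[of k] \<nu>[of l] by simp
    finally have eq: "w (k, l, T) * \<nu> (stri k l T) = c k * d l * sfac k l T" .
    show "w (k, l, T) \<cdot>\<^sub>C S_op h (case (k, l, T) of (k, l, T) \<Rightarrow> e_fun (stri k l T))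
        = (c k * d l * sfac k l T) \<cdot>\<^sub>C f_fun h (stri k l T)"
      unfolding eq[symmetric] using kl by (simp add: S\<nu>[OF stri_in_triples] fun_eq_iff mult.assoc)
  qed
  also have "\<dots> = (\<Sum>k\<in>F. \<Sum>l\<in>G. (c k * d l) \<cdot>\<^sub>C f_series h (basis_prod k l))"
  proof (intro sum.cong refl)
    fix k l assume kl: "k \<in> F" "l \<in> G"
    then have st: "stri k l T \<in> triples" if "T \<in> I k l" for T
      using that F(2) G(2) by (auto simp: I_def intro: stri_in_triples)
    have "f_series h (basis_prod k l) = (\<Sum>T\<in>I k l. sfac k l T \<cdot>\<^sub>C f_fun h (stri k l T))"
      unfolding basis_prod_def I_def[symmetric]
      by (subst f_series_sum[OF h])
         (auto simp: st f_series_scale[OF h] f_series_delta coeff_space_scale delta_in_coeff_space intro!: sum.cong)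
    then show "(\<Sum>T\<in>I k l. (c k * d l * sfac k l T) \<cdot>\<^sub>C f_fun h (stri k l T))
        = (c k * d l) \<cdot>\<^sub>C f_series h (basis_prod k l)"
      by (simp add: fun_eq_iff sum_fun_apply sum_distrib_left mult.assoc)
  qed
  finally show ?thesis .
qed

definition below :: "nat \<Rightarrow> 'n::finite triple set"
  where "below m = {k \<in> triples. tdeg k \<le> m}"

text \<open>A product of basis functions contains no basis function of smaller degree than one of the
  factors, so each coefficient of a product is a finite sum.\<close>

definition cprod :: "('n::finite triple \<Rightarrow> complex) \<Rightarrow> ('n triple \<Rightarrow> complex) \<Rightarrow> 'n triple \<Rightarrow> complex"
  where "cprod c d i = (\<Sum>k\<in>below (tdeg i). \<Sum>l\<in>below (tdeg i). c k * d l * basis_prod k l i)"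

lemma finite_below: "finite (below m)"
  unfolding below_def by (rule finite_triples_le)

lemma basis_prod_nonzero:
  assumes "k \<in> triples" "l \<in> triples" "basis_prod k l i \<noteq> 0"
  shows "i \<in> triples" "tdeg k \<le> tdeg i" "tdeg l \<le> tdeg i"
proof -
  from assms(3) obtain T where T: "T \<le> exK k" "T \<le> exL l" "sfac k l T * delta (stri k l T) i \<noteq> 0"
    unfolding basis_prod_def sum_fun_apply by (auto elim!: sum.not_neutral_contains_not_neutral)
  then have i: "i = stri k l T" by (simp add: delta_def split: if_splits)
  show "i \<in> triples" "tdeg k \<le> tdeg i" "tdeg l \<le> tdeg i"
    using stri_degrees(3,4)[OF assms(1,2) T(1,2)]
    by (auto simp: i tdeg_stri[OF assms(1,2) T(1,2)] stri_in_triples assms T)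
qed

lemma cprod_delta:
  assumes "k \<in> triples" "l \<in> triples"
  shows "cprod (delta k) (delta l) = basis_prod k l"
proof
  fix i
  have "cprod (delta k) (delta l) i
      = (\<Sum>k'\<in>below (tdeg i). if k' = k then
          (\<Sum>l'\<in>below (tdeg i). if l' = l then basis_prod k l i else 0) else 0)"
    unfolding cprod_def by (intro sum.cong refl) (auto simp: delta_def intro!: sum.cong)
  also have "\<dots> = basis_prod k l i"
  proof (cases "basis_prod k l i = 0")
    case False
    then have "k \<in> below (tdeg i)" "l \<in> below (tdeg i)"
      using basis_prod_nonzero[OF assms False] assms by (auto simp: below_def)
    then show ?thesis by (simp add: finite_below)
  qed (simp cong: if_cong)
  finally show "cprod (delta k) (delta l) i = basis_prod k l i" .
qed

text \<open>There are at most \<open>2 ^ tdeg k\<close> contractions, and the constant of each of them is bounded by two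
  binomial coefficients with upper degree at most \<open>tdeg k + tdeg l\<close>.\<close>

lemma norm_basis_prod_le:
  assumes kl: "k \<in> triples" "l \<in> triples"
  shows "cmod (basis_prod k l i) \<le> 8 ^ tdeg k * 8 ^ tdeg l"
proof -
  define I where "I = {T. T \<le> exK k \<and> T \<le> exL l}"
  define s where "s = tdeg k + tdeg l"
  have fac: "cmod (sfac k l T) \<le> 2 ^ s * 2 ^ s" if T: "T \<in> I" for T
  proof -
    have T': "T \<le> exK k" "T \<le> exL l" using T by (auto simp: I_def)
    have ch: "real (mchoose P Q) \<le> 2 ^ s" if "mdeg P \<le> s" for P Q :: "'a option mindex"
    proof -
      have "mchoose P Q \<le> 2 ^ s"
        using mchoose_le[of P Q] power_increasing[OF that, of "2 :: nat"] by linarith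
      then have "real (mchoose P Q) \<le> real (2 ^ s)" by (simp only: of_nat_le_iff)
      then show ?thesis by simp
    qed
    have "cmod (sgm T / of_nat (mfact T)) \<le> 1"
      using mfact_ge_1[of T] by (simp add: sgm_def norm_divide norm_power)
    then have "cmod (sfac k l T) \<le> 1 * (2 ^ s * 2 ^ s)"
      unfolding sfac_def norm_mult norm_of_nat of_nat_mult
      by (intro mult_mono ch) (auto simp: stri_degrees[OF kl T'] s_def)
    then show ?thesis by simp
  qed
  have "cmod (basis_prod k l i) \<le> (\<Sum>T\<in>I. cmod (sfac k l T * delta (stri k l T) i))"
    unfolding basis_prod_def I_def sum_fun_apply by (intro order_trans[OF norm_sum]) simp
  also have "\<dots> \<le> (\<Sum>T\<in>I. 2 ^ s * 2 ^ s)"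
    by (intro sum_mono) (use fac in \<open>auto simp: delta_def\<close>)
  also have "\<dots> = real (card I) * (2 ^ s * 2 ^ s)" by simp
  also have "\<dots> \<le> 2 ^ s * (2 ^ s * 2 ^ s)"
  proof (intro mult_right_mono)
    have "card I \<le> card {T. T \<le> exK k}"
      unfolding I_def by (intro card_mono finite_mindex_le) auto
    also have "\<dots> \<le> 2 ^ tdeg k"
      using card_mindex_le[of "exK k"] by (simp add: mdeg_ex[OF kl(1)])
    also have "\<dots> \<le> 2 ^ s" by (intro power_increasing) (auto simp: s_def)
    finally have "real (card I) \<le> real (2 ^ s)" by (simp only: of_nat_le_iff)
    then show "real (card I) \<le> 2 ^ s" by simp
  qed auto
  also have "\<dots> = (2 * (2 * 2)) ^ s" by (simp only: power_mult_distrib)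
  finally show ?thesis by (simp add: s_def power_add)
qed

lemma cprod_bound:
  assumes e: "0 < \<epsilon>" "\<epsilon> < 1"
  obtains \<epsilon>' B where "0 < \<epsilon>'" "\<epsilon>' < 1" "0 \<le> B"
    "\<And>c d i. c \<in> coeff_space \<Longrightarrow> d \<in> coeff_space \<Longrightarrow>
      cmod (cprod c d i) \<le> B * pn \<epsilon>' c * pn \<epsilon>' d * (fact (tdeg (i :: 'n::finite triple))) powr \<epsilon>"
proof -
  \<comment> \<open>Each factor uses the rate \<open>\<epsilon>'\<close> twice, once for its growth and once to absorb the exponential bound
    on the structure constants.\<close>
  define \<epsilon>' where "\<epsilon>' = \<epsilon> / 4"
  have e': "0 < \<epsilon>'" "\<epsilon>' < 1" using e by (auto simp: \<epsilon>'_def)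
  define g where "g k = 8 ^ tdeg k / (fact (tdeg k)) powr \<epsilon>'" for k :: "'n triple"
  define S where "S = infsum g triples"
  have g: "g summable_on triples" unfolding g_def by (intro summable_on_triples e') auto
  have g0: "0 \<le> g k" for k by (simp add: g_def)
  have S: "(\<Sum>k\<in>below m. g k) \<le> S" for m
    unfolding S_def by (intro finite_sum_le_infsum g finite_below) (auto simp: below_def g0)
  have S0: "0 \<le> S" unfolding S_def by (intro infsum_nonneg g0)
  have c1: "cmod (c k) * 8 ^ tdeg k \<le> pn \<epsilon>' c * (fact m) powr (\<epsilon>/2) * g k"
    if c: "c \<in> coeff_space" and k: "k \<in> below m" for c and k :: "'n triple" and m
  proof -
    have "cmod (c k) \<le> pn \<epsilon>' c * (fact (tdeg k)) powr \<epsilon>'" by (rule coeff_bound(1)[OF c e'])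
    also have "(fact (tdeg k)) powr \<epsilon>' = (fact (tdeg k)) powr (\<epsilon>/2) / (fact (tdeg k) :: real) powr \<epsilon>'"
      by (simp add: \<epsilon>'_def flip: powr_diff)
    also have "pn \<epsilon>' c * ((fact (tdeg k)) powr (\<epsilon>/2) / (fact (tdeg k)) powr \<epsilon>')
        \<le> pn \<epsilon>' c * ((fact m) powr (\<epsilon>/2) / (fact (tdeg k)) powr \<epsilon>')"
      by (intro mult_left_mono divide_right_mono fact_powr_mono coeff_bound(2)[OF c e'])
         (use k e in \<open>auto simp: below_def\<close>)
    finally have "cmod (c k) * 8 ^ tdeg k
        \<le> pn \<epsilon>' c * ((fact m) powr (\<epsilon>/2) / (fact (tdeg k)) powr \<epsilon>') * 8 ^ tdeg k"
      by (intro mult_right_mono) auto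
    then show ?thesis by (simp add: g_def mult_ac)
  qed
  show ?thesis
  proof (rule that[of \<epsilon>' "S * S"])
    fix c d :: "'n triple \<Rightarrow> complex" and i :: "'n triple"
    assume cd: "c \<in> coeff_space" "d \<in> coeff_space"
    define m where "m = tdeg i"
    define X where "X = (fact m :: real) powr (\<epsilon>/2)"
    have pc: "0 \<le> pn \<epsilon>' c" "0 \<le> pn \<epsilon>' d" using coeff_bound(2)[OF _ e'] cd by auto
    have "cmod (cprod c d i) \<le> (\<Sum>k\<in>below m. \<Sum>l\<in>below m. cmod (c k * d l * basis_prod k l i))"
      unfolding cprod_def m_def by (intro order_trans[OF norm_sum] sum_mono norm_sum)
    also have "\<dots> \<le> (\<Sum>k\<in>below m. \<Sum>l\<in>below m. (pn \<epsilon>' c * X * g k) * (pn \<epsilon>' d * X * g l))"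
    proof (intro sum_mono)
      fix k l :: "'n triple" assume kl: "k \<in> below m" "l \<in> below m"
      have "cmod (c k * d l * basis_prod k l i) \<le> cmod (c k) * cmod (d l) * (8 ^ tdeg k * 8 ^ tdeg l)"
        unfolding norm_mult by (intro mult_left_mono norm_basis_prod_le) (use kl in \<open>auto simp: below_def\<close>)
      also have "\<dots> = (cmod (c k) * 8 ^ tdeg k) * (cmod (d l) * 8 ^ tdeg l)" by simp
      also have "\<dots> \<le> (pn \<epsilon>' c * X * g k) * (pn \<epsilon>' d * X * g l)"
        unfolding X_def by (intro mult_mono c1 cd kl mult_nonneg_nonneg pc g0) auto
      finally show "cmod (c k * d l * basis_prod k l i) \<le> (pn \<epsilon>' c * X * g k) * (pn \<epsilon>' d * X * g l)" .
    qed
    also have "\<dots> = (pn \<epsilon>' c * X * (\<Sum>k\<in>below m. g k)) * (pn \<epsilon>' d * X * (\<Sum>l\<in>below m. g l))"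
      unfolding sum_distrib_left[symmetric] sum_distrib_right[symmetric] ..
    also have "\<dots> \<le> (pn \<epsilon>' c * X * S) * (pn \<epsilon>' d * X * S)"
      by (intro mult_mono mult_left_mono S mult_nonneg_nonneg pc sum_nonneg g0 S0) (auto simp: X_def)
    also have "\<dots> = S * S * pn \<epsilon>' c * pn \<epsilon>' d * (X * X)" by simp
    also have "X * X = (fact m) powr \<epsilon>" by (simp add: X_def flip: powr_add)
    finally show "cmod (cprod c d i) \<le> S * S * pn \<epsilon>' c * pn \<epsilon>' d * (fact (tdeg i)) powr \<epsilon>"
      by (simp add: m_def)
  qed (use e' S0 in auto)
qed

lemma cprod_zero: "i \<notin> triples \<Longrightarrow> cprod c d i = 0"
proof -
  assume i: "i \<notin> triples"
  have "basis_prod k l i = 0" if "k \<in> below (tdeg i)" "l \<in> below (tdeg i)" for k l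
    using basis_prod_nonzero(1)[of k l i] that i by (auto simp: below_def)
  then show "cprod c d i = 0" by (simp add: cprod_def)
qed

lemma cprod_in_coeff_space:
  assumes "c \<in> coeff_space" "d \<in> coeff_space"
  shows "cprod c d \<in> coeff_space"
proof (rule coeff_spaceI)
  fix \<epsilon> :: real assume "0 < \<epsilon>" "\<epsilon> < 1"
  then obtain \<epsilon>' B where *: "\<And>c d i. c \<in> coeff_space \<Longrightarrow> d \<in> coeff_space \<Longrightarrow>
      cmod (cprod c d i) \<le> B * pn \<epsilon>' c * pn \<epsilon>' d * (fact (tdeg (i :: 'a triple))) powr \<epsilon>"
    by (rule cprod_bound) blast
  show "\<exists>B. \<forall>k\<in>triples. cmod (cprod c d k) \<le> B * (fact (tdeg k)) powr \<epsilon>"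
    using *[OF assms] by blast
qed (rule cprod_zero)

lemma cprod_add_left: "cprod (c + c') d = cprod c d + cprod c' d"
  and cprod_add_right: "cprod c (d + d') = cprod c d + cprod c d'"
  and cprod_diff_left: "cprod (c - c') d = cprod c d - cprod c' d"
  and cprod_diff_right: "cprod c (d - d') = cprod c d - cprod c d'"
  and cprod_scale_left: "cprod (s \<cdot>\<^sub>C c) d = s \<cdot>\<^sub>C cprod c d"
  and cprod_scale_right: "cprod c (s \<cdot>\<^sub>C d) = s \<cdot>\<^sub>C cprod c d"
  by (simp_all add: fun_eq_iff cprod_def algebra_simps sum.distrib sum_subtractf sum_distrib_left)

lemma cprod_pn_bound:
  assumes e: "0 < \<epsilon>" "\<epsilon> < 1"
  obtains \<epsilon>' B where "0 < \<epsilon>'" "\<epsilon>' < 1" "0 \<le> B"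
    "\<And>c d :: 'n::finite triple \<Rightarrow> complex. c \<in> coeff_space \<Longrightarrow> d \<in> coeff_space \<Longrightarrow>
      pn \<epsilon> (cprod c d) \<le> B * pn \<epsilon>' c * pn \<epsilon>' d"
proof -
  obtain \<epsilon>' B where *: "0 < \<epsilon>'" "\<epsilon>' < 1" "0 \<le> B"
    "\<And>c d i. c \<in> coeff_space \<Longrightarrow> d \<in> coeff_space \<Longrightarrow>
      cmod (cprod c d i) \<le> B * pn \<epsilon>' c * pn \<epsilon>' d * (fact (tdeg (i :: 'n triple))) powr \<epsilon>"
    by (rule cprod_bound[OF e]) blast
  show ?thesis
    by (rule that[OF *(1-3)]) (intro pn_le *(4))
qed

lemma bounded_operator_cprod_left:
  assumes d: "d \<in> coeff_space"
  shows "bounded_operator (\<lambda>c. cprod c d)"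
  unfolding bounded_operator_def linear_on_coeffs_def
proof (intro conjI ballI allI impI)
  fix \<epsilon> :: real assume "0 < \<epsilon> \<and> \<epsilon> < 1"
  then obtain \<epsilon>' B where *: "0 < \<epsilon>'" "\<epsilon>' < 1" "0 \<le> B"
    "\<And>c d :: 'a triple \<Rightarrow> complex. c \<in> coeff_space \<Longrightarrow> d \<in> coeff_space \<Longrightarrow>
      pn \<epsilon> (cprod c d) \<le> B * pn \<epsilon>' c * pn \<epsilon>' d"
    using cprod_pn_bound by metis
  then show "\<exists>\<epsilon>' B. 0 < \<epsilon>' \<and> \<epsilon>' < 1 \<and> 0 \<le> B \<and> (\<forall>c\<in>coeff_space. pn \<epsilon> (cprod c d) \<le> B * pn \<epsilon>' c)"
    using *(4)[OF _ d] coeff_bound(2)[OF d *(1,2)]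
    by (intro exI[of _ \<epsilon>'] exI[of _ "B * pn \<epsilon>' d"]) (auto simp: mult_ac)
qed (use d in \<open>auto simp: cprod_in_coeff_space cprod_add_left cprod_scale_left\<close>)

lemma bounded_operator_cprod_right:
  assumes c: "c \<in> coeff_space"
  shows "bounded_operator (\<lambda>d. cprod c d)"
  unfolding bounded_operator_def linear_on_coeffs_def
proof (intro conjI ballI allI impI)
  fix \<epsilon> :: real assume "0 < \<epsilon> \<and> \<epsilon> < 1"
  then obtain \<epsilon>' B where *: "0 < \<epsilon>'" "\<epsilon>' < 1" "0 \<le> B"
    "\<And>c d :: 'a triple \<Rightarrow> complex. c \<in> coeff_space \<Longrightarrow> d \<in> coeff_space \<Longrightarrow>
      pn \<epsilon> (cprod c d) \<le> B * pn \<epsilon>' c * pn \<epsilon>' d"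
    using cprod_pn_bound by metis
  then show "\<exists>\<epsilon>' B. 0 < \<epsilon>' \<and> \<epsilon>' < 1 \<and> 0 \<le> B \<and> (\<forall>d\<in>coeff_space. pn \<epsilon> (cprod c d) \<le> B * pn \<epsilon>' d)"
    using *(4)[OF c] coeff_bound(2)[OF c *(1,2)]
    by (intro exI[of _ \<epsilon>'] exI[of _ "B * pn \<epsilon>' c"]) (auto simp: mult_ac)
qed (use c in \<open>auto simp: cprod_in_coeff_space cprod_add_right cprod_scale_right\<close>)

text \<open>Density is applied in one argument at a time.\<close>

lemma bilinear_vanishes_by_density:
  fixes c d :: "'n::finite triple \<Rightarrow> complex"
  assumes left: "\<And>d. d \<in> coeff_space \<Longrightarrow> bounded_functional (\<lambda>c :: 'n triple \<Rightarrow> complex. \<Phi> c d)"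
    and right: "\<And>c. c \<in> coeff_space \<Longrightarrow> bounded_functional (\<lambda>d :: 'n triple \<Rightarrow> complex. \<Phi> c d)"
    and basis: "\<And>k l. k \<in> triples \<Longrightarrow> l \<in> triples \<Longrightarrow> \<Phi> (delta k) (delta l) = 0"
    and cd: "c \<in> coeff_space" "d \<in> coeff_space"
  shows "\<Phi> c d = 0"
proof (rule functional_vanishes_by_density[OF left[OF cd(2)] _ cd(1)])
  fix k :: "'n triple" assume k: "k \<in> triples"
  show "\<Phi> (delta k) d = 0"
    by (rule functional_vanishes_by_density[OF right[OF delta_in_coeff_space[OF k]] basis[OF k] cd(2)])
qed


section \<open>The topology on the cone algebra\<close>

lemma Ahat_seminorm_f_series:
  assumes "0 < h" "c \<in> coeff_space"
  shows "Ahat_seminorm h \<epsilon> (f_series h c) = pn \<epsilon> c"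
  using assms by (simp add: Ahat_seminorm_def pn_def the_inv_into_f_f[OF inj_on_f_series])

lemma f_series_eq_iff:
  "0 < h \<Longrightarrow> c \<in> coeff_space \<Longrightarrow> d \<in> coeff_space \<Longrightarrow> f_series h c = f_series h d \<longleftrightarrow> c = d"
  using inj_on_f_series[of h] by (auto dest: inj_onD)

text \<open>The norms decrease with the exponent, so finitely many of them are dominated by the one with the
  smallest exponent, and balls for single norms form a neighbourhood base.\<close>

lemma openin_top_cone:
  fixes U :: "('n::finite point \<Rightarrow> complex) set"
  assumes h: "0 < h"
  shows "openin (top_cone h) U \<longleftrightarrow> U \<subseteq> Ahat_cone h \<and>
    (\<forall>c\<in>coeff_space. f_series h c \<in> U \<longrightarrow> (\<exists>\<epsilon> r. 0 < \<epsilon> \<and> \<epsilon> < 1 \<and> 0 < r \<and>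
      (\<forall>d\<in>coeff_space. pn \<epsilon> (d - c) < r \<longrightarrow> f_series h d \<in> U)))"
    (is "_ \<longleftrightarrow> ?R U")
proof
  let ?B = "{{b \<in> Ahat_cone h. p (b - a) < r} | a p r. a \<in> (Ahat_cone h :: ('n point \<Rightarrow> complex) set) \<and>
      p \<in> {Ahat_seminorm h \<epsilon> | \<epsilon>. 0 < \<epsilon> \<and> \<epsilon> < 1} \<and> 0 < r}"
  have top: "top_cone h = topology_generated_by ?B"
    by (simp add: top_cone_def seminorm_topology_def)
  have diff: "Ahat_seminorm h \<epsilon> (f_series h d - f_series h c) = pn \<epsilon> (d - c)"
    if "c \<in> coeff_space" "d \<in> coeff_space" for \<epsilon> and c d :: "'n triple \<Rightarrow> complex"
    using that h by (simp add: Ahat_seminorm_f_series coeff_space_diff flip: f_series_diff)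
  {
    assume "openin (top_cone h) U"
    then have "generate_topology_on ?B U"
      unfolding top by (rule openin_topology_generated_by)
    then show "?R U"
    proof (induction rule: generate_topology_on.induct)
      case (Int A B)
      show ?case
      proof (intro conjI ballI impI)
        fix c assume c: "c \<in> coeff_space" "f_series h c \<in> A \<inter> B"
        from Int.IH c obtain \<epsilon>1 r1 where 1: "0 < \<epsilon>1" "\<epsilon>1 < 1" "0 < r1"
          "\<forall>d\<in>coeff_space. pn \<epsilon>1 (d - c) < r1 \<longrightarrow> f_series h d \<in> A" by blast
        from Int.IH c obtain \<epsilon>2 r2 where 2: "0 < \<epsilon>2" "\<epsilon>2 < 1" "0 < r2"
          "\<forall>d\<in>coeff_space. pn \<epsilon>2 (d - c) < r2 \<longrightarrow> f_series h d \<in> B" by blast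
        define \<epsilon> r where "\<epsilon> = min \<epsilon>1 \<epsilon>2" and "r = min r1 r2"
        have er: "0 < \<epsilon>" "\<epsilon> < 1" "0 < r" using 1 2 by (auto simp: \<epsilon>_def r_def)
        have "f_series h d \<in> A \<inter> B" if d: "d \<in> coeff_space" "pn \<epsilon> (d - c) < r" for d
        proof -
          have "pn \<epsilon>1 (d - c) \<le> pn \<epsilon> (d - c)" "pn \<epsilon>2 (d - c) \<le> pn \<epsilon> (d - c)"
            by (intro pn_antimono coeff_space_diff d c er; use 1 2 in \<open>simp add: \<epsilon>_def\<close>)+
          then show ?thesis using 1(4) 2(4) d by (auto simp: r_def)
        qed
        then show "\<exists>\<epsilon> r. 0 < \<epsilon> \<and> \<epsilon> < 1 \<and> 0 < r \<and>
            (\<forall>d\<in>coeff_space. pn \<epsilon> (d - c) < r \<longrightarrow> f_series h d \<in> A \<inter> B)" using er by blast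
      qed (use Int.IH in blast)
    next
      case (UN K)
      show ?case
      proof (intro conjI ballI impI)
        fix c assume c: "c \<in> coeff_space" "f_series h c \<in> \<Union>K"
        then obtain k where k: "k \<in> K" "f_series h c \<in> k" by blast
        then obtain \<epsilon> r where "0 < \<epsilon>" "\<epsilon> < 1" "0 < r"
          "\<forall>d\<in>coeff_space. pn \<epsilon> (d - c) < r \<longrightarrow> f_series h d \<in> k" using UN.IH[OF k(1)] c(1) by blast
        then show "\<exists>\<epsilon> r. 0 < \<epsilon> \<and> \<epsilon> < 1 \<and> 0 < r \<and>
            (\<forall>d\<in>coeff_space. pn \<epsilon> (d - c) < r \<longrightarrow> f_series h d \<in> \<Union>K)" using k(1) by blast
      qed (use UN.IH in blast)
    next
      case (Basis s)
      then obtain a \<epsilon> r where s: "s = {b \<in> Ahat_cone h. Ahat_seminorm h \<epsilon> (b - a) < r}"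
        "a \<in> Ahat_cone h" and e: "0 < \<epsilon>" "\<epsilon> < 1" "0 < r" by blast
      obtain a' where a': "a = f_series h a'" "a' \<in> coeff_space"
        using s(2) by (auto simp: Ahat_cone_def)
      show ?case
      proof (intro conjI ballI impI)
        fix c :: "'n triple \<Rightarrow> complex" assume c: "c \<in> coeff_space" "f_series h c \<in> s"
        have lt: "pn \<epsilon> (c - a') < r" using c a' by (simp add: s(1) diff)
        have "f_series h d \<in> s" if d: "d \<in> coeff_space" "pn \<epsilon> (d - c) < r - pn \<epsilon> (c - a')" for d
        proof -
          have "pn \<epsilon> ((d - c) + (c - a')) \<le> pn \<epsilon> (d - c) + pn \<epsilon> (c - a')"
            by (intro pn_triangle coeff_space_diff d c a' e)
          then have "pn \<epsilon> (d - a') < r" using d(2) by simp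
          then show ?thesis using d(1) a' by (auto simp: s(1) diff Ahat_cone_def)
        qed
        then show "\<exists>\<epsilon> r. 0 < \<epsilon> \<and> \<epsilon> < 1 \<and> 0 < r \<and>
            (\<forall>d\<in>coeff_space. pn \<epsilon> (d - c) < r \<longrightarrow> f_series h d \<in> s)"
          using e lt by (intro exI[of _ \<epsilon>] exI[of _ "r - pn \<epsilon> (c - a')"]) auto
      qed (use s in blast)
    qed auto
  }
  {
    assume R: "?R U"
    show "openin (top_cone h) U"
    proof (subst openin_subopen, intro ballI)
      fix x assume x: "x \<in> U"
      then obtain c where c: "c \<in> coeff_space" "x = f_series h c"
        using R by (auto simp: Ahat_cone_def)
      with R x obtain \<epsilon> r where e: "0 < \<epsilon>" "\<epsilon> < 1" "0 < r"
        and ball: "\<forall>d\<in>coeff_space. pn \<epsilon> (d - c) < r \<longrightarrow> f_series h d \<in> U" by blast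
      define T where "T = {b \<in> Ahat_cone h. Ahat_seminorm h \<epsilon> (b - x) < r}"
      have xA: "x \<in> Ahat_cone h" using c by (simp add: Ahat_cone_def)
      have "T \<in> ?B" unfolding T_def using e xA by blast
      then have "openin (top_cone h) T"
        unfolding top by (rule topology_generated_by_Basis)
      moreover have "x \<in> T"
        using e xA c diff[OF c(1) c(1), of \<epsilon>] by (simp add: T_def pn_zero)
      moreover have "T \<subseteq> U"
        using ball diff[OF c(1)] by (auto simp: T_def Ahat_cone_def c(2))
      ultimately show "\<exists>T. openin (top_cone h) T \<and> x \<in> T \<and> T \<subseteq> U" by blast
    qed
  }
qed

lemma topspace_top_cone:
  assumes h: "0 < h"
  shows "topspace (top_cone h) = (Ahat_cone h :: ('n::finite point \<Rightarrow> complex) set)"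
proof -
  have "openin (top_cone h) (Ahat_cone h :: ('n::finite point \<Rightarrow> complex) set)"
    unfolding openin_top_cone[OF h]
    by (intro conjI ballI impI exI[of _ "1/2 :: real"]) (auto simp: Ahat_cone_def)
  from openin_subset[OF this] show ?thesis
    using openin_topspace[of "top_cone h"] unfolding openin_top_cone[OF h] by (intro equalityI) auto
qed

lemma limitin_top_coneI:
  assumes h: "0 < h" and c: "c \<in> coeff_space" "\<And>x. g x \<in> coeff_space"
    and lim: "\<And>\<epsilon>. 0 < \<epsilon> \<Longrightarrow> \<epsilon> < 1 \<Longrightarrow> ((\<lambda>x. pn \<epsilon> (g x - c)) \<longlongrightarrow> 0) F"
  shows "limitin (top_cone h) (\<lambda>x. f_series h (g x)) (f_series h c) F"
  unfolding limitin_def topspace_top_cone[OF h]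
proof (intro conjI allI impI)
  show "f_series h c \<in> Ahat_cone h" using c by (simp add: Ahat_cone_def)
  fix U assume "openin (top_cone h) U \<and> f_series h c \<in> U"
  then obtain \<epsilon> r where e: "0 < \<epsilon>" "\<epsilon> < 1" "0 < r"
    and *: "\<forall>d\<in>coeff_space. pn \<epsilon> (d - c) < r \<longrightarrow> f_series h d \<in> U"
    unfolding openin_top_cone[OF h] using c by blast
  have "eventually (\<lambda>x. pn \<epsilon> (g x - c) < r) F"
    by (rule order_tendstoD(2)[OF lim[OF e(1,2)] e(3)])
  then show "eventually (\<lambda>x. f_series h (g x) \<in> U) F"
    by eventually_elim (use * c in blast)
qed

lemma openin_ball:
  assumes h: "0 < h" and c: "c \<in> coeff_space" and e: "0 < \<epsilon>" "\<epsilon> < 1"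
  shows "openin (top_cone h) (f_series h ` {d \<in> coeff_space. pn \<epsilon> (d - c) < r})"
  unfolding openin_top_cone[OF h]
proof (intro conjI ballI impI)
  fix d :: "'a triple \<Rightarrow> complex"
  assume d: "d \<in> coeff_space" "f_series h d \<in> f_series h ` {d \<in> coeff_space. pn \<epsilon> (d - c) < r}"
  then have lt: "pn \<epsilon> (d - c) < r" by (auto simp: f_series_eq_iff[OF h])
  have "f_series h d' \<in> f_series h ` {d \<in> coeff_space. pn \<epsilon> (d - c) < r}"
    if d': "d' \<in> coeff_space" "pn \<epsilon> (d' - d) < r - pn \<epsilon> (d - c)" for d'
  proof -
    have "pn \<epsilon> ((d' - d) + (d - c)) \<le> pn \<epsilon> (d' - d) + pn \<epsilon> (d - c)"
      by (intro pn_triangle coeff_space_diff d d' c e)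
    then show ?thesis using d' by auto
  qed
  then show "\<exists>\<epsilon>' r'. 0 < \<epsilon>' \<and> \<epsilon>' < 1 \<and> 0 < r' \<and> (\<forall>d'\<in>coeff_space. pn \<epsilon>' (d' - d) < r' \<longrightarrow>
      f_series h d' \<in> f_series h ` {d \<in> coeff_space. pn \<epsilon> (d - c) < r})"
    using e lt by (intro exI[of _ \<epsilon>] exI[of _ "r - pn \<epsilon> (d - c)"]) auto
qed (auto simp: Ahat_cone_def)

lemma limitin_top_coneD:
  assumes h: "0 < h" and c: "c \<in> coeff_space" "\<And>x. g x \<in> coeff_space"
    and lim: "limitin (top_cone h) (\<lambda>x. f_series h (g x)) (f_series h c) F"
    and e: "0 < \<epsilon>" "\<epsilon> < 1"
  shows "((\<lambda>x. pn \<epsilon> (g x - c)) \<longlongrightarrow> 0) F"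
proof (rule order_tendstoI)
  fix r :: real assume "0 < r"
  then have "f_series h c \<in> f_series h ` {d \<in> coeff_space. pn \<epsilon> (d - c) < r}"
    using c(1) by (auto simp: pn_zero)
  then have "eventually (\<lambda>x. f_series h (g x) \<in> f_series h ` {d \<in> coeff_space. pn \<epsilon> (d - c) < r}) F"
    using lim openin_ball[OF h c(1) e] by (auto simp: limitin_def)
  then show "eventually (\<lambda>x. pn \<epsilon> (g x - c) < r) F"
    by eventually_elim (auto simp: f_series_eq_iff[OF h] c)
next
  fix r :: real assume "r < 0"
  moreover have "0 \<le> pn \<epsilon> (g x - c)" for x
    by (intro coeff_bound(2) coeff_space_diff c e)
  ultimately show "eventually (\<lambda>x. r < pn \<epsilon> (g x - c)) F"
    by (intro always_eventually allI) (rule less_le_trans)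
qed

lemma pn_limit_coordinate:
  assumes c: "c \<in> coeff_space" "\<And>x. g x \<in> coeff_space" and e: "0 < \<epsilon>" "\<epsilon> < 1"
    and lim: "((\<lambda>x. pn \<epsilon> (g x - c)) \<longlongrightarrow> 0) F"
  shows "((\<lambda>x. g x i) \<longlongrightarrow> c i) F"
proof (rule LIM_zero_cancel)
  show "((\<lambda>x. g x i - c i) \<longlongrightarrow> 0) F"
  proof (rule Lim_null_comparison)
    show "eventually (\<lambda>x. norm (g x i - c i) \<le> pn \<epsilon> (g x - c) * (fact (tdeg i)) powr \<epsilon>) F"
      using coeff_bound(1)[OF coeff_space_diff[OF c(2) c(1)] e] by (intro always_eventually allI) simp
    show "((\<lambda>x. pn \<epsilon> (g x - c) * (fact (tdeg i)) powr \<epsilon>) \<longlongrightarrow> 0) F"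
      using tendsto_mult_right[OF lim, of "(fact (tdeg i)) powr \<epsilon>"] by simp
  qed
qed

lemma limit_coefficients_unique:
  assumes c: "c \<in> coeff_space" "c' \<in> coeff_space" "\<And>x. g x \<in> coeff_space" and F: "F \<noteq> bot"
    and lim: "((\<lambda>x. pn \<epsilon> (g x - c)) \<longlongrightarrow> 0) F" "((\<lambda>x. pn \<epsilon> (g x - c')) \<longlongrightarrow> 0) F"
    and e: "0 < \<epsilon>" "\<epsilon> < 1"
  shows "c = c'"
  by (rule ext, rule tendsto_unique[OF F pn_limit_coordinate[OF c(1,3) e lim(1)]
        pn_limit_coordinate[OF c(2,3) e lim(2)]])

lemma cprod_continuous:
  assumes cd: "c \<in> coeff_space" "d \<in> coeff_space" "\<And>x. g x \<in> coeff_space" "\<And>x. g' x \<in> coeff_space"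
    and lim: "\<And>\<epsilon>. 0 < \<epsilon> \<Longrightarrow> \<epsilon> < 1 \<Longrightarrow> ((\<lambda>x. pn \<epsilon> (g x - c)) \<longlongrightarrow> 0) F"
      "\<And>\<epsilon>. 0 < \<epsilon> \<Longrightarrow> \<epsilon> < 1 \<Longrightarrow> ((\<lambda>x. pn \<epsilon> (g' x - d)) \<longlongrightarrow> 0) F"
    and e: "0 < \<epsilon>" "\<epsilon> < 1"
  shows "((\<lambda>x. pn \<epsilon> (cprod (g x) (g' x) - cprod c d)) \<longlongrightarrow> 0) F"
proof -
  obtain \<epsilon>' B where B: "0 < \<epsilon>'" "\<epsilon>' < 1" "0 \<le> B"
    "\<And>c d :: 'a triple \<Rightarrow> complex. c \<in> coeff_space \<Longrightarrow> d \<in> coeff_space \<Longrightarrow>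
      pn \<epsilon> (cprod c d) \<le> B * pn \<epsilon>' c * pn \<epsilon>' d"
    by (rule cprod_pn_bound[OF e]) blast
  define D where "D x = B * pn \<epsilon>' (g x - c) * (pn \<epsilon>' (g' x - d) + pn \<epsilon>' d)
      + B * pn \<epsilon>' c * pn \<epsilon>' (g' x - d)" for x
  have le: "pn \<epsilon> (cprod (g x) (g' x) - cprod c d) \<le> D x" for x
  proof -
    note m = coeff_space_diff[OF cd(3) cd(1), of x] coeff_space_diff[OF cd(4) cd(2), of x]
    have eq: "cprod (g x) (g' x) - cprod c d = cprod (g x - c) (g' x) + cprod c (g' x - d)"
      by (simp add: cprod_diff_left cprod_diff_right)
    have "pn \<epsilon> (cprod (g x) (g' x) - cprod c d) \<le> pn \<epsilon> (cprod (g x - c) (g' x)) + pn \<epsilon> (cprod c (g' x - d))"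
      unfolding eq
      by (rule pn_triangle[OF cprod_in_coeff_space[OF m(1) cd(4)] cprod_in_coeff_space[OF cd(1) m(2)] e])
    also have "\<dots> \<le> B * pn \<epsilon>' (g x - c) * pn \<epsilon>' (g' x) + B * pn \<epsilon>' c * pn \<epsilon>' (g' x - d)"
      by (rule add_mono[OF B(4)[OF m(1) cd(4)] B(4)[OF cd(1) m(2)]])
    also have "\<dots> \<le> D x"
    proof -
      have "pn \<epsilon>' ((g' x - d) + d) \<le> pn \<epsilon>' (g' x - d) + pn \<epsilon>' d"
        by (rule pn_triangle[OF m(2) cd(2) B(1,2)])
      then have "pn \<epsilon>' (g' x) \<le> pn \<epsilon>' (g' x - d) + pn \<epsilon>' d" by simp
      then show ?thesis
        unfolding D_def
        by (rule add_right_mono[OF mult_left_mono[OF _ mult_nonneg_nonneg[OF B(3) coeff_bound(2)[OF m(1) B(1,2)]]]])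
    qed
    finally show ?thesis .
  qed
  have "(D \<longlongrightarrow> B * 0 * (0 + pn \<epsilon>' d) + B * pn \<epsilon>' c * 0) F"
    unfolding D_def by (intro tendsto_intros lim B)
  then have D: "(D \<longlongrightarrow> 0) F" by simp
  show ?thesis
  proof (rule Lim_null_comparison[OF _ D])
    have "0 \<le> pn \<epsilon> (cprod (g x) (g' x) - cprod c d)" for x
      by (intro coeff_bound(2) coeff_space_diff cprod_in_coeff_space cd e)
    then show "eventually (\<lambda>x. norm (pn \<epsilon> (cprod (g x) (g' x) - cprod c d)) \<le> D x) F"
      using le by (intro always_eventually allI) simp
  qed
qed

definition trunc :: "nat \<Rightarrow> ('n::finite triple \<Rightarrow> complex) \<Rightarrow> 'n triple \<Rightarrow> complex"
  where "trunc N c = (\<Sum>k\<in>below N. c k \<cdot>\<^sub>C delta k)"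

lemma trunc_apply: "trunc N c k = (if k \<in> below N then c k else 0)"
  by (simp add: finite_below trunc_def sum_fun_apply delta_def if_distrib cong: if_cong)

lemma trunc_in_coeff_space: "trunc N c \<in> coeff_space"
  unfolding trunc_def
  by (intro coeff_space_sum coeff_space_scale delta_in_coeff_space) (simp add: below_def)

lemma trunc_tendsto:
  assumes c: "c \<in> coeff_space" and e: "0 < \<epsilon>" "\<epsilon> < 1"
  shows "(\<lambda>N. pn \<epsilon> (trunc N c - c)) \<longlonglongrightarrow> 0"
proof (rule Lim_null_comparison)
  have "pn \<epsilon> (trunc N c - c) \<le> pn (\<epsilon>/2) c / (fact N) powr (\<epsilon> - \<epsilon>/2)" for N
  proof -
    have "c - trunc N c = restr {k. N \<le> tdeg k \<and> k \<notin> below N} c"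
    proof
      fix k
      show "(c - trunc N c) k = restr {k. N \<le> tdeg k \<and> k \<notin> below N} c k"
        using coeff_zero[OF c, of k] by (auto simp: trunc_apply restr_def below_def)
    qed
    moreover have "pn \<epsilon> (restr {k. N \<le> tdeg k \<and> k \<notin> below N} c) \<le> pn (\<epsilon>/2) c / (fact N) powr (\<epsilon> - \<epsilon>/2)"
      by (rule pn_restr_high_degree[OF c]) (use e in auto)
    ultimately show ?thesis by (simp only: pn_diff_commute[of _ "trunc N c"])
  qed
  moreover have "0 \<le> pn \<epsilon> (trunc N c - c)" for N
    by (intro coeff_bound(2) coeff_space_diff trunc_in_coeff_space c e)
  ultimately show "eventually (\<lambda>N. norm (pn \<epsilon> (trunc N c - c)) \<le> pn (\<epsilon>/2) c / (fact N) powr (\<epsilon> - \<epsilon>/2)) sequentially"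
    by (intro always_eventually allI) simp
  have "(\<lambda>N. 1 ^ N / (fact N) powr (\<epsilon> - \<epsilon>/2) :: real) \<longlonglongrightarrow> 0"
    by (intro summable_LIMSEQ_zero summable_power_over_fact_powr) (use e in auto)
  from tendsto_mult_left[OF this, of "pn (\<epsilon>/2) c"]
  show "(\<lambda>N. pn (\<epsilon>/2) c / (fact N) powr (\<epsilon> - \<epsilon>/2)) \<longlonglongrightarrow> 0"
    by (simp only: power_one times_divide_eq_right mult_1_right mult_zero_right)
qed


section \<open>The completed product\<close>

definition coeffs :: "real \<Rightarrow> ('n::finite point \<Rightarrow> complex) \<Rightarrow> 'n triple \<Rightarrow> complex"
  where "coeffs h = the_inv_into coeff_space (f_series h)"

lemma coeffs_f_series: "0 < h \<Longrightarrow> c \<in> coeff_space \<Longrightarrow> coeffs h (f_series h c) = c"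
  by (simp add: coeffs_def the_inv_into_f_f[OF inj_on_f_series])

lemma Ahat_cone_cases:
  assumes "a \<in> Ahat_cone h"
  obtains c where "c \<in> coeff_space" "a = f_series h c"
  using assms by (auto simp: Ahat_cone_def)

lemma A_cone_finite:
  assumes h: "0 < h" and "a \<in> A_cone h"
  obtains F c where "finite F" "F \<subseteq> triples" "a = (\<Sum>k\<in>F. c k \<cdot>\<^sub>C f_fun h k)"
  using cfun_span_image[OF assms(2)[unfolded A_cone_def]] by blast

lemma cprod_sum_left:
  assumes "finite A"
  shows "cprod (\<Sum>x\<in>A. g x) d = (\<Sum>x\<in>A. cprod (g x) d)"
  using assms
proof induction
  case empty
  show ?case by (simp add: fun_eq_iff cprod_def)
next
  case (insert x A)
  show ?case by (simp only: sum.insert[OF insert.hyps] cprod_add_left insert.IH)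
qed

lemma cprod_sum_right:
  assumes "finite A"
  shows "cprod c (\<Sum>x\<in>A. g x) = (\<Sum>x\<in>A. cprod c (g x))"
  using assms
proof induction
  case empty
  show ?case by (simp add: fun_eq_iff cprod_def)
next
  case (insert x A)
  show ?case by (simp only: sum.insert[OF insert.hyps] cprod_add_right insert.IH)
qed

lemma star_cone_cprod:
  assumes h: "0 < h" and F: "finite F" "F \<subseteq> triples" and G: "finite G" "G \<subseteq> (triples :: 'n::finite triple set)"
  shows "star_cone h (\<Sum>k\<in>F. c k \<cdot>\<^sub>C f_fun h k) (\<Sum>l\<in>G. d l \<cdot>\<^sub>C f_fun h l)
    = f_series h (cprod (\<Sum>k\<in>F. c k \<cdot>\<^sub>C delta k) (\<Sum>l\<in>G. d l \<cdot>\<^sub>C delta l))"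
proof -
  have cl: "cprod (\<Sum>k\<in>F. c k \<cdot>\<^sub>C delta k) e = (\<Sum>k\<in>F. c k \<cdot>\<^sub>C cprod (delta k) e)" for e
    by (simp only: cprod_sum_left[OF F(1)] cprod_scale_left)
  have cr: "cprod e (\<Sum>l\<in>G. d l \<cdot>\<^sub>C delta l) = (\<Sum>l\<in>G. d l \<cdot>\<^sub>C cprod e (delta l))" for e
    by (simp only: cprod_sum_right[OF G(1)] cprod_scale_right)
  have "cprod (\<Sum>k\<in>F. c k \<cdot>\<^sub>C delta k) (\<Sum>l\<in>G. d l \<cdot>\<^sub>C delta l)
      = (\<Sum>k\<in>F. \<Sum>l\<in>G. (c k * d l) \<cdot>\<^sub>C cprod (delta k) (delta l))"
    unfolding cl cr
    by (simp add: fun_eq_iff sum_fun_apply sum_distrib_left mult_ac) (subst sum.swap, simp)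
  also have "\<dots> = (\<Sum>k\<in>F. \<Sum>l\<in>G. (c k * d l) \<cdot>\<^sub>C basis_prod k l)"
    by (intro sum.cong refl) (simp add: cprod_delta subsetD[OF F(2)] subsetD[OF G(2)])
  finally have "f_series h (cprod (\<Sum>k\<in>F. c k \<cdot>\<^sub>C delta k) (\<Sum>l\<in>G. d l \<cdot>\<^sub>C delta l))
      = f_series h (\<Sum>k\<in>F. \<Sum>l\<in>G. (c k * d l) \<cdot>\<^sub>C basis_prod k l)" by simp
  also have "\<dots> = (\<Sum>k\<in>F. f_series h (\<Sum>l\<in>G. (c k * d l) \<cdot>\<^sub>C basis_prod k l))"
    by (intro f_series_sum[OF h] coeff_space_sum coeff_space_scale basis_prod_in_coeff_space)
       (use F(2) G(2) in blast)+
  also have "\<dots> = (\<Sum>k\<in>F. \<Sum>l\<in>G. (c k * d l) \<cdot>\<^sub>C f_series h (basis_prod k l))"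
  proof (rule sum.cong[OF refl])
    fix k assume k: "k \<in> F"
    have mem: "basis_prod k l \<in> coeff_space" if "l \<in> G" for l
      using that k F(2) G(2) by (intro basis_prod_in_coeff_space) blast+
    have "f_series h (\<Sum>l\<in>G. (c k * d l) \<cdot>\<^sub>C basis_prod k l)
        = (\<Sum>l\<in>G. f_series h ((c k * d l) \<cdot>\<^sub>C basis_prod k l))"
      by (intro f_series_sum[OF h] coeff_space_scale mem)
    also have "\<dots> = (\<Sum>l\<in>G. (c k * d l) \<cdot>\<^sub>C f_series h (basis_prod k l))"
      by (intro sum.cong refl f_series_scale[OF h] mem)
    finally show "f_series h (\<Sum>l\<in>G. (c k * d l) \<cdot>\<^sub>C basis_prod k l)
        = (\<Sum>l\<in>G. (c k * d l) \<cdot>\<^sub>C f_series h (basis_prod k l))" .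
  qed
  finally show ?thesis unfolding star_cone_finite[OF h F G] ..
qed

text \<open>The seminorm estimate makes \<open>cprod\<close> jointly continuous, so a continuous extension of the product
  to the completion exists.\<close>

lemma star_hat_spec:
  fixes h :: real
  assumes h: "0 < h"
  shows "continuous_map (prod_topology (top_cone h) (top_cone h)) (top_cone h)
      (\<lambda>(a, b). star_hat h a (b :: 'n::finite point \<Rightarrow> complex))
    \<and> (\<forall>a\<in>A_cone h. \<forall>b\<in>A_cone h. star_hat h a b = star_cone h a (b :: 'n::finite point \<Rightarrow> complex))"
proof -
  define m where "m a b = f_series h (cprod (coeffs h a) (coeffs h b))" for a b :: "'n point \<Rightarrow> complex"
  have "continuous_map (prod_topology (top_cone h) (top_cone h)) (top_cone h) (\<lambda>(a, b). m a b)"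
    unfolding continuous_map_def
  proof (intro conjI allI impI)
    show "(\<lambda>(a, b). m a b) \<in> topspace (prod_topology (top_cone h) (top_cone h)) \<rightarrow> topspace (top_cone h)"
      unfolding topspace_prod_topology topspace_top_cone[OF h]
      by (auto simp: m_def Ahat_cone_def coeffs_f_series[OF h] cprod_in_coeff_space)
    fix U :: "('n point \<Rightarrow> complex) set" assume U: "openin (top_cone h) U"
    let ?S = "{x \<in> topspace (prod_topology (top_cone h) (top_cone h)). (case x of (a, b) \<Rightarrow> m a b) \<in> U}"
    show "openin (prod_topology (top_cone h) (top_cone h)) ?S"
      unfolding openin_prod_topology_alt
    proof (intro allI impI)
      fix a b assume ab: "(a, b) \<in> ?S"
      then have "a \<in> Ahat_cone h" "b \<in> Ahat_cone h"
        by (auto simp: topspace_prod_topology topspace_top_cone[OF h])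
      then obtain c d where cd: "c \<in> coeff_space" "a = f_series h c" "d \<in> coeff_space" "b = f_series h d"
        by (auto simp: Ahat_cone_def)
      have "f_series h (cprod c d) \<in> U"
        using ab cd by (simp add: m_def coeffs_f_series[OF h])
      then obtain \<epsilon> r where e: "0 < \<epsilon>" "\<epsilon> < 1" "0 < r"
        and ball: "\<forall>e\<in>coeff_space. pn \<epsilon> (e - cprod c d) < r \<longrightarrow> f_series h e \<in> U"
        using U cprod_in_coeff_space[OF cd(1,3)] unfolding openin_top_cone[OF h] by blast
      obtain \<epsilon>' B where B: "0 < \<epsilon>'" "\<epsilon>' < 1" "0 \<le> B"
        "\<And>c d :: 'n triple \<Rightarrow> complex. c \<in> coeff_space \<Longrightarrow> d \<in> coeff_space \<Longrightarrow>
          pn \<epsilon> (cprod c d) \<le> B * pn \<epsilon>' c * pn \<epsilon>' d"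
        by (rule cprod_pn_bound[OF e(1,2)]) blast
      \<comment> \<open>If both factors move by at most \<open>s \<le> 1\<close>, the product moves by less than \<open>M * s\<close>.\<close>
      define M where "M = B * (1 + pn \<epsilon>' d) + B * pn \<epsilon>' c + 1"
      have pcd: "0 \<le> pn \<epsilon>' c" "0 \<le> pn \<epsilon>' d" using coeff_bound(2)[OF _ B(1,2)] cd by auto
      have M: "0 < M" using B(3) pcd by (auto simp: M_def intro!: add_nonneg_pos add_nonneg_nonneg mult_nonneg_nonneg)
      define s where "s = min 1 (r / M)"
      have s: "0 < s" "s \<le> 1" "M * s \<le> r" using M e by (auto simp: s_def min_def field_simps)
      define V where "V c = f_series h ` {c' \<in> coeff_space. pn \<epsilon>' (c' - c) < s}" for c :: "'n triple \<Rightarrow> complex"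
      have "V c \<times> V d \<subseteq> ?S"
      proof safe
        fix x y assume "x \<in> V c" "y \<in> V d"
        then obtain c' d' where c': "c' \<in> coeff_space" "pn \<epsilon>' (c' - c) < s" "x = f_series h c'"
          and d': "d' \<in> coeff_space" "pn \<epsilon>' (d' - d) < s" "y = f_series h d'" by (auto simp: V_def)
        have pd': "pn \<epsilon>' d' \<le> 1 + pn \<epsilon>' d"
        proof -
          have "pn \<epsilon>' ((d' - d) + d) \<le> pn \<epsilon>' (d' - d) + pn \<epsilon>' d"
            by (intro pn_triangle coeff_space_diff cd d' B)
          then show ?thesis using d'(2) s(2) by simp
        qed
        have eq: "cprod c' d' - cprod c d = cprod (c' - c) d' + cprod c (d' - d)"
          by (simp add: cprod_diff_left cprod_diff_right)
        have "pn \<epsilon> (cprod c' d' - cprod c d) \<le> pn \<epsilon> (cprod (c' - c) d') + pn \<epsilon> (cprod c (d' - d))"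
          unfolding eq by (intro pn_triangle cprod_in_coeff_space coeff_space_diff cd c' d' e)
        also have "\<dots> \<le> B * pn \<epsilon>' (c' - c) * pn \<epsilon>' d' + B * pn \<epsilon>' c * pn \<epsilon>' (d' - d)"
          by (intro add_mono B(4) coeff_space_diff cd c' d')
        also have "\<dots> \<le> B * s * (1 + pn \<epsilon>' d) + B * pn \<epsilon>' c * s"
          by (intro add_mono mult_mono mult_nonneg_nonneg B pd' pcd order_refl less_imp_le[OF c'(2)]
              less_imp_le[OF d'(2)] coeff_bound(2) coeff_space_diff cd c' d' less_imp_le[OF s(1)])
        also have "\<dots> = (M - 1) * s" by (simp add: M_def algebra_simps)
        also have "\<dots> < M * s" using s(1) by simp
        also have "\<dots> \<le> r" by (rule s(3))
        finally have "f_series h (cprod c' d') \<in> U"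
          using ball cprod_in_coeff_space[OF c'(1) d'(1)] by blast
        then show "(x, y) \<in> topspace (prod_topology (top_cone h) (top_cone h))" "m x y \<in> U"
          using c' d' by (auto simp: topspace_prod_topology topspace_top_cone[OF h] m_def
              coeffs_f_series[OF h] Ahat_cone_def)
      qed
      moreover have "openin (top_cone h) (V c)" "openin (top_cone h) (V d)"
        unfolding V_def by (intro openin_ball[OF h] cd B)+
      moreover have "a \<in> V c" "b \<in> V d"
        using cd s by (auto simp: V_def pn_zero)
      ultimately show "\<exists>U V. openin (top_cone h) U \<and> openin (top_cone h) V \<and> a \<in> U \<and> b \<in> V \<and> U \<times> V \<subseteq> ?S"
        by blast
    qed
  qed
  moreover have "m a b = star_cone h a b" if "a \<in> A_cone h" "b \<in> A_cone h" for a b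
  proof -
    obtain F c where F: "finite F" "F \<subseteq> triples" "a = (\<Sum>k\<in>F. c k \<cdot>\<^sub>C f_fun h k)"
      by (rule A_cone_finite[OF h \<open>a \<in> A_cone h\<close>])
    obtain G d where G: "finite G" "G \<subseteq> triples" "b = (\<Sum>k\<in>G. d k \<cdot>\<^sub>C f_fun h k)"
      by (rule A_cone_finite[OF h \<open>b \<in> A_cone h\<close>])
    have "coeffs h (\<Sum>k\<in>A. e k \<cdot>\<^sub>C f_fun h k) = (\<Sum>k\<in>A. e k \<cdot>\<^sub>C delta k)"
      if "A \<subseteq> triples" for A :: "'n triple set" and e
      unfolding f_series_finite[OF h that, symmetric]
      by (intro coeffs_f_series[OF h] coeff_space_sum coeff_space_scale delta_in_coeff_space) (use that in blast)
    then show ?thesis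
      unfolding m_def F(3) G(3) star_cone_cprod[OF h F(1,2) G(1,2)] using F(2) G(2) by simp
  qed
  ultimately have m: "continuous_map (prod_topology (top_cone h) (top_cone h)) (top_cone h) (\<lambda>(a, b). m a b)
    \<and> (\<forall>a\<in>A_cone h. \<forall>b\<in>A_cone h. m a b = star_cone h a b)" by blast
  define P where "P m \<longleftrightarrow> continuous_map (prod_topology (top_cone h) (top_cone h)) (top_cone h) (\<lambda>(a, b). m a b)
    \<and> (\<forall>a\<in>A_cone h. \<forall>b\<in>A_cone h. m a b = star_cone h a (b :: 'n point \<Rightarrow> complex))" for m
  have "P m" using m by (simp add: P_def)
  then have "P (SOME m. P m)" by (rule someI[of P])
  moreover have "star_hat h = (SOME m. P m)" unfolding star_hat_def P_def ..
  ultimately have "P (star_hat h)" by simp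
  then show ?thesis unfolding P_def .
qed

text \<open>Truncations of both factors converge and their products are known. The limit of the products has
  only one sequence of coefficients, so the extension is unique and given by \<open>cprod\<close>.\<close>

lemma star_hat_f_series:
  fixes c d :: "'n::finite triple \<Rightarrow> complex"
  assumes h: "0 < h" and cd: "c \<in> coeff_space" "d \<in> coeff_space"
  shows "star_hat h (f_series h c) (f_series h d) = f_series h (cprod c d)"
proof -
  note cont = star_hat_spec[OF h, where ?'n = 'n, THEN conjunct1]
    and ext = star_hat_spec[OF h, where ?'n = 'n, THEN conjunct2]
  have trunc_f: "f_series h (trunc N e) = (\<Sum>k\<in>below N. e k \<cdot>\<^sub>C f_fun h k)" for N and e :: "'n triple \<Rightarrow> complex"
    unfolding trunc_def by (rule f_series_finite[OF h]) (auto simp: below_def)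
  have A: "f_series h (trunc N e) \<in> A_cone h" for N and e :: "'n triple \<Rightarrow> complex"
    unfolding trunc_f A_cone_def
    by (intro cfun.span_sum cfun.span_scale cfun.span_base) (auto simp: below_def)
  have star: "star_hat h (f_series h (trunc N c)) (f_series h (trunc N d))
      = f_series h (cprod (trunc N c) (trunc N d))" for N
  proof -
    have sub: "below N \<subseteq> (triples :: 'n triple set)" by (auto simp: below_def)
    have "star_hat h (f_series h (trunc N c)) (f_series h (trunc N d))
        = star_cone h (f_series h (trunc N c)) (f_series h (trunc N d))"
      using ext A by blast
    also have "\<dots> = f_series h (cprod (trunc N c) (trunc N d))"
      unfolding trunc_f unfolding trunc_def by (rule star_cone_cprod[OF h finite_below sub finite_below sub])
    finally show ?thesis .
  qed
  have "limitin (prod_topology (top_cone h) (top_cone h))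
      (\<lambda>N. (f_series h (trunc N c), f_series h (trunc N d))) (f_series h c, f_series h d) sequentially"
    unfolding limitin_pairwise
    by (auto simp: o_def intro!: limitin_top_coneI[OF h] cd trunc_in_coeff_space trunc_tendsto)
  from continuous_map_limit[OF cont this]
  have lim: "limitin (top_cone h) (\<lambda>N. f_series h (cprod (trunc N c) (trunc N d)))
      (star_hat h (f_series h c) (f_series h d)) sequentially"
    by (simp add: o_def star)
  have "star_hat h (f_series h c) (f_series h d) \<in> Ahat_cone h"
    using limitin_topspace[OF lim] by (simp only: topspace_top_cone[OF h])
  then obtain e where e: "e \<in> coeff_space" "star_hat h (f_series h c) (f_series h d) = f_series h e"
    by (rule Ahat_cone_cases)
  have "(\<lambda>N. pn (1/2) (cprod (trunc N c) (trunc N d) - e)) \<longlonglongrightarrow> 0"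
    by (rule limitin_top_coneD[OF h e(1)
          cprod_in_coeff_space[OF trunc_in_coeff_space trunc_in_coeff_space] lim[unfolded e(2)]]) simp_all
  moreover have "(\<lambda>N. pn (1/2) (cprod (trunc N c) (trunc N d) - cprod c d)) \<longlonglongrightarrow> 0"
    by (intro cprod_continuous cd trunc_in_coeff_space trunc_tendsto) auto
  ultimately have "e = cprod c d"
    by (intro limit_coefficients_unique[where g = "\<lambda>N. cprod (trunc N c) (trunc N d)" and F = sequentially
          and \<epsilon> = "1/2"] e(1) cprod_in_coeff_space cd trunc_in_coeff_space) auto
  then show ?thesis using e(2) by simp
qed


section \<open>Conjugation\<close>

definition swap_triple :: "'n triple \<Rightarrow> 'n triple"
  where "swap_triple = (\<lambda>(P, Q, \<alpha>). (Q, P, \<alpha>))"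

definition conj_coeffs :: "('n triple \<Rightarrow> complex) \<Rightarrow> 'n triple \<Rightarrow> complex"
  where "conj_coeffs c k = cnj (c (swap_triple k))"

lemma swap_swap [simp]: "swap_triple (swap_triple k) = k"
  by (cases k) (simp add: swap_triple_def)

lemma swap_in_triples_iff [simp]: "swap_triple k \<in> triples \<longleftrightarrow> k \<in> triples"
  by (cases k) (auto simp: swap_triple_def triples_def)

lemma tdeg_swap [simp]: "tdeg (swap_triple k) = tdeg k"
  by (cases k) (simp add: swap_triple_def)

lemma ex_swap [simp]: "exK (swap_triple k) = exL k" "exL (swap_triple k) = exK k"
  by (cases k; simp add: swap_triple_def exK_def exL_def)+

lemma swap_tri: "mdeg K = mdeg L \<Longrightarrow> swap_triple (tri K L) = tri L K"
  by (simp add: swap_triple_def tri_def)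

lemma swap_bij: "bij_betw swap_triple triples triples"
  by (rule bij_betwI[of _ _ _ swap_triple]) auto

lemma swap_eq_iff [simp]: "swap_triple k = swap_triple l \<longleftrightarrow> k = l"
  by (metis swap_swap)

lemma conj_coeffs_in_coeff_space:
  assumes "c \<in> coeff_space"
  shows "conj_coeffs c \<in> coeff_space"
proof (rule coeff_spaceI)
  fix \<epsilon> :: real assume e: "0 < \<epsilon>" "\<epsilon> < 1"
  have "cmod (conj_coeffs c k) \<le> pn \<epsilon> c * (fact (tdeg k)) powr \<epsilon>" for k
    using coeff_bound(1)[OF assms e, of "swap_triple k"] by (simp add: conj_coeffs_def)
  then show "\<exists>B. \<forall>k\<in>triples. cmod (conj_coeffs c k) \<le> B * (fact (tdeg k)) powr \<epsilon>" by blast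
qed (use assms in \<open>simp add: conj_coeffs_def coeff_zero\<close>)

lemma f_fun_swap: "f_fun h (swap_triple k) z = cnj (f_fun h k z)"
  by (cases k) (simp add: swap_triple_def f_fun_def e_fun_def mult_ac)

lemma f_series_conj: "f_series h (conj_coeffs c) z = cnj (f_series h c z)"
proof -
  have "cnj (f_series h c z) = (\<Sum>\<^sub>\<infinity>k\<in>triples. cnj (c k * f_fun h k z))"
    unfolding f_series_def by (rule infsum_cnj[symmetric])
  also have "\<dots> = (\<Sum>\<^sub>\<infinity>k\<in>triples. cnj (c (swap_triple k) * f_fun h (swap_triple k) z))"
    by (rule infsum_reindex_bij_betw[OF swap_bij, symmetric])
  also have "\<dots> = f_series h (conj_coeffs c) z"
    by (simp add: f_series_def conj_coeffs_def f_fun_swap)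
  finally show ?thesis ..
qed

lemma basis_prod_swap:
  assumes "k \<in> triples" "l \<in> triples"
  shows "basis_prod (swap_triple l) (swap_triple k) (swap_triple i) = cnj (basis_prod k l i)"
proof -
  have "sfac (swap_triple l) (swap_triple k) T * delta (stri (swap_triple l) (swap_triple k) T) (swap_triple i)
      = cnj (sfac k l T * delta (stri k l T) i)" if T: "T \<le> exK k" "T \<le> exL l" for T
  proof -
    have 1: "exL l - T + exL k = exL k + exL l - T"
      using T(2) by (auto simp: fun_eq_iff le_fun_def)
    have 2: "exK l + exK k - T = exK k - T + exK l"
      using T(1) by (auto simp: fun_eq_iff le_fun_def)
    have "stri (swap_triple l) (swap_triple k) T = swap_triple (stri k l T)"
      unfolding stri_def ex_swap 1 2
      by (rule swap_tri[symmetric]) (simp add: stri_degrees[OF assms T])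
    moreover have "sfac (swap_triple l) (swap_triple k) T = sfac k l T"
      unfolding sfac_def ex_swap 1 2 by (simp add: mult_ac)
    moreover have "cnj (sfac k l T) = sfac k l T"
      by (simp add: sfac_def sgm_def)
    ultimately show ?thesis
      by (auto simp: delta_def)
  qed
  then have "(\<Sum>T | T \<le> exK k \<and> T \<le> exL l.
        sfac (swap_triple l) (swap_triple k) T * delta (stri (swap_triple l) (swap_triple k) T) (swap_triple i))
      = (\<Sum>T | T \<le> exK k \<and> T \<le> exL l. cnj (sfac k l T * delta (stri k l T) i))"
    by (intro sum.cong) auto
  moreover have "{T. T \<le> exL l \<and> T \<le> exK k} = {T. T \<le> exK k \<and> T \<le> exL l}" by blast
  ultimately show ?thesis
    by (simp add: basis_prod_def sum_fun_apply)
qed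

text \<open>Conjugation exchanges the derivatives with respect to \<open>z\<close> and to its conjugate, and thereby the two
  factors.\<close>

lemma cprod_conj: "cprod (conj_coeffs d) (conj_coeffs c) = conj_coeffs (cprod c d)"
proof
  fix i :: "'a triple"
  have bij: "bij_betw swap_triple (below m :: 'a triple set) (below m)" for m
    by (rule bij_betwI[of _ _ _ swap_triple]) (auto simp: below_def)
  have "cprod (conj_coeffs d) (conj_coeffs c) i
      = (\<Sum>k\<in>below (tdeg i). \<Sum>l\<in>below (tdeg i). conj_coeffs d k * conj_coeffs c l * basis_prod k l i)"
    by (simp add: cprod_def)
  also have "\<dots> = (\<Sum>k\<in>below (tdeg i). \<Sum>l\<in>below (tdeg i).
      conj_coeffs d (swap_triple k) * conj_coeffs c (swap_triple l) * basis_prod (swap_triple k) (swap_triple l) i)"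
    by (subst sum.reindex_bij_betw[OF bij, symmetric], rule sum.cong[OF refl],
        subst sum.reindex_bij_betw[OF bij, symmetric]) simp
  also have "\<dots> = (\<Sum>k\<in>below (tdeg i). \<Sum>l\<in>below (tdeg i). cnj (c l * d k * basis_prod l k (swap_triple i)))"
  proof (intro sum.cong refl)
    fix k l :: "'a triple" assume "k \<in> below (tdeg i)" "l \<in> below (tdeg i)"
    then have "k \<in> triples" "l \<in> triples" by (auto simp: below_def)
    then show "conj_coeffs d (swap_triple k) * conj_coeffs c (swap_triple l) * basis_prod (swap_triple k) (swap_triple l) i
        = cnj (c l * d k * basis_prod l k (swap_triple i))"
      using basis_prod_swap[of l k "swap_triple i"] by (simp add: conj_coeffs_def)
  qed
  also have "\<dots> = conj_coeffs (cprod c d) i"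
    by (subst sum.swap) (simp add: conj_coeffs_def cprod_def)
  finally show "cprod (conj_coeffs d) (conj_coeffs c) i = conj_coeffs (cprod c d) i" .
qed


section \<open>Multiplication by \<open>y\<close> is central\<close>

definition gsgn :: "'n option \<Rightarrow> complex"
  where "gsgn i = (if i = None then - 1 else 1)"

text \<open>\<open>e_mode h z K L\<close> is the value at \<open>z\<close> of the image of the monomial with exponents \<open>K\<close> and \<open>L\<close>
  under the quantization map \<open>S_op\<close>.\<close>

definition e_mode :: "real \<Rightarrow> 'n::finite point \<Rightarrow> 'n option mindex \<Rightarrow> 'n option mindex \<Rightarrow> complex"
  where "e_mode h z K L = (if z \<in> pos_cone then
    of_real ((2 * h) ^ mdeg K * pochhammer (yfun z / (2 * h)) (mdeg K)) * mon K L z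
      / of_real (yfun z) ^ mdeg K else 0)"

lemma e_mode_eq_f_fun:
  assumes "mdeg K = mdeg L"
  shows "e_mode h z K L = of_real (2 * h) ^ mdeg K * of_nat (mfact K * mfact L) * f_fun h (tri K L) z"
proof (cases "z \<in> pos_cone")
  case True
  have "kfact (tri K L) = mfact K * mfact L"
    by (simp add: kfact_def ex_tri[OF assms])
  then show ?thesis
    using True mfact_pos[of K] mfact_pos[of L]
    by (simp add: e_mode_def f_fun_eq[OF True] e_fun_tri[OF assms])
next
  case False
  then show ?thesis by (cases "tri K L") (simp add: e_mode_def f_fun_def)
qed

lemma mon_unitm: "mon (K + unitm i) (L + unitm i) z = z $ i * cnj (z $ i) * mon K L z"
proof -
  have "mon (unitm i) (unitm i) z = (\<Prod>j\<in>UNIV. if j = i then z $ i * cnj (z $ i) else 1)"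
    unfolding mon_def by (rule prod.cong) (auto simp: unitm_def)
  then have "mon (unitm i) (unitm i) z = z $ i * cnj (z $ i)" by simp
  moreover have "mon (K + unitm i) (L + unitm i) z = mon (unitm i) (unitm i) z * mon K L z"
    by (simp only: mon_mult add.commute)
  ultimately show ?thesis by simp
qed

lemma yfun_eq_sum: "complex_of_real (yfun z) = (\<Sum>i\<in>UNIV. - gsgn i * (z $ i * cnj (z $ i)))"
  by (simp add: yfun_def sum_option gsgn_def sum_negf flip: complex_norm_square)

lemma e_mode_shift:
  assumes h: "0 < h"
  shows "(\<Sum>i\<in>UNIV. - gsgn i * e_mode h z (K + unitm i) (L + unitm i))
    = (of_real (yfun z) + of_real (2 * h) * of_nat (mdeg K)) * e_mode h z K L"
proof (cases "z \<in> pos_cone")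
  case True
  define y where "y = yfun z"
  define m where "m = mdeg K"
  have y: "0 < y" using True by (simp add: pos_cone_def y_def)
  define C where "C = complex_of_real ((2 * h) ^ Suc m * pochhammer (y / (2 * h)) (Suc m)) / of_real y ^ Suc m"
  have e: "e_mode h z (K + unitm i) (L + unitm i) = C * (z $ i * cnj (z $ i)) * mon K L z" for i
    using True by (simp add: e_mode_def mon_unitm mdeg_add C_def y_def m_def)
  have "(\<Sum>i\<in>UNIV. - gsgn i * e_mode h z (K + unitm i) (L + unitm i))
      = C * (\<Sum>i\<in>UNIV. - gsgn i * (z $ i * cnj (z $ i))) * mon K L z"
    unfolding e sum_distrib_left sum_distrib_right by (intro sum.cong refl) (simp only: mult_ac)
  also have "\<dots> = C * of_real y * mon K L z"
    by (simp only: yfun_eq_sum y_def)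
  also have "C * of_real y = of_real ((2 * h) ^ Suc m * pochhammer (y / (2 * h)) (Suc m)) / of_real y ^ m"
    using y by (simp add: C_def)
  also have "(2 * h) ^ Suc m * pochhammer (y / (2 * h)) (Suc m)
      = (y + 2 * h * real m) * ((2 * h) ^ m * pochhammer (y / (2 * h)) m)"
    using h by (simp add: pochhammer_Suc field_simps)
  also have "of_real ((y + 2 * h * real m) * ((2 * h) ^ m * pochhammer (y / (2 * h)) m)) / of_real y ^ m * mon K L z
      = (of_real (yfun z) + of_real (2 * h) * of_nat (mdeg K)) * e_mode h z K L"
    using True by (simp add: e_mode_def y_def m_def)
  finally show ?thesis .
next
  case False
  then show ?thesis by (simp add: e_mode_def)
qed

lemma mfact_unitm: "mfact (T + unitm i) = mfact T * (T i + 1)"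
proof -
  have "mfact (T + unitm i) = (\<Prod>j\<in>UNIV. fact (T j) * (if j = i then T i + 1 else 1))"
    unfolding mfact_def by (rule prod.cong) (auto simp: unitm_def)
  then show ?thesis by (simp add: prod.distrib mfact_def)
qed

lemma sgm_unitm: "sgm (T + unitm i) = gsgn i * sgm T"
  by (auto simp: sgm_def gsgn_def unitm_def)

lemma fall_one_coordinate:
  "(\<Prod>j<t. Suc k - j) = (\<Prod>j<t. k - j) + t * (\<Prod>j<t - 1. k - j :: nat)"
proof (cases t)
  case (Suc s)
  have "(\<Prod>j<Suc s. Suc k - j) = Suc k * (\<Prod>j<s. k - j)"
    unfolding prod.lessThan_Suc_shift by simp
  also have "\<dots> = (\<Prod>j<s. k - j) * (k - s) + Suc s * (\<Prod>j<s. k - j)"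
  proof (cases "s \<le> k")
    case True
    then show ?thesis by (simp add: algebra_simps flip: distrib_left)
  next
    case False
    have "(\<Prod>j<s. k - j) = 0" by (rule prod_zero) (use False in \<open>auto intro!: bexI[of _ k]\<close>)
    then show ?thesis by (simp only: mult_0 mult_0_right add_0_right)
  qed
  finally show ?thesis by (simp add: Suc)
qed simp

lemma fall_add_unitm: "fall (K + unitm i) T = fall K T + T i * fall K (T - unitm i)"
proof -
  define R where "R = (\<Prod>j\<in>UNIV - {i}. \<Prod>l<T j. K j - l)"
  have split: "fall K' T' = (\<Prod>l<T' i. K' i - l) * R"
    if "\<And>j. j \<noteq> i \<Longrightarrow> K' j = K j \<and> T' j = T j" for K' T'
  proof -
    have "fall K' T' = (\<Prod>l<T' i. K' i - l) * (\<Prod>j\<in>UNIV - {i}. \<Prod>l<T' j. K' j - l)"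
      unfolding fall_def by (rule prod.remove) auto
    also have "(\<Prod>j\<in>UNIV - {i}. \<Prod>l<T' j. K' j - l) = R"
      unfolding R_def by (rule prod.cong) (use that in auto)
    finally show ?thesis .
  qed
  have "fall (K + unitm i) T = (\<Prod>l<T i. Suc (K i) - l) * R"
    by (subst split) (auto simp: unitm_def)
  moreover have "fall K T = (\<Prod>l<T i. K i - l) * R"
    by (rule split) auto
  moreover have "fall K (T - unitm i) = (\<Prod>l<T i - 1. K i - l) * R"
    by (subst split) (auto simp: unitm_def)
  ultimately show ?thesis
    unfolding fall_one_coordinate by (simp add: algebra_simps)
qed

definition wick_coeff :: "real \<Rightarrow> 'n::finite option mindex \<Rightarrow> 'n option mindex \<Rightarrow> 'n option mindex \<Rightarrow> complex"
  where "wick_coeff h K L' T = of_real (2 * h) ^ mdeg T * sgm T / of_nat (mfact T) * of_nat (fall K T * fall L' T)"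

text \<open>The value at \<open>z\<close> of the image under \<open>S_op\<close> of the Wick product of two monomials. The factor
  \<open>fall K T\<close> vanishes unless \<open>T \<le> K\<close>; summing over all \<open>T \<le> L'\<close> keeps the index set fixed when \<open>K\<close> is
  shifted.\<close>

definition wick_mode :: "real \<Rightarrow> 'n::finite point \<Rightarrow> 'n option mindex \<Rightarrow> 'n option mindex \<Rightarrow>
    'n option mindex \<Rightarrow> 'n option mindex \<Rightarrow> complex"
  where "wick_mode h z K L K' L' =
    (\<Sum>T | T \<le> L'. wick_coeff h K L' T * e_mode h z (K - T + K') (L + L' - T))"

lemma wick_mode_eq_basis_prod:
  assumes h: "0 < h" and KL: "mdeg K = mdeg L" "mdeg K' = mdeg L'"
  shows "wick_mode h z K L K' L' = (of_real (2 * h) ^ mdeg K * of_nat (mfact K * mfact L))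
    * (of_real (2 * h) ^ mdeg K' * of_nat (mfact K' * mfact L'))
    * f_series h (basis_prod (tri K L) (tri K' L')) z"
proof -
  define k l where "k = tri K L" and "l = tri K' L'"
  have kl: "k \<in> triples" "l \<in> triples" using KL by (auto simp: k_def l_def tri_in_triples)
  have ex: "exK k = K" "exL k = L" "exK l = K'" "exL l = L'"
    using KL by (auto simp: k_def l_def ex_tri)
  define I where "I = {T. T \<le> K \<and> T \<le> L'}"
  define \<nu> :: complex where "\<nu> = (of_real (2 * h) ^ tdeg k * of_nat (kfact k)) * (of_real (2 * h) ^ tdeg l * of_nat (kfact l))"
  have "wick_mode h z K L K' L' = (\<Sum>T\<in>I. wick_coeff h K L' T * e_mode h z (K - T + K') (L + L' - T))"
    unfolding wick_mode_def I_def
    by (rule sum.mono_neutral_right)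
       (use fall_nonzero_iff[of K] in \<open>auto simp: finite_mindex_le wick_coeff_def\<close>)
  also have "\<dots> = (\<Sum>T\<in>I. \<nu> * (sfac k l T * f_fun h (stri k l T) z))"
  proof (rule sum.cong[OF refl])
    fix T assume "T \<in> I"
    then have T: "T \<le> exK k" "T \<le> exL l" by (auto simp: I_def ex)
    have deg: "mdeg (K - T + K') = mdeg (L + L' - T)"
      using stri_degrees(1,2)[OF kl T] by (simp add: ex)
    have s: "stri k l T = tri (K - T + K') (L + L' - T)" by (simp add: stri_def ex)
    have "e_mode h z (K - T + K') (L + L' - T)
        = (of_real (2 * h) ^ tdeg (stri k l T) * of_nat (kfact (stri k l T))) * f_fun h (stri k l T) z"
      unfolding e_mode_eq_f_fun[OF deg] s by (simp add: kfact_def ex_tri[OF deg])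
    then show "wick_coeff h K L' T * e_mode h z (K - T + K') (L + L' - T)
        = \<nu> * (sfac k l T * f_fun h (stri k l T) z)"
      using sfac_normalized[OF kl T h] unfolding ex wick_coeff_def \<nu>_def
      by (simp only: mult.assoc[symmetric])
  qed
  also have "\<dots> = \<nu> * f_series h (basis_prod k l) z"
  proof -
    have st: "stri k l T \<in> triples" if "T \<in> I" for T
      using that by (intro stri_in_triples kl) (auto simp: I_def ex)
    have "f_series h (basis_prod k l) z = (\<Sum>T\<in>I. sfac k l T * f_fun h (stri k l T) z)"
      unfolding basis_prod_def ex I_def[symmetric]
      by (subst bounded_functional_sum[OF bounded_functional_f_series[OF h]])
         (auto simp: st f_series_delta delta_in_coeff_space coeff_space_scale
            bounded_functional_scale[OF bounded_functional_f_series[OF h]] intro!: sum.cong)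
    then show ?thesis by (simp add: sum_distrib_left)
  qed
  finally show ?thesis
    by (simp add: \<nu>_def k_def l_def kfact_def ex_tri KL)
qed

text \<open>Here \<open>y\<close> itself is the image of a quadratic polynomial, and the Leibniz rule for the Wick
  product gives \<open>y \<star> e = (y - 2 h \<alpha>) e\<close> for \<open>e\<close> of degree \<open>\<alpha>\<close>; after quantization this becomes the pointwise
  product with \<open>y\<close>. The correction terms from differentiating \<open>y\<close> cancel against the change of the
  degree.\<close>

lemma wick_mode_shift:
  fixes K L K' L' :: "'n::finite option mindex"
  assumes h: "0 < h" and KL: "mdeg K' = mdeg L'"
  shows "(\<Sum>i\<in>UNIV. - gsgn i * wick_mode h z (K + unitm i) (L + unitm i) K' L')
    = (of_real (yfun z) + of_real (2 * h) * of_nat (mdeg K)) * wick_mode h z K L K' L'"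
proof -
  define E where "E T = e_mode h z (K - T + K') (L + L' - T)" for T
  define A where "A T = wick_coeff h K L' T" for T
  define p where "p T = of_real (2 * h) ^ mdeg T * sgm T / (of_nat (mfact T) :: complex)" for T :: "'n option mindex"
  define X where "X i T = p T * of_nat (fall K T * fall L' T)
      * e_mode h z (K + unitm i - T + K') (L + unitm i + L' - T)" for i T
  define Y where "Y i T = p T * of_nat (T i * fall K (T - unitm i) * fall L' T)
      * e_mode h z (K + unitm i - T + K') (L + unitm i + L' - T)" for i T
  have "wick_mode h z (K + unitm i) (L + unitm i) K' L' = (\<Sum>T | T \<le> L'. X i T) + (\<Sum>T | T \<le> L'. Y i T)" for i
    unfolding wick_mode_def wick_coeff_def fall_add_unitm sum.distrib[symmetric] X_def Y_def p_def
    by (intro sum.cong refl) (simp add: algebra_simps)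
  then have "(\<Sum>i\<in>UNIV. - gsgn i * wick_mode h z (K + unitm i) (L + unitm i) K' L')
      = (\<Sum>i\<in>UNIV. \<Sum>T | T \<le> L'. - gsgn i * X i T) + (\<Sum>i\<in>UNIV. \<Sum>T | T \<le> L'. - gsgn i * Y i T)"
    by (simp add: distrib_left sum.distrib sum_distrib_left)
  also have "(\<Sum>i\<in>UNIV. \<Sum>T | T \<le> L'. - gsgn i * X i T)
      = (\<Sum>T | T \<le> L'. A T * ((of_real (yfun z) + of_real (2 * h) * (of_nat (mdeg K) + of_nat (mdeg K') - of_nat (mdeg T))) * E T))"
  proof (subst sum.swap, rule sum.cong[OF refl])
    fix T assume "T \<in> {T. T \<le> L'}"
    then have T: "T \<le> L'" by simp
    show "(\<Sum>i\<in>UNIV. - gsgn i * X i T)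
        = A T * ((of_real (yfun z) + of_real (2 * h) * (of_nat (mdeg K) + of_nat (mdeg K') - of_nat (mdeg T))) * E T)"
    proof (cases "T \<le> K")
      case True
      have 1: "K + unitm i - T + K' = (K - T + K') + unitm i" "L + unitm i + L' - T = (L + L' - T) + unitm i" for i
      proof -
        have le: "T j \<le> K j" "T j \<le> L' j" for j using True T by (auto simp: le_fun_def)
        show "K + unitm i - T + K' = (K - T + K') + unitm i"
        proof
          fix j
          show "(K + unitm i - T + K') j = ((K - T + K') + unitm i) j"
            using le(1)[of j] by simp
        qed
        show "L + unitm i + L' - T = (L + L' - T) + unitm i"
        proof
          fix j
          show "(L + unitm i + L' - T) j = ((L + L' - T) + unitm i) j"
            using le(2)[of j] by simp
        qed
      qed
      have "(\<Sum>i\<in>UNIV. - gsgn i * X i T)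
          = A T * (\<Sum>i\<in>UNIV. - gsgn i * e_mode h z ((K - T + K') + unitm i) ((L + L' - T) + unitm i))"
        unfolding X_def 1 sum_distrib_left by (intro sum.cong refl) (simp add: A_def wick_coeff_def p_def mult_ac)
      also have "\<dots> = A T * ((of_real (yfun z) + of_real (2 * h) * of_nat (mdeg (K - T + K'))) * E T)"
        unfolding e_mode_shift[OF h] E_def ..
      also have "(of_nat (mdeg (K - T + K')) :: complex) = of_nat (mdeg K) + of_nat (mdeg K') - of_nat (mdeg T)"
        using mdeg_mono[OF True] by (simp add: mdeg_add mdeg_diff[OF True] of_nat_diff)
      finally show ?thesis .
    next
      case False
      then have "fall K T = 0" using fall_nonzero_iff by blast
      then show ?thesis by (simp add: X_def A_def wick_coeff_def)
    qed
  qed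
  also have "(\<Sum>i\<in>UNIV. \<Sum>T | T \<le> L'. - gsgn i * Y i T)
      = (\<Sum>T | T \<le> L'. - of_real (2 * h) * A T * (of_nat (mdeg K') - of_nat (mdeg T)) * E T)"
  proof -
    have Yi: "(\<Sum>T | T \<le> L'. - gsgn i * Y i T)
        = (\<Sum>T | T \<le> L'. - of_real (2 * h) * A T * of_nat (L' i - T i) * E T)" for i
    proof -
      define G where "G = {T. T + unitm i \<le> L'}"
      have G: "finite G"
        unfolding G_def
        by (rule finite_subset[OF _ finite_mindex_le[of L']]) (auto simp: le_fun_def intro: add_leD1)
      have inj: "inj_on (\<lambda>T. T + unitm i) G" by (auto intro: inj_onI)
      have "(\<Sum>T | T \<le> L'. - gsgn i * Y i T) = (\<Sum>T\<in>(\<lambda>T. T + unitm i) ` G. - gsgn i * Y i T)"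
      proof (rule sum.mono_neutral_right[OF finite_mindex_le])
        show "\<forall>T\<in>{T. T \<le> L'} - (\<lambda>T. T + unitm i) ` G. - gsgn i * Y i T = 0"
        proof
          fix T assume T: "T \<in> {T. T \<le> L'} - (\<lambda>T. T + unitm i) ` G"
          have "T i = 0"
          proof (rule ccontr)
            assume "T i \<noteq> 0"
            then have "T = (T - unitm i) + unitm i" by (auto simp: fun_eq_iff unitm_def)
            moreover from this T have "T - unitm i \<in> G" by (simp add: G_def)
            ultimately show False using T by blast
          qed
          then show "- gsgn i * Y i T = 0" by (simp add: Y_def)
        qed
      qed (auto simp: G_def)
      also have "\<dots> = (\<Sum>T\<in>G. - gsgn i * Y i (T + unitm i))"
        by (simp add: sum.reindex[OF inj])
      also have "\<dots> = (\<Sum>T\<in>G. - of_real (2 * h) * A T * of_nat (L' i - T i) * E T)"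
      proof (rule sum.cong[OF refl])
        fix T
        have 1: "K + unitm i - (T + unitm i) + K' = K - T + K'" "L + unitm i + L' - (T + unitm i) = L + L' - T"
          "T + unitm i - unitm i = T" "(T + unitm i) i = T i + 1"
          by (auto simp: fun_eq_iff unitm_def)
        have g: "gsgn i * gsgn i = 1" by (simp add: gsgn_def)
        define a where "a = (of_nat (T i + 1) :: complex)"
        have a: "a \<noteq> 0" unfolding a_def of_nat_eq_0_iff by simp
        have "Y i (T + unitm i) = (of_real (2 * h) ^ mdeg T * of_real (2 * h)) * (gsgn i * sgm T)
            / (of_nat (mfact T) * a) * (a * of_nat (fall K T) * (of_nat (fall L' T) * of_nat (L' i - T i))) * E T"
          unfolding Y_def p_def 1 fall_unitm sgm_unitm mfact_unitm mdeg_add mdeg_unitm E_def a_def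
          by (simp only: of_nat_mult power_add power_one_right)
        also have "\<dots> = gsgn i * (of_real (2 * h) * A T * of_nat (L' i - T i) * E T)"
          using a by (simp add: A_def wick_coeff_def)
        finally show "- gsgn i * Y i (T + unitm i) = - of_real (2 * h) * A T * of_nat (L' i - T i) * E T"
          using g by (simp flip: mult.assoc)
      qed
      also have "\<dots> = (\<Sum>T | T \<le> L'. - of_real (2 * h) * A T * of_nat (L' i - T i) * E T)"
      proof (rule sum.mono_neutral_left[OF finite_mindex_le])
        show "G \<subseteq> {T. T \<le> L'}" by (auto simp: G_def le_fun_def intro: add_leD1)
        show "\<forall>T\<in>{T. T \<le> L'} - G. - of_real (2 * h) * A T * of_nat (L' i - T i) * E T = 0"
        proof
          fix T assume T: "T \<in> {T. T \<le> L'} - G"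
          then obtain j where "\<not> (T + unitm i) j \<le> L' j" by (auto simp: G_def le_fun_def)
          moreover have "T j \<le> L' j" using T by (auto simp: le_fun_def)
          ultimately have "L' i - T i = 0" by (auto simp: unitm_def split: if_splits)
          then show "- of_real (2 * h) * A T * of_nat (L' i - T i) * E T = 0" by simp
        qed
      qed
      finally show ?thesis .
    qed
    have deg: "(\<Sum>i\<in>UNIV. of_nat (L' i - T i)) = (of_nat (mdeg K') - of_nat (mdeg T) :: complex)" if T: "T \<le> L'" for T
    proof -
      have "(\<Sum>i\<in>UNIV. of_nat (L' i - T i)) = (of_nat (mdeg (L' - T)) :: complex)"
        by (simp add: mdeg_def)
      also have "\<dots> = of_nat (mdeg K') - of_nat (mdeg T)"
        using mdeg_mono[OF T] by (simp add: mdeg_diff[OF T] KL of_nat_diff)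
      finally show ?thesis .
    qed
    show ?thesis
      unfolding Yi
    proof (subst sum.swap, rule sum.cong[OF refl])
      fix T assume "T \<in> {T. T \<le> L'}"
      then have T: "T \<le> L'" by simp
      show "(\<Sum>i\<in>UNIV. - of_real (2 * h) * A T * of_nat (L' i - T i) * E T)
          = - of_real (2 * h) * A T * (of_nat (mdeg K') - of_nat (mdeg T)) * E T"
        unfolding deg[OF T, symmetric] sum_distrib_left sum_distrib_right ..
    qed
  qed
  also have "(\<Sum>T | T \<le> L'. A T * ((of_real (yfun z) + of_real (2 * h) * (of_nat (mdeg K) + of_nat (mdeg K') - of_nat (mdeg T))) * E T))
      + (\<Sum>T | T \<le> L'. - of_real (2 * h) * A T * (of_nat (mdeg K') - of_nat (mdeg T)) * E T)
      = (\<Sum>T | T \<le> L'. (of_real (yfun z) + of_real (2 * h) * of_nat (mdeg K)) * (A T * E T))"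
    unfolding sum.distrib[symmetric] by (intro sum.cong refl) (simp add: algebra_simps)
  also have "\<dots> = (of_real (yfun z) + of_real (2 * h) * of_nat (mdeg K)) * wick_mode h z K L K' L'"
    by (simp add: wick_mode_def A_def E_def sum_distrib_left)
  finally show ?thesis .
qed


section \<open>Reduction on the level set\<close>

text \<open>The coefficients in the expansion of \<open>(1 + \<Sum>i s i) ^ q\<close>.\<close>

primrec level_coeff :: "nat \<Rightarrow> 'n::finite mindex \<Rightarrow> nat" where
  "level_coeff 0 R = (if R = 0 then 1 else 0)"
| "level_coeff (Suc q) R = level_coeff q R + (\<Sum>i\<in>UNIV. if 0 < R i then level_coeff q (R - unitm i) else 0)"

lemma mindex_minus_unitm: "0 < R i \<Longrightarrow> (R - unitm i) + unitm i = R"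
  by (auto simp: fun_eq_iff unitm_def)

lemma level_coeff_zero: "q < mdeg R \<Longrightarrow> level_coeff q R = 0"
proof (induction q arbitrary: R)
  case (Suc q)
  have "level_coeff q (R - unitm i) = 0" if "0 < R i" for i
  proof (rule Suc.IH)
    have "mdeg R = mdeg ((R - unitm i) + unitm i)" by (simp only: mindex_minus_unitm[of R i, OF that])
    then show "q < mdeg (R - unitm i)" using Suc.prems by (simp only: mdeg_add mdeg_unitm)
  qed
  then show ?case using Suc by simp
qed (auto simp: mdeg_eq_0_iff)

lemma level_coeff_at_zero: "level_coeff q 0 = 1"
  by (induction q) (simp_all add: fun_eq_iff)

lemma level_coeff_le: "level_coeff q (R :: 'n::finite mindex) \<le> CARD('n option) ^ q"
proof (induction q arbitrary: R)
  case (Suc q)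
  have "level_coeff (Suc q) R \<le> CARD('n option) ^ q + (\<Sum>i\<in>(UNIV :: 'n set). CARD('n option) ^ q)"
  proof -
    have "(if 0 < R i then level_coeff q (R - unitm i) else 0) \<le> CARD('n option) ^ q" for i
      using Suc.IH[of "R - unitm i"] by (cases "0 < R i") (simp_all only: if_True if_False zero_le)
    then show ?thesis
      unfolding level_coeff.simps by (intro add_mono sum_mono Suc.IH)
  qed
  also have "\<dots> = CARD('n option) ^ Suc q" by (simp add: card_UNIV_option)
  finally show ?case .
qed simp

lemma level_coeff_sum:
  fixes s :: "'n::finite \<Rightarrow> complex"
  shows "(1 + (\<Sum>i\<in>UNIV. s i)) ^ q = (\<Sum>R | mdeg R \<le> q. of_nat (level_coeff q R) * (\<Prod>i\<in>UNIV. s i ^ R i))"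
proof (induction q)
  case 0
  have "{R :: 'n mindex. mdeg R \<le> 0} = {0}" by (auto simp: mdeg_eq_0_iff)
  then show ?case by (simp add: fun_eq_iff)
next
  case (Suc q)
  define m where "m R = (\<Prod>i\<in>UNIV. s i ^ R i)" for R :: "'n mindex"
  have m_unitm: "m (R + unitm i) = s i * m R" for R i
  proof -
    have "m (R + unitm i) = (\<Prod>j\<in>UNIV. s j ^ R j * (if j = i then s i else 1))"
      unfolding m_def by (rule prod.cong) (auto simp: unitm_def)
    then show ?thesis by (simp add: prod.distrib m_def)
  qed
  have shift: "s i * (\<Sum>R | mdeg R \<le> q. of_nat (level_coeff q R) * m R)
      = (\<Sum>R | mdeg R \<le> Suc q. of_nat (if 0 < R i then level_coeff q (R - unitm i) else 0) * m R)" for i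
  proof -
    have inj: "inj_on (\<lambda>R. R + unitm i) {R. mdeg R \<le> q}" by (auto intro: inj_onI)
    have "(\<Sum>R | mdeg R \<le> Suc q. of_nat (if 0 < R i then level_coeff q (R - unitm i) else 0) * m R)
        = (\<Sum>R\<in>(\<lambda>R. R + unitm i) ` {R. mdeg R \<le> q}. of_nat (if 0 < R i then level_coeff q (R - unitm i) else 0) * m R)"
    proof (rule sum.mono_neutral_right[OF finite_mdeg_le])
      show "\<forall>R\<in>{R. mdeg R \<le> Suc q} - (\<lambda>R. R + unitm i) ` {R. mdeg R \<le> q}.
          of_nat (if 0 < R i then level_coeff q (R - unitm i) else 0) * m R = 0"
      proof
        fix R assume R: "R \<in> {R. mdeg R \<le> Suc q} - (\<lambda>R. R + unitm i) ` {R. mdeg R \<le> q}"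
        have "\<not> 0 < R i"
        proof
          assume pos: "0 < R i"
          have "mdeg R = mdeg (R - unitm i) + 1"
            using mindex_minus_unitm[of R i, OF pos] by (metis mdeg_add mdeg_unitm)
          then have "R - unitm i \<in> {R. mdeg R \<le> q}" using R by simp
          then show False using R mindex_minus_unitm[of R i, OF pos] by (metis DiffD2 image_eqI)
        qed
        then show "of_nat (if 0 < R i then level_coeff q (R - unitm i) else 0) * m R = 0" by simp
      qed
    qed (auto simp: mdeg_add)
    also have "\<dots> = (\<Sum>R | mdeg R \<le> q. of_nat (level_coeff q R) * m (R + unitm i))"
    proof -
      have e: "R + unitm i - unitm i = R" "0 < (R + unitm i) i" for R :: "'n mindex"
        by (auto simp: fun_eq_iff unitm_def)
      show ?thesis
        unfolding sum.reindex[OF inj] o_def by (intro sum.cong refl) (simp only: e if_True)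
    qed
    finally show ?thesis by (simp add: m_unitm sum_distrib_left mult_ac)
  qed
  have "(\<Sum>R | mdeg R \<le> q. of_nat (level_coeff q R) * m R) = (\<Sum>R | mdeg R \<le> Suc q. of_nat (level_coeff q R) * m R)"
    by (rule sum.mono_neutral_left[OF finite_mdeg_le]) (auto simp: level_coeff_zero not_le)
  moreover have "(\<Sum>i\<in>UNIV. s i * (\<Sum>R | mdeg R \<le> q. of_nat (level_coeff q R) * m R))
      = (\<Sum>R | mdeg R \<le> Suc q. of_nat (\<Sum>i\<in>UNIV. if 0 < R i then level_coeff q (R - unitm i) else 0) * m R)"
    unfolding shift by (subst sum.swap) (simp only: of_nat_sum sum_distrib_right)
  ultimately have "(1 + (\<Sum>i\<in>UNIV. s i)) * (\<Sum>R | mdeg R \<le> q. of_nat (level_coeff q R) * m R)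
      = (\<Sum>R | mdeg R \<le> Suc q. of_nat (level_coeff (Suc q) R) * m R)"
    by (simp only: distrib_right mult_1_left sum_distrib_right of_nat_add level_coeff.simps sum.distrib)
  then show ?case using Suc.IH by (simp add: m_def)
qed

definition mmax :: "'n::finite triple \<Rightarrow> nat"
  where "mmax k = max (mdeg (fst k)) (mdeg (fst (snd k)))"

definition mtri :: "'n::finite mindex \<Rightarrow> 'n mindex \<Rightarrow> 'n triple"
  where "mtri P Q = (P, Q, max (mdeg P) (mdeg Q))"

definition reduced_triples :: "'n::finite triple set"
  where "reduced_triples = range (\<lambda>(P, Q). mtri P Q)"

lemma reduced_iff: "k \<in> reduced_triples \<longleftrightarrow> tdeg k = mmax k"
  by (cases k) (auto simp: reduced_triples_def mtri_def mmax_def)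

lemma mtri_simps [simp]: "mtri P Q \<in> reduced_triples" "mtri P Q \<in> triples" "tdeg (mtri P Q) = max (mdeg P) (mdeg Q)"
  by (auto simp: reduced_triples_def mtri_def triples_def)

lemma mtri_inject [simp]: "mtri P Q = mtri P' Q' \<longleftrightarrow> P = P' \<and> Q = Q'"
  by (auto simp: mtri_def)

lemma reduced_in_triples: "reduced_triples \<subseteq> triples"
  by (auto simp: reduced_triples_def)

lemma mmax_le: "k \<in> triples \<Longrightarrow> mmax k \<le> tdeg k"
  by (cases k) (auto simp: mmax_def triples_def)

definition lift_triple :: "'n::finite triple \<Rightarrow> 'n mindex \<Rightarrow> 'n triple"
  where "lift_triple k R = mtri (fst k + R) (fst (snd k) + R)"

lemma tdeg_lift: "tdeg (lift_triple k R) = mmax k + mdeg R"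
  by (auto simp: lift_triple_def mmax_def mdeg_add)

lemma lift_simps [simp]: "lift_triple k R \<in> reduced_triples" "lift_triple k R \<in> triples"
  by (auto simp: lift_triple_def)

lemma lift_inject: "lift_triple k R = lift_triple k R' \<longleftrightarrow> R = R'"
  by (auto simp: lift_triple_def)

text \<open>Where \<open>yfun w = 1\<close>, the product of the coordinate \<open>0\<close> and its conjugate is \<open>1 + \<Sum>i |w i|\<^sup>2\<close>, so
  every common power of these two coordinates can be expanded.\<close>

lemma e_fun_level:
  assumes k: "k \<in> triples" and w: "yfun w = 1"
  shows "e_fun k w = (\<Sum>R | mdeg R \<le> tdeg k - mmax k.
    of_nat (level_coeff (tdeg k - mmax k) R) * e_fun (lift_triple k R) w)"
proof -
  obtain P Q \<alpha> where [simp]: "k = (P, Q, \<alpha>)" by (cases k)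
  define m where "m = mmax k"
  define q where "q = \<alpha> - m"
  have le: "mdeg P \<le> m" "mdeg Q \<le> m" "m \<le> \<alpha>" using k by (auto simp: triples_def m_def mmax_def)
  define a b where "a = w $ None" and "b = cnj (w $ None)"
  define A where "A = (\<Prod>i\<in>UNIV. (w $ Some i) ^ P i) * (\<Prod>i\<in>UNIV. cnj (w $ Some i) ^ Q i)"
  define s where "s i = w $ Some i * cnj (w $ Some i)" for i
  have ab: "a * b = 1 + (\<Sum>i\<in>UNIV. s i)"
  proof -
    have "complex_of_real (yfun w) = a * b - (\<Sum>i\<in>UNIV. s i)"
      by (simp add: yfun_def a_def b_def s_def flip: complex_norm_square)
    then show ?thesis using w by (simp add: algebra_simps)
  qed
  have "e_fun k w = a ^ (\<alpha> - mdeg P) * b ^ (\<alpha> - mdeg Q) * A"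
    by (simp add: e_fun_def A_def a_def b_def)
  also have "a ^ (\<alpha> - mdeg P) = a ^ q * a ^ (m - mdeg P)"
    using le by (simp add: q_def flip: power_add)
  also have "b ^ (\<alpha> - mdeg Q) = b ^ q * b ^ (m - mdeg Q)"
    using le by (simp add: q_def flip: power_add)
  also have "a ^ q * a ^ (m - mdeg P) * (b ^ q * b ^ (m - mdeg Q)) * A
      = (a * b) ^ q * (a ^ (m - mdeg P) * b ^ (m - mdeg Q) * A)"
    by (simp add: power_mult_distrib)
  also have "\<dots> = (\<Sum>R | mdeg R \<le> q. of_nat (level_coeff q R) * e_fun (lift_triple k R) w)"
    unfolding ab level_coeff_sum sum_distrib_right
  proof (rule sum.cong[OF refl])
    fix R :: "'a mindex"
    have t: "lift_triple k R = (P + R, Q + R, m + mdeg R)"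
      by (auto simp: lift_triple_def mtri_def m_def mmax_def mdeg_add)
    have "e_fun (lift_triple k R) w = a ^ (m - mdeg P) * b ^ (m - mdeg Q) * A * (\<Prod>i\<in>UNIV. s i ^ R i)"
      unfolding t e_fun_def
      by (simp add: mdeg_add power_add prod.distrib A_def a_def b_def s_def power_mult_distrib mult_ac)
    then show "of_nat (level_coeff q R) * (\<Prod>i\<in>UNIV. s i ^ R i) * (a ^ (m - mdeg P) * b ^ (m - mdeg Q) * A)
        = of_nat (level_coeff q R) * e_fun (lift_triple k R) w"
      by (simp add: mult_ac)
  qed
  finally show ?thesis by (simp add: q_def m_def)
qed

definition level_fac :: "real \<Rightarrow> 'n::finite triple \<Rightarrow> real"
  where "level_fac h k = pochhammer (1 / (2 * h)) (tdeg k) / real (kfact k)"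

lemma level_fac_pos: "0 < h \<Longrightarrow> 0 < level_fac h k"
  by (simp add: level_fac_def kfact_pos pochhammer_pos)

lemma f_fun_level_eq: "yfun w = 1 \<Longrightarrow> f_fun h k w = of_real (level_fac h k) * e_fun k w"
  by (simp add: f_fun_eq pos_cone_def level_fac_def)

text \<open>The expansion of \<open>f_fun h k\<close> on the level set; \<open>level_fac\<close> is the ratio between \<open>f_fun\<close> and \<open>e_fun\<close>
  there.\<close>

definition red_basis :: "real \<Rightarrow> 'n::finite triple \<Rightarrow> 'n triple \<Rightarrow> complex"
  where "red_basis h k = (\<Sum>R | mdeg R \<le> tdeg k - mmax k.
    of_real (real (level_coeff (tdeg k - mmax k) R) * level_fac h k / level_fac h (lift_triple k R))
      \<cdot>\<^sub>C delta (lift_triple k R))"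

definition Red :: "real \<Rightarrow> ('n::finite triple \<Rightarrow> complex) \<Rightarrow> 'n triple \<Rightarrow> complex"
  where "Red h c i = (\<Sum>\<^sub>\<infinity>k\<in>triples. c k * red_basis h k i)"

lemma red_basis_lift:
  "mdeg R \<le> tdeg k - mmax k \<Longrightarrow> red_basis h k (lift_triple k R)
    = of_real (real (level_coeff (tdeg k - mmax k) R) * level_fac h k / level_fac h (lift_triple k R))"
  by (simp add: red_basis_def sum_fun_apply delta_def lift_inject finite_mdeg_le if_distrib cong: if_cong)

lemma red_basis_nonzero:
  assumes "red_basis h k i \<noteq> 0"
  obtains R where "mdeg R \<le> tdeg k - mmax k" "i = lift_triple k R"
proof -
  from assms obtain R where "R \<in> {R. mdeg R \<le> tdeg k - mmax k}" "delta (lift_triple k R) i \<noteq> 0"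
    unfolding red_basis_def sum_fun_apply by (auto elim!: sum.not_neutral_contains_not_neutral)
  then show ?thesis using that by (auto simp: delta_def split: if_splits)
qed

lemma level_fac_upper:
  assumes h: "0 < h" and k: "k \<in> (triples :: 'n::finite triple set)"
  shows "level_fac h k \<le> ((1 / (2 * h) + 1) * (real CARD('n option))\<^sup>2) ^ tdeg k / fact (tdeg k)"
proof -
  define \<alpha> N where "\<alpha> = tdeg k" and "N = real CARD('n option)"
  have *: "1 / real (mfact K) \<le> N ^ \<alpha> / fact \<alpha>" if "mdeg K = \<alpha>" for K :: "'n option mindex"
  proof -
    have "real (fact (mdeg K)) \<le> real (CARD('n option) ^ mdeg K * mfact K)"
      using fact_mdeg_le[of K] by (simp only: of_nat_le_iff)
    then show ?thesis using mfact_pos[of K] that by (simp add: N_def field_simps)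
  qed
  have "level_fac h k = pochhammer (1 / (2 * h)) \<alpha> * ((1 / real (mfact (exK k))) * (1 / real (mfact (exL k))))"
    by (simp add: level_fac_def kfact_def \<alpha>_def)
  also have "\<dots> \<le> ((1 / (2 * h) + 1) ^ \<alpha> * fact \<alpha>) * ((N ^ \<alpha> / fact \<alpha>) * (N ^ \<alpha> / fact \<alpha>))"
    using h mdeg_ex[OF k]
    by (intro mult_mono * mult_nonneg_nonneg pochhammer_upper) (auto simp: \<alpha>_def N_def)
  also have "\<dots> = ((1 / (2 * h) + 1) * N\<^sup>2) ^ \<alpha> / fact \<alpha>"
    by (simp add: power_mult_distrib power2_eq_square)
  finally show ?thesis by (simp add: \<alpha>_def N_def)
qed

lemma level_fac_lower:
  assumes h: "0 < h" and k: "k \<in> (triples :: 'n::finite triple set)"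
  shows "1 / level_fac h k \<le> (1 / min (1 / (2 * h)) 1) ^ tdeg k * fact (tdeg k)"
proof -
  define \<alpha> a where "\<alpha> = tdeg k" and "a = min (1 / (2 * h)) 1"
  have a: "0 < a" using h by (simp add: a_def)
  have "mfact (exK k) * mfact (exL k) \<le> fact \<alpha> * fact \<alpha>"
    using mfact_le[of "exK k"] mfact_le[of "exL k"] mdeg_ex[OF k] by (intro mult_mono) (auto simp: \<alpha>_def)
  then have 1: "real (kfact k) \<le> fact \<alpha> * fact \<alpha>"
    unfolding kfact_def by (metis of_nat_fact of_nat_le_iff of_nat_mult)
  have 2: "a ^ \<alpha> * fact \<alpha> \<le> pochhammer (1 / (2 * h)) \<alpha>"
    unfolding a_def by (rule pochhammer_lower) (use h in simp)
  have "1 / level_fac h k = real (kfact k) / pochhammer (1 / (2 * h)) \<alpha>"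
    by (simp add: level_fac_def \<alpha>_def)
  also have "\<dots> \<le> (fact \<alpha> * fact \<alpha>) / (a ^ \<alpha> * fact \<alpha>)"
    by (rule frac_le) (use 1 2 a in auto)
  also have "\<dots> = (1 / a) ^ \<alpha> * fact \<alpha>"
    using a by (simp add: power_one_over field_simps)
  finally show ?thesis by (simp add: \<alpha>_def a_def)
qed

lemma red_basis_bound:
  assumes h: "0 < h"
  obtains D where "0 \<le> D"
    "\<And>k i. k \<in> (triples :: 'n::finite triple set) \<Longrightarrow> red_basis h k i \<noteq> 0 \<Longrightarrow> tdeg i \<le> tdeg k"
    "\<And>k i. k \<in> (triples :: 'n triple set) \<Longrightarrow>
      cmod (red_basis h k i) \<le> D ^ tdeg k * (fact (tdeg i) / fact (tdeg k))"
proof -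
  define N where "N = real CARD('n option)"
  define A where "A = (1 / (2 * h) + 1) * N\<^sup>2"
  define a where "a = 1 / min (1 / (2 * h)) 1"
  have a: "1 \<le> a" using h by (simp add: a_def min_def)
  have A: "0 \<le> A" and N: "1 \<le> N" using h by (auto simp: A_def N_def card_UNIV_option)
  have main: "tdeg i \<le> tdeg k \<and> cmod (red_basis h k i) \<le> (N * A * a) ^ tdeg k * (fact (tdeg i) / fact (tdeg k))"
    if k: "k \<in> triples" and nz: "red_basis h k i \<noteq> 0" for k i :: "'n triple"
  proof -
    obtain R where R: "mdeg R \<le> tdeg k - mmax k" "i = lift_triple k R" by (rule red_basis_nonzero[OF nz])
    have le: "tdeg i \<le> tdeg k" using R(1) mmax_le[OF k] by (simp add: R(2) tdeg_lift)
    have i: "i \<in> triples" using R(2) by simp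
    have "cmod (red_basis h k i) = real (level_coeff (tdeg k - mmax k) R) * (level_fac h k * (1 / level_fac h i))"
      unfolding R(2) red_basis_lift[OF R(1)]
      by (simp add: norm_mult norm_divide abs_of_pos[OF level_fac_pos[OF h]])
    also have "\<dots> \<le> N ^ tdeg k * ((A ^ tdeg k / fact (tdeg k)) * (a ^ tdeg k * fact (tdeg i)))"
    proof (intro mult_mono mult_nonneg_nonneg)
      have "real (level_coeff (tdeg k - mmax k) R) \<le> real (CARD('n option) ^ (tdeg k - mmax k))"
        using level_coeff_le by (simp only: of_nat_le_iff)
      also have "\<dots> \<le> N ^ tdeg k"
        unfolding N_def of_nat_power by (intro power_increasing) (use N in \<open>auto simp: N_def\<close>)
      finally show "real (level_coeff (tdeg k - mmax k) R) \<le> N ^ tdeg k" .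
      show "level_fac h k \<le> A ^ tdeg k / fact (tdeg k)"
        unfolding A_def N_def by (rule level_fac_upper[OF h k])
      have "1 / level_fac h i \<le> a ^ tdeg i * fact (tdeg i)"
        unfolding a_def by (rule level_fac_lower[OF h i])
      also have "\<dots> \<le> a ^ tdeg k * fact (tdeg i)"
        by (intro mult_right_mono power_increasing le a) auto
      finally show "1 / level_fac h i \<le> a ^ tdeg k * fact (tdeg i)" .
    qed (use less_imp_le[OF level_fac_pos[OF h]] A a N in \<open>simp_all del: split_paired_All\<close>)
    also have "\<dots> = (N * A * a) ^ tdeg k * (fact (tdeg i) / fact (tdeg k))"
      by (simp add: power_mult_distrib)
    finally show ?thesis using le by blast
  qed
  show ?thesis
  proof (rule that[of "N * A * a"])
    show "0 \<le> N * A * a" using N A a by simp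
    fix k i :: "'n triple" assume k: "k \<in> triples"
    show "tdeg i \<le> tdeg k" if "red_basis h k i \<noteq> 0" using main[OF k that] by blast
    show "cmod (red_basis h k i) \<le> (N * A * a) ^ tdeg k * (fact (tdeg i) / fact (tdeg k))"
      using main[OF k, of i] N A a by (cases "red_basis h k i = 0") auto
  qed
qed

text \<open>A matrix entry from degree \<open>\<alpha>\<close> to degree \<open>m \<le> \<alpha>\<close> is at most \<open>m!/\<alpha>!\<close> up to an exponential factor.
  Since \<open>m!/\<alpha>! \<le> (m!/\<alpha>!) powr \<epsilon>\<close>, this beats coefficients growing like \<open>(\<alpha>!) powr (\<epsilon>/2)\<close>.\<close>

lemma Red_kernel_bound:
  assumes h: "0 < h"
  obtains D where "0 \<le> D"
    "\<And>k i \<epsilon>. k \<in> (triples :: 'n::finite triple set) \<Longrightarrow> 0 < \<epsilon> \<Longrightarrow> \<epsilon> < 1 \<Longrightarrow>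
      cmod (red_basis h k i) \<le> (fact (tdeg i)) powr \<epsilon> * (D ^ tdeg k / (fact (tdeg k)) powr \<epsilon>)"
proof -
  obtain D where D: "0 \<le> D"
    "\<And>k i. k \<in> (triples :: 'n triple set) \<Longrightarrow> red_basis h k i \<noteq> 0 \<Longrightarrow> tdeg i \<le> tdeg k"
    "\<And>k i. k \<in> (triples :: 'n triple set) \<Longrightarrow>
      cmod (red_basis h k i) \<le> D ^ tdeg k * (fact (tdeg i) / fact (tdeg k))"
    by (rule red_basis_bound[OF h]) blast
  show ?thesis
  proof (rule that[OF D(1)])
    fix k i :: "'n triple" and \<epsilon> :: real assume k: "k \<in> triples" and e: "0 < \<epsilon>" "\<epsilon> < 1"
    show "cmod (red_basis h k i) \<le> (fact (tdeg i)) powr \<epsilon> * (D ^ tdeg k / (fact (tdeg k)) powr \<epsilon>)"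
    proof (cases "red_basis h k i = 0")
      case False
      define x where "x = (fact (tdeg i) / fact (tdeg k) :: real)"
      have x: "0 < x" "x \<le> 1"
        using fact_mono[OF D(2)[OF k False], where ?'a = real] by (auto simp: x_def)
      have "x powr 1 \<le> x powr \<epsilon>" by (rule powr_mono') (use x e in auto)
      then have "D ^ tdeg k * x \<le> D ^ tdeg k * (x powr \<epsilon>)"
        using x D(1) by (intro mult_left_mono) auto
      also have "x powr \<epsilon> = (fact (tdeg i)) powr \<epsilon> / (fact (tdeg k)) powr \<epsilon>"
        by (simp add: x_def powr_divide)
      finally show ?thesis using D(3)[OF k, of i] by (simp add: x_def mult.commute)
    qed (use D(1) in simp)
  qed
qed

lemma Red_delta: "k \<in> triples \<Longrightarrow> Red h (delta k) = red_basis h k"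
  by (simp add: fun_eq_iff Red_def kernel_sum_delta)

lemma Red_zero:
  assumes "i \<notin> reduced_triples"
  shows "Red h c i = 0"
proof -
  have "red_basis h k i = 0" for k
    using assms red_basis_nonzero[of h k i] by fastforce
  then show ?thesis by (simp add: Red_def)
qed

lemma bounded_operator_Red:
  assumes h: "0 < h"
  shows "bounded_operator (Red h :: ('n::finite triple \<Rightarrow> complex) \<Rightarrow> _)"
proof -
  obtain D where D: "0 \<le> D"
    "\<And>k i \<epsilon>. k \<in> (triples :: 'n triple set) \<Longrightarrow> 0 < \<epsilon> \<Longrightarrow> \<epsilon> < 1 \<Longrightarrow>
      cmod (red_basis h k i) \<le> (fact (tdeg i)) powr \<epsilon> * (D ^ tdeg k / (fact (tdeg k)) powr \<epsilon>)"
    by (rule Red_kernel_bound[OF h]) blast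
  show ?thesis
  proof (rule bounded_operatorI)
    have half: "cmod (red_basis h k i) \<le> (fact (tdeg i)) powr (1/2) * (D ^ tdeg k / (fact (tdeg k)) powr (1/2))"
      if "k \<in> triples" for k i :: "'n triple" using D(2)[OF that, of "1/2" i] by simp
    show "linear_on_coeffs (Red h :: ('n triple \<Rightarrow> complex) \<Rightarrow> _)"
      unfolding linear_on_coeffs_def
    proof (intro conjI ballI allI ext)
      fix c d :: "'n triple \<Rightarrow> complex" and i assume "c \<in> coeff_space" "d \<in> coeff_space"
      then show "Red h (c + d) i = (Red h c + Red h d) i"
        using kernel_sum_linear(1)[OF _ _ D(1) half, of i c d] by (simp add: Red_def)
    next
      fix s and c :: "'n triple \<Rightarrow> complex" and i
      show "Red h (s \<cdot>\<^sub>C c) i = (s \<cdot>\<^sub>C Red h c) i"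
        using kernel_sum_linear(2)[OF _ _ D(1) half, of i s c] by (simp add: Red_def)
    qed
  next
    fix \<epsilon> :: real assume e: "0 < \<epsilon>" "\<epsilon> < 1"
    define S where "S = (\<Sum>\<^sub>\<infinity>k\<in>(triples :: 'n triple set). D ^ tdeg k / (fact (tdeg k)) powr (\<epsilon> - \<epsilon>/2))"
    have S: "0 \<le> S" unfolding S_def using D(1) by (intro infsum_nonneg) auto
    have "cmod (Red h c i) \<le> S * pn (\<epsilon>/2) c * (fact (tdeg i)) powr \<epsilon>"
      if "c \<in> coeff_space" for c :: "'n triple \<Rightarrow> complex" and i
      using kernel_sum(2)[OF that _ _ _ _ D(1) D(2)[OF _ e], of "\<epsilon>/2" i] e
      by (simp add: Red_def S_def mult_ac)
    then show "\<exists>\<epsilon>' B. 0 < \<epsilon>' \<and> \<epsilon>' < 1 \<and> 0 \<le> B \<and> (\<forall>c\<in>coeff_space. \<forall>k\<in>(triples :: 'n triple set).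
        cmod (Red h c k) \<le> B * pn \<epsilon>' c * (fact (tdeg k)) powr \<epsilon>)"
      using e S by (intro exI[of _ "\<epsilon>/2"] exI[of _ S]) auto
  next
    fix c and k :: "'n triple" assume "k \<notin> triples"
    then show "Red h c k = 0" using reduced_in_triples by (intro Red_zero) blast
  qed
qed

lemmas Red_in_coeff_space = bounded_operator_mem[OF bounded_operator_Red]

lemma f_series_red_basis:
  assumes h: "0 < h" and k: "k \<in> triples" and w: "yfun w = 1"
  shows "f_series h (red_basis h k) w = f_fun h k w"
proof -
  let ?I = "{R. mdeg R \<le> tdeg k - mmax k}"
  let ?q = "tdeg k - mmax k"
  have "f_series h (red_basis h k) w = (\<Sum>R\<in>?I. of_real (real (level_coeff ?q R) * level_fac h k / level_fac h (lift_triple k R))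
      * f_fun h (lift_triple k R) w)"
    unfolding red_basis_def
    by (subst bounded_functional_sum[OF bounded_functional_f_series[OF h]])
       (auto simp: f_series_delta delta_in_coeff_space coeff_space_scale
          bounded_functional_scale[OF bounded_functional_f_series[OF h]] intro!: sum.cong)
  also have "\<dots> = (\<Sum>R\<in>?I. of_real (level_fac h k) * (of_nat (level_coeff ?q R) * e_fun (lift_triple k R) w))"
  proof (rule sum.cong[OF refl])
    fix R
    show "of_real (real (level_coeff ?q R) * level_fac h k / level_fac h (lift_triple k R)) * f_fun h (lift_triple k R) w
        = of_real (level_fac h k) * (of_nat (level_coeff ?q R) * e_fun (lift_triple k R) w)"
      using level_fac_pos[OF h, of "lift_triple k R"] by (simp add: f_fun_level_eq[OF w])
  qed
  also have "\<dots> = of_real (level_fac h k) * e_fun k w"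
    unfolding e_fun_level[OF k w] sum_distrib_left ..
  finally show ?thesis by (simp add: f_fun_level_eq[OF w])
qed

lemma f_series_Red:
  assumes h: "0 < h" and c: "c \<in> coeff_space" and w: "yfun w = 1"
  shows "f_series h (Red h c) w = f_series h c w"
proof -
  have "bounded_functional (\<lambda>c. f_series h (Red h c) w - f_series h c w)"
    by (intro bounded_functional_minus bounded_functional_compose[OF _ bounded_operator_Red]
        bounded_functional_f_series h)
  from functional_vanishes_by_density[OF this _ c] show ?thesis
    by (simp add: Red_delta f_series_red_basis[OF h _ w] f_series_delta)
qed

text \<open>Near the point \<open>z = (1, 0)\<close> of the level set the terms of lowest total degree dominate.\<close>

lemma reduced_coefficients_unique:
  fixes c :: "'n::finite triple \<Rightarrow> complex"
  assumes h: "0 < h" and c: "c \<in> coeff_space" and red: "\<And>k. k \<notin> reduced_triples \<Longrightarrow> c k = 0"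
    and zero: "\<And>w. yfun w = 1 \<Longrightarrow> f_series h c w = 0"
  shows "c = 0"
proof (rule ccontr)
  assume "c \<noteq> 0"
  then obtain k1 where k1: "c k1 \<noteq> 0" by (auto simp: fun_eq_iff)
  define deg where "deg k = mdeg (fst k) + mdeg (fst (snd k))" for k :: "'n triple"
  define M where "M = (LEAST d. \<exists>k. c k \<noteq> 0 \<and> deg k = d)"
  have ex: "\<exists>k. c k \<noteq> 0 \<and> deg k = M"
    unfolding M_def by (rule LeastI[of _ "deg k1"]) (use k1 in blast)
  have min: "M \<le> deg k" if "c k \<noteq> 0" for k
    unfolding M_def by (rule Least_le) (use that in blast)
  define F where "F = {k \<in> reduced_triples. deg k = M}"
  have F: "finite F"
  proof (rule finite_subset[OF _ finite_triples_le[of M]])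
    show "F \<subseteq> {k \<in> triples. tdeg k \<le> M}"
      using reduced_in_triples by (auto simp: F_def reduced_iff mmax_def deg_def)
  qed
  define u where "u k = complex_of_real (level_fac h k)" for k :: "'n triple"
  define ex2 where "ex2 k = 2 * mmax k - deg k" for k :: "'n triple"
  have prod0: "c k * u k = 0" if kF: "k \<in> F" for k
  proof (rule monomials_independent[OF F zero_less_one, where K = fst and L = "\<lambda>k. fst (snd k)"
        and c = "\<lambda>k. c k * u k" and ?x0.0 = k])
    fix v :: "complex ^ 'n"
    define V where "V = (norm v)\<^sup>2"
    define s where "s t = sqrt (1 + t\<^sup>2 * V)" for t :: real
    \<comment> \<open>A curve on the level set that tends to \<open>(1, 0)\<close>; along it the term of \<open>k\<close> is of order
      \<open>t ^ deg k\<close>.\<close>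
    define w where "w t = (\<chi> i. case i of None \<Rightarrow> of_real (s t) | Some j \<Rightarrow> of_real t * v $ j)" for t
    define g where "g t k = c k * f_fun h k (w t)" for t k
    have V: "0 \<le> V" by (simp add: V_def)
    have s: "(s t)\<^sup>2 = 1 + t\<^sup>2 * V" "1 \<le> s t" for t using V by (auto simp: s_def)
    have y: "yfun (w t) = 1" for t
    proof -
      have "(cmod (of_real (s t)))\<^sup>2 = 1 + t\<^sup>2 * V" using s(1)[of t] by simp
      then show ?thesis
        by (simp add: yfun_def w_def norm_mult power_mult_distrib V_def norm_vec_sq sum_distrib_left)
    qed
    have gval: "g t k = (c k * u k * mon (fst k) (fst (snd k)) v) * of_real (s t ^ ex2 k) * of_real (t ^ deg k)"
      if kr: "k \<in> reduced_triples" for t k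
    proof -
      obtain P Q where [simp]: "k = mtri P Q" using kr by (auto simp: reduced_triples_def)
      define m where "m = max (mdeg P) (mdeg Q)"
      have e: "ex2 k = (m - mdeg P) + (m - mdeg Q)"
        by (auto simp: ex2_def mmax_def deg_def mtri_def m_def)
      have "e_fun k (w t) = of_real (s t) ^ (m - mdeg P) * of_real (s t) ^ (m - mdeg Q) * mon P Q (of_real t *s v)"
        by (simp add: mtri_def e_fun_def m_def mon_def prod.distrib w_def mult_ac)
      also have "\<dots> = mon P Q v * of_real (s t ^ ex2 k) * of_real (t ^ deg k)"
        unfolding mon_scale e by (simp add: power_add deg_def mtri_def)
      finally show ?thesis
        by (simp add: g_def f_fun_level_eq[OF y] u_def mtri_def)
    qed
    have summ: "(\<lambda>k. norm (g t k)) summable_on triples" for t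
    proof -
      obtain C where C: "0 \<le> C"
        "\<And>k. k \<in> triples \<Longrightarrow> cmod (f_fun h k (w t)) \<le> 1 * (C ^ tdeg k / (fact (tdeg k)) powr 1)"
        by (rule f_fun_bound[OF h, of "w t"]) blast
      show ?thesis
        unfolding g_def by (rule kernel_sum(1)[OF c, of "1/2" 1 1 C]) (use C in auto)
    qed
    define B where "B = (\<Sum>\<^sub>\<infinity>k\<in>triples. norm (g 1 k))"
    define \<phi> where "\<phi> t = (\<Sum>k\<in>F. (c k * u k * mon (fst k) (fst (snd k)) v) * of_real (s t ^ ex2 k))" for t
    have bound: "cmod (\<phi> t) \<le> t * B" if t: "0 < t" "t \<le> 1" for t
    proof -
      have sub: "F \<subseteq> triples" using reduced_in_triples by (auto simp: F_def)
      have gs: "g t summable_on A" if "A \<subseteq> triples" for A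
        by (rule summable_on_subset_banach[OF abs_summable_summable[OF summ] that])
      have "0 = infsum (g t) triples"
        using zero[OF y] by (simp add: f_series_def g_def[abs_def])
      also have "triples = F \<union> (triples - F)" using sub by blast
      also have "infsum (g t) (F \<union> (triples - F)) = infsum (g t) F + infsum (g t) (triples - F)"
        by (intro infsum_Un_disjoint gs sub) auto
      also have "infsum (g t) F = of_real (t ^ M) * \<phi> t"
        using F by (simp add: \<phi>_def sum_distrib_left) (rule sum.cong, auto simp: F_def gval)
      finally have "of_real (t ^ M) * \<phi> t = - infsum (g t) (triples - F)"
        by (simp add: eq_neg_iff_add_eq_0)
      then have "t ^ M * cmod (\<phi> t) = cmod (infsum (g t) (triples - F))"
        using t by (metis abs_of_nonneg less_imp_le norm_minus_cancel norm_mult norm_of_real zero_le_power)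
      also have "\<dots> \<le> (\<Sum>\<^sub>\<infinity>k\<in>triples - F. norm (g t k))"
        by (intro norm_infsum_bound summable_on_subset_banach[OF summ]) auto
      also have "\<dots> \<le> (\<Sum>\<^sub>\<infinity>k\<in>triples - F. t ^ Suc M * norm (g 1 k))"
      proof (rule infsum_mono)
        show "(\<lambda>k. norm (g t k)) summable_on triples - F"
          by (intro summable_on_subset_banach[OF summ]) auto
        show "(\<lambda>k. t ^ Suc M * norm (g 1 k)) summable_on triples - F"
          by (intro summable_on_cmult_right summable_on_subset_banach[OF summ]) auto
        fix k assume k: "k \<in> triples - F"
        show "norm (g t k) \<le> t ^ Suc M * norm (g 1 k)"
        proof (cases "c k = 0")
          case False
          then have r: "k \<in> reduced_triples" using red by blast
          have "Suc M \<le> deg k" using min[OF False] k r by (auto simp: F_def)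
          then have 1: "t ^ deg k \<le> t ^ Suc M" using t by (intro power_decreasing) auto
          have "s t \<le> s 1"
            unfolding s_def using t V
            by (intro real_sqrt_le_mono add_left_mono mult_right_mono) (auto simp: power_le_one)
          then have 2: "s t ^ ex2 k \<le> s 1 ^ ex2 k" using s(2)[of t] by (intro power_mono) auto
          define b where "b = cmod (c k * u k * mon (fst k) (fst (snd k)) v)"
          have st: "0 \<le> s t" "0 \<le> s 1" using s(2)[of t] s(2)[of 1] by linarith+
          have "norm (g t k) = b * s t ^ ex2 k * t ^ deg k"
            using t st by (simp add: gval[OF r] b_def norm_mult norm_power)
          also have "\<dots> \<le> b * s 1 ^ ex2 k * t ^ Suc M"
            using t st by (intro mult_mono mult_left_mono 1 2) (auto simp: b_def)
          also have "b * s 1 ^ ex2 k = norm (g 1 k)"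
            using st by (simp add: gval[OF r] b_def norm_mult norm_power)
          finally show ?thesis by (simp add: mult_ac)
        qed (use t in \<open>simp add: g_def\<close>)
      qed
      also have "\<dots> = t ^ Suc M * (\<Sum>\<^sub>\<infinity>k\<in>triples - F. norm (g 1 k))"
        by (intro infsum_cmult_right summable_on_subset_banach[OF summ]) auto
      also have "\<dots> \<le> t ^ Suc M * B"
        unfolding B_def using t
        by (intro mult_left_mono infsum_mono2 summable_on_subset_banach[OF summ]) auto
      finally have "t ^ M * cmod (\<phi> t) \<le> t ^ M * (t * B)" by (simp add: mult_ac)
      then show ?thesis using t by (simp add: mult_le_cancel_left)
    qed
    have "((\<lambda>t. cmod (\<phi> t)) \<longlongrightarrow> cmod (\<phi> 0)) (at_right 0)"
    proof -
      have "continuous_on UNIV \<phi>" unfolding \<phi>_def s_def by (intro continuous_intros)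
      then have "(\<phi> \<longlongrightarrow> \<phi> 0) (at 0)" by (simp add: continuous_on_def)
      then have "(\<phi> \<longlongrightarrow> \<phi> 0) (at_right 0)" by (rule tendsto_within_subset) simp
      then show ?thesis by (rule tendsto_norm)
    qed
    moreover have "((\<lambda>t. t * B) \<longlongrightarrow> 0 * B) (at_right 0)"
      by (intro tendsto_mult tendsto_const tendsto_ident_at)
    moreover have "eventually (\<lambda>t. cmod (\<phi> t) \<le> t * B) (at_right 0)"
      using eventually_at_right_less[of "0 :: real"] eventually_at_right_real[OF zero_less_one]
      by eventually_elim (auto intro: bound)
    ultimately have "cmod (\<phi> 0) \<le> 0 * B"
      by (intro tendsto_le[of "at_right 0"]) auto
    then have "\<phi> 0 = 0" by simp
    then show "(\<Sum>k\<in>F. c k * u k * mon (fst k) (fst (snd k)) v) = 0"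
      by (simp add: \<phi>_def s_def)
  next
    show "inj_on (\<lambda>k. (fst k, fst (snd k))) F"
      by (auto simp: inj_on_def F_def reduced_triples_def mtri_def)
  qed (rule kF)
  obtain k where k: "c k \<noteq> 0" "deg k = M" using ex by blast
  have "k \<in> F" using k red[of k] by (auto simp: F_def)
  moreover have "u k \<noteq> 0" using level_fac_pos[OF h, of k] by (simp add: u_def)
  ultimately show False using prod0[of k] k(1) by simp
qed


section \<open>The vanishing ideal of the level set\<close>

text \<open>The coefficients of the image under \<open>S_op\<close> of the monomial with exponents \<open>K\<close> and \<open>L\<close>.\<close>

definition mode :: "real \<Rightarrow> 'n::finite option mindex \<Rightarrow> 'n option mindex \<Rightarrow> 'n triple \<Rightarrow> complex"
  where "mode h K L = (of_real (2 * h) ^ mdeg K * of_nat (mfact K * mfact L)) \<cdot>\<^sub>C delta (tri K L)"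

lemma mode_in_coeff_space: "mdeg K = mdeg L \<Longrightarrow> mode h K L \<in> coeff_space"
  unfolding mode_def by (intro coeff_space_scale delta_in_coeff_space tri_in_triples)

lemma f_series_mode:
  assumes h: "0 < h" and KL: "mdeg K = mdeg L"
  shows "f_series h (mode h K L) z = e_mode h z K L"
  unfolding mode_def e_mode_eq_f_fun[OF KL]
  by (simp add: bounded_functional_scale[OF bounded_functional_f_series[OF h]]
      delta_in_coeff_space tri_in_triples[OF KL] f_series_delta)

lemma delta_eq_mode:
  assumes h: "0 < h" and KL: "mdeg K = mdeg L"
  shows "delta (tri K L) = (1 / (of_real (2 * h) ^ mdeg K * of_nat (mfact K * mfact L))) \<cdot>\<^sub>C mode h K L"
  using h mfact_pos[of K] mfact_pos[of L] by (simp add: mode_def fun_eq_iff)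

lemma bounded_functional_cprod_eval:
  assumes h: "0 < h" and d: "d \<in> coeff_space"
  shows "bounded_functional (\<lambda>c. f_series h (cprod c d) z)"
    and "bounded_functional (\<lambda>c. f_series h (cprod d c) z)"
  by (rule bounded_functional_compose[OF bounded_functional_f_series[OF h] bounded_operator_cprod_left[OF d]])
     (rule bounded_functional_compose[OF bounded_functional_f_series[OF h] bounded_operator_cprod_right[OF d]])

lemma f_series_cprod_mode:
  assumes h: "0 < h" and KL: "mdeg K = mdeg L" "mdeg K' = mdeg L'"
  shows "f_series h (cprod (mode h K L) (mode h K' L')) z = wick_mode h z K L K' L'"
proof -
  have "cprod (mode h K L) (mode h K' L') = (of_real (2 * h) ^ mdeg K * of_nat (mfact K * mfact L)) \<cdot>\<^sub>C
      (of_real (2 * h) ^ mdeg K' * of_nat (mfact K' * mfact L')) \<cdot>\<^sub>C basis_prod (tri K L) (tri K' L')"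
    unfolding mode_def cprod_scale_left cprod_scale_right
    by (simp only: cprod_delta tri_in_triples KL) (simp add: fun_eq_iff mult_ac)
  then show ?thesis
    unfolding wick_mode_eq_basis_prod[OF h KL]
    by (simp add: bounded_functional_scale[OF bounded_functional_f_series[OF h]] coeff_space_scale
        basis_prod_in_coeff_space tri_in_triples KL)
qed

text \<open>The coefficients of \<open>y - 1\<close> times the image of a monomial of degree \<open>\<alpha>\<close>: multiplying the monomial
  by \<open>y\<close> multiplies its image by \<open>y + 2 h \<alpha>\<close>.\<close>

definition y_relation :: "real \<Rightarrow> 'n::finite option mindex \<Rightarrow> 'n option mindex \<Rightarrow> 'n triple \<Rightarrow> complex"
  where "y_relation h K L = (\<Sum>i\<in>UNIV. (- gsgn i) \<cdot>\<^sub>C mode h (K + unitm i) (L + unitm i))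
    - (1 + of_real (2 * h) * of_nat (mdeg K)) \<cdot>\<^sub>C mode h K L"

text \<open>The condition on products only has \<open>c\<close> as the left factor; conjugation takes care of the other
  side.\<close>

definition null_ideal :: "real \<Rightarrow> ('n::finite triple \<Rightarrow> complex) set"
  where "null_ideal h = {c \<in> coeff_space. (\<forall>w. yfun w = 1 \<longrightarrow> f_series h c w = 0) \<and>
    (\<forall>d\<in>coeff_space. \<forall>w. yfun w = 1 \<longrightarrow> f_series h (cprod c d) w = 0)}"

lemma null_ideal_subspace:
  assumes h: "0 < h"
  shows "cfun.subspace (null_ideal h :: ('n::finite triple \<Rightarrow> complex) set)"
proof -
  note e = bounded_functional_f_series[OF h]
  show ?thesis
    unfolding cfun.subspace_def
  proof (intro conjI ballI allI)
    show "0 \<in> (null_ideal h :: ('n triple \<Rightarrow> complex) set)"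
      by (simp add: null_ideal_def coeff_space_zero bounded_functional_zero[OF e]
          bounded_functional_zero[OF bounded_functional_cprod_eval(1)[OF h]])
  next
    fix c c' :: "'n triple \<Rightarrow> complex" assume "c \<in> null_ideal h" "c' \<in> null_ideal h"
    then show "c + c' \<in> null_ideal h"
      by (simp add: null_ideal_def coeff_space_add cprod_add_left f_series_add[OF h] cprod_in_coeff_space)
  next
    fix s and c :: "'n triple \<Rightarrow> complex" assume "c \<in> null_ideal h"
    then show "s \<cdot>\<^sub>C c \<in> null_ideal h"
      by (simp add: null_ideal_def coeff_space_scale cprod_scale_left f_series_scale[OF h] cprod_in_coeff_space)
  qed
qed

lemma functional_y_relation:
  assumes L: "bounded_functional \<Lambda>" and KL: "mdeg K = mdeg L"
  shows "\<Lambda> (y_relation h K L) = (\<Sum>i\<in>UNIV. - gsgn i * \<Lambda> (mode h (K + unitm i) (L + unitm i)))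
    - (1 + of_real (2 * h) * of_nat (mdeg K)) * \<Lambda> (mode h K L)"
proof -
  have m: "mode h (K + unitm i) (L + unitm i) \<in> coeff_space" "mode h K L \<in> coeff_space" for i
    by (rule mode_in_coeff_space, simp add: mdeg_add KL)+
  have "\<Lambda> (y_relation h K L) = \<Lambda> (\<Sum>i\<in>UNIV. (- gsgn i) \<cdot>\<^sub>C mode h (K + unitm i) (L + unitm i))
      - \<Lambda> ((1 + of_real (2 * h) * of_nat (mdeg K)) \<cdot>\<^sub>C mode h K L)"
    unfolding y_relation_def
    by (rule bounded_functional_diff[OF L]) (intro coeff_space_sum coeff_space_scale m)+
  also have "\<Lambda> (\<Sum>i\<in>UNIV. (- gsgn i) \<cdot>\<^sub>C mode h (K + unitm i) (L + unitm i))
      = (\<Sum>i\<in>UNIV. \<Lambda> ((- gsgn i) \<cdot>\<^sub>C mode h (K + unitm i) (L + unitm i)))"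
    by (rule bounded_functional_sum[OF L]) (intro coeff_space_scale m)
  finally show ?thesis
    by (simp only: bounded_functional_scale[OF L m(1)] bounded_functional_scale[OF L m(2)])
qed

text \<open>Since \<open>y\<close> is central and acts by pointwise multiplication, the factor \<open>y - 1\<close> persists in every
  product.\<close>

lemma y_relation_in_null_ideal:
  fixes K L :: "'n::finite option mindex"
  assumes h: "0 < h" and KL: "mdeg K = mdeg L"
  shows "y_relation h K L \<in> null_ideal h"
proof -
  have KLi: "mdeg (K + unitm i) = mdeg (L + unitm i)" for i by (simp only: mdeg_add KL mdeg_unitm)
  have mem: "y_relation h K L \<in> coeff_space"
    unfolding y_relation_def by (intro coeff_space_diff coeff_space_sum coeff_space_scale mode_in_coeff_space KL KLi)
  moreover have "f_series h (y_relation h K L) w = 0" if w: "yfun w = 1" for w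
    unfolding functional_y_relation[OF bounded_functional_f_series[OF h] KL]
    unfolding f_series_mode[OF h KLi] f_series_mode[OF h KL] e_mode_shift[OF h] w by simp
  moreover have "f_series h (cprod (y_relation h K L) d) w = 0"
    if d: "d \<in> coeff_space" and w: "yfun w = 1" for d w
  proof (rule functional_vanishes_by_density[OF bounded_functional_cprod_eval(2)[OF h mem] _ d])
    fix l :: "'n triple" assume "l \<in> triples"
    then obtain K' L' where l: "l = tri K' L'" and KL': "mdeg K' = mdeg L'" by (rule triples_cases)
    have "f_series h (cprod (y_relation h K L) (mode h K' L')) w = 0"
      unfolding functional_y_relation[OF bounded_functional_cprod_eval(1)[OF h mode_in_coeff_space[OF KL']] KL]
      unfolding f_series_cprod_mode[OF h KLi KL'] f_series_cprod_mode[OF h KL KL'] wick_mode_shift[OF h KL'] w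
      by simp
    then show "f_series h (cprod (y_relation h K L) (delta l)) w = 0"
      unfolding l delta_eq_mode[OF h KL'] cprod_scale_right
      by (simp add: bounded_functional_scale[OF bounded_functional_f_series[OF h]] cprod_in_coeff_space mem
          mode_in_coeff_space KL')
  qed
  ultimately show ?thesis by (simp add: null_ideal_def)
qed

definition red_space :: "('n::finite triple \<Rightarrow> complex) set"
  where "red_space = {c \<in> coeff_space. \<forall>k. k \<notin> reduced_triples \<longrightarrow> c k = 0}"

lemma red_space_subspace: "cfun.subspace red_space"
  by (auto simp: cfun.subspace_def red_space_def coeff_space_zero coeff_space_add coeff_space_scale)

lemma red_space_coeff: "c \<in> red_space \<Longrightarrow> c \<in> coeff_space"
  by (simp add: red_space_def)

lemma Red_in_red_space: "0 < h \<Longrightarrow> c \<in> coeff_space \<Longrightarrow> Red h c \<in> red_space"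
  by (simp add: red_space_def Red_in_coeff_space Red_zero)

lemma delta_in_red_space: "k \<in> reduced_triples \<Longrightarrow> delta k \<in> red_space"
  using reduced_in_triples by (auto simp: red_space_def delta_in_coeff_space delta_def)

text \<open>The relation \<open>y = 1\<close> trades one common factor \<open>z\<^sup>0\<close> and its conjugate against monomials with fewer
  such factors.\<close>

lemma mode_mod_null_ideal:
  fixes K L :: "'n::finite option mindex"
  assumes h: "0 < h" and KL: "mdeg K = mdeg L"
  shows "\<exists>s\<in>red_space. mode h K L - s \<in> null_ideal h"
  using KL
proof (induction "min (K None) (L None)" arbitrary: K L)
  case 0
  then have "tri K L \<in> reduced_triples"
    using mdeg_option[of K] mdeg_option[of L] by (auto simp: reduced_iff tri_def mmax_def min_def split: if_splits)
  then have "mode h K L \<in> red_space"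
    unfolding mode_def by (intro cfun.subspace_scale[OF red_space_subspace] delta_in_red_space)
  then show ?case
    using cfun.subspace_0[OF null_ideal_subspace[OF h]]
    by (intro bexI[of _ "mode h K L"]) (simp_all only: diff_self)
next
  case (Suc q)
  define G where "G = {c :: 'n triple \<Rightarrow> complex. \<exists>s\<in>red_space. c - s \<in> null_ideal h}"
  have G: "cfun.subspace G"
  proof -
    note N = null_ideal_subspace[OF h] and R = red_space_subspace
    have "c + d \<in> G" if cd: "c \<in> G" "d \<in> G" for c d
    proof -
      obtain s t where "s \<in> red_space" "c - s \<in> null_ideal h" "t \<in> red_space" "d - t \<in> null_ideal h"
        using cd by (auto simp: G_def)
      then have "s + t \<in> red_space" "(c - s) + (d - t) \<in> null_ideal h"
        using cfun.subspace_add[OF R] cfun.subspace_add[OF N] by blast+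
      then show ?thesis unfolding G_def by (auto simp: algebra_simps intro!: bexI[of _ "s + t"])
    qed
    moreover have "a \<cdot>\<^sub>C c \<in> G" if c: "c \<in> G" for a c
    proof -
      obtain s where "s \<in> red_space" "c - s \<in> null_ideal h" using c by (auto simp: G_def)
      then have "a \<cdot>\<^sub>C s \<in> red_space" "a \<cdot>\<^sub>C (c - s) \<in> null_ideal h"
        using cfun.subspace_scale[OF R] cfun.subspace_scale[OF N] by blast+
      then show ?thesis unfolding G_def by (auto simp: cfun.scale_right_diff_distrib intro!: bexI[of _ "a \<cdot>\<^sub>C s"])
    qed
    moreover have "0 \<in> G"
      unfolding G_def using cfun.subspace_0[OF N] cfun.subspace_0[OF R] by (auto intro!: bexI[of _ 0])
    ultimately show ?thesis by (simp add: cfun.subspace_def)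
  qed
  have NG: "c \<in> G" if "c \<in> null_ideal h" for c
    unfolding G_def using that cfun.subspace_0[OF red_space_subspace] by (auto intro!: bexI[of _ 0])
  have pos: "0 < K None" "0 < L None" using Suc.hyps(2) by linarith+
  define K1 L1 where "K1 = K - unitm None" and "L1 = L - unitm None"
  have K: "K1 + unitm None = K" "L1 + unitm None = L"
    unfolding K1_def L1_def using pos by (auto intro!: mindex_minus_unitm)
  have KL1: "mdeg K1 = mdeg L1"
    using Suc.prems mdeg_add[of K1 "unitm None"] mdeg_add[of L1 "unitm None"] by (simp only: K mdeg_unitm)
  have q: "q = min (K1 None) (L1 None)"
    using Suc.hyps(2) pos by (simp add: K1_def L1_def unitm_def)
  have m1: "mode h K1 L1 \<in> G"
    unfolding G_def using Suc.hyps(1)[OF q KL1] by simp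
  have m2: "mode h (K1 + unitm (Some j)) (L1 + unitm (Some j)) \<in> G" for j
  proof -
    have "q = min ((K1 + unitm (Some j)) None) ((L1 + unitm (Some j)) None)"
      using q by (simp add: unitm_def)
    moreover have "mdeg (K1 + unitm (Some j)) = mdeg (L1 + unitm (Some j))"
      by (simp only: mdeg_add KL1 mdeg_unitm)
    ultimately show ?thesis
      unfolding G_def mem_Collect_eq by (rule Suc.hyps(1))
  qed
  have "mode h K L = y_relation h K1 L1 + (\<Sum>j\<in>UNIV. mode h (K1 + unitm (Some j)) (L1 + unitm (Some j)))
      + (1 + of_real (2 * h) * of_nat (mdeg K1)) \<cdot>\<^sub>C mode h K1 L1"
    unfolding y_relation_def sum_option K
    by (simp add: gsgn_def fun_eq_iff sum_fun_apply sum_negf)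
  also have "\<dots> \<in> G"
    by (intro cfun.subspace_add[OF G] cfun.subspace_sum[OF G] cfun.subspace_scale[OF G] m1 m2 NG
        y_relation_in_null_ideal[OF h KL1])
  finally show ?case by (simp add: G_def)
qed

text \<open>Some reduced coefficients are congruent to the basis element modulo the ideal; they agree with
  \<open>Red h (delta k)\<close> by uniqueness, so the outcome of the rewriting need not be computed.\<close>

lemma delta_minus_Red_in_null_ideal:
  assumes h: "0 < h" and k: "k \<in> (triples :: 'n::finite triple set)"
  shows "delta k - Red h (delta k) \<in> null_ideal h"
proof -
  obtain K L where kKL: "k = tri K L" and KL: "mdeg K = mdeg L" using k by (rule triples_cases)
  define a :: complex where "a = 1 / (of_real (2 * h) ^ mdeg K * of_nat (mfact K * mfact L))"
  obtain s where s: "s \<in> red_space" "mode h K L - s \<in> null_ideal h"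
    using mode_mod_null_ideal[OF h KL] by blast
  have d: "delta k = a \<cdot>\<^sub>C mode h K L"
    unfolding kKL a_def by (rule delta_eq_mode[OF h KL])
  have n: "delta k - a \<cdot>\<^sub>C s \<in> null_ideal h"
    unfolding d cfun.scale_right_diff_distrib[symmetric]
    by (rule cfun.subspace_scale[OF null_ideal_subspace[OF h] s(2)])
  have as: "a \<cdot>\<^sub>C s \<in> red_space" by (rule cfun.subspace_scale[OF red_space_subspace s(1)])
  note dc = delta_in_coeff_space[OF k]
  have "a \<cdot>\<^sub>C s - Red h (delta k) = 0"
  proof (rule reduced_coefficients_unique[OF h])
    have r: "a \<cdot>\<^sub>C s - Red h (delta k) \<in> red_space"
      by (rule cfun.subspace_diff[OF red_space_subspace as Red_in_red_space[OF h dc]])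
    then show "a \<cdot>\<^sub>C s - Red h (delta k) \<in> coeff_space" by (rule red_space_coeff)
    show "(a \<cdot>\<^sub>C s - Red h (delta k)) i = 0" if "i \<notin> reduced_triples" for i
      using r that unfolding red_space_def by blast
    fix w :: "'n point" assume w: "yfun w = 1"
    have "f_series h (delta k - a \<cdot>\<^sub>C s) w = 0"
      using n w by (simp add: null_ideal_def)
    then show "f_series h (a \<cdot>\<^sub>C s - Red h (delta k)) w = 0"
      using f_series_Red[OF h dc w]
      by (simp add: f_series_diff[OF h dc red_space_coeff[OF as]]
          f_series_diff[OF h red_space_coeff[OF as] Red_in_coeff_space[OF h dc]])
  qed
  then show ?thesis using n by simp
qed

definition level_null :: "real \<Rightarrow> ('n::finite triple \<Rightarrow> complex) \<Rightarrow> bool"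
  where "level_null h c \<longleftrightarrow> (\<forall>w. yfun w = 1 \<longrightarrow> f_series h c w = 0)"

lemma level_null_iff_Red:
  assumes h: "0 < h" and c: "c \<in> coeff_space"
  shows "level_null h c \<longleftrightarrow> Red h c = 0"
proof
  assume "level_null h c"
  then show "Red h c = 0"
    using f_series_Red[OF h c]
    by (intro reduced_coefficients_unique[OF h Red_in_coeff_space[OF h c] Red_zero]) (auto simp: level_null_def)
next
  assume R: "Red h c = 0"
  have "f_series h c w = 0" if "yfun w = 1" for w
    by (rule trans[OF f_series_Red[OF h c that, unfolded R, symmetric]
          bounded_functional_zero[OF bounded_functional_f_series[OF h]]])
  then show "level_null h c" by (simp add: level_null_def)
qed

text \<open>By density, products with \<open>c\<close> and with \<open>Red h c\<close> agree on the level set, and \<open>Red h c = 0\<close>.\<close>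

lemma level_null_cprod_left:
  assumes h: "0 < h" and c: "c \<in> coeff_space" and d: "d \<in> coeff_space" and null: "level_null h c"
  shows "level_null h (cprod c d)"
  unfolding level_null_def
proof (intro allI impI)
  fix w :: "'a point" assume w: "yfun w = 1"
  have R: "Red h c = 0" using null level_null_iff_Red[OF h c] by blast
  have "bounded_functional (\<lambda>c. f_series h (cprod c d) w - f_series h (cprod (Red h c) d) w)"
    by (intro bounded_functional_minus bounded_functional_cprod_eval h d
        bounded_functional_compose[OF bounded_functional_cprod_eval(1)[OF h d] bounded_operator_Red[OF h]])
  moreover have "f_series h (cprod (delta k) d) w - f_series h (cprod (Red h (delta k)) d) w = 0"
    if k: "k \<in> triples" for k
    using delta_minus_Red_in_null_ideal[OF h k] d w
      bounded_functional_diff[OF bounded_functional_cprod_eval(1)[OF h d, of w] delta_in_coeff_space[OF k]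
        Red_in_coeff_space[OF h delta_in_coeff_space[OF k]]]
    by (simp add: null_ideal_def)
  ultimately have "f_series h (cprod c d) w - f_series h (cprod (Red h c) d) w = 0"
    by (rule functional_vanishes_by_density[OF _ _ c])
  then show "f_series h (cprod c d) w = 0"
    unfolding R using bounded_functional_zero[OF bounded_functional_cprod_eval(1)[OF h d, of w]] by simp
qed

lemma level_null_cprod_right:
  assumes h: "0 < h" and c: "c \<in> coeff_space" and d: "d \<in> coeff_space" and null: "level_null h c"
  shows "level_null h (cprod d c)"
proof -
  have "level_null h (conj_coeffs c)"
    using null by (simp add: level_null_def f_series_conj)
  then have "level_null h (cprod (conj_coeffs c) (conj_coeffs d))"
    by (intro level_null_cprod_left conj_coeffs_in_coeff_space h c d)
  then show ?thesis
    unfolding cprod_conj by (simp add: level_null_def f_series_conj)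
qed


section \<open>The algebra on the disc in coefficients\<close>

definition disc_series :: "real \<Rightarrow> ('n::finite triple \<Rightarrow> complex) \<Rightarrow> complex ^ 'n \<Rightarrow> complex"
  where "disc_series h c = quot_class (f_series h c)"

text \<open>A coordinate map, as \<open>disc_series h\<close> maps \<open>red_space\<close> bijectively onto \<open>Ahat_disc h\<close>.\<close>

definition kap :: "real \<Rightarrow> (complex ^ 'n::finite \<Rightarrow> complex) \<Rightarrow> 'n triple \<Rightarrow> complex"
  where "kap h = the_inv_into red_space (disc_series h)"

lemma f_series_in_Ahat: "c \<in> coeff_space \<Longrightarrow> f_series h c \<in> Ahat_cone h"
  by (simp add: Ahat_cone_def)

lemma disc_series_eq_iff:
  assumes h: "0 < h" and cd: "c \<in> coeff_space" "d \<in> coeff_space"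
  shows "disc_series h c = disc_series h d \<longleftrightarrow> level_null h (c - d)"
proof -
  have "f_series h c - f_series h d = f_series h (c - d)"
    by (simp add: f_series_diff[OF h cd])
  then show ?thesis
    unfolding disc_series_def using quot_class_eq_iff[of "f_series h c" h "f_series h d"] cd
    by (auto simp: f_series_in_Ahat coeff_space_diff J_level_def level_null_def)
qed

lemma disc_series_add: "0 < h \<Longrightarrow> c \<in> coeff_space \<Longrightarrow> d \<in> coeff_space \<Longrightarrow> disc_series h (c + d) = disc_series h c + disc_series h d"
  and disc_series_diff: "0 < h \<Longrightarrow> c \<in> coeff_space \<Longrightarrow> d \<in> coeff_space \<Longrightarrow> disc_series h (c - d) = disc_series h c - disc_series h d"
  and disc_series_scale: "0 < h \<Longrightarrow> c \<in> coeff_space \<Longrightarrow> disc_series h (s \<cdot>\<^sub>C c) = s \<cdot>\<^sub>C disc_series h c"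
  by (simp_all add: disc_series_def fun_eq_iff quot_class_def f_series_add f_series_diff f_series_scale)

lemma disc_series_sum:
  assumes h: "0 < h" and g: "\<And>x. x \<in> A \<Longrightarrow> g x \<in> coeff_space"
  shows "disc_series h (\<Sum>x\<in>A. g x) = (\<Sum>x\<in>A. disc_series h (g x))"
proof -
  have "f_series h (\<Sum>x\<in>A. g x) = (\<Sum>x\<in>A. f_series h (g x))" by (rule f_series_sum[OF h g])
  then show ?thesis by (simp add: disc_series_def fun_eq_iff quot_class_def sum_fun_apply)
qed

lemma f_disc_eq_disc_series: "f_disc h P Q = disc_series h (delta (mtri P Q))"
  by (simp add: f_disc_def disc_series_def f_series_delta) (simp add: mtri_def)

lemma disc_series_Red:
  assumes h: "0 < h" and c: "c \<in> coeff_space"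
  shows "disc_series h (Red h c) = disc_series h c"
  using disc_series_eq_iff[OF h Red_in_coeff_space[OF h c] c] f_series_Red[OF h c]
  by (simp add: level_null_def f_series_diff[OF h Red_in_coeff_space[OF h c] c])

lemma inj_on_disc_series:
  assumes h: "0 < h"
  shows "inj_on (disc_series h) red_space"
proof (rule inj_onI)
  fix c d :: "'a triple \<Rightarrow> complex" assume cd: "c \<in> red_space" "d \<in> red_space" "disc_series h c = disc_series h d"
  have m: "c - d \<in> red_space" by (rule cfun.subspace_diff[OF red_space_subspace cd(1,2)])
  have "c - d = 0"
    using disc_series_eq_iff[OF h red_space_coeff[OF cd(1)] red_space_coeff[OF cd(2)]] cd(3) m
    by (intro reduced_coefficients_unique[OF h]) (auto simp: level_null_def red_space_def)
  then show "c = d" by simp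
qed

lemma kap_disc_series: "0 < h \<Longrightarrow> c \<in> coeff_space \<Longrightarrow> kap h (disc_series h c) = Red h c"
  unfolding kap_def
  using the_inv_into_f_f[OF inj_on_disc_series Red_in_red_space, of h h c] by (simp add: disc_series_Red)

lemma kap_disc_series_reduced: "0 < h \<Longrightarrow> c \<in> red_space \<Longrightarrow> kap h (disc_series h c) = c"
  unfolding kap_def by (rule the_inv_into_f_f[OF inj_on_disc_series])

lemma disc_series_in_Ahat_disc: "c \<in> coeff_space \<Longrightarrow> disc_series h c \<in> Ahat_disc h"
  by (simp add: disc_series_def Ahat_disc_def f_series_in_Ahat)

lemma Ahat_disc_cases:
  assumes h: "0 < h" and F: "F \<in> Ahat_disc h"
  shows "kap h F \<in> red_space" "disc_series h (kap h F) = F"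
proof -
  obtain c where c: "c \<in> coeff_space" "F = disc_series h c"
    using F by (auto simp: Ahat_disc_def Ahat_cone_def disc_series_def)
  show "kap h F \<in> red_space" "disc_series h (kap h F) = F"
    using c by (simp_all add: kap_disc_series[OF h] Red_in_red_space[OF h] disc_series_Red[OF h])
qed

lemma kap_diff:
  assumes h: "0 < h" and "F \<in> Ahat_disc h" "G \<in> Ahat_disc h"
  shows "kap h (F - G) = kap h F - kap h G" "F - G \<in> Ahat_disc h"
proof -
  note F = Ahat_disc_cases[OF h assms(2)] and G = Ahat_disc_cases[OF h assms(3)]
  have m: "kap h F - kap h G \<in> red_space" by (rule cfun.subspace_diff[OF red_space_subspace F(1) G(1)])
  have eq: "F - G = disc_series h (kap h F - kap h G)"
    using disc_series_diff[OF h red_space_coeff[OF F(1)] red_space_coeff[OF G(1)]] F(2) G(2) by simp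
  show "kap h (F - G) = kap h F - kap h G"
    unfolding eq by (rule kap_disc_series_reduced[OF h m])
  show "F - G \<in> Ahat_disc h"
    unfolding eq by (rule disc_series_in_Ahat_disc[OF red_space_coeff[OF m]])
qed

lemma kap_add:
  assumes h: "0 < h" and "F \<in> Ahat_disc h" "G \<in> Ahat_disc h"
  shows "kap h (F + G) = kap h F + kap h G" "F + G \<in> Ahat_disc h"
proof -
  note F = Ahat_disc_cases[OF h assms(2)] and G = Ahat_disc_cases[OF h assms(3)]
  have m: "kap h F + kap h G \<in> red_space" by (rule cfun.subspace_add[OF red_space_subspace F(1) G(1)])
  have eq: "F + G = disc_series h (kap h F + kap h G)"
    using disc_series_add[OF h red_space_coeff[OF F(1)] red_space_coeff[OF G(1)]] F(2) G(2) by simp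
  show "kap h (F + G) = kap h F + kap h G"
    unfolding eq by (rule kap_disc_series_reduced[OF h m])
  show "F + G \<in> Ahat_disc h"
    unfolding eq by (rule disc_series_in_Ahat_disc[OF red_space_coeff[OF m]])
qed

lemma disc_series_cprod_cong:
  assumes h: "0 < h" and m: "c \<in> coeff_space" "c' \<in> coeff_space" "d \<in> coeff_space" "d' \<in> coeff_space"
    and eq: "disc_series h c' = disc_series h c" "disc_series h d' = disc_series h d"
  shows "disc_series h (cprod c' d') = disc_series h (cprod c d)"
proof -
  have n: "level_null h (c' - c)" "level_null h (d' - d)"
    using eq m by (simp_all add: disc_series_eq_iff[OF h])
  have "level_null h (cprod (c' - c) d')"
    by (rule level_null_cprod_left[OF h coeff_space_diff[OF m(2,1)] m(4) n(1)])
  moreover have "level_null h (cprod c (d' - d))"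
    by (rule level_null_cprod_right[OF h coeff_space_diff[OF m(4,3)] m(1) n(2)])
  moreover have "cprod c' d' - cprod c d = cprod (c' - c) d' + cprod c (d' - d)"
    by (simp add: cprod_diff_left cprod_diff_right)
  ultimately have "level_null h (cprod c' d' - cprod c d)"
    by (simp add: level_null_def f_series_add[OF h] cprod_in_coeff_space coeff_space_diff m)
  then show ?thesis by (simp add: disc_series_eq_iff[OF h] cprod_in_coeff_space m)
qed

lemma star_disc_disc_series:
  fixes c d :: "'n::finite triple \<Rightarrow> complex"
  assumes h: "0 < h" and cd: "c \<in> coeff_space" "d \<in> coeff_space"
  shows "star_disc h (disc_series h c) (disc_series h d) = disc_series h (cprod c d)"
  unfolding star_disc_def
proof (rule the_equality)
  show "\<forall>a\<in>Ahat_cone h. \<forall>b\<in>Ahat_cone h. quot_class a = disc_series h c \<and> quot_class b = disc_series h d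
      \<longrightarrow> disc_series h (cprod c d) = quot_class (star_hat h a b)"
  proof (intro ballI impI)
    fix a b :: "'n point \<Rightarrow> complex"
    assume ab: "a \<in> Ahat_cone h" "b \<in> Ahat_cone h" and q: "quot_class a = disc_series h c \<and> quot_class b = disc_series h d"
    obtain c' where c': "c' \<in> coeff_space" "a = f_series h c'" using ab(1) by (rule Ahat_cone_cases)
    obtain d' where d': "d' \<in> coeff_space" "b = f_series h d'" using ab(2) by (rule Ahat_cone_cases)
    have "disc_series h (cprod c' d') = disc_series h (cprod c d)"
      by (rule disc_series_cprod_cong[OF h cd(1) c'(1) cd(2) d'(1)]) (use q c' d' in \<open>auto simp: disc_series_def\<close>)
    then show "disc_series h (cprod c d) = quot_class (star_hat h a b)"
      by (simp add: c'(2) d'(2) star_hat_f_series[OF h c'(1) d'(1)] disc_series_def)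
  qed
next
  fix H assume "\<forall>a\<in>Ahat_cone h. \<forall>b\<in>Ahat_cone h. quot_class a = disc_series h c \<and> quot_class b = disc_series h d
      \<longrightarrow> H = quot_class (star_hat h a b)"
  then have "H = quot_class (star_hat h (f_series h c) (f_series h d))"
    using cd by (simp add: f_series_in_Ahat disc_series_def)
  then show "H = disc_series h (cprod c d)"
    by (simp add: star_hat_f_series[OF h cd] disc_series_def)
qed


section \<open>The Gel'fand ideal\<close>

definition base_point :: "'n::finite point"
  where "base_point = axis None 1"

lemma yfun_base: "yfun base_point = 1"
  by (simp add: yfun_def base_point_def axis_def)

lemma disc_series_at_zero:
  assumes "c \<in> coeff_space"
  shows "disc_series h c 0 = f_series h c base_point"
proof -
  have "disc_proj base_point = (0 :: complex ^ 'a)"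
    by (simp add: disc_proj_def base_point_def axis_def vec_eq_iff)
  then show ?thesis
    unfolding disc_series_def using quot_class_apply[OF f_series_in_Ahat[OF assms] yfun_base] by metis
qed

lemma prod_zero_power: "(\<Prod>i\<in>(UNIV :: 'n::finite set). (0 :: complex) ^ P i) = (if P = 0 then 1 else 0)"
  by (auto simp: fun_eq_iff)

lemma f_fun_base:
  fixes P Q :: "'n::finite mindex"
  shows "f_fun h (P, Q, \<alpha>) base_point
    = (if P = 0 \<and> Q = 0 then of_real (level_fac h ((0, 0, \<alpha>) :: 'n triple)) else 0)"
  unfolding f_fun_level_eq[OF yfun_base]
  by (auto simp: e_fun_def base_point_def axis_def prod_zero_power)

definition pair_weight :: "real \<Rightarrow> 'n::finite triple \<Rightarrow> real"
  where "pair_weight h l = (if l \<in> reduced_triples \<and> fst l = 0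
    then level_fac h ((0, 0, tdeg l) :: 'n triple) / real (mfact (fst (snd l))) else 0)"

text \<open>At the base point every monomial that contains a coordinate other than \<open>0\<close> vanishes. The contraction
  therefore has to remove all of these coordinates from both factors, which forces the triples to be
  \<open>(Q, 0)\<close> and \<open>(0, Q)\<close> and leaves only the contraction \<open>T = Q\<close>.\<close>

lemma basis_prod_at_base:
  fixes k l :: "'n::finite triple"
  assumes h: "0 < h" and kl: "k \<in> reduced_triples" "l \<in> reduced_triples"
  shows "f_series h (basis_prod k l) base_point = (if k = swap_triple l then of_real (pair_weight h l) else 0)"
proof -
  obtain P1 Q1 where k: "k = mtri P1 Q1" using kl by (auto simp: reduced_triples_def)
  obtain P2 Q2 where l: "l = mtri P2 Q2" using kl by (auto simp: reduced_triples_def)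
  have t: "k \<in> triples" "l \<in> triples" using kl reduced_in_triples by auto
  define I where "I = {T. T \<le> exK k \<and> T \<le> exL l}"
  define T0 where "T0 = up Q2 (mdeg Q2)"
  have I: "finite I" unfolding I_def by (rule finite_contractions)
  have ex: "exK k = up P1 (tdeg k)" "exL k = up Q1 (tdeg k)" "exK l = up P2 (tdeg l)" "exL l = up Q2 (tdeg l)"
    by (simp_all add: exK_def exL_def k l mtri_def)
  have f: "f_fun h (stri k l T) base_point = (if k = swap_triple l \<and> fst l = 0 \<and> T = T0
      then of_real (level_fac h ((0, 0, tdeg l) :: 'n triple)) else 0)" if T: "T \<in> I" for T
  proof -
    have le: "T (Some j) \<le> P1 j" "T (Some j) \<le> Q2 j" for j
      using T by (auto simp: I_def le_fun_def ex up_def split: option.splits)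
    have fst0: "(exK k - T + exK l) \<circ> Some = 0 \<longleftrightarrow> P2 = 0 \<and> T \<circ> Some = P1"
    proof -
      have "P1 j \<le> T (Some j) \<longleftrightarrow> T (Some j) = P1 j" for j
        using le(1)[of j] by arith
      then show ?thesis by (simp add: ex fun_eq_iff all_conj_distrib conj_commute)
    qed
    have snd0: "(exL k + exL l - T) \<circ> Some = 0 \<longleftrightarrow> Q1 = 0 \<and> T \<circ> Some = Q2"
    proof -
      have "Q1 j + Q2 j \<le> T (Some j) \<longleftrightarrow> Q1 j = 0 \<and> T (Some j) = Q2 j" for j
        using le(2)[of j] by arith
      then show ?thesis by (simp add: ex fun_eq_iff all_conj_distrib)
    qed
    have st: "stri k l T = ((exK k - T + exK l) \<circ> Some, (exL k + exL l - T) \<circ> Some, tdeg k + tdeg l - mdeg T)"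
      using stri_degrees(1)[OF t, of T] T by (simp add: stri_def tri_def I_def)
    have cond: "(P2 = 0 \<and> T \<circ> Some = P1) \<and> (Q1 = 0 \<and> T \<circ> Some = Q2)
        \<longleftrightarrow> k = swap_triple l \<and> fst l = 0 \<and> T = T0"
    proof
      assume a: "(P2 = 0 \<and> T \<circ> Some = P1) \<and> (Q1 = 0 \<and> T \<circ> Some = Q2)"
      have "T None \<le> exL l None" using T by (auto simp: I_def le_fun_def)
      then have "T None = 0" using a by (simp add: exL_def l mtri_def)
      then have "T = T0" using a by (auto simp: T0_def fun_eq_iff up_def split: option.split)
      moreover have "P1 = Q2" using a by metis
      ultimately show "k = swap_triple l \<and> fst l = 0 \<and> T = T0" using a by (simp add: k l mtri_def swap_triple_def)
    next
      assume a: "k = swap_triple l \<and> fst l = 0 \<and> T = T0"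
      then have "P2 = 0" "P1 = Q2" "Q1 = 0" by (auto simp: k l mtri_def swap_triple_def)
      moreover have "T \<circ> Some = Q2" using a by (simp add: T0_def)
      ultimately show "(P2 = 0 \<and> T \<circ> Some = P1) \<and> (Q1 = 0 \<and> T \<circ> Some = Q2)" by simp
    qed
    have "tdeg k + tdeg l - mdeg T = tdeg l" if "k = swap_triple l \<and> fst l = 0 \<and> T = T0"
    proof -
      have "mdeg T = tdeg l" using that by (simp add: T0_def l mtri_def)
      then show ?thesis using that by simp
    qed
    then show ?thesis
      unfolding st f_fun_base fst0 snd0 cond by (auto simp: k l)
  qed
  have "f_series h (basis_prod k l) base_point = (\<Sum>T\<in>I. sfac k l T * f_fun h (stri k l T) base_point)"
  proof -
    have st: "stri k l T \<in> triples" if "T \<in> I" for T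
      using that by (intro stri_in_triples t) (auto simp: I_def)
    show ?thesis
      unfolding basis_prod_def I_def[symmetric]
      by (subst bounded_functional_sum[OF bounded_functional_f_series[OF h]])
         (auto simp: st f_series_delta delta_in_coeff_space coeff_space_scale
            bounded_functional_scale[OF bounded_functional_f_series[OF h]] intro!: sum.cong)
  qed
  also have "\<dots> = (\<Sum>T\<in>I. if T = T0 then (if k = swap_triple l \<and> fst l = 0
      then sfac k l T0 * of_real (level_fac h ((0, 0, tdeg l) :: 'n triple)) else 0) else 0)"
    by (rule sum.cong) (auto simp: f)
  also have "\<dots> = (if T0 \<in> I then (if k = swap_triple l \<and> fst l = 0
      then sfac k l T0 * of_real (level_fac h ((0, 0, tdeg l) :: 'n triple)) else 0) else 0)"
    using I by simp
  also have "\<dots> = (if k = swap_triple l then of_real (pair_weight h l) else 0)"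
  proof (cases "k = swap_triple l \<and> fst l = 0")
    case True
    then have *: "P2 = 0" "P1 = Q2" "Q1 = 0" by (auto simp: k l mtri_def swap_triple_def)
    have e: "exK k = T0" "exL l = T0" by (auto simp: exK_def exL_def k l mtri_def * T0_def)
    have c1: "mchoose A A = 1" for A :: "'n option mindex" by (simp add: mchoose_def)
    have "exK k - T0 + exK l = exK l" "exL k + exL l - T0 = exL k"
      by (auto simp: e fun_eq_iff)
    then have "sfac k l T0 = 1 / of_nat (mfact Q2)"
      by (simp add: sfac_def c1 sgm_def T0_def mfact_up)
    moreover have "T0 \<in> I" by (simp add: I_def e)
    ultimately show ?thesis
      using True kl by (simp add: pair_weight_def l mtri_def)
  next
    case False
    then show ?thesis by (auto simp: pair_weight_def)
  qed
  finally show ?thesis .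
qed

lemma pair_weight_bound:
  assumes h: "0 < h"
  obtains C where "0 \<le> C" "\<And>l :: 'n::finite triple. 0 \<le> pair_weight h l"
    "\<And>l :: 'n triple. pair_weight h l \<le> C ^ tdeg l / fact (tdeg l)"
proof -
  define C where "C = (1 / (2 * h) + 1) * (real CARD('n option))\<^sup>2"
  have C: "0 \<le> C" using h by (simp add: C_def)
  show ?thesis
  proof (rule that[OF C])
    fix l :: "'n triple"
    show "0 \<le> pair_weight h l"
      by (auto simp: pair_weight_def intro!: divide_nonneg_nonneg less_imp_le[OF level_fac_pos[OF h]])
    have "level_fac h ((0, 0, tdeg l) :: 'n triple) / real (mfact (fst (snd l))) \<le> level_fac h ((0, 0, tdeg l) :: 'n triple) / 1"
      using mfact_ge_1[of "fst (snd l)"] less_imp_le[OF level_fac_pos[OF h, of "(0, 0, tdeg l) :: 'n triple"]]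
      by (intro divide_left_mono) auto
    also have "\<dots> \<le> C ^ tdeg l / fact (tdeg l)"
      using level_fac_upper[OF h, of "(0, 0, tdeg l) :: 'n triple"] by (simp add: C_def triples_def)
    finally show "pair_weight h l \<le> C ^ tdeg l / fact (tdeg l)"
      using C by (simp add: pair_weight_def)
  qed
qed

lemma product_at_base:
  fixes c d :: "'n::finite triple \<Rightarrow> complex"
  assumes h: "0 < h" and cd: "c \<in> coeff_space" "d \<in> coeff_space"
  shows "f_series h (cprod (restr reduced_triples c) (restr reduced_triples d)) base_point
    = (\<Sum>\<^sub>\<infinity>l\<in>triples. d l * (c (swap_triple l) * of_real (pair_weight h l)))"
    and "(\<lambda>l. norm (d l * (c (swap_triple l) * of_real (pair_weight h l)))) summable_on triples"
proof -
  obtain C where C: "0 \<le> C" "\<And>l :: 'n triple. 0 \<le> pair_weight h l"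
    "\<And>l :: 'n triple. pair_weight h l \<le> C ^ tdeg l / fact (tdeg l)"
    by (rule pair_weight_bound[OF h]) blast
  have swap_w: "pair_weight h l \<le> C ^ tdeg l / fact (tdeg l)" for l :: "'n triple" by (rule C(3))
  have bound: "cmod (e i * of_real x) \<le> pn (1/2) e * (C ^ tdeg i / (fact (tdeg i)) powr (1/2))"
    if e: "e \<in> coeff_space" and x: "0 \<le> x" "x \<le> C ^ tdeg i / fact (tdeg i)" for e and i :: "'n triple" and x
  proof -
    define p where "p = (fact (tdeg i) :: real) powr (1/2)"
    have p: "0 < p" "fact (tdeg i) = p * p" by (simp_all add: p_def flip: powr_add)
    have "cmod (e i * of_real x) \<le> (pn (1/2) e * p) * (C ^ tdeg i / fact (tdeg i))"
      unfolding norm_mult p_def using x coeff_bound[OF e, of "1/2"]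
      by (intro mult_mono) (auto intro!: mult_nonneg_nonneg)
    also have "\<dots> = pn (1/2) e * (C ^ tdeg i / p)"
      unfolding p(2) using p(1) by simp
    finally show ?thesis by (simp only: p_def)
  qed
  define \<Phi> where "\<Phi> c d = f_series h (cprod (restr reduced_triples c) (restr reduced_triples d)) base_point
      - (\<Sum>\<^sub>\<infinity>l\<in>triples. d l * (c (swap_triple l) * of_real (pair_weight h l)))" for c d :: "'n triple \<Rightarrow> complex"
  have b1: "cmod (c (swap_triple l) * of_real (pair_weight h l)) \<le> pn (1/2) c * (C ^ tdeg l / (fact (tdeg l)) powr (1/2))"
    if c: "c \<in> coeff_space" for c and l :: "'n triple"
    using bound[OF c C(2)[of l], of "swap_triple l"] C(3)[of l] by simp
  have b2: "cmod (d (swap_triple k) * of_real (pair_weight h (swap_triple k))) \<le> pn (1/2) d * (C ^ tdeg k / (fact (tdeg k)) powr (1/2))"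
    if d: "d \<in> coeff_space" for d and k :: "'n triple"
    using bound[OF d C(2)[of "swap_triple k"], of "swap_triple k"] C(3)[of "swap_triple k"] by simp
  have "\<Phi> c d = 0"
  proof (rule bilinear_vanishes_by_density[OF _ _ _ cd])
    fix c :: "'n triple \<Rightarrow> complex" assume c: "c \<in> coeff_space"
    show "bounded_functional (\<lambda>d. \<Phi> c d)"
      unfolding \<Phi>_def
      by (intro bounded_functional_minus bounded_functional_kernel[OF _ _ C(1) b1[OF c]]
          bounded_functional_compose[OF bounded_functional_cprod_eval(2)[OF h] bounded_operator_restr]
          restr_in_coeff_space c coeff_bound(2)) auto
  next
    fix d :: "'n triple \<Rightarrow> complex" assume d: "d \<in> coeff_space"
    have re: "(\<Sum>\<^sub>\<infinity>l\<in>triples. d l * (c (swap_triple l) * of_real (pair_weight h l)))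
        = (\<Sum>\<^sub>\<infinity>k\<in>triples. c k * (d (swap_triple k) * of_real (pair_weight h (swap_triple k))))" for c
      by (subst infsum_reindex_bij_betw[OF swap_bij, symmetric]) (simp add: mult_ac)
    show "bounded_functional (\<lambda>c. \<Phi> c d)"
      unfolding \<Phi>_def re
      by (intro bounded_functional_minus bounded_functional_kernel[OF _ _ C(1) b2[OF d]]
          bounded_functional_compose[OF bounded_functional_cprod_eval(1)[OF h] bounded_operator_restr]
          restr_in_coeff_space d coeff_bound(2)) auto
  next
    fix k l :: "'n triple" assume kl: "k \<in> triples" "l \<in> triples"
    have r: "restr reduced_triples (delta i) = (if i \<in> reduced_triples then delta i else 0)" for i :: "'n triple"
      by (auto simp: fun_eq_iff restr_def delta_def)
    have z: "cprod 0 e = 0" "cprod e 0 = 0" for e :: "'n triple \<Rightarrow> complex" by (auto simp: fun_eq_iff cprod_def)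
    have "(\<Sum>\<^sub>\<infinity>i\<in>triples. delta l i * (delta k (swap_triple i) * of_real (pair_weight h i)))
        = delta k (swap_triple l) * of_real (pair_weight h l)"
      by (rule kernel_sum_delta[OF kl(2)])
    also have "\<dots> = f_series h (cprod (restr reduced_triples (delta k)) (restr reduced_triples (delta l))) base_point"
    proof (cases "k \<in> reduced_triples \<and> l \<in> reduced_triples")
      case True
      then show ?thesis
        by (auto simp: r cprod_delta kl basis_prod_at_base[OF h] delta_def)
    next
      case False
      have "delta k (swap_triple l) * complex_of_real (pair_weight h l) = 0"
        using False by (auto simp: delta_def pair_weight_def reduced_iff mmax_def swap_triple_def split: prod.splits)
      then show ?thesis
        using False bounded_functional_zero[OF bounded_functional_f_series[OF h]] by (auto simp: r z)
    qed
    finally show "\<Phi> (delta k) (delta l) = 0" by (simp add: \<Phi>_def)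
  qed
  then show "f_series h (cprod (restr reduced_triples c) (restr reduced_triples d)) base_point
    = (\<Sum>\<^sub>\<infinity>l\<in>triples. d l * (c (swap_triple l) * of_real (pair_weight h l)))"
    by (simp add: \<Phi>_def)
  show "(\<lambda>l. norm (d l * (c (swap_triple l) * of_real (pair_weight h l)))) summable_on triples"
    by (rule kernel_sum(1)[OF cd(2) _ _ _ _ C(1) b1[OF cd(1)], of "1/4"]) (use coeff_bound(2)[OF cd(1)] in auto)
qed

lemma restr_red_space: "c \<in> red_space \<Longrightarrow> restr reduced_triples c = c"
  by (auto simp: restr_def red_space_def fun_eq_iff)

lemma cnj_disc_series: "(\<lambda>v. cnj (disc_series h c v)) = disc_series h (conj_coeffs c)"
  by (simp add: fun_eq_iff disc_series_def quot_class_def f_series_conj)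

text \<open>For reduced coefficients \<open>c\<close> the vacuum expectation of the square is \<open>\<Sum>Q wt Q |c(0, Q)|\<^sup>2\<close> with positive
  weights.\<close>

lemma J_zero_eq:
  assumes h: "0 < h"
  shows "J_zero h = {F \<in> (Ahat_disc h :: (complex ^ 'n::finite \<Rightarrow> complex) set). \<forall>Q. kap h F (mtri 0 Q) = 0}"
proof -
  have "star_disc h (\<lambda>v. cnj (F v)) F 0 = 0 \<longleftrightarrow> (\<forall>Q. kap h F (mtri 0 Q) = 0)"
    if F: "F \<in> Ahat_disc h" for F :: "complex ^ 'n \<Rightarrow> complex"
  proof -
    define c where "c = kap h F"
    have c: "c \<in> red_space" "F = disc_series h c" using Ahat_disc_cases[OF h F] by (auto simp: c_def)
    note cc = red_space_coeff[OF c(1)] and cj = conj_coeffs_in_coeff_space[OF red_space_coeff[OF c(1)]]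
    define t where "t l = (cmod (c l))\<^sup>2 * pair_weight h l" for l
    have r: "restr reduced_triples (conj_coeffs c) = conj_coeffs c"
      using c(1) by (auto simp: fun_eq_iff restr_def conj_coeffs_def red_space_def reduced_iff mmax_def
          swap_triple_def max.commute split: prod.splits)
    have te: "c l * (conj_coeffs c (swap_triple l) * of_real (pair_weight h l)) = of_real (t l)" for l
      by (simp add: conj_coeffs_def t_def flip: complex_norm_square mult.assoc)
    have t0: "0 \<le> t l" for l
      by (auto simp: t_def pair_weight_def
          intro!: mult_nonneg_nonneg divide_nonneg_nonneg less_imp_le[OF level_fac_pos[OF h]])
    have ts: "t summable_on triples"
      using product_at_base(2)[OF h cj cc] t0 unfolding te by simp
    have "star_disc h (\<lambda>v. cnj (F v)) F 0 = f_series h (cprod (conj_coeffs c) c) base_point"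
      unfolding c(2) cnj_disc_series star_disc_disc_series[OF h cj cc] by (rule disc_series_at_zero[OF cprod_in_coeff_space[OF cj cc]])
    also have "\<dots> = (\<Sum>\<^sub>\<infinity>l\<in>triples. of_real (t l))"
      using product_at_base(1)[OF h cj cc] unfolding te r restr_red_space[OF c(1)] .
    also have "\<dots> = of_real (infsum t triples)"
      using has_sum_of_real[OF has_sum_infsum[OF ts]] by (rule infsumI)
    finally have eq: "star_disc h (\<lambda>v. cnj (F v)) F 0 = 0 \<longleftrightarrow> infsum t triples = 0" by simp
    have pw: "0 < pair_weight h (mtri 0 Q)" for Q :: "'n mindex"
    proof -
      have "fst (mtri 0 Q :: 'n triple) = 0" by (simp add: mtri_def)
      then show ?thesis
        unfolding pair_weight_def by (simp add: level_fac_pos[OF h] mfact_pos divide_pos_pos)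
    qed
    show ?thesis
      unfolding eq
    proof
      assume "infsum t triples = 0"
      then have "t l = 0" if "l \<in> triples" for l
        using nonneg_infsum_le_0D[OF _ ts t0 that] by simp
      then have tQ: "t (mtri 0 Q) = 0" for Q by simp
      have "c (mtri 0 Q) = 0" for Q
        using tQ[of Q] pw[of Q] by (simp add: t_def)
      then show "\<forall>Q. kap h F (mtri 0 Q) = 0"
        by (simp add: c_def)
    next
      assume *: "\<forall>Q. kap h F (mtri 0 Q) = 0"
      have "t l = 0" for l
      proof (cases "l \<in> reduced_triples \<and> fst l = 0")
        case True
        then obtain Q where "l = mtri 0 Q" by (auto simp: reduced_triples_def mtri_def)
        then show ?thesis using * by (simp add: t_def c_def)
      qed (auto simp: t_def pair_weight_def)
      then show "infsum t triples = 0" by (intro infsum_0)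
    qed
  qed
  then show ?thesis by (auto simp: J_zero_def)
qed


section \<open>The topology on the disc algebra\<close>

lemma topspace_top_disc:
  "0 < h \<Longrightarrow> topspace (top_disc h) = (Ahat_disc h :: (complex ^ 'n::finite \<Rightarrow> complex) set)"
  by (simp add: top_disc_def topspace_quotient_topology topspace_top_cone Ahat_disc_def)

lemma limitin_top_discI:
  assumes h: "0 < h" and c: "c \<in> coeff_space" "\<And>x. g x \<in> coeff_space"
    and lim: "\<And>\<epsilon>. 0 < \<epsilon> \<Longrightarrow> \<epsilon> < 1 \<Longrightarrow> ((\<lambda>x. pn \<epsilon> (g x - c)) \<longlongrightarrow> 0) F"
  shows "limitin (top_disc h) (\<lambda>x. disc_series h (g x)) (disc_series h c) F"
proof -
  have "continuous_map (top_cone h) (top_disc h) quot_class"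
    unfolding top_disc_def by (intro quotient_imp_continuous_map quotient_map_quotient_topology)
  from continuous_map_limit[OF this limitin_top_coneI[OF h c lim]] show ?thesis
    by (simp add: o_def disc_series_def)
qed

text \<open>Reduction is a bounded operator, so the norms of the reduced coefficients are continuous on the cone
  algebra and descend to the quotient.\<close>

lemma openin_disc_ball:
  fixes G :: "complex ^ 'n::finite \<Rightarrow> complex"
  assumes h: "0 < h" and G: "G \<in> Ahat_disc h" and e: "0 < \<epsilon>" "\<epsilon> < 1"
  shows "openin (top_disc h) {F \<in> Ahat_disc h. pn \<epsilon> (kap h F - kap h G) < r}"
  unfolding top_disc_def openin_quotient_topology topspace_top_cone[OF h]
proof (intro conjI)
  let ?O = "{F \<in> Ahat_disc h. pn \<epsilon> (kap h F - kap h G) < r}"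
  show "?O \<subseteq> quot_class ` Ahat_cone h" by (auto simp: Ahat_disc_def)
  show "openin (top_cone h) {x \<in> Ahat_cone h. quot_class x \<in> ?O}"
    unfolding openin_top_cone[OF h]
  proof (intro conjI ballI impI)
    fix c :: "'n triple \<Rightarrow> complex"
    assume c: "c \<in> coeff_space" "f_series h c \<in> {x \<in> Ahat_cone h. quot_class x \<in> ?O}"
    note g = red_space_coeff[OF Ahat_disc_cases(1)[OF h G]] and R = Red_in_coeff_space[OF h]
    have lt: "pn \<epsilon> (Red h c - kap h G) < r"
      using c by (simp flip: disc_series_def add: kap_disc_series[OF h])
    obtain \<epsilon>' B where B: "0 < \<epsilon>'" "\<epsilon>' < 1" "0 \<le> B"
      "\<And>c :: 'n triple \<Rightarrow> complex. c \<in> coeff_space \<Longrightarrow> pn \<epsilon> (Red h c) \<le> B * pn \<epsilon>' c"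
      by (rule bounded_operatorE[OF bounded_operator_Red[OF h] e]) blast
    define s where "s = (r - pn \<epsilon> (Red h c - kap h G)) / (B + 1)"
    have s: "0 < s" "(B + 1) * s = r - pn \<epsilon> (Red h c - kap h G)" using lt B(3) by (auto simp: s_def)
    have "f_series h d \<in> {x \<in> Ahat_cone h. quot_class x \<in> ?O}"
      if d: "d \<in> coeff_space" "pn \<epsilon>' (d - c) < s" for d
    proof -
      have dc: "d - c \<in> coeff_space" by (rule coeff_space_diff[OF d(1) c(1)])
      have eq: "Red h d - kap h G = Red h (d - c) + (Red h c - kap h G)"
        by (simp add: bounded_operator_diff[OF bounded_operator_Red[OF h] d(1) c(1)])
      have "pn \<epsilon> (Red h d - kap h G) \<le> pn \<epsilon> (Red h (d - c)) + pn \<epsilon> (Red h c - kap h G)"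
        unfolding eq by (rule pn_triangle[OF R[OF dc] coeff_space_diff[OF R[OF c(1)] g] e])
      moreover have "pn \<epsilon> (Red h (d - c)) \<le> B * s"
        using B(4)[OF dc] mult_left_mono[OF less_imp_le[OF d(2)] B(3)] by linarith
      moreover have "B * s < (B + 1) * s" using s(1) by simp
      ultimately have "pn \<epsilon> (Red h d - kap h G) < r" using s(2) by linarith
      then show ?thesis
        using d(1) by (simp flip: disc_series_def add: kap_disc_series[OF h] disc_series_in_Ahat_disc f_series_in_Ahat)
    qed
    then show "\<exists>\<epsilon> r'. 0 < \<epsilon> \<and> \<epsilon> < 1 \<and> 0 < r' \<and> (\<forall>d\<in>coeff_space. pn \<epsilon> (d - c) < r' \<longrightarrow>
        f_series h d \<in> {x \<in> Ahat_cone h. quot_class x \<in> ?O})"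
      using B s(1) by blast
  qed auto
qed

lemma limitin_top_discD:
  assumes h: "0 < h" and g: "\<And>x. g x \<in> red_space"
    and lim: "limitin (top_disc h) (\<lambda>x. disc_series h (g x)) G F" and e: "0 < \<epsilon>" "\<epsilon> < 1"
  shows "((\<lambda>x. pn \<epsilon> (g x - kap h G)) \<longlongrightarrow> 0) F"
proof (rule order_tendstoI)
  have G: "G \<in> Ahat_disc h" using limitin_topspace[OF lim] by (simp only: topspace_top_disc[OF h])
  {
    fix r :: real assume "0 < r"
    then have "G \<in> {F \<in> Ahat_disc h. pn \<epsilon> (kap h F - kap h G) < r}"
      using G by (simp only: mem_Collect_eq diff_self pn_zero)
    then have "eventually (\<lambda>x. disc_series h (g x) \<in> {F \<in> Ahat_disc h. pn \<epsilon> (kap h F - kap h G) < r}) F"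
      using lim openin_disc_ball[OF h G e] unfolding limitin_def by blast
    then show "eventually (\<lambda>x. pn \<epsilon> (g x - kap h G) < r) F"
      by eventually_elim (simp add: kap_disc_series_reduced[OF h g])
  }
  fix r :: real assume "r < 0"
  moreover have "0 \<le> pn \<epsilon> (g x - kap h G)" for x
    by (intro coeff_bound(2) coeff_space_diff e red_space_coeff g Ahat_disc_cases(1)[OF h G])
  ultimately show "eventually (\<lambda>x. r < pn \<epsilon> (g x - kap h G)) F"
    by (intro always_eventually allI) (rule less_le_trans)
qed

text \<open>The quotient seminorms control the coefficients, so the coefficients of a convergent series of
  basis functions are those of its sum.\<close>

lemma coefficients_of_series:
  fixes \<iota> :: "'i \<Rightarrow> 'n::finite triple"
  assumes h: "0 < h" and \<iota>: "\<And>i. \<iota> i \<in> reduced_triples" "inj \<iota>"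
    and ser: "series_sums (top_disc h) (\<lambda>i. a i \<cdot>\<^sub>C disc_series h (delta (\<iota> i))) G"
  shows "G \<in> Ahat_disc h" "kap h G (\<iota> i) = a i" "k \<notin> range \<iota> \<Longrightarrow> kap h G k = 0"
proof -
  define p where "p S = (\<Sum>i\<in>S. a i \<cdot>\<^sub>C delta (\<iota> i))" for S
  have m: "delta (\<iota> i) \<in> red_space" for i by (rule delta_in_red_space[OF \<iota>(1)])
  have p: "p S \<in> red_space" for S
    unfolding p_def by (intro cfun.subspace_sum[OF red_space_subspace] cfun.subspace_scale[OF red_space_subspace] m)
  have "disc_series h (p S) = (\<Sum>i\<in>S. a i \<cdot>\<^sub>C disc_series h (delta (\<iota> i)))" for S
  proof -
    have "disc_series h (p S) = (\<Sum>i\<in>S. disc_series h (a i \<cdot>\<^sub>C delta (\<iota> i)))"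
      unfolding p_def by (intro disc_series_sum[OF h] coeff_space_scale red_space_coeff m)
    then show ?thesis by (simp only: disc_series_scale[OF h red_space_coeff[OF m]])
  qed
  then have lim: "limitin (top_disc h) (\<lambda>S. disc_series h (p S)) G (finite_subsets_at_top UNIV)"
    using ser by (simp add: series_sums_def)
  show G: "G \<in> Ahat_disc h" using limitin_topspace[OF lim] by (simp only: topspace_top_disc[OF h])
  have "((\<lambda>S. pn (1/2) (p S - kap h G)) \<longlongrightarrow> 0) (finite_subsets_at_top UNIV)"
    by (rule limitin_top_discD[OF h p lim]) auto
  then have co: "((\<lambda>S. p S k) \<longlongrightarrow> kap h G k) (finite_subsets_at_top UNIV)" for k
    by (rule pn_limit_coordinate[OF red_space_coeff[OF Ahat_disc_cases(1)[OF h G]] red_space_coeff[OF p], rotated 2]) auto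
  show "kap h G (\<iota> i) = a i"
  proof (rule tendsto_unique[OF _ co])
    have "eventually (\<lambda>S. p S (\<iota> i) = a i) (finite_subsets_at_top UNIV)"
      using eventually_finite_subsets_at_top_weakI[of UNIV "\<lambda>S. True"]
      unfolding eventually_finite_subsets_at_top
    proof (intro exI[of _ "{i}"] conjI allI impI)
      fix S assume S: "finite S \<and> {i} \<subseteq> S \<and> S \<subseteq> UNIV"
      have "p S (\<iota> i) = (\<Sum>j\<in>S. if j = i then a i else 0)"
        unfolding p_def sum_fun_apply using \<iota>(2) by (intro sum.cong) (auto simp: delta_def inj_eq)
      then show "p S (\<iota> i) = a i" using S by simp
    qed auto
    then show "((\<lambda>S. p S (\<iota> i)) \<longlongrightarrow> a i) (finite_subsets_at_top UNIV)"
      by (rule tendsto_eventually)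
  qed simp
  show "kap h G k = 0" if k: "k \<notin> range \<iota>"
  proof (rule tendsto_unique[OF _ co])
    have "p S k = 0" for S
      unfolding p_def sum_fun_apply using k by (intro sum.neutral) (auto simp: delta_def)
    then show "((\<lambda>S. p S k) \<longlongrightarrow> 0) (finite_subsets_at_top UNIV)" by simp
  qed simp
qed

text \<open>Absolute convergence in a norm bounds the distance of a partial sum to the sum of the coordinates by
  the tail of the series of norms.\<close>

lemma series_converges:
  fixes g :: "'i \<Rightarrow> 'n::finite triple \<Rightarrow> complex"
  assumes h: "0 < h" and g: "\<And>i. g i \<in> coeff_space" and s: "s \<in> coeff_space"
    and summ: "\<And>\<epsilon>. 0 < \<epsilon> \<Longrightarrow> \<epsilon> < 1 \<Longrightarrow> (\<lambda>i. pn \<epsilon> (g i)) summable_on UNIV"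
    and sum: "\<And>k. ((\<lambda>i. g i k) has_sum s k) UNIV"
  shows "series_sums (top_disc h) (\<lambda>i. disc_series h (g i)) (disc_series h s)"
proof -
  have "limitin (top_disc h) (\<lambda>S. disc_series h (\<Sum>i\<in>S. g i)) (disc_series h s) (finite_subsets_at_top UNIV)"
  proof (rule limitin_top_discI[OF h s coeff_space_sum[OF g]])
    fix \<epsilon> :: real assume e: "0 < \<epsilon>" "\<epsilon> < 1"
    define X where "X = (\<Sum>\<^sub>\<infinity>i. pn \<epsilon> (g i))"
    have p0: "0 \<le> pn \<epsilon> (g i)" for i by (rule coeff_bound(2)[OF g e])
    have le: "pn \<epsilon> ((\<Sum>i\<in>S. g i) - s) \<le> X - (\<Sum>i\<in>S. pn \<epsilon> (g i))" if S: "finite S" for S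
    proof -
      have rest: "((\<lambda>i. pn \<epsilon> (g i)) has_sum X - (\<Sum>i\<in>S. pn \<epsilon> (g i))) (UNIV - S)"
        unfolding X_def by (rule has_sum_Diff[OF has_sum_infsum[OF summ[OF e]] has_sum_finite[OF S]]) simp
      show ?thesis
      proof (rule pn_le)
        fix k :: "'n triple"
        define F where "F = (fact (tdeg k) :: real) powr \<epsilon>"
        have "((\<lambda>i. g i k) has_sum s k - (\<Sum>i\<in>S. g i k)) (UNIV - S)"
          by (rule has_sum_Diff[OF sum has_sum_finite[OF S]]) simp
        moreover have "((\<lambda>i. pn \<epsilon> (g i) * F) has_sum (X - (\<Sum>i\<in>S. pn \<epsilon> (g i))) * F) (UNIV - S)"
          by (rule has_sum_cmult_left[OF rest])
        ultimately have "norm (s k - (\<Sum>i\<in>S. g i k)) \<le> (X - (\<Sum>i\<in>S. pn \<epsilon> (g i))) * F"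
          by (rule norm_infsum_le) (simp add: F_def coeff_bound(1)[OF g e])
        then show "cmod (((\<Sum>i\<in>S. g i) - s) k) \<le> (X - (\<Sum>i\<in>S. pn \<epsilon> (g i))) * (fact (tdeg k)) powr \<epsilon>"
          by (simp add: sum_fun_apply F_def norm_minus_commute)
      qed
    qed
    have "((\<lambda>S. X - (\<Sum>i\<in>S. pn \<epsilon> (g i))) \<longlongrightarrow> X - X) (finite_subsets_at_top UNIV)"
      unfolding X_def by (intro tendsto_diff tendsto_const infsum_tendsto summ e)
    then have lim: "((\<lambda>S. X - (\<Sum>i\<in>S. pn \<epsilon> (g i))) \<longlongrightarrow> 0) (finite_subsets_at_top UNIV)" by simp
    show "((\<lambda>S. pn \<epsilon> ((\<Sum>i\<in>S. g i) - s)) \<longlongrightarrow> 0) (finite_subsets_at_top UNIV)"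
    proof (rule Lim_null_comparison[OF _ lim])
      show "eventually (\<lambda>S. norm (pn \<epsilon> ((\<Sum>i\<in>S. g i) - s)) \<le> X - (\<Sum>i\<in>S. pn \<epsilon> (g i))) (finite_subsets_at_top UNIV)"
      proof (rule eventually_finite_subsets_at_top_weakI)
        fix S :: "'i set" assume "finite S"
        moreover have "0 \<le> pn \<epsilon> ((\<Sum>i\<in>S. g i) - s)"
          by (intro coeff_bound(2) coeff_space_diff coeff_space_sum g s e)
        ultimately show "norm (pn \<epsilon> ((\<Sum>i\<in>S. g i) - s)) \<le> X - (\<Sum>i\<in>S. pn \<epsilon> (g i))"
          using le by simp
      qed
    qed
  qed
  then show ?thesis
    by (simp add: series_sums_def disc_series_sum[OF h g])
qed


section \<open>The GNS representation\<close>

text \<open>The coefficients that survive modulo the Gel'fand ideal.\<close>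

definition vac :: "('n::finite triple \<Rightarrow> complex) \<Rightarrow> 'n triple \<Rightarrow> complex"
  where "vac = restr {k. fst k = 0}"

lemma vac_in_red_space: "c \<in> red_space \<Longrightarrow> vac c \<in> red_space"
  by (simp add: vac_def red_space_def restr_in_coeff_space) (simp add: restr_def)

lemma summable_on_fact_mdeg:
  assumes d: "0 < \<delta>"
  shows "(\<lambda>Q :: 'n::finite mindex. 1 / (fact (mdeg Q)) powr \<delta> :: real) summable_on UNIV"
proof -
  have inj: "inj (\<lambda>Q :: 'n mindex. mtri 0 Q)" by (rule injI) simp
  have "(\<lambda>k :: 'n triple. 1 ^ tdeg k / (fact (tdeg k)) powr \<delta> :: real) summable_on range (\<lambda>Q. mtri 0 Q)"
    by (rule summable_on_subset_banach[OF summable_on_triples]) (use d in auto)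
  then show ?thesis
    unfolding summable_on_reindex[OF inj] by (simp add: o_def)
qed

lemma D_space_eq:
  fixes h :: real
  assumes h: "0 < h"
  shows "D_space h = {F \<in> (Ahat_disc h :: (complex ^ 'n::finite \<Rightarrow> complex) set). vac (kap h F) = kap h F}"
proof (intro equalityI subsetI)
  fix F :: "complex ^ 'n \<Rightarrow> complex"
  assume "F \<in> D_space h"
  then obtain c where c: "series_sums (top_disc h) (\<lambda>Q. c Q \<cdot>\<^sub>C disc_series h (delta (mtri 0 Q))) F"
    by (auto simp: D_space_def f_disc_eq_disc_series)
  have inj: "inj (\<lambda>Q :: 'n mindex. mtri 0 Q)" by (rule injI) simp
  note co = coefficients_of_series[OF h mtri_simps(1) inj c]
  have F: "F \<in> Ahat_disc h" by (rule co(1))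
  have "kap h F k = 0" if "fst k \<noteq> 0" for k
  proof (rule co(3))
    show "k \<notin> range (\<lambda>Q. mtri 0 Q)" using that by (auto simp: mtri_def)
  qed
  then have "vac (kap h F) = kap h F"
    by (intro ext) (metis (mono_tags, lifting) mem_Collect_eq restr_def vac_def)
  with F show "F \<in> {F \<in> Ahat_disc h. vac (kap h F) = kap h F}" by simp
next
  fix F :: "complex ^ 'n \<Rightarrow> complex"
  assume "F \<in> {F \<in> Ahat_disc h. vac (kap h F) = kap h F}"
  then have F: "F \<in> Ahat_disc h" and v: "vac (kap h F) = kap h F" by auto
  define c where "c = kap h F"
  have c: "c \<in> red_space" "F = disc_series h c" using Ahat_disc_cases[OF h F] by (auto simp: c_def)
  note cc = red_space_coeff[OF c(1)]
  have supp: "c k = 0" if "k \<notin> range (\<lambda>Q. mtri 0 Q)" for k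
  proof (rule ccontr)
    assume nz: "c k \<noteq> 0"
    then have "k \<in> reduced_triples" using c(1) unfolding red_space_def by blast
    moreover have "fst k = 0"
    proof (rule ccontr)
      assume "fst k \<noteq> 0"
      then have "vac c k = 0" by (simp add: vac_def restr_def)
      then show False using v nz by (simp add: c_def)
    qed
    ultimately show False using that by (auto simp: reduced_triples_def mtri_def)
  qed
  have "subfactorial_growth (\<lambda>Q. c (mtri 0 Q))"
    unfolding subfactorial_growth_def
  proof (intro allI impI)
    fix \<epsilon> :: real assume e: "0 < \<epsilon>"
    define \<epsilon>' where "\<epsilon>' = min \<epsilon> (1/2)"
    have e': "0 < \<epsilon>'" "\<epsilon>' < 1" "\<epsilon>' \<le> \<epsilon>" using e by (auto simp: \<epsilon>'_def)
    have "cmod (c (mtri 0 Q)) \<le> pn \<epsilon>' c * (fact (mdeg Q)) powr \<epsilon>" for Q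
    proof -
      have "cmod (c (mtri 0 Q)) \<le> pn \<epsilon>' c * (fact (mdeg Q)) powr \<epsilon>'"
        using coeff_bound(1)[OF cc e'(1,2), of "mtri 0 Q"] by simp
      also have "\<dots> \<le> pn \<epsilon>' c * (fact (mdeg Q)) powr \<epsilon>"
        by (intro mult_left_mono powr_mono e' coeff_bound(2)[OF cc e'(1,2)]) simp
      finally show ?thesis .
    qed
    then show "\<exists>C. \<forall>Q. cmod (c (mtri 0 Q)) \<le> C * (fact (mdeg Q)) powr \<epsilon>" by blast
  qed
  moreover have "series_sums (top_disc h) (\<lambda>Q. c (mtri 0 Q) \<cdot>\<^sub>C f_disc h 0 Q) F"
  proof -
    define g where "g Q = c (mtri 0 Q) \<cdot>\<^sub>C delta (mtri 0 Q)" for Q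
    have g: "g Q = restr {mtri 0 Q} c" for Q by (auto simp: g_def restr_def delta_def fun_eq_iff)
    have gm: "g Q \<in> coeff_space" for Q unfolding g by (rule restr_in_coeff_space[OF cc])
    have "series_sums (top_disc h) (\<lambda>Q. disc_series h (g Q)) (disc_series h c)"
    proof (rule series_converges[OF h gm cc])
      fix \<epsilon> :: real assume e: "0 < \<epsilon>" "\<epsilon> < 1"
      have "(\<lambda>Q :: 'n mindex. pn (\<epsilon>/2) c * (1 / (fact (mdeg Q)) powr (\<epsilon> - \<epsilon>/2))) summable_on UNIV"
        by (intro summable_on_cmult_right summable_on_fact_mdeg) (use e in auto)
      then show "(\<lambda>Q. pn \<epsilon> (g Q)) summable_on UNIV"
      proof (rule summable_on_comparison_test)
        fix Q :: "'n mindex"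
        have "pn \<epsilon> (g Q) \<le> pn (\<epsilon>/2) c / (fact (mdeg Q)) powr (\<epsilon> - \<epsilon>/2)"
          unfolding g by (rule pn_restr_high_degree[OF cc]) (use e in auto)
        then show "pn \<epsilon> (g Q) \<le> pn (\<epsilon>/2) c * (1 / (fact (mdeg Q)) powr (\<epsilon> - \<epsilon>/2))" by simp
        show "0 \<le> pn \<epsilon> (g Q)" by (rule coeff_bound(2)[OF gm e])
      qed
    next
      fix k :: "'n triple"
      show "((\<lambda>Q. g Q k) has_sum c k) UNIV"
      proof (cases "k \<in> range (\<lambda>Q. mtri 0 Q)")
        case True
        then obtain Q where Q: "k = mtri 0 Q" by blast
        show ?thesis
          by (rule has_sum_finite_neutralI[of "{Q}"]) (auto simp: g_def Q delta_def)
      next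
        case False
        then have "g Q k = 0" for Q by (auto simp: g_def delta_def)
        then show ?thesis by (simp add: supp[OF False])
      qed
    qed
    then show ?thesis
      by (simp add: c(2) g_def f_disc_eq_disc_series disc_series_scale[OF h] delta_in_coeff_space)
  qed
  ultimately show "F \<in> D_space h" unfolding D_space_def by blast
qed

lemma reduced_fst_zero: "k \<in> reduced_triples \<Longrightarrow> fst k = 0 \<Longrightarrow> k = mtri 0 (fst (snd k))"
  by (auto simp: reduced_triples_def mtri_def)

lemma vac_eqI:
  assumes "c \<in> red_space" "d \<in> red_space" "\<And>Q. c (mtri 0 Q) = d (mtri 0 Q)"
  shows "vac c = vac d"
proof
  fix k
  show "vac c k = vac d k"
  proof (cases "k \<in> reduced_triples \<and> fst k = 0")
    case True
    then have "k = mtri 0 (fst (snd k))" by (intro reduced_fst_zero) auto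
    then have "c k = d k" using assms(3) by metis
    then show ?thesis by (simp add: vac_def restr_def)
  next
    case False
    then have "c k = 0 \<and> d k = 0 \<or> fst k \<noteq> 0" using assms(1,2) unfolding red_space_def by blast
    then show ?thesis by (auto simp: vac_def restr_def)
  qed
qed

lemma vac_mtri [simp]: "vac c (mtri 0 Q) = c (mtri 0 Q)"
  by (simp add: vac_def restr_def) (simp add: mtri_def)

lemma vac_idem: "vac (vac c) = vac c"
  by (rule ext) (simp add: vac_def restr_def)

lemma pr_D_eq:
  assumes h: "0 < h" and b: "b \<in> Ahat_disc h"
  shows "pr_D h b = disc_series h (vac (kap h b))"
  unfolding pr_D_def
proof (rule the_equality)
  note k = Ahat_disc_cases[OF h b]
  have v: "vac (kap h b) \<in> red_space" by (rule vac_in_red_space[OF k(1)])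
  have d: "disc_series h (vac (kap h b)) \<in> Ahat_disc h" by (rule disc_series_in_Ahat_disc[OF red_space_coeff[OF v]])
  show "disc_series h (vac (kap h b)) \<in> D_space h \<and> b - disc_series h (vac (kap h b)) \<in> J_zero h"
    unfolding D_space_eq[OF h] J_zero_eq[OF h]
    using kap_diff[OF h b d] d by (simp add: kap_disc_series_reduced[OF h v] vac_idem)
next
  fix d assume "d \<in> D_space h \<and> b - d \<in> J_zero h"
  then have d: "d \<in> Ahat_disc h" "vac (kap h d) = kap h d" and j: "\<And>Q. kap h (b - d) (mtri 0 Q) = 0"
    by (auto simp: D_space_eq[OF h] J_zero_eq[OF h])
  have "vac (kap h d) = vac (kap h b)"
  proof (rule vac_eqI[OF Ahat_disc_cases(1)[OF h d(1)] Ahat_disc_cases(1)[OF h b]])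
    fix Q show "kap h d (mtri 0 Q) = kap h b (mtri 0 Q)"
      using j[of Q] by (simp add: kap_diff(1)[OF h b d(1)])
  qed
  then show "d = disc_series h (vac (kap h b))"
    using d(2) Ahat_disc_cases(2)[OF h d(1)] by simp
qed

lemma pr_D_in_D_space:
  assumes h: "0 < h" and b: "b \<in> Ahat_disc h"
  shows "pr_D h b \<in> D_space h" "b - pr_D h b \<in> J_zero h"
proof -
  note k = Ahat_disc_cases[OF h b]
  have v: "vac (kap h b) \<in> red_space" by (rule vac_in_red_space[OF k(1)])
  have d: "disc_series h (vac (kap h b)) \<in> Ahat_disc h" by (rule disc_series_in_Ahat_disc[OF red_space_coeff[OF v]])
  show "pr_D h b \<in> D_space h" "b - pr_D h b \<in> J_zero h"
    unfolding pr_D_eq[OF h b] D_space_eq[OF h] J_zero_eq[OF h]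
    using kap_diff[OF h b d] d by (simp_all add: kap_disc_series_reduced[OF h v] vac_idem)
qed

lemma star_disc_eq:
  assumes h: "0 < h" and ab: "a \<in> Ahat_disc h" "b \<in> Ahat_disc h"
  shows "star_disc h a b = disc_series h (cprod (kap h a) (kap h b))"
    and "star_disc h a b \<in> Ahat_disc h"
    and "kap h (star_disc h a b) = Red h (cprod (kap h a) (kap h b))"
proof -
  note a = Ahat_disc_cases[OF h ab(1)] and b = Ahat_disc_cases[OF h ab(2)]
  have m: "cprod (kap h a) (kap h b) \<in> coeff_space"
    by (intro cprod_in_coeff_space red_space_coeff a b)
  show eq: "star_disc h a b = disc_series h (cprod (kap h a) (kap h b))"
    using star_disc_disc_series[OF h red_space_coeff[OF a(1)] red_space_coeff[OF b(1)]] by (simp only: a(2) b(2))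
  show "star_disc h a b \<in> Ahat_disc h" unfolding eq by (rule disc_series_in_Ahat_disc[OF m])
  show "kap h (star_disc h a b) = Red h (cprod (kap h a) (kap h b))"
    unfolding eq by (rule kap_disc_series[OF h m])
qed

lemma fst_stri:
  assumes "T \<le> exK k"
  shows "fst (stri k l T) = 0 \<longleftrightarrow> fst l = 0 \<and> T \<circ> Some = fst k"
proof -
  have le: "T (Some j) \<le> fst k j" for j
    using assms by (auto simp: le_fun_def exK_def dest: spec[of _ "Some j"])
  have "fst k j \<le> T (Some j) \<longleftrightarrow> T (Some j) = fst k j" for j
    using le[of j] by arith
  then show ?thesis
    by (simp add: stri_def tri_def exK_def fun_eq_iff all_conj_distrib conj_commute)
qed

lemma red_basis_vac:
  assumes h: "0 < h" and k: "k \<in> triples"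
  shows "vac (red_basis h k) = (if fst k = 0
    then of_real (level_fac h k / level_fac h (mtri 0 (fst (snd k)))) \<cdot>\<^sub>C delta (mtri 0 (fst (snd k))) else 0)"
proof
  fix i
  have nz: "fst k = 0 \<and> i = mtri 0 (fst (snd k))" if "vac (red_basis h k) i \<noteq> 0"
  proof -
    have i: "fst i = 0" "red_basis h k i \<noteq> 0" using that by (auto simp: vac_def restr_def split: if_splits)
    obtain R where R: "i = lift_triple k R" by (rule red_basis_nonzero[OF i(2)])
    have "fst k + R = 0" using i(1) by (simp add: R lift_triple_def mtri_def)
    then have "fst k = 0" "R = 0" by (auto simp: fun_eq_iff)
    then show ?thesis by (simp add: R lift_triple_def)
  qed
  show "vac (red_basis h k) i = (if fst k = 0
      then of_real (level_fac h k / level_fac h (mtri 0 (fst (snd k)))) \<cdot>\<^sub>C delta (mtri 0 (fst (snd k))) else 0) i"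
  proof (cases "fst k = 0 \<and> i = mtri 0 (fst (snd k))")
    case True
    then have i: "i = lift_triple k 0" by (simp add: lift_triple_def)
    have "vac (red_basis h k) i = red_basis h k i" using True by simp
    then show ?thesis
      using True i red_basis_lift[of 0 k h] by (simp add: level_coeff_at_zero delta_def)
  next
    case False
    then show ?thesis using nz by (auto simp: delta_def)
  qed
qed

lemma bounded_functional_vac_Red:
  assumes h: "0 < h"
  shows "bounded_functional (\<lambda>c. vac (Red h c) i)"
  unfolding vac_def
  by (rule bounded_functional_compose[OF bounded_functional_compose[OF bounded_functional_coordinate
        bounded_operator_restr] bounded_operator_Red[OF h]])

lemma vac_Red_basis_prod:
  assumes h: "0 < h" and kl: "k \<in> triples" "l \<in> triples"
  shows "vac (Red h (basis_prod k l)) i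
    = (\<Sum>T | T \<le> exK k \<and> T \<le> exL l. sfac k l T * vac (red_basis h (stri k l T)) i)"
proof -
  have st: "delta (stri k l T) \<in> coeff_space" if "T \<in> {T. T \<le> exK k \<and> T \<le> exL l}" for T
    using that by (intro delta_in_coeff_space stri_in_triples kl) auto
  note L = bounded_functional_vac_Red[OF h]
  have "vac (Red h (basis_prod k l)) i
      = (\<Sum>T | T \<le> exK k \<and> T \<le> exL l. vac (Red h (sfac k l T \<cdot>\<^sub>C delta (stri k l T))) i)"
    unfolding basis_prod_def by (rule bounded_functional_sum[OF L]) (rule coeff_space_scale[OF st])
  also have "\<dots> = (\<Sum>T | T \<le> exK k \<and> T \<le> exL l. sfac k l T * vac (red_basis h (stri k l T)) i)"
  proof (rule sum.cong[OF refl])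
    fix T assume T: "T \<in> {T. T \<le> exK k \<and> T \<le> exL l}"
    have "vac (Red h (sfac k l T \<cdot>\<^sub>C delta (stri k l T))) i = sfac k l T * vac (Red h (delta (stri k l T))) i"
      by (rule bounded_functional_scale[OF L st[OF T]])
    also have "Red h (delta (stri k l T)) = red_basis h (stri k l T)"
      by (rule Red_delta) (use T kl in \<open>auto intro: stri_in_triples\<close>)
    finally show "vac (Red h (sfac k l T \<cdot>\<^sub>C delta (stri k l T))) i = sfac k l T * vac (red_basis h (stri k l T)) i" .
  qed
  finally show ?thesis .
qed

text \<open>The Wick product differentiates only the antiholomorphic part of the right factor, and reduction never
  lowers an exponent \<open>P\<close>; so if the right factor has no terms with \<open>P = 0\<close>, neither has the product.\<close>

lemma J_zero_left_ideal:
  assumes h: "0 < h" and a: "a \<in> Ahat_disc h" and j: "j \<in> J_zero h"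
  shows "star_disc h a j \<in> J_zero h"
proof -
  define D where "D = {k :: 'a triple. fst k \<noteq> 0}"
  have j': "j \<in> Ahat_disc h" "\<And>Q. kap h j (mtri 0 Q) = 0" using j by (auto simp: J_zero_eq[OF h])
  note A = red_space_coeff[OF Ahat_disc_cases(1)[OF h a]] and B = red_space_coeff[OF Ahat_disc_cases(1)[OF h j'(1)]]
  have jD: "restr D (kap h j) = kap h j"
  proof
    fix k
    show "restr D (kap h j) k = kap h j k"
    proof (cases "k \<in> reduced_triples \<and> fst k = 0")
      case True
      then have "k = mtri 0 (fst (snd k))" by (intro reduced_fst_zero) auto
      then have "kap h j k = 0" using j'(2) by metis
      then show ?thesis by (simp add: restr_def)
    next
      case False
      then have "kap h j k = 0 \<or> fst k \<noteq> 0" using Ahat_disc_cases(1)[OF h j'(1)] unfolding red_space_def by blast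
      then show ?thesis by (auto simp: restr_def D_def)
    qed
  qed
  have "vac (Red h (cprod c (restr D d))) i = 0" if cd: "c \<in> coeff_space" "d \<in> coeff_space" for c d and i :: "'a triple"
  proof (rule bilinear_vanishes_by_density[of "\<lambda>c d. vac (Red h (cprod c (restr D d))) i", OF _ _ _ cd])
    show "bounded_functional (\<lambda>c. vac (Red h (cprod c (restr D d))) i)" if "d \<in> coeff_space" for d
      by (intro bounded_functional_compose[OF bounded_functional_vac_Red[OF h] bounded_operator_cprod_left]
          restr_in_coeff_space that)
    show "bounded_functional (\<lambda>d. vac (Red h (cprod c (restr D d))) i)" if "c \<in> coeff_space" for c
      by (intro bounded_functional_compose[OF bounded_functional_compose[OF bounded_functional_vac_Red[OF h]
            bounded_operator_cprod_right] bounded_operator_restr] that)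
    fix k l :: "'a triple" assume kl: "k \<in> triples" "l \<in> triples"
    show "vac (Red h (cprod (delta k) (restr D (delta l)))) i = 0"
    proof (cases "l \<in> D")
      case True
      then have r: "restr D (delta l) = delta l" by (auto simp: fun_eq_iff restr_def delta_def)
      have "sfac k l T * vac (red_basis h (stri k l T)) i = 0" if T: "T \<le> exK k" "T \<le> exL l" for T
        using True fst_stri[OF T(1), of l] red_basis_vac[OF h stri_in_triples[OF kl T]] by (simp add: D_def)
      then show ?thesis
        unfolding r cprod_delta[OF kl] vac_Red_basis_prod[OF h kl] by (intro sum.neutral) auto
    next
      case False
      then have r: "restr D (delta l) = 0" by (auto simp: fun_eq_iff restr_def delta_def)
      have z: "cprod (delta k) (0 :: 'a triple \<Rightarrow> complex) = 0" by (simp add: fun_eq_iff cprod_def)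
      show ?thesis unfolding r z by (rule bounded_functional_zero[OF bounded_functional_vac_Red[OF h]])
    qed
  qed
  from this[OF A B, of "mtri 0 Q" for Q]
  have "kap h (star_disc h a j) (mtri 0 Q) = 0" for Q
    by (simp add: star_disc_eq(3)[OF h a j'(1)] jD)
  then show ?thesis
    using star_disc_eq(2)[OF h a j'(1)] by (simp add: J_zero_eq[OF h])
qed

lemma J_zero_closed:
  fixes j j' :: "complex ^ 'a::finite \<Rightarrow> complex"
  assumes h: "0 < h"
  shows "j \<in> J_zero h \<Longrightarrow> j' \<in> J_zero h \<Longrightarrow> j + j' \<in> J_zero h"
    and "j \<in> J_zero h \<Longrightarrow> j' \<in> J_zero h \<Longrightarrow> j - j' \<in> J_zero h"
    and "(0 :: complex ^ 'a \<Rightarrow> complex) \<in> J_zero h"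
    and "j \<in> J_zero h \<Longrightarrow> j \<in> Ahat_disc h"
proof -
  show d: "j - j' \<in> J_zero h" if "j \<in> J_zero h" "j' \<in> J_zero h" for j j' :: "complex ^ 'a \<Rightarrow> complex"
    using that by (simp add: J_zero_eq[OF h] kap_diff[OF h])
  show "j + j' \<in> J_zero h" if "j \<in> J_zero h" "j' \<in> J_zero h"
    using that by (simp add: J_zero_eq[OF h] kap_add[OF h])
  have z: "0 = disc_series h (0 :: 'a triple \<Rightarrow> complex)"
    using disc_series_diff[OF h, of "0 :: 'a triple \<Rightarrow> complex" 0, OF coeff_space_zero coeff_space_zero] by (simp only: diff_self)
  have "(0 :: 'a triple \<Rightarrow> complex) \<in> red_space" by (rule cfun.subspace_0[OF red_space_subspace])
  then have "kap h (disc_series h (0 :: 'a triple \<Rightarrow> complex)) = 0" by (rule kap_disc_series_reduced[OF h])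
  then have "kap h (0 :: complex ^ 'a \<Rightarrow> complex) = 0" by (simp only: z[symmetric])
  moreover have "(0 :: complex ^ 'a \<Rightarrow> complex) \<in> Ahat_disc h"
    unfolding z by (rule disc_series_in_Ahat_disc[OF coeff_space_zero])
  ultimately show "(0 :: complex ^ 'a \<Rightarrow> complex) \<in> J_zero h" unfolding J_zero_eq[OF h] by simp
  show "j \<in> J_zero h \<Longrightarrow> j \<in> Ahat_disc h" by (simp add: J_zero_eq[OF h])
qed

lemma gns_class_eq_iff:
  assumes h: "0 < h"
  shows "gns_class h b = gns_class h b' \<longleftrightarrow> b - b' \<in> J_zero h"
proof
  assume "gns_class h b = gns_class h b'"
  moreover have "b \<in> gns_class h b"
    unfolding gns_class_def using J_zero_closed(3)[OF h] by (auto intro!: exI[of _ 0])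
  ultimately obtain j where "j \<in> J_zero h" "b = b' + j" by (auto simp: gns_class_def)
  then show "b - b' \<in> J_zero h" by simp
next
  assume d: "b - b' \<in> J_zero h"
  show "gns_class h b = gns_class h b'"
  proof (intro equalityI subsetI)
    fix x assume "x \<in> gns_class h b"
    then obtain j where j: "j \<in> J_zero h" "x = b + j" by (auto simp: gns_class_def)
    then have "x = b' + ((b - b') + j)" "(b - b') + j \<in> J_zero h"
      using J_zero_closed(1)[OF h d j(1)] by auto
    then show "x \<in> gns_class h b'" unfolding gns_class_def by blast
  next
    fix x assume "x \<in> gns_class h b'"
    then obtain j where j: "j \<in> J_zero h" "x = b' + j" by (auto simp: gns_class_def)
    then have "x = b + (j - (b - b'))" "j - (b - b') \<in> J_zero h"
      using J_zero_closed(2)[OF h j(1) d] by auto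
    then show "x \<in> gns_class h b" unfolding gns_class_def by blast
  qed
qed

text \<open>As the Gel'fand ideal is a left ideal, the class of the product does not depend on the representative,
  and \<open>pr_D\<close> selects its unique element in \<open>D_space\<close>.\<close>

lemma gns_rep_D_eq:
  assumes h: "0 < h" and a: "a \<in> Ahat_disc h" and \<psi>: "\<psi> \<in> D_space h"
  shows "gns_rep_D h a \<psi> = pr_D h (star_disc h a \<psi>)"
proof -
  have \<psi>A: "\<psi> \<in> Ahat_disc h" using \<psi> by (simp add: D_space_eq[OF h])
  define b where "b = star_disc h a \<psi>"
  have b: "b \<in> Ahat_disc h" unfolding b_def by (rule star_disc_eq(2)[OF h a \<psi>A])
  note p = pr_D_in_D_space[OF h b]
  have step: "gns_class h (star_disc h a (\<psi> + j)) = gns_class h b" if j: "j \<in> J_zero h" for j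
  proof -
    have jA: "j \<in> Ahat_disc h" by (rule J_zero_closed(4)[OF h j])
    have m1: "cprod (kap h a) (kap h \<psi>) \<in> coeff_space" and m2: "cprod (kap h a) (kap h j) \<in> coeff_space"
      by (intro cprod_in_coeff_space red_space_coeff Ahat_disc_cases(1)[OF h] a \<psi>A jA)+
    have "star_disc h a (\<psi> + j) - b = star_disc h a j"
      unfolding b_def star_disc_eq(1)[OF h a kap_add(2)[OF h \<psi>A jA]] star_disc_eq(1)[OF h a \<psi>A]
        star_disc_eq(1)[OF h a jA] kap_add(1)[OF h \<psi>A jA] cprod_add_right disc_series_add[OF h m1 m2]
      by (simp only: add_diff_cancel_left')
    then show ?thesis
      unfolding gns_class_eq_iff[OF h] using J_zero_left_ideal[OF h a j] by simp
  qed
  have "gns_rep h a (gns_class h \<psi>) = (\<Union>j\<in>J_zero h. gns_class h (star_disc h a (\<psi> + j)))"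
    unfolding gns_rep_def gns_class_def by blast
  also have "\<dots> = (\<Union>j\<in>(J_zero h :: (complex ^ 'a \<Rightarrow> complex) set). gns_class h b)"
    by (rule SUP_cong[OF refl step])
  also have "\<dots> = gns_class h b" using J_zero_closed(3)[OF h] by auto
  also have "\<dots> = gns_class h (pr_D h b)"
    unfolding gns_class_eq_iff[OF h] by (rule p(2))
  finally have rep: "gns_rep h a (gns_class h \<psi>) = gns_class h (pr_D h b)" .
  have inj: "inj_on (gns_class h) (D_space h :: (complex ^ 'a \<Rightarrow> complex) set)"
  proof (rule inj_onI)
    fix d d' :: "complex ^ 'a \<Rightarrow> complex"
    assume d: "d \<in> D_space h" "d' \<in> D_space h" "gns_class h d = gns_class h d'"
    have A: "d \<in> Ahat_disc h" "vac (kap h d) = kap h d" "d' \<in> Ahat_disc h" "vac (kap h d') = kap h d'"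
      using d(1,2) by (auto simp: D_space_eq[OF h])
    have "kap h (d - d') (mtri 0 Q) = 0" for Q
      using d(3) by (simp add: gns_class_eq_iff[OF h] J_zero_eq[OF h])
    then have "vac (kap h d) = vac (kap h d')"
      by (intro vac_eqI Ahat_disc_cases(1)[OF h] A) (simp add: kap_diff(1)[OF h A(1,3)])
    then have "kap h d = kap h d'" using A by simp
    then show "d = d'" using Ahat_disc_cases(2)[OF h A(1)] Ahat_disc_cases(2)[OF h A(3)] by metis
  qed
  show ?thesis
    unfolding gns_rep_D_def rep b_def[symmetric] by (rule the_inv_into_f_f[OF inj p(1)])
qed


section \<open>The explicit series\<close>

definition gns_coeff :: "real \<Rightarrow> 'n::finite mindex \<Rightarrow> 'n mindex \<Rightarrow> 'n mindex \<Rightarrow> real"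
  where "gns_coeff h P Q S = (let \<alpha> = max (mdeg P) (mdeg Q) in
    1 / (mfact P * fact (\<alpha> - mdeg Q))
      * mchoose (Q + S - P) Q
      * ((\<alpha> + mdeg S - mdeg P) choose mdeg S)
      * ((1 / fact (\<alpha> + mdeg S - mdeg P)
            * pochhammer (1 / (2 * h)) (\<alpha> + mdeg S - mdeg P))
         / (1 / fact (mdeg Q + mdeg S - mdeg P)
            * pochhammer (1 / (2 * h)) (mdeg Q + mdeg S - mdeg P))))"

text \<open>Only the full contraction \<open>T = P\<close> of the \<open>P\<close> derivatives leaves no factor \<open>z\<^sup>i\<close> with \<open>i > 0\<close>, and it
  requires \<open>P \<le> S\<close>; the coordinate \<open>0\<close> cannot be contracted, as the right factor does not contain the
  conjugate of \<open>z\<^sup>0\<close>.\<close>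

lemma vac_basis_product:
  fixes P Q S :: "'n::finite mindex"
  assumes h: "0 < h"
  shows "vac (Red h (basis_prod (mtri P Q) (mtri 0 S)))
    = (if P \<le> S then of_real (gns_coeff h P Q S) \<cdot>\<^sub>C delta (mtri 0 (Q + S - P)) else 0)"
proof
  fix i
  define k l :: "'n triple" where "k = mtri P Q" and "l = mtri 0 S"
  define \<alpha> where "\<alpha> = max (mdeg P) (mdeg Q)"
  define T0 where "T0 = up P (mdeg P)"
  define I where "I = {T. T \<le> exK k \<and> T \<le> exL l}"
  have t: "k \<in> triples" "l \<in> triples" by (simp_all add: k_def l_def)
  have I: "finite I" unfolding I_def by (rule finite_contractions)
  have ex: "exK k = up P \<alpha>" "exL k = up Q \<alpha>" "exK l = up 0 (mdeg S)" "exL l = up S (mdeg S)"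
    by (simp_all add: exK_def exL_def k_def l_def mtri_def \<alpha>_def)
  have lek: "mdeg P \<le> \<alpha>" "mdeg Q \<le> \<alpha>" by (auto simp: \<alpha>_def)
  have T0K: "T0 \<le> exK k"
    by (auto simp: ex le_fun_def T0_def up_def split: option.splits)
  have T0L: "T0 \<le> exL l \<longleftrightarrow> P \<le> S"
    by (auto simp: ex le_fun_def T0_def up_def split: option.splits)
  have only: "T = T0" if T: "T \<in> I" and f: "fst (stri k l T) = 0" for T
  proof -
    have "T \<circ> Some = P" using fst_stri[of T k l] T f by (auto simp: I_def k_def mtri_def)
    moreover have "T None \<le> exL l None" using T by (auto simp: I_def le_fun_def)
    then have "T None = 0" by (simp add: ex)
    ultimately show ?thesis by (auto simp: T0_def fun_eq_iff up_def split: option.split)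
  qed
  have terms: "(\<Sum>T\<in>I. sfac k l T * vac (red_basis h (stri k l T)) i) = (\<Sum>T\<in>I. if T = T0 then sfac k l T0 * vac (red_basis h (stri k l T0)) i else 0)"
  proof (rule sum.cong[OF refl])
    fix T assume T: "T \<in> I"
    have st: "stri k l T \<in> triples" using T by (intro stri_in_triples t) (auto simp: I_def)
    show "sfac k l T * vac (red_basis h (stri k l T)) i
        = (if T = T0 then sfac k l T0 * vac (red_basis h (stri k l T0)) i else 0)"
    proof (cases "T = T0")
      case False
      then have "fst (stri k l T) \<noteq> 0" using only[OF T] by blast
      then have "vac (red_basis h (stri k l T)) i = 0" unfolding red_basis_vac[OF h st] by simp
      then show ?thesis using False by simp
    qed simp
  qed
  have single: "vac (Red h (basis_prod k l)) i
      = (if P \<le> S then sfac k l T0 * vac (red_basis h (stri k l T0)) i else 0)"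
    unfolding vac_Red_basis_prod[OF h t] I_def[symmetric] terms sum.delta[OF I]
    using T0K T0L by (simp add: I_def)
  have evaluated: "(if P \<le> S then sfac k l T0 * vac (red_basis h (stri k l T0)) i else 0)
      = (if P \<le> S then of_real (gns_coeff h P Q S) * delta (mtri 0 (Q + S - P)) i else 0)"
  proof (cases "P \<le> S")
    case PS: True
    define \<gamma> R where "\<gamma> = \<alpha> + mdeg S - mdeg P" and "R = Q + S - P"
    have degP: "mdeg P \<le> mdeg S" by (rule mdeg_mono[OF PS])
    have degR: "mdeg R = mdeg Q + mdeg S - mdeg P"
    proof -
      have "P \<le> Q + S" using PS by (auto simp: le_fun_def intro: trans_le_add2)
      then show ?thesis by (simp add: R_def mdeg_diff mdeg_add)
    qed
    have KT: "exK k - T0 + exK l = up 0 \<gamma>"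
    proof
      fix x
      show "(exK k - T0 + exK l) x = up 0 \<gamma> x"
        using lek degP by (cases x) (simp_all add: ex T0_def \<gamma>_def)
    qed
    have LT: "exL k + exL l - T0 = up R \<gamma>"
    proof
      fix x
      show "(exL k + exL l - T0) x = up R \<gamma> x"
        using lek degP degR by (cases x) (simp_all add: ex T0_def \<gamma>_def R_def)
    qed
    have Rg: "mdeg R \<le> \<gamma>" using lek degP by (simp add: degR \<gamma>_def)
    have st: "stri k l T0 = (0, R, \<gamma>)"
      unfolding stri_def KT LT by (simp add: tri_def)
    have stt: "(0, R, \<gamma>) \<in> triples" using Rg by (simp add: triples_def)
    have ch1: "mchoose (up 0 \<gamma>) (up 0 (mdeg S) :: 'n option mindex) = \<gamma> choose mdeg S"
      by (simp add: mchoose_def prod_option)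
    have "\<gamma> - mdeg R = \<alpha> - mdeg Q" using lek degP by (simp add: degR \<gamma>_def)
    then have ch2: "mchoose (up R \<gamma>) (up Q \<alpha>) = mchoose R Q"
      by (simp add: mchoose_def prod_option)
    have sf: "sfac k l T0 = of_real (1 / mfact P * ((\<gamma> choose mdeg S) * mchoose R Q))"
      unfolding sfac_def KT LT unfolding ex ch1 ch2
      by (simp add: sgm_def T0_def mfact_up)
    have kf1: "kfact (0, R, \<gamma>) = fact \<gamma> * (mfact R * fact (\<alpha> - mdeg Q))"
      using \<open>\<gamma> - mdeg R = \<alpha> - mdeg Q\<close> by (simp add: kfact_def exK_def exL_def mfact_up)
    have kf2: "kfact (mtri 0 R) = fact (mdeg R) * mfact R"
      by (simp add: kfact_def exK_def exL_def mfact_up mtri_def)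
    define x where "x = 1 / (2 * h)"
    have "sfac k l T0 * vac (red_basis h (stri k l T0)) i
        = of_real (1 / mfact P * ((\<gamma> choose mdeg S) * mchoose R Q) * (level_fac h (0, R, \<gamma>) / level_fac h (mtri 0 R)))
          * delta (mtri 0 R) i"
      unfolding sf st red_basis_vac[OF h stt] by simp
    also have "1 / mfact P * ((\<gamma> choose mdeg S) * mchoose R Q) * (level_fac h (0, R, \<gamma>) / level_fac h (mtri 0 R))
        = gns_coeff h P Q S"
    proof -
      have d1: "tdeg (mtri 0 R) = mdeg R" by simp
      have "level_fac h (0, R, \<gamma>) / level_fac h (mtri 0 R)
          = (pochhammer x \<gamma> / (fact \<gamma> * (mfact R * fact (\<alpha> - mdeg Q)))) / (pochhammer x (mdeg R) / (fact (mdeg R) * mfact R))"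
        unfolding level_fac_def kf1 kf2 d1 tdeg_simp x_def[symmetric] by simp
      also have "\<dots> = (1 / fact (\<alpha> - mdeg Q)) * ((1 / fact \<gamma> * pochhammer x \<gamma>) / (1 / fact (mdeg R) * pochhammer x (mdeg R)))"
        using mfact_pos[of R] by (simp add: field_simps)
      finally show ?thesis
        unfolding gns_coeff_def Let_def \<alpha>_def[symmetric] \<gamma>_def[symmetric] degR[symmetric] R_def[symmetric] x_def[symmetric]
        by (simp add: mult_ac)
    qed
    finally show ?thesis by (simp only: PS if_True R_def)
  qed simp
  show "vac (Red h (basis_prod (mtri P Q) (mtri 0 S))) i
      = (if P \<le> S then of_real (gns_coeff h P Q S) \<cdot>\<^sub>C delta (mtri 0 (Q + S - P)) else 0) i"
    unfolding k_def[symmetric] l_def[symmetric] single evaluated by simp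
qed

definition piece :: "'n::finite mindex \<Rightarrow> ('n triple \<Rightarrow> complex) \<Rightarrow> 'n triple \<Rightarrow> complex"
  where "piece Q = restr {k \<in> triples. fst (snd k) = Q}"

lemma piece_in_coeff_space: "c \<in> coeff_space \<Longrightarrow> piece Q c \<in> coeff_space"
  unfolding piece_def by (rule restr_in_coeff_space)

lemma pn_piece:
  assumes "c \<in> coeff_space" "0 < \<epsilon>" "\<epsilon> < 1"
  shows "pn \<epsilon> (piece Q c) \<le> pn (\<epsilon>/2) c * (1 / (fact (mdeg Q)) powr (\<epsilon> - \<epsilon>/2))"
proof -
  have "pn \<epsilon> (piece Q c) \<le> pn (\<epsilon>/2) c / (fact (mdeg Q)) powr (\<epsilon> - \<epsilon>/2)"
    unfolding piece_def by (rule pn_restr_high_degree) (use assms in \<open>auto simp: triples_def\<close>)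
  then show ?thesis by simp
qed

text \<open>A finite set of pieces that contains all those with \<open>mdeg Q \<le> N\<close> misses only coefficients of
  degree at least \<open>N\<close>; these are small in the norm with a slightly larger exponent.\<close>

lemma functional_has_sum_pieces:
  assumes L: "bounded_functional \<Lambda>" and c: "c \<in> coeff_space"
  shows "((\<lambda>Q. \<Lambda> (piece Q c)) has_sum \<Lambda> c) UNIV"
proof -
  from L obtain \<epsilon> B where e: "0 < \<epsilon>" "\<epsilon> < 1"
    and B: "\<And>c. c \<in> coeff_space \<Longrightarrow> cmod (\<Lambda> c) \<le> B * pn \<epsilon> c"
    unfolding bounded_functional_def by blast
  have Bp: "cmod (\<Lambda> c) \<le> \<bar>B\<bar> * pn \<epsilon> c" if "c \<in> coeff_space" for c
    using B[OF that] mult_right_mono[OF abs_ge_self[of B] coeff_bound(2)[OF that e]] by linarith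
  define C where "C = \<bar>B\<bar> * pn (\<epsilon>/2) c"
  have key: "cmod ((\<Sum>Q\<in>F. \<Lambda> (piece Q c)) - \<Lambda> c) \<le> C * (1 / (fact N) powr (\<epsilon> - \<epsilon>/2))"
    if F: "finite F" "{Q. mdeg Q \<le> N} \<subseteq> F" for F N
  proof -
    have m: "(\<Sum>Q\<in>F. piece Q c) \<in> coeff_space" by (intro coeff_space_sum piece_in_coeff_space c)
    have "c - (\<Sum>Q\<in>F. piece Q c) = restr {k \<in> triples. fst (snd k) \<notin> F} c"
    proof
      fix k
      have "(\<Sum>Q\<in>F. piece Q c) k = (\<Sum>Q\<in>F. if Q = fst (snd k) then (if k \<in> triples then c k else 0) else 0)"
        unfolding sum_fun_apply piece_def restr_def by (intro sum.cong) auto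
      then show "(c - (\<Sum>Q\<in>F. piece Q c)) k = restr {k \<in> triples. fst (snd k) \<notin> F} c k"
        using F(1) coeff_zero[OF c, of k] by (auto simp: restr_def)
    qed
    moreover have "pn \<epsilon> (restr {k \<in> triples. fst (snd k) \<notin> F} c) \<le> pn (\<epsilon>/2) c / (fact N) powr (\<epsilon> - \<epsilon>/2)"
    proof (rule pn_restr_high_degree[OF c])
      fix k assume k: "k \<in> {k \<in> triples. fst (snd k) \<notin> F}"
      then have "\<not> mdeg (fst (snd k)) \<le> N" using F(2) by blast
      moreover have "mdeg (fst (snd k)) \<le> tdeg k" using k by (cases k) (auto simp: triples_def)
      ultimately show "N \<le> tdeg k" by linarith
    qed (use e in auto)
    ultimately have le: "pn \<epsilon> (c - (\<Sum>Q\<in>F. piece Q c)) \<le> pn (\<epsilon>/2) c / (fact N) powr (\<epsilon> - \<epsilon>/2)" by simp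
    have "(\<Sum>Q\<in>F. \<Lambda> (piece Q c)) = \<Lambda> (\<Sum>Q\<in>F. piece Q c)"
      by (rule bounded_functional_sum[OF L, symmetric]) (rule piece_in_coeff_space[OF c])
    then have "cmod ((\<Sum>Q\<in>F. \<Lambda> (piece Q c)) - \<Lambda> c) = cmod (\<Lambda> (c - (\<Sum>Q\<in>F. piece Q c)))"
      by (simp add: bounded_functional_diff[OF L c m] norm_minus_commute)
    also have "\<dots> \<le> \<bar>B\<bar> * pn \<epsilon> (c - (\<Sum>Q\<in>F. piece Q c))"
      by (rule Bp[OF coeff_space_diff[OF c m]])
    also have "\<dots> \<le> \<bar>B\<bar> * (pn (\<epsilon>/2) c / (fact N) powr (\<epsilon> - \<epsilon>/2))"
      by (intro mult_left_mono le) auto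
    finally show ?thesis by (simp only: C_def times_divide_eq_right mult_1_right)
  qed
  have "(\<lambda>N. 1 ^ N / (fact N) powr (\<epsilon> - \<epsilon>/2) :: real) \<longlonglongrightarrow> 0"
    by (intro summable_LIMSEQ_zero summable_power_over_fact_powr) (use e in auto)
  from tendsto_mult_left[OF this, of C] have lim: "(\<lambda>N. C * (1 / (fact N) powr (\<epsilon> - \<epsilon>/2))) \<longlonglongrightarrow> 0"
    by (simp only: power_one mult_zero_right)
  show ?thesis
    unfolding has_sum_def tendsto_iff
  proof (intro allI impI)
    fix r :: real assume "0 < r"
    then have "eventually (\<lambda>N. C * (1 / (fact N) powr (\<epsilon> - \<epsilon>/2)) < r) sequentially"
      by (rule order_tendstoD(2)[OF lim])
    then obtain N where N: "C * (1 / (fact N) powr (\<epsilon> - \<epsilon>/2)) < r"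
      by (auto simp: eventually_sequentially)
    show "eventually (\<lambda>F. dist (\<Sum>Q\<in>F. \<Lambda> (piece Q c)) (\<Lambda> c) < r) (finite_subsets_at_top UNIV)"
      unfolding eventually_finite_subsets_at_top dist_norm
    proof (intro exI[of _ "{Q. mdeg Q \<le> N}"] conjI allI impI finite_mdeg_le subset_UNIV)
      fix F :: "('a \<Rightarrow> nat) set" assume F: "finite F \<and> {Q. mdeg Q \<le> N} \<subseteq> F \<and> F \<subseteq> UNIV"
      show "norm ((\<Sum>Q\<in>F. \<Lambda> (piece Q c)) - \<Lambda> c) < r"
        by (rule le_less_trans[OF key N]) (use F in auto)
    qed
  qed
qed

text \<open>Both sides depend on \<open>A\<close> through bounded functionals, so \<open>A\<close> may be replaced by a basis element.\<close>

lemma vac_product_pieces: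
  fixes A B :: "'n::finite triple \<Rightarrow> complex"
  assumes h: "0 < h" and A: "A \<in> red_space" and B: "B \<in> red_space" "vac B = B"
  shows "vac (Red h (cprod (piece Q A) (piece S B)))
    = (\<Sum>P | P \<le> S. (A (mtri P Q) * B (mtri 0 S) * of_real (gns_coeff h P Q S)) \<cdot>\<^sub>C delta (mtri 0 (Q + S - P)))"
proof
  fix i
  define M where "M = {k :: 'n triple. k \<in> reduced_triples \<and> fst (snd k) = Q}"
  define \<Lambda> where "\<Lambda> c = vac (Red h (cprod (restr M c) (delta (mtri 0 S)))) i" for c
  define \<Lambda>' where "\<Lambda>' c = (\<Sum>P | P \<le> S. (of_real (gns_coeff h P Q S) * delta (mtri 0 (Q + S - P)) i) * c (mtri P Q))"
    for c :: "'n triple \<Rightarrow> complex"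
  have dS: "delta (mtri 0 S) \<in> coeff_space" by (rule delta_in_coeff_space) simp
  have "bounded_functional \<Lambda>"
    unfolding \<Lambda>_def
    by (rule bounded_functional_compose[OF bounded_functional_compose[OF bounded_functional_vac_Red[OF h]
          bounded_operator_cprod_left[OF dS]] bounded_operator_restr])
  moreover have "bounded_functional \<Lambda>'"
    unfolding \<Lambda>'_def
    by (intro bounded_functional_sum_map finite_mindex_le bounded_functional_scaled bounded_functional_coordinate)
  ultimately have bf: "bounded_functional (\<lambda>c. \<Lambda> c - \<Lambda>' c)" by (rule bounded_functional_minus)
  have eq: "\<Lambda> c = \<Lambda>' c" if c: "c \<in> coeff_space" for c
  proof -
    have "\<Lambda> c - \<Lambda>' c = 0"
    proof (rule functional_vanishes_by_density[OF bf _ c])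
      fix k :: "'n triple" assume k: "k \<in> triples"
      show "\<Lambda> (delta k) - \<Lambda>' (delta k) = 0"
      proof (cases "k \<in> M")
        case True
        then obtain P where P: "k = mtri P Q" by (auto simp: M_def reduced_triples_def mtri_def)
        have r: "restr M (delta k) = delta k" using True by (auto simp: fun_eq_iff restr_def delta_def)
        have "\<Lambda> (delta k) = vac (Red h (basis_prod (mtri P Q) (mtri 0 S))) i"
          unfolding \<Lambda>_def r by (simp add: P cprod_delta)
        also have "\<dots> = (if P \<le> S then of_real (gns_coeff h P Q S) * delta (mtri 0 (Q + S - P)) i else 0)"
          unfolding vac_basis_product[OF h] by simp
        also have "\<dots> = (\<Sum>P' | P' \<le> S. if P' = P then of_real (gns_coeff h P Q S) * delta (mtri 0 (Q + S - P)) i else 0)"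
          using finite_mindex_le[of S] by simp
        also have "\<dots> = \<Lambda>' (delta k)"
          unfolding \<Lambda>'_def by (rule sum.cong) (auto simp: delta_def P)
        finally show ?thesis by simp
      next
        case False
        then have r: "restr M (delta k) = 0" by (auto simp: fun_eq_iff restr_def delta_def)
        have z: "cprod 0 (delta (mtri 0 S)) = (0 :: 'n triple \<Rightarrow> complex)" by (simp add: fun_eq_iff cprod_def)
        have "\<Lambda> (delta k) = 0"
          unfolding \<Lambda>_def r z by (rule bounded_functional_zero[OF bounded_functional_vac_Red[OF h]])
        moreover have "\<Lambda>' (delta k) = 0"
        proof -
          have "mtri P Q \<noteq> k" for P
          proof
            assume "mtri P Q = k"
            then have "k \<in> M" by (auto simp: M_def) (auto simp: mtri_def)
            then show False using False by simp
          qed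
          then show ?thesis by (auto simp: \<Lambda>'_def delta_def intro!: sum.neutral)
        qed
        ultimately show ?thesis by simp
      qed
    qed
    then show ?thesis by simp
  qed
  have pA: "piece Q A = restr M A"
  proof
    fix k
    show "piece Q A k = restr M A k"
    proof (cases "k \<in> reduced_triples")
      case True
      then show ?thesis using reduced_in_triples by (auto simp: piece_def restr_def M_def)
    next
      case False
      then have "A k = 0" using A unfolding red_space_def by blast
      then show ?thesis by (simp add: piece_def restr_def)
    qed
  qed
  have pB: "piece S B = B (mtri 0 S) \<cdot>\<^sub>C delta (mtri 0 S)"
  proof
    fix k
    show "piece S B k = (B (mtri 0 S) \<cdot>\<^sub>C delta (mtri 0 S)) k"
    proof (cases "k = mtri 0 S")
      case True
      have "fst (snd (mtri 0 S)) = S" by (simp add: mtri_def)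
      then show ?thesis using True by (simp add: piece_def restr_def delta_def)
    next
      case False
      have "B k = 0 \<or> fst (snd k) \<noteq> S"
      proof (cases "k \<in> reduced_triples \<and> fst k = 0")
        case True
        then have "k = mtri 0 (fst (snd k))" by (intro reduced_fst_zero) auto
        then show ?thesis using False by metis
      next
        case F: False
        show ?thesis
        proof (cases "k \<in> reduced_triples")
          case True
          have "B k = vac B k" using B(2) by simp
          also have "\<dots> = 0" using F True by (simp add: vac_def restr_def)
          finally show ?thesis ..
        next
          case False
          then show ?thesis using B(1) unfolding red_space_def by blast
        qed
      qed
      then show ?thesis using False by (auto simp: piece_def restr_def delta_def)
    qed
  qed
  have m: "cprod (restr M A) (delta (mtri 0 S)) \<in> coeff_space"
    by (intro cprod_in_coeff_space restr_in_coeff_space red_space_coeff[OF A] dS)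
  have "vac (Red h (cprod (piece Q A) (piece S B))) i = B (mtri 0 S) * \<Lambda> A"
    unfolding pA pB cprod_scale_right \<Lambda>_def by (rule bounded_functional_scale[OF bounded_functional_vac_Red[OF h] m])
  also have "\<dots> = B (mtri 0 S) * \<Lambda>' A" by (simp add: eq red_space_coeff[OF A])
  also have "\<dots> = (\<Sum>P | P \<le> S. (A (mtri P Q) * B (mtri 0 S) * of_real (gns_coeff h P Q S)) \<cdot>\<^sub>C delta (mtri 0 (Q + S - P))) i"
    by (simp add: \<Lambda>'_def sum_fun_apply sum_distrib_left mult_ac)
  finally show "vac (Red h (cprod (piece Q A) (piece S B))) i
    = (\<Sum>P | P \<le> S. (A (mtri P Q) * B (mtri 0 S) * of_real (gns_coeff h P Q S)) \<cdot>\<^sub>C delta (mtri 0 (Q + S - P))) i" .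
qed

text \<open>The pieces of coefficients with a fixed second index decay faster than some negative power of the
  factorial of its degree, so the bilinear estimate gives absolute convergence of the double series.\<close>

lemma product_series:
  fixes A B :: "'n::finite triple \<Rightarrow> complex"
  assumes h: "0 < h" and A: "A \<in> coeff_space" and B: "B \<in> coeff_space"
  shows "series_sums (top_disc h) (\<lambda>(Q, S). disc_series h (vac (Red h (cprod (piece Q A) (piece S B)))))
    (disc_series h (vac (Red h (cprod A B))))"
proof -
  define g where "g = (\<lambda>(Q, S). vac (Red h (cprod (piece Q A) (piece S B))))"
  have vR: "bounded_operator (\<lambda>c. vac (Red h c) :: 'n triple \<Rightarrow> complex)"
    unfolding vac_def by (rule bounded_operator_compose[OF bounded_operator_restr bounded_operator_Red[OF h]])
  have g: "g x \<in> coeff_space" for x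
    unfolding g_def by (cases x) (simp add: bounded_operator_mem[OF vR] cprod_in_coeff_space piece_in_coeff_space A B)
  have s: "vac (Red h (cprod A B)) \<in> coeff_space"
    by (intro bounded_operator_mem[OF vR] cprod_in_coeff_space A B)
  have summ: "(\<lambda>x. pn \<epsilon> (g x)) summable_on UNIV" if e: "0 < \<epsilon>" "\<epsilon> < 1" for \<epsilon>
  proof -
    obtain \<epsilon>1 C1 where 1: "0 < \<epsilon>1" "\<epsilon>1 < 1" "0 \<le> C1"
      "\<And>c. c \<in> coeff_space \<Longrightarrow> pn \<epsilon> (vac (Red h c) :: 'n triple \<Rightarrow> complex) \<le> C1 * pn \<epsilon>1 c"
      by (rule bounded_operatorE[OF vR e]) blast
    obtain \<epsilon>2 C2 where 2: "0 < \<epsilon>2" "\<epsilon>2 < 1" "0 \<le> C2"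
      "\<And>c d :: 'n triple \<Rightarrow> complex. c \<in> coeff_space \<Longrightarrow> d \<in> coeff_space \<Longrightarrow>
        pn \<epsilon>1 (cprod c d) \<le> C2 * pn \<epsilon>2 c * pn \<epsilon>2 d"
      by (rule cprod_pn_bound[OF 1(1,2)]) blast
    define w where "w Q = 1 / (fact (mdeg Q)) powr (\<epsilon>2 - \<epsilon>2/2)" for Q :: "'n mindex"
    define CA CB where "CA = pn (\<epsilon>2/2) A" and "CB = pn (\<epsilon>2/2) B"
    have w: "w summable_on UNIV" unfolding w_def by (rule summable_on_fact_mdeg) (use 2 in simp)
    have w0: "0 \<le> w Q" for Q by (simp add: w_def)
    have C0: "0 \<le> CA" "0 \<le> CB" unfolding CA_def CB_def by (intro coeff_bound(2) A B; use 2 in simp)+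
    have "(\<lambda>(Q, S). (C1 * C2 * CA * w Q) * (CB * w S)) summable_on UNIV \<times> UNIV"
      by (intro summable_on_product_nonneg summable_on_cmult_right w mult_nonneg_nonneg 1 2 C0 w0)
    then have "(\<lambda>(Q, S). (C1 * C2 * CA * w Q) * (CB * w S)) summable_on UNIV" by simp
    then show ?thesis
    proof (rule summable_on_comparison_test)
      fix x :: "'n mindex \<times> 'n mindex"
      obtain Q S where x: "x = (Q, S)" by (cases x)
      have pA: "pn \<epsilon>2 (piece Q A) \<le> CA * w Q" and pB: "pn \<epsilon>2 (piece S B) \<le> CB * w S"
        unfolding CA_def CB_def w_def by (intro pn_piece A B 2)+
      have "pn \<epsilon> (g x) \<le> C1 * pn \<epsilon>1 (cprod (piece Q A) (piece S B))"
        unfolding g_def x prod.case by (intro 1(4) cprod_in_coeff_space piece_in_coeff_space A B)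
      also have "\<dots> \<le> C1 * (C2 * pn \<epsilon>2 (piece Q A) * pn \<epsilon>2 (piece S B))"
        by (intro mult_left_mono 2(4) piece_in_coeff_space A B 1)
      also have "\<dots> \<le> C1 * (C2 * (CA * w Q) * (CB * w S))"
        by (intro mult_left_mono mult_mono pA pB 1(3) 2(3) order_refl mult_nonneg_nonneg C0 w0
            coeff_bound(2) piece_in_coeff_space A B 2(1,2))
      finally show "pn \<epsilon> (g x) \<le> (case x of (Q, S) \<Rightarrow> (C1 * C2 * CA * w Q) * (CB * w S))"
        by (simp add: x mult_ac)
      show "0 \<le> pn \<epsilon> (g x)" by (rule coeff_bound(2)[OF g e])
    qed
  qed
  have "((\<lambda>x. g x k) has_sum vac (Red h (cprod A B)) k) UNIV" for k
  proof -
    have "((\<lambda>x. g x k) has_sum vac (Red h (cprod A B)) k) (Sigma UNIV (\<lambda>_. UNIV))"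
    proof (rule has_sum_SigmaI)
      fix Q :: "'n mindex"
      show "((\<lambda>S. g (Q, S) k) has_sum vac (Red h (cprod (piece Q A) B)) k) UNIV"
        unfolding g_def prod.case
        by (rule functional_has_sum_pieces[OF bounded_functional_compose[OF bounded_functional_vac_Red[OF h]
                bounded_operator_cprod_right[OF piece_in_coeff_space[OF A]]] B])
    next
      show "((\<lambda>Q. vac (Red h (cprod (piece Q A) B)) k) has_sum vac (Red h (cprod A B)) k) UNIV"
        by (rule functional_has_sum_pieces[OF bounded_functional_compose[OF bounded_functional_vac_Red[OF h]
                bounded_operator_cprod_left[OF B]] A])
    next
      have "(\<lambda>x. pn (1/2) (g x) * (fact (tdeg k)) powr (1/2)) summable_on UNIV"
        by (intro summable_on_cmult_left summ) auto
      then have "(\<lambda>x. norm (g x k)) summable_on UNIV"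
        by (rule summable_on_comparison_test) (auto intro!: coeff_bound(1) g)
      then show "(\<lambda>x. g x k) summable_on (Sigma UNIV (\<lambda>_. UNIV))"
        using abs_summable_summable by fastforce
    qed
    then show ?thesis by simp
  qed
  from series_converges[OF h g s summ this]
  have "series_sums (top_disc h) (\<lambda>x. disc_series h (g x)) (disc_series h (vac (Red h (cprod A B))))" .
  moreover have "(\<lambda>x. disc_series h (g x)) = (\<lambda>(Q, S). disc_series h (vac (Red h (cprod (piece Q A) (piece S B)))))"
    by (simp add: g_def fun_eq_iff split: prod.splits)
  ultimately show ?thesis by simp
qed

theorem proposition5p25:
  fixes h :: real
    and a \<psi> :: "complex ^ 'n::finite \<Rightarrow> complex"
    and a_coeff :: "'n mindex \<Rightarrow> 'n mindex \<Rightarrow> complex"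
    and \<psi>_coeff :: "'n mindex \<Rightarrow> complex"
  assumes "h > 0"
    and "a \<in> Ahat_disc h"
    and "series_sums (top_disc h) (\<lambda>(P, Q). a_coeff P Q \<cdot>\<^sub>C f_disc h P Q) a"
    and "\<psi> \<in> D_space h"
    and "series_sums (top_disc h) (\<lambda>Q. \<psi>_coeff Q \<cdot>\<^sub>C f_disc h 0 Q) \<psi>"
  shows "gns_rep_D h a \<psi> = pr_D h (star_disc h a \<psi>)
    \<and> series_sums (top_D h)
        (\<lambda>(Q, S). \<Sum>P | P \<le> S.
          let \<alpha> = max (mdeg P) (mdeg Q) in
          (a_coeff P Q * \<psi>_coeff S *
            complex_of_real
              (1 / (mfact P * fact (\<alpha> - mdeg Q))
                * mchoose (Q + S - P) Q
                * ((\<alpha> + mdeg S - mdeg P) choose mdeg S)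
                * ((1 / fact (\<alpha> + mdeg S - mdeg P)
                      * pochhammer (1 / (2 * h)) (\<alpha> + mdeg S - mdeg P))
                   / (1 / fact (mdeg Q + mdeg S - mdeg P)
                      * pochhammer (1 / (2 * h)) (mdeg Q + mdeg S - mdeg P)))))
          \<cdot>\<^sub>C f_disc h 0 (Q + S - P))
        (gns_rep_D h a \<psi>)"
proof
  note h = assms(1) and a = assms(2) and \<psi> = assms(4)
  have \<psi>A: "\<psi> \<in> Ahat_disc h" "vac (kap h \<psi>) = kap h \<psi>" using \<psi> by (auto simp: D_space_eq[OF h])
  show rep: "gns_rep_D h a \<psi> = pr_D h (star_disc h a \<psi>)" by (rule gns_rep_D_eq[OF h a \<psi>])
  define A B where "A = kap h a" and "B = kap h \<psi>"
  have A: "A \<in> red_space" and B: "B \<in> red_space" "vac B = B"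
    using Ahat_disc_cases(1)[OF h a] Ahat_disc_cases(1)[OF h \<psi>A(1)] \<psi>A(2) by (simp_all add: A_def B_def)
  have Ac: "A (mtri P Q) = a_coeff P Q" for P Q
  proof -
    have inj: "inj (\<lambda>(P :: 'n mindex, Q). mtri P Q)" by (auto intro!: injI)
    have eq: "(\<lambda>x. (case x of (P, Q) \<Rightarrow> a_coeff P Q) \<cdot>\<^sub>C disc_series h (delta (case x of (P, Q) \<Rightarrow> mtri P Q)))
        = (\<lambda>(P, Q). a_coeff P Q \<cdot>\<^sub>C f_disc h P Q)"
      by (rule ext) (simp only: f_disc_eq_disc_series case_prod_beta)
    have red: "(case x of (P :: 'n mindex, Q) \<Rightarrow> mtri P Q) \<in> reduced_triples" for x by (cases x) simp
    show ?thesis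
      using coefficients_of_series(2)[OF h red inj assms(3)[folded eq], of "(P, Q)"] by (simp add: A_def)
  qed
  have Bc: "B (mtri 0 S) = \<psi>_coeff S" for S
  proof -
    have inj: "inj (\<lambda>Q :: 'n mindex. mtri 0 Q)" by (rule injI) simp
    show ?thesis
      unfolding B_def by (rule coefficients_of_series(2)[OF h mtri_simps(1) inj assms(5)[unfolded f_disc_eq_disc_series]])
  qed
  define t where "t = (\<lambda>(Q, S). disc_series h (vac (Red h (cprod (piece Q A) (piece S B)))))"
  have piece_red: "vac (Red h (cprod (piece Q A) (piece S B))) \<in> red_space" for Q S
    by (intro vac_in_red_space Red_in_red_space h cprod_in_coeff_space piece_in_coeff_space red_space_coeff A B)
  have term_eq: "(\<Sum>P | P \<le> S. let \<alpha> = max (mdeg P) (mdeg Q) in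
          (a_coeff P Q * \<psi>_coeff S *
            complex_of_real
              (1 / (mfact P * fact (\<alpha> - mdeg Q))
                * mchoose (Q + S - P) Q
                * ((\<alpha> + mdeg S - mdeg P) choose mdeg S)
                * ((1 / fact (\<alpha> + mdeg S - mdeg P)
                      * pochhammer (1 / (2 * h)) (\<alpha> + mdeg S - mdeg P))
                   / (1 / fact (mdeg Q + mdeg S - mdeg P)
                      * pochhammer (1 / (2 * h)) (mdeg Q + mdeg S - mdeg P)))))
          \<cdot>\<^sub>C f_disc h 0 (Q + S - P)) = t (Q, S)" for Q S
  proof -
    have d: "delta (mtri 0 R) \<in> coeff_space" for R :: "'n mindex" by (rule delta_in_coeff_space) simp
    have "t (Q, S) = (\<Sum>P | P \<le> S. disc_series h ((A (mtri P Q) * B (mtri 0 S) * of_real (gns_coeff h P Q S))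
        \<cdot>\<^sub>C delta (mtri 0 (Q + S - P))))"
      unfolding t_def prod.case vac_product_pieces[OF h A B] by (intro disc_series_sum[OF h] coeff_space_scale d)
    also have "\<dots> = (\<Sum>P | P \<le> S. (a_coeff P Q * \<psi>_coeff S * of_real (gns_coeff h P Q S))
        \<cdot>\<^sub>C f_disc h 0 (Q + S - P))"
      by (simp only: disc_series_scale[OF h d] f_disc_eq_disc_series Ac Bc)
    finally show ?thesis by (simp only: gns_coeff_def Let_def)
  qed
  have lim: "series_sums (top_disc h) t (gns_rep_D h a \<psi>)"
    unfolding rep pr_D_eq[OF h star_disc_eq(2)[OF h a \<psi>A(1)]] star_disc_eq(3)[OF h a \<psi>A(1)] t_def
      A_def[symmetric] B_def[symmetric]
    by (rule product_series[OF h red_space_coeff[OF A] red_space_coeff[OF B(1)]])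
  have "series_sums (top_D h) t (gns_rep_D h a \<psi>)"
    unfolding series_sums_def top_D_def limitin_subtopology
  proof (intro conjI)
    show "gns_rep_D h a \<psi> \<in> D_space h"
      unfolding rep by (rule pr_D_in_D_space(1)[OF h star_disc_eq(2)[OF h a \<psi>A(1)]])
    show "limitin (top_disc h) (\<lambda>F. \<Sum>x\<in>F. t x) (gns_rep_D h a \<psi>) (finite_subsets_at_top UNIV)"
      using lim by (simp add: series_sums_def)
    have "(\<Sum>x\<in>F. t x) \<in> D_space h" for F
    proof -
      define c where "c = (\<Sum>x\<in>F. case x of (Q, S) \<Rightarrow> vac (Red h (cprod (piece Q A) (piece S B))))"
      have c: "c \<in> red_space"
        unfolding c_def by (intro cfun.subspace_sum[OF red_space_subspace]) (simp add: piece_red split: prod.splits)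
      have "disc_series h c = (\<Sum>x\<in>F. disc_series h (case x of (Q, S) \<Rightarrow> vac (Red h (cprod (piece Q A) (piece S B)))))"
        unfolding c_def by (rule disc_series_sum[OF h]) (simp add: red_space_coeff piece_red split: prod.splits)
      also have "\<dots> = (\<Sum>x\<in>F. t x)" by (simp add: t_def case_prod_beta)
      finally have "(\<Sum>x\<in>F. t x) = disc_series h c" ..
      moreover have "vac c = c"
        by (auto simp: c_def fun_eq_iff vac_def restr_def sum_fun_apply intro!: sum.neutral sym[OF sum.neutral])
      ultimately show ?thesis
        unfolding D_space_eq[OF h] by (simp add: kap_disc_series_reduced[OF h c] disc_series_in_Ahat_disc[OF red_space_coeff[OF c]])
    qed
    then show "eventually (\<lambda>F. (\<Sum>x\<in>F. t x) \<in> D_space h) (finite_subsets_at_top UNIV)" by simp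
  qed
  then show "series_sums (top_D h)
        (\<lambda>(Q, S). \<Sum>P | P \<le> S.
          let \<alpha> = max (mdeg P) (mdeg Q) in
          (a_coeff P Q * \<psi>_coeff S *
            complex_of_real
              (1 / (mfact P * fact (\<alpha> - mdeg Q))
                * mchoose (Q + S - P) Q
                * ((\<alpha> + mdeg S - mdeg P) choose mdeg S)
                * ((1 / fact (\<alpha> + mdeg S - mdeg P)
                      * pochhammer (1 / (2 * h)) (\<alpha> + mdeg S - mdeg P))
                   / (1 / fact (mdeg Q + mdeg S - mdeg P)
                      * pochhammer (1 / (2 * h)) (mdeg Q + mdeg S - mdeg P)))))
          \<cdot>\<^sub>C f_disc h 0 (Q + S - P))
        (gns_rep_D h a \<psi>)"
    unfolding term_eq by (simp add: t_def)
qed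

end
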